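(* Let $X$ be a symmetrically self-similar graph with bounded geometry and origin vertex $o$, let $d$ be its transition function and let $\sigma$ be the associated $1$-periodic function defined in the context. If the Julia set $\mathcal J$ of $d$ is a Cantor set, then $\sigma$ is non-constant.
   Context: Graphs $X=(VX,EX)$ are undirected, without loops or multiple edges. The boundary $\theta C$ of $C\subset VX$ is the set of vertices in $VX\setminus C$ which are adjacent to some vertex in $C$, and $\hat C$ denotes the subgraph of $X$ spanned by $C\cup\theta C$, with vertex set $V\hat C$. For $F\subset VX$ let $\mathcal C_X(F)$ be the set of connected components of $VX\setminus F$. The reduced graph $X_F$ has vertex set $VX_F=F$, and two vertices $x,y\in F$ are joined by an edge of $X_F$ if and only if there is a $C\in\mathcal C_X(F)$ with $x,y\in\theta C$. A connected infinite graph $X$ is self-similar with respect to $F\subset VX$ and $\psi:VX\to VX_F$ if (F1) no vertices in $F$ are adjacent in $X$; (F2) the intersection of the boundaries of two different components in $\mathcal C_X(F)$ contains not more than one vertex; (F3) $\psi$ is an isomorphism between $X$ and $X_F$. The components in $\mathcal C_X(F)$ are called cells (1-cells), and $\hat C$ is the cell graph of a cell $C$. The 2-cells are the connected components of $VX\setminus\psi(F)$. An origin vertex is a fixed point of $\psi$. A self-similar graph $X$ is symmetrically self-similar if it is locally finite and: (S1) all cells are finite and for any pair of cells $C,D$ there exists an isomorphism $\alpha$ of $\hat C$ and $\hat D$ such that $\alpha(\theta C)=\theta D$; (S2) the automorphism group $\mathrm{Aut}(\hat C)$ acts transitively on $\{(x,y)\mid x,y\in\theta C,\ x\ne y\}$.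 A graph has bounded geometry if its set of vertex degrees is bounded. The mass scaling factor $\mu$ is the number of 1-cells contained in a 2-cell (independent of the 2-cell). For a cell $C$ and nonempty $B\subset\theta C$, let $Q_B=(q_B(x,y))_{x,y\in V\hat C}$ with $q_B(x,y)=1/\deg_{\hat C}(x)$ if $x\in V\hat C\setminus B$ is adjacent to $y$ in $\hat C$, and $q_B(x,y)=0$ otherwise; let $Q_B^*(z)=(I-zQ_B)^{-1}$. For $v\in\theta C$ the transition function is the rational function $d(z)=\sum_{w\in\theta C\setminus\{v\}}(Q^*_{\theta C\setminus\{v\}}(z))_{v,w}$, independent of $v$ and $C$, regarded as a self-map of the Riemann sphere. The time scaling factor is $\tau=d'(1)$, and the spectral dimension is $d_s=2\log(\mu)/\log(\tau)$. $p^{(n)}(x,y)$ denotes the $n$-step transition probability of the simple random walk on $X$. The Green function is $G(z)=\sum_{n\ge0}p^{(n)}(o,o)z^n$ for $|z|<1$; it is understood with its holomorphic continuation, which exists at least on $(\mathbb C\setminus\mathbb R)\cup(-1,1)$. For $z_0\in\mathbb C$, $r>0$, $0<\delta\le\pi$: $U_\delta(z_0,r)$ is the set of all $z\in\mathbb C\setminus\{z_0\}$ with $|z-z_0|<r$ and $|\arg(z_0-z)|<\delta$. For $b>1$: $S(b)=\{z\in\mathbb C\mid|\mathrm{Im}(z)|<\pi/\log(b)\}$. The function $\omega$ is the $1$-periodic holomorphic function on $S(\tau)$ for which there is $r>0$ with $G(z)=(1-z)^{\frac{d_s}{2}-1}\bigl(\omega\bigl(\frac{\log(1-z)}{\log(\tau)}\bigr)+\mathcal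 O_\delta(|z-1|)\bigr)$ for $z\in U_\delta(1,r)$, $0<\delta<\pi$ (such a function exists), and $\hat\omega(k)$ is its $k$-th Fourier coefficient. The function $\sigma:S(\tau^2)\to\mathbb C$ is the $1$-periodic holomorphic function $$\sigma(z)=\sum_{k=-\infty}^{\infty}\frac{\hat\omega(-k)}{\Gamma\bigl(1-\frac{\log(\mu)-2k\pi i}{\log(\tau)}\bigr)}e^{2k\pi iz},$$ which describes the asymptotics: $p^{(n)}(o,o)=n^{-d_s/2}(\sigma(\frac{\log n}{\log\tau})+\mathcal O(n^{-1}))$ if $X$ is not bipartite, and $p^{(2n)}(o,o)=2(2n)^{-d_s/2}(\sigma(\frac{\log(2n)}{\log\tau})+\mathcal O(n^{-1}))$ if $X$ is bipartite. *)

theory Defs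
  imports
    "HOL-Complex_Analysis.Complex_Analysis"
    "Graph_Theory.Digraph_Component"
begin

section \<open>Graphs\<close>

text \<open>
  An undirected graph without loops or multiple edges is a symmetric, loop-free pair digraph
  (locale \<^locale>\<open>pair_bidirected_digraph\<close>, no finiteness assumed); its edges are the pairs
  of mutually inverse arcs, so that the degree of a vertex is its out-degree.
\<close>

abbreviation neighbours :: "'v pair_pre_digraph \<Rightarrow> 'v \<Rightarrow> 'v set" where
  "neighbours X x \<equiv> {y. (x, y) \<in> parcs X}"

abbreviation degree_in :: "'v pair_pre_digraph \<Rightarrow> 'v \<Rightarrow> nat" where
  "degree_in X x \<equiv> out_degree (with_proj X) x"

definition boundary :: "'v pair_pre_digraph \<Rightarrow> 'v set \<Rightarrow> 'v set" where
  "boundary X C = {y \<in> pverts X - C. \<exists>x\<in>C. (x, y) \<in> parcs X}"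

definition spanned_subgraph :: "'v pair_pre_digraph \<Rightarrow> 'v set \<Rightarrow> 'v pair_pre_digraph" where
  "spanned_subgraph X S = \<lparr>pverts = S, parcs = parcs X \<inter> S \<times> S\<rparr>"

definition cell_graph :: "'v pair_pre_digraph \<Rightarrow> 'v set \<Rightarrow> 'v pair_pre_digraph" where
  "cell_graph X C = spanned_subgraph X (C \<union> boundary X C)"

text \<open>
  The vertex sets of the connected components of \<open>VX - F\<close>; since arcs come in inverse pairs,
  strongly connected components are connected components.
\<close>

definition cells :: "'v pair_pre_digraph \<Rightarrow> 'v set \<Rightarrow> 'v set set" where
  "cells X F = pre_digraph.sccs_verts (with_proj (spanned_subgraph X (pverts X - F)))"

definition reduced_graph :: "'v pair_pre_digraph \<Rightarrow> 'v set \<Rightarrow> 'v pair_pre_digraph" where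
  "reduced_graph X F =
     \<lparr>pverts = F,
      parcs = {(x, y). x \<in> F \<and> y \<in> F \<and> x \<noteq> y \<and>
                 (\<exists>C\<in>cells X F. x \<in> boundary X C \<and> y \<in> boundary X C)}\<rparr>"

definition graph_isomorphism ::
  "('v \<Rightarrow> 'w) \<Rightarrow> 'v pair_pre_digraph \<Rightarrow> 'w pair_pre_digraph \<Rightarrow> bool" where
  "graph_isomorphism f X Y \<longleftrightarrow>
     bij_betw f (pverts X) (pverts Y) \<and>
     (\<forall>x\<in>pverts X. \<forall>y\<in>pverts X. (x, y) \<in> parcs X \<longleftrightarrow> (f x, f y) \<in> parcs Y)"

definition locally_finite :: "'v pair_pre_digraph \<Rightarrow> bool" where
  "locally_finite X \<longleftrightarrow> (\<forall>x\<in>pverts X. finite (neighbours X x))"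

definition bounded_geometry :: "'v pair_pre_digraph \<Rightarrow> bool" where
  "bounded_geometry X \<longleftrightarrow>
     (\<exists>M. \<forall>x\<in>pverts X. finite (neighbours X x) \<and> degree_in X x \<le> M)"


section \<open>Symmetrically self-similar graphs\<close>

definition self_similar :: "'v pair_pre_digraph \<Rightarrow> 'v set \<Rightarrow> ('v \<Rightarrow> 'v) \<Rightarrow> bool" where
  "self_similar X F \<psi> \<longleftrightarrow>
     pair_bidirected_digraph X \<and> Digraph_Component.connected (with_proj X) \<and>
     infinite (pverts X) \<and> F \<subseteq> pverts X \<and>
     (\<forall>x\<in>F. \<forall>y\<in>F. (x, y) \<notin> parcs X) \<and>
     (\<forall>C\<in>cells X F. \<forall>D\<in>cells X F. C \<noteq> D \<longrightarrow>
        (\<forall>x\<in>boundary X C \<inter> boundary X D. \<forall>y\<in>boundary X C \<inter> boundary X D. x = y)) \<and>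
     graph_isomorphism \<psi> X (reduced_graph X F)"

text \<open>
  For the automorphism group of a cell graph to act on the ordered pairs of distinct boundary
  vertices, automorphisms must map the boundary to itself. As for the isomorphisms between
  cell graphs, this is required of the automorphism carrying one given pair to another.
\<close>

definition symmetrically_self_similar ::
  "'v pair_pre_digraph \<Rightarrow> 'v set \<Rightarrow> ('v \<Rightarrow> 'v) \<Rightarrow> bool" where
  "symmetrically_self_similar X F \<psi> \<longleftrightarrow>
     self_similar X F \<psi> \<and> locally_finite X \<and>
     (\<forall>C\<in>cells X F. finite C) \<and>
     (\<forall>C\<in>cells X F. \<forall>D\<in>cells X F. \<exists>\<alpha>.
        graph_isomorphism \<alpha> (cell_graph X C) (cell_graph X D) \<and>
        \<alpha> ` boundary X C = boundary X D) \<and>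
     (\<forall>C\<in>cells X F. \<forall>x\<in>boundary X C. \<forall>y\<in>boundary X C. \<forall>x'\<in>boundary X C. \<forall>y'\<in>boundary X C.
        x \<noteq> y \<and> x' \<noteq> y' \<longrightarrow>
        (\<exists>\<alpha>. graph_isomorphism \<alpha> (cell_graph X C) (cell_graph X C) \<and>
             \<alpha> ` boundary X C = boundary X C \<and> \<alpha> x = x' \<and> \<alpha> y = y'))"

definition origin_vertex :: "'v pair_pre_digraph \<Rightarrow> ('v \<Rightarrow> 'v) \<Rightarrow> 'v \<Rightarrow> bool" where
  "origin_vertex X \<psi> v \<longleftrightarrow> v \<in> pverts X \<and> \<psi> v = v"

text \<open>
  The number of 1-cells in a 2-cell does not depend on the 2-cell, so any choice will do.
\<close>

definition mass_scaling :: "'v pair_pre_digraph \<Rightarrow> 'v set \<Rightarrow> ('v \<Rightarrow> 'v) \<Rightarrow> nat" where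
  "mass_scaling X F \<psi> =
     (let D = (SOME D. D \<in> cells X (\<psi> ` F)) in card {C \<in> cells X F. C \<subseteq> D})"


section \<open>The transition function\<close>

text \<open>
  Matrices with rows and columns indexed by a finite set \<open>S\<close> are functions of two arguments.
  The entries of the inverse outside \<open>S\<close> are set to 0, which makes it unique.
\<close>

definition matrix_inverse_on ::
  "'v set \<Rightarrow> ('v \<Rightarrow> 'v \<Rightarrow> complex) \<Rightarrow> 'v \<Rightarrow> 'v \<Rightarrow> complex" where
  "matrix_inverse_on S A =
     (THE N. (\<forall>x y. x \<notin> S \<or> y \<notin> S \<longrightarrow> N x y = 0) \<and>
        (\<forall>x\<in>S. \<forall>y\<in>S. (\<Sum>w\<in>S. A x w * N w y) = (if x = y then 1 else 0)) \<and>
        (\<forall>x\<in>S. \<forall>y\<in>S. (\<Sum>w\<in>S. N x w * A w y) = (if x = y then 1 else 0)))"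

definition cell_transition_matrix ::
  "'v pair_pre_digraph \<Rightarrow> 'v set \<Rightarrow> 'v set \<Rightarrow> 'v \<Rightarrow> 'v \<Rightarrow> real" where
  "cell_transition_matrix X C B x y =
     (if x \<in> pverts (cell_graph X C) - B \<and> (x, y) \<in> parcs (cell_graph X C)
      then 1 / real (degree_in (cell_graph X C) x) else 0)"

definition cell_resolvent ::
  "'v pair_pre_digraph \<Rightarrow> 'v set \<Rightarrow> 'v set \<Rightarrow> complex \<Rightarrow> 'v \<Rightarrow> 'v \<Rightarrow> complex" where
  "cell_resolvent X C B z =
     matrix_inverse_on (pverts (cell_graph X C))
       (\<lambda>x y. (if x = y then 1 else 0) - z * of_real (cell_transition_matrix X C B x y))"

definition cell_transition_function ::
  "'v pair_pre_digraph \<Rightarrow> 'v set \<Rightarrow> 'v \<Rightarrow> complex \<Rightarrow> complex" where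
  "cell_transition_function X C v z =
     (\<Sum>w\<in>boundary X C - {v}. cell_resolvent X C (boundary X C - {v}) z v w)"

text \<open>
  The function is independent of the cell and of the boundary vertex. It is given here by the
  matrix formula, hence on the complement of the finitely many \<open>z\<close> at which the matrix
  is singular; its extension to the Riemann sphere is \<open>sphere_map\<close> below.
\<close>

definition transition_function ::
  "'v pair_pre_digraph \<Rightarrow> 'v set \<Rightarrow> complex \<Rightarrow> complex" where
  "transition_function X F =
     (let (C, v) = (SOME (C, v). C \<in> cells X F \<and> v \<in> boundary X C)
      in cell_transition_function X C v)"

text \<open>The derivative at 1 is a real number, since the matrices above are real.\<close>

definition time_scaling :: "'v pair_pre_digraph \<Rightarrow> 'v set \<Rightarrow> real" where
  "time_scaling X F = Re (deriv (transition_function X F) 1)"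

definition spectral_dimension :: "'v pair_pre_digraph \<Rightarrow> 'v set \<Rightarrow> ('v \<Rightarrow> 'v) \<Rightarrow> real" where
  "spectral_dimension X F \<psi> = 2 * ln (real (mass_scaling X F \<psi>)) / ln (time_scaling X F)"


section \<open>The Riemann sphere, Julia sets and Cantor sets\<close>

datatype riemann_sphere = Finite complex | Infinity

text \<open>
  Inverse stereographic projection onto the unit sphere of \<open>\<complex> \<times> \<real>\<close>. The metric is the
  resulting chordal metric.
\<close>

primrec inverse_stereographic :: "riemann_sphere \<Rightarrow> complex \<times> real" where
  "inverse_stereographic (Finite z) =
     ((2 / ((norm z)\<^sup>2 + 1)) *\<^sub>R z, ((norm z)\<^sup>2 - 1) / ((norm z)\<^sup>2 + 1))"
| "inverse_stereographic Infinity = (0, 1)"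

lemma inverse_stereographic_Finite_ne: "inverse_stereographic (Finite z) \<noteq> (0, 1)"
proof
  assume "inverse_stereographic (Finite z) = (0, 1)"
  then have "((norm z)\<^sup>2 - 1) / ((norm z)\<^sup>2 + 1) = 1" by simp
  moreover have "(norm z)\<^sup>2 + 1 \<noteq> 0"
    using zero_le_power2[of "norm z"] by linarith
  ultimately show False by (simp add: divide_eq_eq)
qed

lemma inj_inverse_stereographic: "inj inverse_stereographic"
proof (rule injI)
  fix a b :: riemann_sphere
  assume eq: "inverse_stereographic a = inverse_stereographic b"
  show "a = b"
  proof (cases a; cases b)
    fix z w assume ab: "a = Finite z" "b = Finite w"
    define s where "s = (norm z)\<^sup>2 + 1"
    define t where "t = (norm w)\<^sup>2 + 1"
    have pos: "s > 0" "t > 0"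
      unfolding s_def t_def using zero_le_power2[of "norm z"] zero_le_power2[of "norm w"] by linarith+
    have "(s - 2) / s = (t - 2) / t"
      using eq ab by (simp add: s_def t_def)
    then have "s = t"
      using pos by (simp add: field_simps)
    moreover have "(2 / s) *\<^sub>R z = (2 / t) *\<^sub>R w"
      using eq ab by (simp add: s_def t_def)
    ultimately have "z = w" using pos by simp
    with ab show ?thesis by simp
  qed (use eq inverse_stereographic_Finite_ne in \<open>auto simp del: inverse_stereographic.simps(1)
        dest: sym\<close>)
qed

instantiation riemann_sphere :: metric_space
begin

definition dist_riemann_sphere :: "riemann_sphere \<Rightarrow> riemann_sphere \<Rightarrow> real" where
  "dist_riemann_sphere a b = dist (inverse_stereographic a) (inverse_stereographic b)"

definition uniformity_riemann_sphere :: "(riemann_sphere \<times> riemann_sphere) filter" where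
  "uniformity_riemann_sphere = (INF e\<in>{0<..}. principal {(x, y). dist x y < e})"

definition open_riemann_sphere :: "riemann_sphere set \<Rightarrow> bool" where
  "open_riemann_sphere U \<longleftrightarrow>
     (\<forall>x\<in>U. eventually (\<lambda>(x', y). x' = x \<longrightarrow> y \<in> U) uniformity)"

instance
proof
  fix x y z :: riemann_sphere
  show "dist x y = 0 \<longleftrightarrow> x = y"
    using inj_inverse_stereographic by (simp add: dist_riemann_sphere_def inj_eq)
  show "dist x y \<le> dist x z + dist y z"
    by (simp add: dist_riemann_sphere_def dist_triangle2)
qed (simp_all add: uniformity_riemann_sphere_def open_riemann_sphere_def)

end

text \<open>
  A rational function, given on the complement of a finite subset of \<open>\<complex>\<close>, is turned into a self-map
  of the sphere by taking limits in the sphere: this removes removable singularities, sends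
  poles to infinity and supplies the value at infinity. (The argument \<open>Infinity\<close> is immaterial
  in the case distinction: it does not occur near a finite point nor in a punctured
  neighbourhood of infinity.)
\<close>

definition sphere_map :: "(complex \<Rightarrow> complex) \<Rightarrow> riemann_sphere \<Rightarrow> riemann_sphere" where
  "sphere_map f w =
     Lim (at w) (\<lambda>u. case u of Finite z \<Rightarrow> Finite (f z) | Infinity \<Rightarrow> Infinity)"

text \<open>
  Normality in the sense of Montel: every sequence in the family has a subsequence converging
  locally uniformly. As the sphere is compact, no divergence to infinity needs separate treatment.
\<close>

definition normal_family_on :: "'a::metric_space set \<Rightarrow> ('a \<Rightarrow> 'b::metric_space) set \<Rightarrow> bool" where
  "normal_family_on U \<F> \<longleftrightarrow>
     (\<forall>s::nat \<Rightarrow> 'a \<Rightarrow> 'b. range s \<subseteq> \<F> \<longrightarrow>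
        (\<exists>(r::nat \<Rightarrow> nat) g. strict_mono r \<and>
           (\<forall>K. compact K \<and> K \<subseteq> U \<longrightarrow> uniform_limit K (s \<circ> r) g sequentially)))"

definition fatou_set :: "(riemann_sphere \<Rightarrow> riemann_sphere) \<Rightarrow> riemann_sphere set" where
  "fatou_set f = {w. \<exists>U. open U \<and> w \<in> U \<and> normal_family_on U (range (\<lambda>n. f ^^ n))}"

definition julia_set :: "(riemann_sphere \<Rightarrow> riemann_sphere) \<Rightarrow> riemann_sphere set" where
  "julia_set f = - fatou_set f"

primrec middle_thirds_stage :: "nat \<Rightarrow> real set" where
  "middle_thirds_stage 0 = {0..1}"
| "middle_thirds_stage (Suc n) =
     (\<lambda>x. x / 3) ` middle_thirds_stage n \<union> (\<lambda>x. 2 / 3 + x / 3) ` middle_thirds_stage n"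

definition middle_thirds_set :: "real set" where
  "middle_thirds_set = (\<Inter>n. middle_thirds_stage n)"

definition cantor_set :: "'a::topological_space set \<Rightarrow> bool" where
  "cantor_set S \<longleftrightarrow> S homeomorphic middle_thirds_set"


section \<open>The Green function and its singularity at 1\<close>

fun walk_probability :: "'v pair_pre_digraph \<Rightarrow> nat \<Rightarrow> 'v \<Rightarrow> 'v \<Rightarrow> real" where
  "walk_probability X 0 x y = (if x = y then 1 else 0)"
| "walk_probability X (Suc n) x y =
     (\<Sum>w\<in>neighbours X x. 1 / real (degree_in X x) * walk_probability X n w y)"

definition slit_plane :: "complex set" where
  "slit_plane = {z. z \<notin> \<real> \<or> \<bar>Re z\<bar> < 1}"

text \<open>
  The holomorphic continuation of the Green function to \<^const>\<open>slit_plane\<close>. It exists there and is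
  unique by the identity theorem; the values elsewhere are unspecified and never used.
\<close>

definition green_function :: "'v pair_pre_digraph \<Rightarrow> 'v \<Rightarrow> complex \<Rightarrow> complex" where
  "green_function X v =
     (SOME G. G holomorphic_on slit_plane \<and>
        (\<forall>z. norm z < 1 \<longrightarrow> G z = (\<Sum>n. of_real (walk_probability X n v v) * z ^ n)))"

definition sector :: "real \<Rightarrow> complex \<Rightarrow> real \<Rightarrow> complex set" where
  "sector \<delta> z0 r = {z. z \<noteq> z0 \<and> norm (z - z0) < r \<and> \<bar>Arg (z0 - z)\<bar> < \<delta>}"

definition strip :: "real \<Rightarrow> complex set" where
  "strip b = {z. \<bar>Im z\<bar> < pi / ln b}"

text \<open>
  In the expansion the \<open>O\<close>-term is the \<open>e\<close> below; its constant \<open>K\<close> may depend on \<open>\<delta>\<close>, but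
  \<open>r\<close> may not.
\<close>

definition singular_expansion ::
  "(complex \<Rightarrow> complex) \<Rightarrow> real \<Rightarrow> real \<Rightarrow> (complex \<Rightarrow> complex) \<Rightarrow> bool" where
  "singular_expansion G ds \<tau> \<omega> \<longleftrightarrow>
     (\<exists>r>0. \<forall>\<delta>. 0 < \<delta> \<and> \<delta> < pi \<longrightarrow>
        (\<exists>K. \<forall>z\<in>sector \<delta> 1 r. \<exists>e.
           norm e \<le> K * norm (z - 1) \<and>
           G z = (1 - z) powr of_real (ds / 2 - 1) * (\<omega> (Ln (1 - z) / of_real (ln \<tau>)) + e)))"

text \<open>The function \<open>\<omega>\<close> exists and is unique on the strip.\<close>

definition omega_function ::
  "'v pair_pre_digraph \<Rightarrow> 'v set \<Rightarrow> ('v \<Rightarrow> 'v) \<Rightarrow> 'v \<Rightarrow> complex \<Rightarrow> complex" where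
  "omega_function X F \<psi> v =
     (SOME \<omega>. \<omega> holomorphic_on strip (time_scaling X F) \<and>
        (\<forall>z\<in>strip (time_scaling X F). \<omega> (z + 1) = \<omega> z) \<and>
        singular_expansion (green_function X v) (spectral_dimension X F \<psi>) (time_scaling X F) \<omega>)"

definition fourier_coefficient :: "(complex \<Rightarrow> complex) \<Rightarrow> int \<Rightarrow> complex" where
  "fourier_coefficient f k =
     integral {0..1} (\<lambda>t. f (of_real t) * exp (- 2 * of_int k * of_real pi * \<i> * of_real t))"

text \<open>
  \<^const>\<open>rGamma\<close> is the entire function \<open>1 / \<Gamma>\<close>, equal to 0 at the poles of \<open>\<Gamma>\<close>. The series
  converges absolutely on \<open>strip (\<tau>\<^sup>2)\<close>.
\<close>

definition sigma_function ::
  "'v pair_pre_digraph \<Rightarrow> 'v set \<Rightarrow> ('v \<Rightarrow> 'v) \<Rightarrow> 'v \<Rightarrow> complex \<Rightarrow> complex" where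
  "sigma_function X F \<psi> v z =
     (\<Sum>\<^sub>\<infinity>k::int\<in>UNIV.
        fourier_coefficient (omega_function X F \<psi> v) (- k)
        * rGamma (1 - (of_real (ln (real (mass_scaling X F \<psi>))) - 2 * of_int k * of_real pi * \<i>)
                      / of_real (ln (time_scaling X F)))
        * exp (2 * of_int k * of_real pi * \<i> * z))"

end

theory Submission
  imports Defs "Jordan_Normal_Form.Determinant"
begin

text \<open>
  Replacing the walk on \<open>X\<close> by its trace on \<open>F\<close>, which is again a simple random walk on a copy of
  \<open>X\<close>, gives \<open>G z = f z * G (d z)\<close> with \<open>f\<close> rational and \<open>f 1 = \<tau> / \<mu>\<close>. An energy estimate shows
  that \<open>d\<close> maps the plane slit along \<open>[1, \<infinity>)\<close> and \<open>(-\<infinity>, 1 - \<theta>]\<close>, with \<open>\<theta>\<close> the number of boundary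
  vertices of a cell, into itself. There all orbits tend to the superattracting fixed point 0, so
  the equation continues \<open>G\<close> holomorphically. At the fixed point 1, which is repelling with
  multiplier \<open>\<tau>\<close>, a Koenigs linearization turns the equation into the singular expansion of \<open>G\<close>.

  If \<open>\<sigma>\<close> is constant, then all Fourier coefficients of \<open>\<omega>\<close> except the one of index 0 vanish,
  since \<open>1 / \<Gamma>\<close> has no zeros at the points in question; hence \<open>\<omega>\<close> is constant. Then \<open>G\<close> is, up to a
  holomorphic factor, a power of the Koenigs function near 1, and so has different limits from the two
  sides of the slit \<open>(1, 1 + r)\<close>. When \<open>d\<close> has a Cantor Julia set, there are points of the
  slit whose orbits tend to 0 instead. By the functional equation, the two limits
  of \<open>G\<close> agree at such points, a contradiction.
\<close>

section \<open>Repelling fixed points\<close>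

text \<open>Since \<open>X\<close> is isomorphic to its own reduced graph, its edges split into
  cliques with \<theta> vertices. On a cell graph this bounds the quadratic form of the averaging
  operator below by -1/(\<theta> - 1) times the squared norm, which puts the end of the left cut at
  1 - \<theta>. Convergence of orbits to 0 in the doubly slit plane is then Schwarz's lemma after a
  Riemann map. The exponent \<open>s\<close>, which is half the spectral dimension minus 1, lies
  strictly between -1 and 0 because 1 < \<mu> < \<tau>; this is why the powers on the two sides of
  the cut differ.

  For the contradiction, a point of the cut is needed at which the iterated functional equation is
  continuous. A Cantor set contains no segment, so Fatou points lie on the cut arbitrarily near 1.
  Nearby nonreal points have orbits tending to 0, and normality makes this uniform, so that one
  iterate carries them all into the disc. The countably many points whose orbits meet singularities
  are avoided. Since \<omega> is given by a choice operator, the expansion is used twice: it is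
  derived to show that \<omega> exists, and inverted for whichever \<omega> is chosen.\<close>

lemma contraction_iterates:
  fixes g :: "complex \<Rightarrow> complex"
  assumes g: "\<And>z. z \<in> ball p e \<Longrightarrow> norm (g z - p) \<le> \<kappa> * norm (z - p)"
    and \<kappa>: "0 \<le> \<kappa>" "\<kappa> < 1" and z: "z \<in> ball p e"
  shows "(g ^^ n) z \<in> ball p e \<and> norm ((g ^^ n) z - p) \<le> \<kappa> ^ n * norm (z - p)"
proof (induction n)
  case 0
  then show ?case using z by simp
next
  case (Suc n)
  have "norm (g ((g ^^ n) z) - p) \<le> \<kappa> * norm ((g ^^ n) z - p)"
    using g Suc by blast
  also have "\<dots> \<le> \<kappa> * (\<kappa> ^ n * norm (z - p))"
    using Suc \<kappa> by (intro mult_left_mono) auto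
  finally have le: "norm (g ((g ^^ n) z) - p) \<le> \<kappa> ^ Suc n * norm (z - p)"
    by (simp add: mult.assoc)
  also have "\<dots> \<le> norm (z - p)"
    using \<kappa> by (intro mult_left_le_one_le) (auto simp: power_le_one simp del: power_Suc)
  finally have "norm (g ((g ^^ n) z) - p) \<le> norm (z - p)" .
  then show ?case
    using le z by (simp add: dist_norm norm_minus_commute)
qed

text \<open>The quotient of \<open>h z - h p\<close> by \<open>z - p\<close> extends holomorphically
  over \<open>p\<close>, hence is bounded on the compact disc.\<close>

lemma holomorphic_lipschitz_at_centre:
  assumes h: "h holomorphic_on ball p e" and r: "0 < r" "r < e"
  obtains C where "C \<ge> 0" "\<And>z. z \<in> cball p r \<Longrightarrow> norm (h z - h p) \<le> C * norm (z - p)"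
proof -
  have "(\<lambda>u. h (p + u) - h p) holomorphic_on ball 0 e"
  proof -
    have "h \<circ> (\<lambda>u. p + u) holomorphic_on ball 0 e"
      by (rule holomorphic_on_compose_gen[OF _ h]) (auto intro!: holomorphic_intros simp: dist_norm)
    then show ?thesis by (auto intro!: holomorphic_intros simp: o_def)
  qed
  then obtain k where k: "k holomorphic_on ball 0 e"
      "\<And>u. norm u < e \<Longrightarrow> h (p + u) - h p = u * k u"
    using Schwarz3[of "\<lambda>u. h (p + u) - h p" e] by auto
  have "compact (k ` cball 0 r)"
    by (rule compact_continuous_image)
       (use r in \<open>auto intro!: continuous_on_subset[OF holomorphic_on_imp_continuous_on[OF k(1)]]\<close>)
  then obtain C where C: "\<And>u. u \<in> cball 0 r \<Longrightarrow> norm (k u) \<le> C"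
    using compact_imp_bounded[of "k ` cball 0 r"] unfolding bounded_iff by blast
  show ?thesis
  proof (rule that)
    show "C \<ge> 0" using order_trans[OF norm_ge_zero C[of 0]] r by simp
    fix z assume "z \<in> cball p r"
    then have "norm (z - p) \<le> r" by (simp add: dist_norm norm_minus_commute)
    then have "h z - h p = (z - p) * k (z - p)" "norm (k (z - p)) \<le> C"
      using k(2)[of "z - p"] C[of "z - p"] r by auto
    then show "norm (h z - h p) \<le> C * norm (z - p)"
      using mult_right_mono[of "norm (k (z - p))" C "norm (z - p)"] by (simp add: norm_mult mult.commute)
  qed
qed

text \<open>\<open>P\<close> is the infinite product of \<open>q\<close> along the orbit of
  \<open>z\<close> under \<open>g\<close>. It converges because \<open>q - 1\<close> is bounded by a
  multiple of the distance to \<open>p\<close>, which shrinks geometrically. Splitting off the first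
  factor gives the cocycle equation. Both the Koenigs function and the coboundary \<open>H\<close>
  are obtained in this way.\<close>

lemma product_along_contraction:
  fixes g q :: "complex \<Rightarrow> complex"
  assumes e: "e > 0" and g_hol: "g holomorphic_on ball p e"
    and g: "\<And>z. z \<in> ball p e \<Longrightarrow> norm (g z - p) \<le> \<kappa> * norm (z - p)"
    and \<kappa>: "0 \<le> \<kappa>" "\<kappa> < 1"
    and q_hol: "q holomorphic_on ball p e" and qp: "q p = 1"
  obtains P r where "0 < r" "r < e" "P holomorphic_on ball p r" "P p = 1"
    "\<And>z. z \<in> ball p r \<Longrightarrow> g z \<in> ball p r \<and> P z = q z * P (g z)"
proof -
  define r where "r = e / 2"
  have r: "0 < r" "r < e" using e by (auto simp: r_def)
  have gp: "g p = p" using g[of p] e by simp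
  obtain C where C0: "C \<ge> 0" and "\<And>z. z \<in> cball p r \<Longrightarrow> norm (q z - q p) \<le> C * norm (z - p)"
    using holomorphic_lipschitz_at_centre[OF q_hol r] by blast
  then have q_bound: "norm (q z - 1) \<le> C * norm (z - p)" if "z \<in> cball p r" for z
    using that by (simp add: qp)
  have it: "(g ^^ n) z \<in> cball p r" "norm ((g ^^ n) z - p) \<le> \<kappa> ^ n * norm (z - p)"
    if "z \<in> cball p r" for n z
  proof -
    have "z \<in> ball p e" using that r by simp
    from contraction_iterates[OF g \<kappa> this, of n]
    show le: "norm ((g ^^ n) z - p) \<le> \<kappa> ^ n * norm (z - p)" by simp
    also have "\<dots> \<le> norm (z - p)"
      using \<kappa> by (intro mult_left_le_one_le) (auto simp: power_le_one)
    finally show "(g ^^ n) z \<in> cball p r"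
      using that by (simp add: dist_norm norm_minus_commute)
  qed
  have gn_hol: "(g ^^ n) holomorphic_on ball p e" for n
  proof (induction n)
    case (Suc n)
    have "g \<circ> (g ^^ n) holomorphic_on ball p e"
      by (rule holomorphic_on_compose_gen[OF Suc g_hol])
         (use contraction_iterates[OF g \<kappa>] in blast)
    then show ?case by (simp add: o_def)
  qed (auto simp: id_def intro: holomorphic_intros)
  define F where "F n z = q ((g ^^ n) z)" for n z
  have F_hol: "F n holomorphic_on ball p e" for n
  proof -
    have "q \<circ> (g ^^ n) holomorphic_on ball p e"
      by (rule holomorphic_on_compose_gen[OF gn_hol q_hol])
         (use contraction_iterates[OF g \<kappa>] in blast)
    then show ?thesis by (simp add: o_def F_def[abs_def])
  qed
  have F_cont: "continuous_on (cball p r) (F n)" for n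
    using holomorphic_on_imp_continuous_on[OF F_hol] by (rule continuous_on_subset) (use r in auto)
  have F_bound: "norm (F n z - 1) \<le> C * r * \<kappa> ^ n" if "z \<in> cball p r" for n z
  proof -
    have "norm (F n z - 1) \<le> C * norm ((g ^^ n) z - p)"
      using q_bound it that unfolding F_def by blast
    also have "\<dots> \<le> C * (\<kappa> ^ n * norm (z - p))"
      using it that C0 by (intro mult_left_mono) auto
    also have "\<dots> \<le> C * (\<kappa> ^ n * r)"
      using that C0 \<kappa> by (intro mult_left_mono) (auto simp: dist_norm norm_minus_commute)
    finally show ?thesis by (simp add: mult_ac)
  qed
  have "uniformly_convergent_on (cball p r) (\<lambda>N z. \<Sum>n<N. norm (F n z - 1))"
    by (rule Weierstrass_m_test'_ev[where M = "\<lambda>n. C * r * \<kappa> ^ n"])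
       (use F_bound \<kappa> in \<open>auto intro!: always_eventually summable_mult\<close>)
  then have "uniformly_convergent_on (cball p r) (\<lambda>N z. \<Prod>n<N. F n z)"
    by (intro uniformly_convergent_on_prod' F_cont) auto
  then obtain P where P: "uniform_limit (cball p r) (\<lambda>N z. \<Prod>n<N. F n z) P sequentially"
    unfolding uniformly_convergent_on_def by blast
  have P_lim: "(\<lambda>N. \<Prod>n<N. F n z) \<longlonglongrightarrow> P z" if "z \<in> cball p r" for z
    using tendsto_uniform_limitI[OF P that] .
  have "P holomorphic_on ball p r"
  proof (rule holomorphic_uniform_sequence)
    show "(\<lambda>z. \<Prod>n<N. F n z) holomorphic_on ball p r" for N
      by (intro holomorphic_on_prod holomorphic_on_subset[OF F_hol]) (use r in auto)
    fix x assume "x \<in> ball p r"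
    then obtain \<epsilon> where "\<epsilon> > 0" "cball x \<epsilon> \<subseteq> ball p r"
      using open_contains_cball[of "ball p r"] by blast
    moreover from this have "cball x \<epsilon> \<subseteq> cball p r" using ball_subset_cball by blast
    ultimately show "\<exists>d>0. cball x d \<subseteq> ball p r \<and> uniform_limit (cball x d) (\<lambda>N z. \<Prod>n<N. F n z) P sequentially"
      using uniform_limit_on_subset[OF P] by blast
  qed auto
  moreover have "P p = 1"
  proof -
    have "(g ^^ n) p = p" for n by (induction n) (auto simp: gp)
    then have "(\<lambda>N. \<Prod>n<N. F n p) = (\<lambda>N. 1)" by (simp add: F_def qp)
    then show ?thesis using P_lim[of p] r by (simp add: LIMSEQ_const_iff)
  qed
  moreover have "g z \<in> ball p r \<and> P z = q z * P (g z)" if "z \<in> ball p r" for z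
  proof -
    have z: "z \<in> cball p r" "z \<in> ball p e" using that r by auto
    have "norm (g z - p) \<le> 1 * norm (z - p)"
      using g[OF z(2)] \<kappa> by (meson mult_right_mono norm_ge_zero order_trans less_imp_le)
    then have gz: "g z \<in> ball p r" using that by (simp add: dist_norm norm_minus_commute)
    have "(\<Prod>n<Suc N. F n z) = q z * (\<Prod>n<N. F n (g z))" for N
      by (subst prod.lessThan_Suc_shift) (simp add: F_def funpow_Suc_right del: funpow.simps)
    moreover have "(\<lambda>N. \<Prod>n<Suc N. F n z) \<longlonglongrightarrow> P z"
      using P_lim[OF z(1)] by (rule LIMSEQ_Suc)
    moreover have "(\<lambda>N. q z * (\<Prod>n<N. F n (g z))) \<longlonglongrightarrow> q z * P (g z)"
      using P_lim[of "g z"] gz by (intro tendsto_intros) auto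
    ultimately show ?thesis using gz LIMSEQ_unique by simp
  qed
  ultimately show ?thesis using that[of r P] r by blast
qed

lemma local_inverse_of_repelling_fixpoint:
  fixes d :: "complex \<Rightarrow> complex"
  assumes hol: "d holomorphic_on S" and S: "open S" "p \<in> S" and dp: "d p = p"
    and l: "norm (deriv d p) > 1"
  obtains g e r \<kappa> where "e > 0" "ball p e \<subseteq> S" "inj_on d (ball p e)" "r > 0" "r \<le> e"
    "g holomorphic_on ball p r" "g p = p" "deriv g p = 1 / deriv d p"
    "0 \<le> \<kappa>" "\<kappa> < 1" "\<And>z. z \<in> ball p r \<Longrightarrow> norm (g z - p) \<le> \<kappa> * norm (z - p)"
    "\<And>z. z \<in> ball p r \<Longrightarrow> d (g z) = z"
    "\<And>w. w \<in> ball p e \<Longrightarrow> g (d w) = w"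
proof -
  have "deriv d p \<noteq> 0" using l by auto
  then obtain e where e: "e > 0" "ball p e \<subseteq> S" "inj_on d (ball p e)"
    using has_complex_derivative_locally_injective[OF hol S(2) S(1)] by blast
  have hol': "d holomorphic_on ball p e" using hol e(2) by (rule holomorphic_on_subset)
  obtain g where g: "g holomorphic_on (d ` ball p e)"
      "\<And>z. z \<in> ball p e \<Longrightarrow> deriv d z * deriv g (d z) = 1"
      "\<And>z. z \<in> ball p e \<Longrightarrow> g (d z) = z"
    using holomorphic_has_inverse[OF hol' _ e(3)] by auto
  have "open (d ` ball p e)" using open_mapping_thm3[OF hol' _ e(3)] by auto
  moreover have pim: "p \<in> d ` ball p e" using dp e(1) by (metis centre_in_ball imageI)
  ultimately obtain r1 where r1: "r1 > 0" "ball p r1 \<subseteq> d ` ball p e"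
    using openE by blast
  have gp: "g p = p" using g(3)[of p] dp e(1) by simp
  have dg: "deriv g p = 1 / deriv d p"
    using g(2)[of p] dp e(1) \<open>deriv d p \<noteq> 0\<close> by (simp add: field_simps)
  \<comment> \<open>The midpoint between the modulus of the derivative of \<open>g\<close> at
    \<open>p\<close> and 1; the difference quotient of \<open>g\<close> stays below it near
    \<open>p\<close>.\<close>
  define \<kappa> where "\<kappa> = (1 + 1 / norm (deriv d p)) / 2"
  have \<kappa>: "norm (deriv g p) < \<kappa>" "0 \<le> \<kappa>" "\<kappa> < 1"
  proof -
    have "1 / norm (deriv d p) < 1" using l by (subst divide_less_eq_1_pos) auto
    then show "norm (deriv g p) < \<kappa>" "0 \<le> \<kappa>" "\<kappa> < 1"
      by (auto simp: \<kappa>_def dg norm_divide intro: add_nonneg_nonneg)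
  qed
  have "(g has_field_derivative deriv g p) (at p)"
    using g(1) r1 by (metis \<open>open (d ` ball p e)\<close> holomorphic_derivI pim)
  then have "(\<lambda>z. norm ((g z - g p) / (z - p))) \<midarrow>p\<rightarrow> norm (deriv g p)"
    unfolding has_field_derivative_iff by (intro tendsto_norm)
  then have "eventually (\<lambda>z. norm ((g z - g p) / (z - p)) < \<kappa>) (at p)"
    using \<kappa>(1) by (rule order_tendstoD)
  then obtain r2 where r2: "r2 > 0" "\<And>z. z \<noteq> p \<Longrightarrow> dist z p < r2 \<Longrightarrow> norm ((g z - g p) / (z - p)) < \<kappa>"
    unfolding eventually_at by auto
  define r where "r = min e (min r1 r2)"
  have r: "r > 0" "r \<le> e" "r \<le> r1" "r \<le> r2" using e r1 r2 by (auto simp: r_def)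
  have "ball p r \<subseteq> d ` ball p e" using r1(2) r(3) by (meson subset_ball subset_trans)
  then show ?thesis
  proof (intro that[of e r g \<kappa>] e r gp dg \<kappa> g(3))
    show "g holomorphic_on ball p r" using g(1) \<open>ball p r \<subseteq> _\<close> holomorphic_on_subset by blast
    show "norm (g z - p) \<le> \<kappa> * norm (z - p)" if "z \<in> ball p r" for z
    proof (cases "z = p")
      case False
      then have "norm ((g z - g p) / (z - p)) < \<kappa>" using that r r2(2)[of z] by (simp add: dist_commute)
      then show ?thesis using False by (simp add: norm_divide gp divide_simps mult.commute)
    qed (simp add: gp)
    show "d (g z) = z" if "z \<in> ball p r" for z
      using that \<open>ball p r \<subseteq> _\<close> g(3) by fastforce
  qed
qed

text \<open>Products along orbits of \<open>d\<close> would diverge, so they are taken along the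
  local inverse \<open>g\<close>, which contracts. With \<open>q z\<close> equal to \<open>l\<close>
  times the quotient of \<open>g z - p\<close> by \<open>z - p\<close>, the function
  \<open>z - p\<close> times the product of \<open>q\<close> is the Koenigs function. As
  \<open>d\<close> expands, the equations can only be claimed where \<open>d z\<close> is still in
  the disc.\<close>

lemma linearization_at_repelling_fixpoint:
  fixes d :: "complex \<Rightarrow> complex"
  assumes hol: "d holomorphic_on S" "f holomorphic_on S" and S: "open S" "p \<in> S" and dp: "d p = p"
    and l: "norm (deriv d p) > 1" and fp: "f p \<noteq> 0"
  obtains \<phi> H e where "e > 0" "ball p e \<subseteq> S"
    "\<phi> holomorphic_on ball p e" "\<phi> p = 0" "deriv \<phi> p = 1"
    "\<And>z. z \<in> ball p e \<Longrightarrow> d z \<in> ball p e \<Longrightarrow> \<phi> (d z) = deriv d p * \<phi> z"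
    "H holomorphic_on ball p e" "H p = 1"
    "\<And>z. z \<in> ball p e \<Longrightarrow> d z \<in> ball p e \<Longrightarrow> H (d z) = H z * f z / f p"
proof -
  define l where "l = deriv d p"
  have l0: "l \<noteq> 0" using l l_def by auto
  obtain g e r \<kappa> where er: "e > 0" "ball p e \<subseteq> S" "inj_on d (ball p e)" "r > 0" "r \<le> e"
    and g: "g holomorphic_on ball p r" "g p = p" "deriv g p = 1 / l"
    and \<kappa>: "0 \<le> \<kappa>" "\<kappa> < 1" "\<And>z. z \<in> ball p r \<Longrightarrow> norm (g z - p) \<le> \<kappa> * norm (z - p)"
    and dg: "\<And>z. z \<in> ball p r \<Longrightarrow> d (g z) = z"
    and gd: "\<And>w. w \<in> ball p e \<Longrightarrow> g (d w) = w"
    using local_inverse_of_repelling_fixpoint[OF hol(1) S dp l] unfolding l_def by metis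
  define q where "q z = (if z = p then 1 else l * (g z - p) / (z - p))" for z
  have q_hol: "q holomorphic_on ball p r"
  proof -
    have "(\<lambda>z. if z = p then deriv g p else (g z - g p) / (z - p)) holomorphic_on ball p r"
      by (rule pole_lemma_open) (use g in auto)
    then have "(\<lambda>z. l * (if z = p then deriv g p else (g z - g p) / (z - p))) holomorphic_on ball p r"
      by (intro holomorphic_intros)
    moreover have "(\<lambda>z. l * (if z = p then deriv g p else (g z - g p) / (z - p))) = q"
      using l0 g by (auto simp: q_def fun_eq_iff)
    ultimately show ?thesis by simp
  qed
  have g_eq: "l * (g z - p) = (z - p) * q z" for z
    by (auto simp: q_def g)
  have qp: "q p = 1" by (simp add: q_def)
  obtain P r1 where P: "0 < r1" "r1 < r" "P holomorphic_on ball p r1" "P p = 1"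
    "\<And>z. z \<in> ball p r1 \<Longrightarrow> g z \<in> ball p r1 \<and> P z = q z * P (g z)"
    using product_along_contraction[OF er(4) g(1) \<kappa>(3,1,2) q_hol qp] by metis
  have g_ball: "g z \<in> ball p r" if "z \<in> ball p r" for z
    using contraction_iterates[OF \<kappa>(3,1,2) that, of 1] by simp
  \<comment> \<open>The equation for \<open>H\<close> is used at \<open>d z\<close>, where
    \<open>g (d z) = z\<close> turns this factor into \<open>f z / f p\<close>.\<close>
  define q2 where "q2 z = f (g z) / f p" for z
  have q2_hol: "q2 holomorphic_on ball p r"
  proof -
    have "f \<circ> g holomorphic_on ball p r"
      by (rule holomorphic_on_compose_gen[OF g(1) hol(2)]) (use g_ball er in fastforce)
    then show ?thesis by (auto intro!: holomorphic_intros simp: fp o_def q2_def[abs_def])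
  qed
  have "q2 p = 1" by (simp add: g fp q2_def)
  then obtain H r2 where H: "0 < r2" "r2 < r" "H holomorphic_on ball p r2" "H p = 1"
    "\<And>z. z \<in> ball p r2 \<Longrightarrow> g z \<in> ball p r2 \<and> H z = q2 z * H (g z)"
    using product_along_contraction[OF er(4) g(1) \<kappa>(3,1,2) q2_hol]
    by metis
  define e' where "e' = min r1 r2"
  have e': "e' > 0" "e' \<le> r1" "e' \<le> r2" "e' \<le> e" using P H er by (auto simp: e'_def)
  define \<phi> where "\<phi> z = (z - p) * P z" for z
  have \<phi>_hol: "\<phi> holomorphic_on ball p e'"
    unfolding \<phi>_def by (intro holomorphic_intros holomorphic_on_subset[OF P(3)]) (use e' in auto)
  have "(\<phi> has_field_derivative 1 * P p + deriv P p * (p - p)) (at p)"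
    unfolding \<phi>_def[abs_def]
    by (intro DERIV_mult holomorphic_derivI[OF P(3)])
       (use P(1) in \<open>auto intro!: derivative_eq_intros\<close>)
  then have "deriv \<phi> p = 1" using P(4) by (auto intro: DERIV_imp_deriv)
  moreover have "\<phi> (d z) = deriv d p * \<phi> z" if "z \<in> ball p e'" "d z \<in> ball p e'" for z
  proof -
    have "d z \<in> ball p r1" using that e' by auto
    moreover have gz: "g (d z) = z" using gd that e' by auto
    ultimately have "P (d z) = q (d z) * P z" using P(5)[of "d z"] by simp
    then have "\<phi> (d z) = (d z - p) * q (d z) * P z" by (simp add: \<phi>_def)
    also have "\<dots> = l * (z - p) * P z" using g_eq[of "d z"] gz by simp
    finally show ?thesis by (simp add: \<phi>_def l_def)
  qed
  moreover have "H (d z) = H z * f z / f p" if "z \<in> ball p e'" "d z \<in> ball p e'" for z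
  proof -
    have "d z \<in> ball p r2" using that e' by auto
    moreover have gz: "g (d z) = z" using gd that e' by auto
    ultimately show ?thesis using H(5)[of "d z"] by (simp add: q2_def)
  qed
  moreover have "H holomorphic_on ball p e'" by (rule holomorphic_on_subset[OF H(3)]) (use e' in auto)
  moreover have "ball p e' \<subseteq> S" using er(2) e' by (meson subset_ball subset_trans)
  ultimately show ?thesis
    using that[of e' \<phi> H] e' \<phi>_hol H(4) by (simp add: \<phi>_def)
qed

section \<open>Continuation of the Green function\<close>

definition slit :: "real \<Rightarrow> complex set" where
  "slit c = {z. Im z \<noteq> 0 \<or> (- c < Re z \<and> Re z < 1)}"

lemma open_slit: "open (slit c)"
proof -
  have "slit c = {z. Im z \<noteq> 0} \<union> ({z. - c < Re z} \<inter> {z. Re z < 1})"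
    by (auto simp: slit_def)
  then show ?thesis
    by (auto intro!: open_Un open_Int open_Collect_neq open_Collect_less continuous_intros)
qed

lemma slit_plane_eq_slit: "slit_plane = slit 1"
  by (auto simp: slit_plane_def slit_def complex_is_Real_iff)

lemma slit_mono: "c \<le> c' \<Longrightarrow> slit c \<subseteq> slit c'"
  by (auto simp: slit_def)

lemma zero_in_slit: "c > 0 \<Longrightarrow> 0 \<in> slit c"
  by (simp add: slit_def)

lemma ball_subset_slit:
  assumes "c \<ge> 1"
  shows "ball 0 1 \<subseteq> slit c"
proof
  fix z :: complex assume "z \<in> ball 0 1"
  then have "\<bar>Re z\<bar> < 1" using abs_Re_le_cmod[of z] by simp
  then show "z \<in> slit c" using assms by (auto simp: slit_def abs_less_iff)
qed

lemma starlike_slit: "c > 0 \<Longrightarrow> starlike (slit c)"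
  unfolding starlike_def
proof (intro bexI ballI subsetI)
  fix x y assume c: "c > 0" and x: "x \<in> slit c" and "y \<in> closed_segment 0 x"
  then obtain u where u: "0 \<le> u" "u \<le> 1" "y = u *\<^sub>R x"
    by (auto simp: in_segment)
  show "y \<in> slit c"
  proof (cases "Im x = 0 \<or> u = 0")
    case True
    have "- c < u * Re x \<and> u * Re x < 1" if "u \<noteq> 0" "- c < Re x" "Re x < 1"
    proof -
      show ?thesis
      proof (cases "Re x \<ge> 0")
        case True
        then have "0 \<le> u * Re x" "u * Re x \<le> Re x"
          using u mult_left_le_one_le[of "Re x" u] by auto
        then show ?thesis using that c by linarith
      next
        case False
        then have "u * Re x \<le> 0" "Re x \<le> u * Re x"
          using u mult_left_le_one_le[of "- Re x" u] by (auto intro: mult_nonneg_nonpos)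
        then show ?thesis using that c by linarith
      qed
    qed
    then show ?thesis using True x u c by (cases "u = 0") (auto simp: slit_def)
  next
    case False
    then show ?thesis using u by (simp add: slit_def)
  qed
qed (simp add: zero_in_slit)

lemma slit_simply_connected: "c > 0 \<Longrightarrow> simply_connected (slit c)"
  by (intro starlike_imp_simply_connected starlike_slit)

lemma slit_connected: "c > 0 \<Longrightarrow> Topological_Spaces.connected (slit c)"
  by (intro starlike_imp_connected starlike_slit)

text \<open>A Riemann map turns \<open>d\<close> into a self-map \<open>D\<close> of the disc that
  fixes 0 with derivative 0. It is no rotation, so Schwarz's lemma gives
  \<open>D x = x * h x\<close> with \<open>h\<close> strictly below 1 in modulus; on a smaller disc
  the bound is uniform and the iterates decay geometrically.\<close>

lemma superattracting_orbits:
  assumes S: "open S" "simply_connected S" "S \<noteq> UNIV" "0 \<in> S"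
    and d: "d holomorphic_on S" "d ` S \<subseteq> S" "d 0 = 0" "deriv d 0 = 0" and z: "z \<in> S"
  shows "(\<lambda>n. (d ^^ n) z) \<longlonglongrightarrow> 0"
proof -
  obtain T T' where T: "T holomorphic_on S" "T' holomorphic_on ball 0 1"
      "\<And>z. z \<in> S \<Longrightarrow> T z \<in> ball 0 1" "\<And>z. z \<in> S \<Longrightarrow> T' (T z) = z"
      "\<And>z. z \<in> ball 0 1 \<Longrightarrow> T' z \<in> S" "\<And>z. z \<in> ball 0 1 \<Longrightarrow> T (T' z) = z"
    using S simply_connected_eq_biholomorphic_to_disc[OF S(1)] by blast
  define a where "a = T 0"
  have a: "norm a < 1" using T(3)[OF S(4)] by (simp add: a_def)
  \<comment> \<open>The Moebius factor moves the image of the fixed point to 0, as Schwarz's lemma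
    requires.\<close>
  define A where "A = Moebius_function 0 a \<circ> T"
  define B where "B = T' \<circ> Moebius_function 0 (- a)"
  have A_hol: "A holomorphic_on S"
    unfolding A_def using T(3)
    by (intro holomorphic_on_compose_gen[OF T(1) Moebius_function_holomorphic]) (auto simp: a)
  have Mb: "Moebius_function 0 (- a) x \<in> ball 0 1" if "x \<in> ball 0 1" for x
    using Moebius_function_norm_lt_1[of "- a" x 0] a that by simp
  have B_hol: "B holomorphic_on ball 0 1"
    unfolding B_def
    by (intro holomorphic_on_compose_gen[OF Moebius_function_holomorphic T(2)]) (use a Mb in auto)
  have A_ball: "norm (A z) < 1" if "z \<in> S" for z
    using Moebius_function_norm_lt_1[of a "T z" 0] T(3)[OF that] a by (simp add: A_def)
  have B_S: "B x \<in> S" if "norm x < 1" for x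
    using T(5) Mb that by (simp add: B_def)
  have BA: "B (A z) = z" if "z \<in> S" for z
    using T(3,4)[OF that] Moebius_function_compose[of "- a" a "T z"] a by (simp add: A_def B_def)
  have AB: "A (B x) = x" if "norm x < 1" for x
    using T(6)[OF Mb[of x]] Moebius_function_compose[of a "- a" x] a that
    by (simp add: A_def B_def)
  have A0: "A 0 = 0" by (simp add: A_def a_def Moebius_function_eq_zero)
  have B0: "B 0 = 0" using BA[OF S(4)] A0 by simp
  define D where "D = A \<circ> d \<circ> B"
  have D_lt: "norm (D x) < 1" if "norm x < 1" for x
    using A_ball B_S[OF that] d(2) by (force simp: D_def)
  have D0: "D 0 = 0" using A0 B0 d(3) by (simp add: D_def)
  have D_hol: "D holomorphic_on ball 0 1"
  proof -
    have "A \<circ> d holomorphic_on S"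
      using d(2) by (intro holomorphic_on_compose_gen[OF d(1) A_hol])
    then show ?thesis
      unfolding D_def by (rule holomorphic_on_compose_gen[OF B_hol]) (use B_S in auto)
  qed
  have dD: "(D has_field_derivative 0) (at 0)"
  proof -
    have "(B has_field_derivative deriv B 0) (at 0)"
      by (rule holomorphic_derivI[OF B_hol]) auto
    moreover have "(d has_field_derivative 0) (at (B 0))"
      using holomorphic_derivI[OF d(1) S(1) S(4)] d(4) B0 by simp
    moreover have "(A has_field_derivative deriv A 0) (at (d (B 0)))"
      using holomorphic_derivI[OF A_hol S(1) S(4)] B0 d(3) by simp
    ultimately show ?thesis
      using DERIV_chain[of A "deriv A 0" "d \<circ> B" 0 "0 * deriv B 0"] DERIV_chain[of d 0 B 0]
      by (auto simp: D_def comp_assoc)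
  qed
  obtain h where h: "h holomorphic_on ball 0 1" "\<And>x. norm x < 1 \<Longrightarrow> D x = x * h x" "deriv D 0 = h 0"
    using Schwarz3[OF D_hol D0] by blast
  have h0: "h 0 = 0" using h(3) dD DERIV_imp_deriv by fastforce
  \<comment> \<open>Equality would make \<open>D\<close> a rotation, whose derivative at 0 has
    modulus 1 instead of 0.\<close>
  have not_eq: "norm (D x) \<noteq> norm x" if "norm x < 1" "x \<noteq> 0" for x
  proof
    assume "norm (D x) = norm x"
    with that obtain \<alpha> where \<alpha>: "\<And>z. norm z < 1 \<Longrightarrow> D z = \<alpha> * z" "norm \<alpha> = 1"
      using Schwarz_Lemma(3)[OF D_hol D0 D_lt, of 0] by auto
    have "((\<lambda>z. \<alpha> * z) has_field_derivative \<alpha>) (at 0)"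
      by (auto intro!: derivative_eq_intros)
    then have "(D has_field_derivative \<alpha>) (at 0)"
      by (rule has_field_derivative_transform_within_open[of _ _ _ "ball 0 1"]) (auto simp: \<alpha>)
    then show False using dD DERIV_unique \<alpha>(2) by fastforce
  qed
  have h_lt: "norm (h x) < 1" if "norm x < 1" for x
  proof (cases "x = 0")
    case False
    have "norm (D x) < norm x"
      using Schwarz_Lemma(1)[OF D_hol D0 D_lt that] not_eq[OF that False] by simp
    then show ?thesis using h(2)[OF that] False by (simp add: norm_mult)
  qed (simp add: h0)
  define x0 where "x0 = A z"
  have x0: "norm x0 < 1" using A_ball z by (simp add: x0_def)
  \<comment> \<open>Any radius strictly between \<open>norm x0\<close> and 1 would do: the closed
    disc is compact, so \<open>h\<close> has a maximal modulus \<open>m < 1\<close> there, and the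
    open disc contains the starting point.\<close>
  define e where "e = (norm x0 + 1) / 2"
  have e: "norm x0 < e" "e < 1" "0 < e"
    using x0 by (auto simp: e_def intro: add_nonneg_pos)
  have "compact ((\<lambda>x. norm (h x)) ` cball 0 e)"
    using e by (intro compact_continuous_image continuous_intros
        continuous_on_subset[OF holomorphic_on_imp_continuous_on[OF h(1)]]) auto
  moreover have "(\<lambda>x. norm (h x)) ` cball 0 e \<noteq> {}" using e by simp
  ultimately obtain m where m: "m \<in> (\<lambda>x. norm (h x)) ` cball 0 e"
      "\<And>t. t \<in> (\<lambda>x. norm (h x)) ` cball 0 e \<Longrightarrow> t \<le> m"
    using compact_attains_sup by metis
  have m01: "0 \<le> m" "m < 1" using m(1) h_lt e by auto
  have Dm: "norm (D x - 0) \<le> m * norm (x - 0)" if "x \<in> ball 0 e" for x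
  proof -
    have "norm (h x) \<le> m" using that by (intro m(2)) auto
    moreover have "D x = x * h x" using h(2)[of x] that e by simp
    ultimately show ?thesis
      by (metis diff_zero mult.commute mult_left_mono norm_ge_zero norm_mult)
  qed
  have x0e: "x0 \<in> ball 0 e" using e by simp
  note it = contraction_iterates[OF Dm m01 x0e]
  have "(\<lambda>n. m ^ n * norm (x0 - 0)) \<longlonglongrightarrow> 0"
    using m01 by (auto intro!: tendsto_mult_left_zero LIMSEQ_realpow_zero)
  then have "(\<lambda>n. (D ^^ n) x0) \<longlonglongrightarrow> 0"
    by (rule Lim_null_comparison[rotated]) (use it in auto)
  moreover have "isCont B 0"
    using holomorphic_on_imp_continuous_on[OF B_hol] by (simp add: continuous_on_eq_continuous_at)
  ultimately have "(\<lambda>n. B ((D ^^ n) x0)) \<longlonglongrightarrow> B 0"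
    using isCont_tendsto_compose by blast
  moreover have "(d ^^ n) z = B ((D ^^ n) x0)" for n
  proof (induction n)
    case 0
    then show ?case using BA z by (simp add: x0_def)
  next
    case (Suc n)
    have "norm ((D ^^ n) x0) < 1" using it[of n] e by (auto intro: less_trans)
    then have "d (B ((D ^^ n) x0)) \<in> S" using B_S d(2) by blast
    then have "B (D ((D ^^ n) x0)) = d (B ((D ^^ n) x0))"
      using BA unfolding D_def comp_apply by blast
    then show ?case using Suc by simp
  qed
  ultimately show ?thesis using B0 by simp
qed

text \<open>
  For the random walk, \<open>d\<close> is the transition function, \<open>f\<close> the generating function of the
  excursions from the origin that avoid the other vertices of \<open>F\<close>, and \<open>G0\<close> the Green function.
  Since \<open>G0\<close> behaves like \<open>(1 - z) powr s\<close>, the value of \<open>f\<close> at 1 has to be \<open>\<tau> powr (- s)\<close>.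
\<close>

locale green_dynamics =
  fixes d f G0 :: "complex \<Rightarrow> complex" and c s \<tau> :: real and Z :: "complex set"
  assumes c: "c \<ge> 1"
    and Z: "closed Z" "countable Z" "Z \<inter> slit c = {}" "1 \<notin> Z"
    and d_hol: "d holomorphic_on - Z" and f_hol: "f holomorphic_on - Z"
    and d_slit: "\<And>z. z \<in> slit c \<Longrightarrow> d z \<in> slit c"
    and d_small: "\<And>z. norm z < 1 \<Longrightarrow> norm (d z) \<le> (norm z)\<^sup>2"
    and d_cnj: "\<And>z. z \<notin> Z \<Longrightarrow> d (cnj z) = cnj (d z)"
    and d_1: "d 1 = 1" and d'_1: "deriv d 1 = of_real \<tau>" and \<tau>: "\<tau> > 1"
    and f_1: "f 1 = of_real (\<tau> powr (- s))" and s: "- 1 < s" "s < 0"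
    and G0_hol: "G0 holomorphic_on ball 0 1" and G0_0: "G0 0 \<noteq> 0"
    and G0_eq: "\<And>z. norm z < 1 \<Longrightarrow> G0 z = f z * G0 (d z)"
begin

lemma slit_Z: "slit c \<subseteq> - Z"
  using Z by auto

lemma d_hol_slit: "d holomorphic_on slit c" and f_hol_slit: "f holomorphic_on slit c"
  using d_hol f_hol slit_Z holomorphic_on_subset by blast+

lemma d_0: "d 0 = 0"
  using d_small[of 0] by simp

lemma d'_0: "deriv d 0 = 0"
proof -
  have "(\<lambda>z. (d z - d 0) / (z - 0)) \<midarrow>0\<rightarrow> 0"
  proof (rule Lim_null_comparison)
    have *: "norm ((d z - d 0) / (z - 0)) \<le> norm z" if "z \<noteq> 0 \<and> dist z 0 < 1" for z
    proof -
      have "norm (d z) / norm z \<le> (norm z)\<^sup>2 / norm z"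
        using d_small[of z] that by (intro divide_right_mono) auto
      then show ?thesis using that by (simp add: d_0 norm_divide power2_eq_square)
    qed
    show "\<forall>\<^sub>F z in at 0. norm ((d z - d 0) / (z - 0)) \<le> norm z"
      unfolding eventually_at by (intro exI[of _ "1 :: real"] conjI ballI impI *) simp_all
    show "norm \<midarrow>0\<rightarrow> 0" by (rule tendsto_norm_zero) (rule tendsto_ident_at)
  qed
  then have "(d has_field_derivative 0) (at 0)" by (simp add: has_field_derivative_iff)
  then show ?thesis by (rule DERIV_imp_deriv)
qed

lemma funpow_d_slit: "z \<in> slit c \<Longrightarrow> (d ^^ n) z \<in> slit c"
  by (induction n) (auto simp: d_slit)

lemma funpow_d_hol: "(d ^^ n) holomorphic_on slit c"
proof (induction n)
  case (Suc n)
  have "d \<circ> (d ^^ n) holomorphic_on slit c"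
    by (rule holomorphic_on_compose_gen[OF Suc d_hol_slit]) (use funpow_d_slit in auto)
  then show ?case by (simp add: o_def)
qed (auto simp: id_def intro: holomorphic_intros)

lemma orbit_tendsto_0:
  assumes "z \<in> slit c"
  shows "(\<lambda>n. (d ^^ n) z) \<longlonglongrightarrow> 0"
proof (rule superattracting_orbits[OF open_slit[of c]])
  have "1 \<notin> slit c" by (simp add: slit_def)
  then show "slit c \<noteq> UNIV" by auto
qed (use c assms d_slit d_0 d'_0 d_hol_slit in \<open>auto simp: zero_in_slit slit_simply_connected\<close>)

lemma orbit_enters_disc:
  assumes "z \<in> slit c"
  obtains n where "norm ((d ^^ n) z) < 1"
proof -
  have "eventually (\<lambda>n. dist ((d ^^ n) z) 0 < 1) sequentially"
    using orbit_tendsto_0[OF assms] by (rule tendstoD) simp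
  then show ?thesis using that eventually_happens'[OF sequentially_bot] by fastforce
qed

lemma G0_iterate:
  assumes "norm z < 1"
  shows "norm ((d ^^ n) z) < 1" "G0 z = (\<Prod>k<n. f ((d ^^ k) z)) * G0 ((d ^^ n) z)"
proof (induction n)
  case (Suc n)
  {
    case 1
    have "norm (d ((d ^^ n) z)) \<le> (norm ((d ^^ n) z))\<^sup>2" using d_small Suc by blast
    also have "\<dots> < 1" using Suc by (simp add: power_less_one_iff abs_square_less_1)
    finally show ?case by simp
  next
    case 2
    then show ?case using Suc G0_eq[OF Suc(1)] by (simp add: mult_ac)
  }
qed (use assms in auto)

text \<open>The continuation is pulled back from the unit disc along the orbit. By
  \<open>G_eq_iterate\<close> the value does not depend on the entry time chosen.\<close>

definition G :: "complex \<Rightarrow> complex" where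
  "G z = (let n = (SOME n. norm ((d ^^ n) z) < 1)
          in (\<Prod>k<n. f ((d ^^ k) z)) * G0 ((d ^^ n) z))"

text \<open>For two entry times, the functional equation of \<open>G0\<close>, iterated from the
  earlier one, inserts exactly the factors by which the two products differ.\<close>

lemma G_eq_iterate:
  assumes "norm ((d ^^ n) z) < 1"
  shows "G z = (\<Prod>k<n. f ((d ^^ k) z)) * G0 ((d ^^ n) z)"
proof -
  have *: "(\<Prod>k<n. f ((d ^^ k) z)) * G0 ((d ^^ n) z) = (\<Prod>k<m. f ((d ^^ k) z)) * G0 ((d ^^ m) z)"
    if nm: "n \<le> m" and n: "norm ((d ^^ n) z) < 1" for n m
  proof -
    have it: "(d ^^ (n + j)) z = (d ^^ j) ((d ^^ n) z)" for j
      by (induction j) auto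
    have "(\<Prod>k<n + j. f ((d ^^ k) z))
        = (\<Prod>k<n. f ((d ^^ k) z)) * (\<Prod>k<j. f ((d ^^ k) ((d ^^ n) z)))" for j
      by (induction j) (simp_all add: it mult.assoc)
    moreover obtain j where "m = n + j" using nm le_Suc_ex by blast
    ultimately show ?thesis
      using G0_iterate(2)[OF n, of j] it[of j] by (simp add: mult.assoc)
  qed
  define m where "m = (SOME n. norm ((d ^^ n) z) < 1)"
  have m: "norm ((d ^^ m) z) < 1" unfolding m_def using assms by (rule someI)
  have "G z = (\<Prod>k<m. f ((d ^^ k) z)) * G0 ((d ^^ m) z)"
    by (simp add: G_def m_def Let_def)
  then show ?thesis
    using *[of n m] *[of m n] assms m by (metis nat_le_linear)
qed

lemma G_eq_G0: "norm z < 1 \<Longrightarrow> G z = G0 z"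
  using G_eq_iterate[of 0 z] by simp

lemma G_0: "G 0 \<noteq> 0"
  using G_eq_G0[of 0] G0_0 by simp

lemma G_eq:
  assumes "z \<in> slit c"
  shows "G z = f z * G (d z)"
proof -
  obtain n where n: "norm ((d ^^ n) (d z)) < 1" using orbit_enters_disc[OF d_slit[OF assms]] .
  have it: "(d ^^ Suc k) z = (d ^^ k) (d z)" for k by (simp add: funpow_swap1)
  have "norm ((d ^^ Suc n) z) < 1" using n it by simp
  then have "G z = (\<Prod>k<Suc n. f ((d ^^ k) z)) * G0 ((d ^^ Suc n) z)" by (rule G_eq_iterate)
  also have "(\<Prod>k<Suc n. f ((d ^^ k) z)) = f z * (\<Prod>k<n. f ((d ^^ k) (d z)))"
    using prod.lessThan_Suc_shift[of "\<lambda>k. f ((d ^^ k) z)" n] unfolding it by simp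
  also have "\<dots> * G0 ((d ^^ Suc n) z) = f z * G (d z)"
    using G_eq_iterate[OF n] by (simp only: it mult.assoc)
  finally show ?thesis .
qed

lemma G_iterate:
  assumes "z \<in> slit c"
  shows "G z = (\<Prod>k<n. f ((d ^^ k) z)) * G ((d ^^ n) z)"
proof (induction n)
  case 0
  show ?case by (simp only: lessThan_0 prod.empty funpow_0 mult_1)
next
  case (Suc n)
  have "G ((d ^^ n) z) = f ((d ^^ n) z) * G ((d ^^ Suc n) z)"
    using G_eq[OF funpow_d_slit[OF assms], of n] by simp
  then have "(\<Prod>k<n. f ((d ^^ k) z)) * G ((d ^^ n) z) = (\<Prod>k<Suc n. f ((d ^^ k) z)) * G ((d ^^ Suc n) z)"
    by (simp only: prod.lessThan_Suc mult.assoc)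
  with Suc show ?case by (rule trans)
qed

text \<open>An entry time for \<open>z\<close> is an entry time for all points of a neighbourhood
  \<open>U\<close>, on which \<open>G\<close> is therefore given by a single formula.\<close>

lemma G_hol: "G holomorphic_on slit c"
  unfolding holomorphic_on_open[OF open_slit]
proof
  fix z assume z: "z \<in> slit c"
  then obtain n where n: "norm ((d ^^ n) z) < 1" using orbit_enters_disc by blast
  define U where "U = {w \<in> slit c. (d ^^ n) w \<in> ball 0 1}"
  have "U = slit c \<inter> (d ^^ n) -` ball 0 1" by (auto simp: U_def)
  then have "open U"
    using continuous_open_preimage[OF holomorphic_on_imp_continuous_on[OF funpow_d_hol] open_slit open_ball]
    by simp
  have U: "z \<in> U" "U \<subseteq> slit c" using z n by (auto simp: U_def)
  have "f \<circ> (d ^^ k) holomorphic_on U" for k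
    by (rule holomorphic_on_compose_gen[OF holomorphic_on_subset[OF funpow_d_hol] f_hol_slit])
       (use U funpow_d_slit in auto)
  moreover have "G0 \<circ> (d ^^ n) holomorphic_on U"
    by (rule holomorphic_on_compose_gen[OF holomorphic_on_subset[OF funpow_d_hol] G0_hol])
       (use U in \<open>auto simp: U_def\<close>)
  ultimately have "(\<lambda>w. (\<Prod>k<n. f ((d ^^ k) w)) * G0 ((d ^^ n) w)) holomorphic_on U"
    by (intro holomorphic_intros) (auto simp: o_def)
  then have "G holomorphic_on U"
    by (rule holomorphic_transform) (auto simp: U_def G_eq_iterate)
  from holomorphic_derivI[OF this \<open>open U\<close> U(1)]
  show "\<exists>f'. (G has_field_derivative f') (at z)" by (rule exI)
qed

end

section \<open>The singular expansion at 1\<close>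

text \<open>
  \<open>\<phi>\<close> is a Koenigs function at the repelling fixed point 1, normalized by \<open>\<phi> z = (1 - z) * \<rho> z\<close>,
  and \<open>\<Phi>\<close> is its local inverse; \<open>H\<close> turns the cocycle \<open>f / f 1\<close> into a coboundary.
\<close>

locale green_chart = green_dynamics +
  fixes \<phi> H \<rho> \<Phi> :: "complex \<Rightarrow> complex" and e R :: real
  assumes e: "0 < e" "e \<le> 1" "ball 1 e \<subseteq> - Z"
    and \<phi>_hol: "\<phi> holomorphic_on ball 1 e" and \<phi>_inj: "inj_on \<phi> (ball 1 e)"
    and \<phi>_cnj: "\<And>z. z \<in> ball 1 e \<Longrightarrow> \<phi> (cnj z) = cnj (\<phi> z)"
    and \<phi>_d: "\<And>z. z \<in> ball 1 e \<Longrightarrow> d z \<in> ball 1 e \<Longrightarrow> \<phi> (d z) = of_real \<tau> * \<phi> z"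
    and \<phi>_\<rho>: "\<And>z. z \<in> ball 1 e \<Longrightarrow> \<phi> z = (1 - z) * \<rho> z"
    and \<rho>_hol: "\<rho> holomorphic_on ball 1 e" and \<rho>_1: "\<rho> 1 = 1"
    and \<rho>_pos: "\<And>z. z \<in> ball 1 e \<Longrightarrow> Re (\<rho> z) > 0"
    and H_hol: "H holomorphic_on ball 1 e" and H_1: "H 1 = 1"
    and H_nz: "\<And>z. z \<in> ball 1 e \<Longrightarrow> H z \<noteq> 0" and f_nz: "\<And>z. z \<in> ball 1 e \<Longrightarrow> f z \<noteq> 0"
    and H_d: "\<And>z. z \<in> ball 1 e \<Longrightarrow> d z \<in> ball 1 e \<Longrightarrow> H (d z) = H z * f z / f 1"
    and R: "R > 0"
    and \<Phi>_hol: "\<Phi> holomorphic_on ball 0 R"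
    and \<Phi>_ball: "\<And>u. u \<in> ball 0 R \<Longrightarrow> \<Phi> u \<in> ball 1 e \<and> d (\<Phi> u) \<in> ball 1 e \<and> \<phi> (\<Phi> u) = u"

lemma holomorphic_near:
  assumes "h holomorphic_on S" "open S" "p \<in> S" "h p \<in> T" "open T"
  shows "eventually (\<lambda>z. h z \<in> T) (nhds (p :: complex))"
proof -
  have "continuous_on S h" using assms(1) by (rule holomorphic_on_imp_continuous_on)
  then have "isCont h p" using assms by (simp add: continuous_on_eq_continuous_at)
  then have "(h \<longlongrightarrow> h p) (nhds p)" by (simp add: isCont_def tendsto_at_iff_tendsto_nhds)
  then show ?thesis using assms(4,5) by (simp add: topological_tendstoD)
qed

lemma eventually_nhds_ball:
  assumes "eventually P (nhds (p :: 'a :: metric_space))"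
  shows "\<exists>e>0. \<forall>z\<in>ball p e. P z"
  using assms unfolding eventually_nhds_metric by (metis dist_commute mem_ball)

text \<open>The general linearization is made symmetric under conjugation and normalized; the disc
  is then shrunk until the chart is injective and \<open>\<rho>\<close>, \<open>H\<close> and
  \<open>f\<close> keep the required distance from their bad values.\<close>

lemma (in green_dynamics) chart_exists:
  "\<exists>\<phi> H \<rho> \<Phi> e R. green_chart d f G0 c s \<tau> Z \<phi> H \<rho> \<Phi> e R"
proof -
  have oZ: "open (- Z)" "1 \<in> - Z" using Z by auto
  have f1: "f 1 \<noteq> 0" using f_1 \<tau> by auto
  obtain \<phi>0 H e0 where e0: "e0 > 0" "ball 1 e0 \<subseteq> - Z"
    and \<phi>0: "\<phi>0 holomorphic_on ball 1 e0" "\<phi>0 1 = 0" "deriv \<phi>0 1 = 1"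
      "\<And>z. z \<in> ball 1 e0 \<Longrightarrow> d z \<in> ball 1 e0 \<Longrightarrow> \<phi>0 (d z) = deriv d 1 * \<phi>0 z"
    and H: "H holomorphic_on ball 1 e0" "H 1 = 1"
      "\<And>z. z \<in> ball 1 e0 \<Longrightarrow> d z \<in> ball 1 e0 \<Longrightarrow> H (d z) = H z * f z / f 1"
  proof -
    have l: "norm (deriv d 1) > 1" using d'_1 \<tau> by simp
    show thesis
      by (rule linearization_at_repelling_fixpoint[OF d_hol f_hol oZ d_1 l f1]) (rule that)
  qed
  have cnj_ball: "cnj z \<in> ball 1 r \<longleftrightarrow> z \<in> ball 1 r" for z r
  proof -
    have "dist 1 (cnj z) = norm (cnj (1 - z))" by (simp add: dist_norm)
    then show ?thesis by (simp only: complex_mod_cnj mem_ball dist_norm)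
  qed
  \<comment> \<open>Since \<open>d\<close> commutes with conjugation and \<tau> is real, the
    conjugate of a Koenigs function is again one, and so is the average. The sign makes \<phi> agree
    with \<open>1 - z\<close> to first order.\<close>
  define \<phi> where "\<phi> z = - (\<phi>0 z + cnj (\<phi>0 (cnj z))) / 2" for z
  have cnj_img: "cnj ` ball 1 e0 = ball 1 e0"
    unfolding image_cnj_conv_vimage_cnj by (auto simp: cnj_ball simp del: mem_ball)
  have "cnj \<circ> \<phi>0 \<circ> cnj holomorphic_on ball 1 e0"
    by (intro holomorphic_on_compose_cnj_cnj) (use \<phi>0 in \<open>simp_all add: cnj_img\<close>)
  then have cc: "(\<lambda>z. cnj (\<phi>0 (cnj z))) holomorphic_on ball 1 e0" by (simp add: o_def)
  have \<phi>_hol: "\<phi> holomorphic_on ball 1 e0"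
    unfolding \<phi>_def by (intro holomorphic_intros cc \<phi>0) auto
  have "(\<phi>0 has_field_derivative 1) (at 1)"
    using holomorphic_derivI[OF \<phi>0(1), of 1] e0 \<phi>0(3) by simp
  moreover from this have "((\<lambda>z. cnj (\<phi>0 (cnj z))) has_field_derivative 1) (at 1)"
    using has_field_derivative_cnj_cnj[of \<phi>0 1 1] by (simp add: o_def)
  ultimately have "(\<phi> has_field_derivative - (1 + 1) / 2) (at 1)"
    unfolding \<phi>_def by (intro DERIV_cdivide DERIV_minus DERIV_add)
  then have d\<phi>: "deriv \<phi> 1 = - 1" by (simp add: DERIV_imp_deriv)
  have \<phi>1: "\<phi> 1 = 0" by (simp add: \<phi>_def \<phi>0)
  define \<rho> where "\<rho> z = - (if z = 1 then deriv \<phi> 1 else (\<phi> z - \<phi> 1) / (z - 1))" for z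
  have \<rho>_hol: "\<rho> holomorphic_on ball 1 e0"
    unfolding \<rho>_def by (intro holomorphic_intros pole_lemma_open \<phi>_hol) auto
  have \<rho>1: "\<rho> 1 = 1" by (simp add: \<rho>_def d\<phi>)
  have \<phi>_\<rho>: "\<phi> z = (1 - z) * \<rho> z" for z
    by (simp add: \<rho>_def \<phi>1 divide_simps) (simp add: algebra_simps)
  have one: "1 \<in> ball 1 e0" using e0 by simp
  note ev = holomorphic_near[OF _ open_ball one]
  have d\<phi>_nz: "deriv \<phi> 1 \<noteq> 0" by (simp add: d\<phi>)
  obtain e1 where e1: "e1 > 0" "ball 1 e1 \<subseteq> ball (1 :: complex) e0" "inj_on \<phi> (ball 1 e1)"
    by (rule has_complex_derivative_locally_injective[OF \<phi>_hol one open_ball d\<phi>_nz]) (rule that)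
  have "eventually (\<lambda>z. z \<in> ball 1 (min 1 e1)) (nhds 1)"
    using e1 by (intro eventually_nhds_in_open) auto
  moreover have "eventually (\<lambda>z. \<rho> z \<in> {z. 0 < Re z}) (nhds 1)"
    by (intro ev \<rho>_hol open_Collect_less continuous_intros) (simp add: \<rho>1)
  moreover have "eventually (\<lambda>z. H z \<in> - {0}) (nhds 1)"
    by (intro ev H) (auto simp: H)
  moreover have "eventually (\<lambda>z. f z \<in> - {0}) (nhds 1)"
    using f_hol oZ by (rule holomorphic_near) (auto simp: f1)
  ultimately have "eventually (\<lambda>z. z \<in> ball 1 (min 1 e1) \<and> Re (\<rho> z) > 0 \<and> H z \<noteq> 0 \<and> f z \<noteq> 0) (nhds 1)"
    by eventually_elim auto
  then obtain e where e: "e > 0"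
      "\<And>z. z \<in> ball 1 e \<Longrightarrow> z \<in> ball 1 (min 1 e1) \<and> Re (\<rho> z) > 0 \<and> H z \<noteq> 0 \<and> f z \<noteq> 0"
    using eventually_nhds_ball[of _ "1 :: complex"] by blast
  have "ball 1 e \<subseteq> ball (1 :: complex) (min 1 e1)" using e(2) by blast
  then have "e \<le> min 1 e1" using e(1) by (simp add: ball_subset_ball_iff)
  then have e_le: "e \<le> 1" "e \<le> e1" by simp_all
  have sub: "ball 1 e \<subseteq> ball (1 :: complex) e0" using subset_ball[OF e_le(2)] e1(2) by (rule subset_trans)
  have \<phi>_hol': "\<phi> holomorphic_on ball 1 e" using \<phi>_hol sub by (rule holomorphic_on_subset)
  have inj: "inj_on \<phi> (ball 1 e)" using e1(3) subset_ball[OF e_le(2)] by (rule inj_on_subset)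
  obtain \<Phi> where \<Phi>: "\<Phi> holomorphic_on \<phi> ` ball 1 e" "\<And>z. z \<in> ball 1 e \<Longrightarrow> \<Phi> (\<phi> z) = z"
    by (rule holomorphic_has_inverse[OF \<phi>_hol' open_ball inj]) (rule that)
  have op: "open (\<phi> ` ball 1 e)" using open_mapping_thm3[OF \<phi>_hol' open_ball inj] by simp
  moreover have im0: "0 \<in> \<phi> ` ball 1 e" by (rule image_eqI[of _ _ 1]) (use \<phi>1 e in auto)
  moreover have \<Phi>0: "\<Phi> 0 = 1" using \<Phi>(2)[of 1] e(1) \<phi>1 by simp
  ultimately have "isCont \<Phi> 0"
    using holomorphic_on_imp_continuous_on[OF \<Phi>(1)] continuous_on_eq_continuous_at[OF op] by blast
  then have \<Phi>_lim: "(\<Phi> \<longlongrightarrow> 1) (nhds 0)"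
    using tendsto_at_iff_tendsto_nhds[of \<Phi> 0] by (simp add: isCont_def \<Phi>0)
  have "eventually (\<lambda>z. d z \<in> ball 1 e) (nhds 1)"
    using d_hol oZ by (rule holomorphic_near) (auto simp: d_1 e)
  \<comment> \<open>The equations for \<phi> and \<open>H\<close> hold only where \<open>d\<close>
    does not leave the disc, so \<open>R\<close> has to ensure this for all points
    \<open>\<Phi> u\<close>.\<close>
  then have "eventually (\<lambda>u. d (\<Phi> u) \<in> ball 1 e) (nhds 0)"
    using \<Phi>_lim by (rule eventually_compose_filterlim)
  moreover have "eventually (\<lambda>u. u \<in> \<phi> ` ball 1 e) (nhds 0)"
    using op im0 by (rule eventually_nhds_in_open)
  ultimately have "eventually (\<lambda>u. u \<in> \<phi> ` ball 1 e \<and> d (\<Phi> u) \<in> ball 1 e) (nhds 0)"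
    by eventually_elim auto
  then obtain R where R: "R > 0" "\<And>u. u \<in> ball 0 R \<Longrightarrow> u \<in> \<phi> ` ball 1 e \<and> d (\<Phi> u) \<in> ball 1 e"
    using eventually_nhds_ball[of _ "0 :: complex"] by blast
  have "green_chart d f G0 c s \<tau> Z \<phi> H \<rho> \<Phi> e R"
  proof (unfold_locales)
    show "ball 1 e \<subseteq> - Z" using sub e0 by blast
    show "\<phi> (cnj z) = cnj (\<phi> z)" for z
      by (simp add: \<phi>_def add.commute)
    show "\<phi> (d z) = of_real \<tau> * \<phi> z" if "z \<in> ball 1 e" "d z \<in> ball 1 e" for z
    proof -
      have z: "z \<in> ball 1 e0" "d z \<in> ball 1 e0" "z \<notin> Z" "cnj z \<in> ball 1 e0"
        using that sub e0 cnj_ball by blast+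
      moreover have "d (cnj z) \<in> ball 1 e0"
        using z(2,3) d_cnj cnj_ball[of "d z" e0] by simp
      ultimately show ?thesis
        using \<phi>0(4)[of z] \<phi>0(4)[of "cnj z"] d_cnj[of z] d'_1 by (simp add: \<phi>_def algebra_simps)
    qed
    show "H (d z) = H z * f z / f 1" if "z \<in> ball 1 e" "d z \<in> ball 1 e" for z
      using H(3) that sub by blast
    show "\<Phi> holomorphic_on ball 0 R" using \<Phi>(1) by (rule holomorphic_on_subset) (use R in blast)
    show "\<Phi> u \<in> ball 1 e \<and> d (\<Phi> u) \<in> ball 1 e \<and> \<phi> (\<Phi> u) = u" if "u \<in> ball 0 R" for u
      using R(2)[OF that] \<Phi>(2) by auto
  qed (use e e_le R inj \<phi>_\<rho> \<rho>1 H(2) \<phi>_hol' in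
      \<open>auto intro: holomorphic_on_subset[OF \<rho>_hol sub] holomorphic_on_subset[OF H(1) sub]\<close>)
  then show ?thesis by blast
qed

lemma cnj_in_ball_1: "cnj z \<in> ball 1 r \<longleftrightarrow> z \<in> ball 1 r"
proof -
  have "dist 1 (cnj z) = norm (cnj (1 - z))" by (simp add: dist_norm)
  then show ?thesis by (simp only: complex_mod_cnj mem_ball dist_norm)
qed

text \<open>Translation to the left by a sufficiently large integer reaches the half strip, and
  periodicity makes the result independent of that integer. The half strip is the logarithmic
  picture of a slit disc around 0.\<close>

lemma periodic_extension:
  fixes h :: "complex \<Rightarrow> complex" and a b :: real
  assumes hol: "h holomorphic_on {w. Re w < a \<and> \<bar>Im w\<bar> < b}"
    and per: "\<And>w. Re w < a - 1 \<Longrightarrow> \<bar>Im w\<bar> < b \<Longrightarrow> h (w + 1) = h w"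
  obtains \<omega> where "\<omega> holomorphic_on {w. \<bar>Im w\<bar> < b}" "\<And>w. \<bar>Im w\<bar> < b \<Longrightarrow> \<omega> (w + 1) = \<omega> w"
    "\<And>w. Re w < a \<Longrightarrow> \<bar>Im w\<bar> < b \<Longrightarrow> \<omega> w = h w"
proof -
  define L where "L = {w. Re w < a \<and> \<bar>Im w\<bar> < b}"
  have hn: "h w = h (w - of_nat n)" if "Re w < a" "\<bar>Im w\<bar> < b" for w n
  proof (induction n)
    case (Suc n)
    have "h (w - of_nat (Suc n) + 1) = h (w - of_nat (Suc n))"
      by (rule per) (use that in auto)
    then show ?case using Suc by (simp add: algebra_simps)
  qed simp
  \<comment> \<open>The summand 1 makes the inequality \<open>Re w - N w < a\<close> strict.\<close>
  define N where "N w = nat \<lceil>Re w - a\<rceil> + 1" for w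
  define \<omega> where "\<omega> w = h (w - of_nat (N w))" for w
  have \<omega>_eq: "\<omega> w = h (w - of_nat n)" if n: "Re w - of_nat n < a" "\<bar>Im w\<bar> < b" for w n
  proof -
    have "Re w - a < of_nat (N w)" unfolding N_def by linarith
    then have N: "Re (w - of_nat (N w)) < a" by simp
    show ?thesis
    proof (cases "n \<le> N w")
      case True
      then show ?thesis using hn[of "w - of_nat n" "N w - n"] n
        by (simp add: \<omega>_def of_nat_diff algebra_simps)
    next
      case False
      then show ?thesis using hn[of "w - of_nat (N w)" "n - N w"] n N
        by (simp add: \<omega>_def of_nat_diff algebra_simps)
    qed
  qed
  show ?thesis
  proof (rule that)
    show "\<omega> w = h w" if "Re w < a" "\<bar>Im w\<bar> < b" for w
      using \<omega>_eq[of w 0] that by simp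
    show "\<omega> (w + 1) = \<omega> w" if "\<bar>Im w\<bar> < b" for w
    proof -
      obtain n :: nat where n: "Re w - a < of_nat n" using reals_Archimedean2 by blast
      then show ?thesis using \<omega>_eq[of w n] \<omega>_eq[of "w + 1" "Suc n"] that by (simp add: algebra_simps)
    qed
    have "open {w. \<bar>Im w\<bar> < b}" by (intro open_Collect_less continuous_intros)
    then show "\<omega> holomorphic_on {w. \<bar>Im w\<bar> < b}"
      unfolding holomorphic_on_open[OF \<open>open _\<close>]
    proof (intro ballI)
      fix w0 :: complex assume w0: "w0 \<in> {w. \<bar>Im w\<bar> < b}"
      obtain n :: nat where n: "Re w0 - a < of_nat n" using reals_Archimedean2 by blast
      define U where "U = {w :: complex. Re w < a + of_nat n \<and> \<bar>Im w\<bar> < b}"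
      have "U = {w. Re w < a + of_nat n} \<inter> {w. \<bar>Im w\<bar> < b}" by (auto simp: U_def)
      then have U: "open U" by (auto intro!: open_Int open_Collect_less continuous_intros)
      have "h \<circ> (\<lambda>w. w - of_nat n) holomorphic_on U"
        by (rule holomorphic_on_compose_gen[OF _ hol]) (auto simp: U_def intro!: holomorphic_intros)
      then have "\<omega> holomorphic_on U"
      proof (rule holomorphic_transform)
        show "(h \<circ> (\<lambda>w. w - of_nat n)) x = \<omega> x" if "x \<in> U" for x
          using \<omega>_eq[of x n] that by (simp add: U_def)
      qed
      moreover have "w0 \<in> U" using w0 n by (simp add: U_def)
      ultimately have "(\<omega> has_field_derivative deriv \<omega> w0) (at w0)" using U holomorphic_derivI by blast
      then show "\<exists>f'. (\<omega> has_field_derivative f') (at w0)" by (rule exI)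
    qed
  qed
qed

lemma sin_between_neg: "- (3 * pi / 2) < x \<Longrightarrow> x \<le> - pi \<Longrightarrow> sin x \<ge> (0 :: real)"
  using sin_ge_zero[of "x + 2 * pi"] by simp

section \<open>The chart near the cut and the periodic function in logarithmic coordinates\<close>

context green_chart
begin

text \<open>Because of \<open>e \<le> 1\<close> the disc keeps away from the left cut.\<close>

lemma ball_slit: "z \<in> ball 1 e \<Longrightarrow> z \<in> slit c \<longleftrightarrow> 1 - z \<notin> \<real>\<^sub>\<le>\<^sub>0"
proof -
  assume "z \<in> ball 1 e"
  then have "\<bar>Re (1 - z)\<bar> < 1" using e(2) abs_Re_le_cmod[of "1 - z"] by (simp add: dist_norm)
  then show ?thesis using c by (auto simp: slit_def complex_nonpos_Reals_iff)
qed

text \<open>\<phi> is injective and commutes with conjugation, so a point with real image is its own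
  conjugate.\<close>

lemma Im_\<phi>_nz: "z \<in> ball 1 e \<Longrightarrow> Im z \<noteq> 0 \<Longrightarrow> Im (\<phi> z) \<noteq> 0"
proof
  assume z: "z \<in> ball 1 e" "Im z \<noteq> 0" and "Im (\<phi> z) = 0"
  then have "\<phi> (cnj z) = \<phi> z" using \<phi>_cnj[OF z(1)] by (simp add: complex_eq_iff)
  then have "cnj z = z" using inj_onD[OF \<phi>_inj] z(1) cnj_in_ball_1 by blast
  then show False using z(2) by (simp add: complex_eq_iff)
qed

lemma \<phi>_slit: "z \<in> ball 1 e \<Longrightarrow> z \<in> slit c \<longleftrightarrow> \<phi> z \<notin> \<real>\<^sub>\<le>\<^sub>0"
proof (cases "Im z = 0")
  case True
  assume z: "z \<in> ball 1 e"
  have "cnj z = z" using True by (simp add: complex_eq_iff)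
  then have "cnj (\<phi> z) = \<phi> z" using \<phi>_cnj[OF z] by simp
  then have "Im (\<phi> z) = 0" by (simp add: complex_eq_iff)
  moreover have "Re (\<phi> z) = Re (1 - z) * Re (\<rho> z)" using \<phi>_\<rho>[OF z] True by simp
  ultimately show ?thesis
    unfolding ball_slit[OF z] using True \<rho>_pos[OF z]
    by (simp add: complex_nonpos_Reals_iff mult_le_0_iff)
next
  case False
  assume z: "z \<in> ball 1 e"
  then show ?thesis using Im_\<phi>_nz[OF z False] False by (simp add: slit_def complex_nonpos_Reals_iff)
qed

text \<open>On the connected upper half disc \<open>Im (\<phi> z)\<close> never vanishes, so its
  sign is that at the test point \<open>z0\<close>. There \<open>1 - z0\<close> is negative
  imaginary and \<open>Re (\<rho> z0)\<close> is positive.\<close>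

lemma Im_\<phi>_neg:
  assumes "z \<in> ball 1 e" "Im z > 0"
  shows "Im (\<phi> z) < 0"
proof (rule ccontr)
  assume "\<not> Im (\<phi> z) < 0"
  define U where "U = ball 1 e \<inter> {z. Im z > 0}"
  define z0 where "z0 = 1 + \<i> * of_real (e / 2)"
  have z0: "z0 \<in> ball 1 e" "Im z0 > 0" using e by (auto simp: z0_def dist_norm norm_mult)
  have "Im (\<phi> z0) = - (e / 2 * Re (\<rho> z0))"
    using \<phi>_\<rho>[OF z0(1)] by (simp add: z0_def)
  then have "Im (\<phi> z0) < 0" using \<rho>_pos[OF z0(1)] e by simp
  have "convex U" unfolding U_def by (intro convex_Int convex_ball convex_halfspace_Im_gt)
  then have "Topological_Spaces.connected ((\<lambda>z. Im (\<phi> z)) ` U)"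
    by (intro connected_continuous_image convex_connected continuous_intros
        continuous_on_subset[OF holomorphic_on_imp_continuous_on[OF \<phi>_hol]]) (auto simp: U_def)
  moreover have "Im (\<phi> z0) \<in> (\<lambda>z. Im (\<phi> z)) ` U" "Im (\<phi> z) \<in> (\<lambda>z. Im (\<phi> z)) ` U"
    using z0 assms by (auto simp: U_def)
  ultimately have "{Im (\<phi> z0)..Im (\<phi> z)} \<subseteq> (\<lambda>z. Im (\<phi> z)) ` U"
    by (rule connected_contains_Icc)
  moreover have "0 \<in> {Im (\<phi> z0)..Im (\<phi> z)}"
    using \<open>Im (\<phi> z0) < 0\<close> \<open>\<not> Im (\<phi> z) < 0\<close> by simp
  ultimately obtain w where "w \<in> U" "Im (\<phi> w) = 0" by force
  then show False using Im_\<phi>_nz[of w] by (auto simp: U_def)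
qed

lemma Im_\<phi>_pos:
  assumes "z \<in> ball 1 e" "Im z < 0"
  shows "Im (\<phi> z) > 0"
  using Im_\<phi>_neg[of "cnj z"] \<phi>_cnj[OF assms(1)] assms by (simp add: cnj_in_ball_1 del: mem_ball)

text \<open>No jump by 2\<pi>i occurs: the argument of \<open>\<rho> z\<close> is less than \<pi>/2
  in modulus, and if the sum of the arguments left the principal range, its sine would contradict
  the sign of \<open>Im (\<phi> z)\<close>.\<close>

lemma Ln_\<phi>:
  assumes z: "z \<in> ball 1 e" "z \<in> slit c"
  shows "Ln (\<phi> z) = Ln (1 - z) + Ln (\<rho> z)"
proof -
  define a where "a = Im (Ln (1 - z))"
  define b where "b = Im (Ln (\<rho> z))"
  have \<rho>: "Re (\<rho> z) > 0" "\<rho> z \<noteq> 0" using \<rho>_pos[OF z(1)] by auto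
  have nz: "1 - z \<noteq> 0" using z by (auto simp: slit_def)
  have b: "\<bar>b\<bar> < pi / 2" using Re_Ln_pos_lt_imp[OF \<rho>(1)] by (simp add: b_def)
  have a: "- pi < a" "a \<le> pi" using mpi_less_Im_Ln[OF nz] Im_Ln_le_pi[OF nz] by (auto simp: a_def)
  have "\<phi> z = exp (Ln (1 - z) + Ln (\<rho> z))" using \<phi>_\<rho>[OF z(1)] nz \<rho> by (simp add: exp_add)
  then have Im: "Im (\<phi> z) = exp (Re (Ln (1 - z) + Ln (\<rho> z))) * sin (a + b)"
    by (simp only: Im_exp plus_complex.simps a_def b_def)
  have "- pi < a + b \<and> a + b \<le> pi"
  proof (cases "Im z" "0 :: real" rule: linorder_cases)
    case equal
    then have "a = 0" using z ball_slit nz by (auto simp: a_def slit_def Im_Ln_eq_0)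
    then show ?thesis using b by (auto simp: abs_less_iff)
  next
    case greater
    then have "\<not> (0 \<le> a \<and> a \<le> pi)" using Im_Ln_pos_le[OF nz] by (simp add: a_def)
    then have "a < 0" using a by simp
    moreover have "\<not> a + b \<le> - pi"
    proof
      assume "a + b \<le> - pi"
      then have "sin (a + b) \<ge> 0" using b a by (intro sin_between_neg) (auto simp: abs_less_iff)
      then show False using Im Im_\<phi>_neg[OF z(1) greater] by (simp add: mult_less_0_iff)
    qed
    ultimately show ?thesis using b by (auto simp: abs_less_iff)
  next
    case less
    then have "0 < a \<and> a < pi" using Im_Ln_pos_lt[OF nz] by (simp add: a_def)
    moreover have "\<not> pi < a + b"
    proof
      assume "pi < a + b"
      then have "sin (- (a + b)) \<ge> 0" using b a by (intro sin_between_neg) (auto simp: abs_less_iff)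
      then have "sin (a + b) \<le> 0" by (simp only: sin_minus neg_0_le_iff_le)
      then show False using Im Im_\<phi>_pos[OF z(1) less] by (simp add: zero_less_mult_iff)
    qed
    ultimately show ?thesis using b by (auto simp: abs_less_iff)
  qed
  then show ?thesis
    using Ln_times_simple[OF nz \<rho>(2)] \<phi>_\<rho>[OF z(1)] by (simp add: a_def b_def)
qed

text \<open>The Green function in Koenigs coordinates, corrected by \<open>H\<close> so that the
  functional equation becomes exact homogeneity of degree \<open>s\<close> under multiplication by
  \<tau>.\<close>

definition \<Lambda> :: "complex \<Rightarrow> complex" where
  "\<Lambda> u = G (\<Phi> u) * H (\<Phi> u)"

lemma \<Phi>_slit: "u \<in> ball 0 R \<Longrightarrow> u \<notin> \<real>\<^sub>\<le>\<^sub>0 \<Longrightarrow> \<Phi> u \<in> slit c"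
  using \<Phi>_ball[of u] \<phi>_slit[of "\<Phi> u"] by simp

lemma \<Phi>_\<phi>: "z \<in> ball 1 e \<Longrightarrow> \<phi> z \<in> ball 0 R \<Longrightarrow> \<Phi> (\<phi> z) = z"
  using \<Phi>_ball[of "\<phi> z"] inj_onD[OF \<phi>_inj] by blast

lemma \<Lambda>_hol: "\<Lambda> holomorphic_on ball 0 R - \<real>\<^sub>\<le>\<^sub>0"
proof -
  have \<Phi>: "\<Phi> holomorphic_on ball 0 R - \<real>\<^sub>\<le>\<^sub>0" by (rule holomorphic_on_subset[OF \<Phi>_hol]) auto
  have "G \<circ> \<Phi> holomorphic_on ball 0 R - \<real>\<^sub>\<le>\<^sub>0"
    by (rule holomorphic_on_compose_gen[OF \<Phi> G_hol]) (use \<Phi>_slit in auto)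
  moreover have "H \<circ> \<Phi> holomorphic_on ball 0 R - \<real>\<^sub>\<le>\<^sub>0"
    by (rule holomorphic_on_compose_gen[OF \<Phi> H_hol]) (use \<Phi>_ball in auto)
  ultimately show ?thesis unfolding \<Lambda>_def by (auto intro!: holomorphic_intros simp: o_def)
qed

text \<open>In the coordinate \<open>u\<close> the map \<open>d\<close> is multiplication by \<tau>,
  and \<open>H\<close> absorbs \<open>f / f 1\<close>. What remains of the functional equation is
  the constant \<open>1 / f 1\<close>.\<close>

lemma \<Lambda>_\<tau>:
  assumes u: "u \<notin> \<real>\<^sub>\<le>\<^sub>0" "norm (of_real \<tau> * u) < R"
  shows "\<Lambda> (of_real \<tau> * u) = of_real (\<tau> powr s) * \<Lambda> u"
proof -
  have "1 * norm u \<le> \<tau> * norm u" using \<tau> by (intro mult_right_mono) auto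
  then have uR: "u \<in> ball 0 R" "of_real \<tau> * u \<in> ball 0 R" using u \<tau> by (auto simp: norm_mult)
  note \<Phi>1 = \<Phi>_ball[OF uR(1)] and \<Phi>2 = \<Phi>_ball[OF uR(2)]
  have "\<phi> (d (\<Phi> u)) = \<phi> (\<Phi> (of_real \<tau> * u))" using \<phi>_d[of "\<Phi> u"] \<Phi>1 \<Phi>2 by simp
  then have eq: "\<Phi> (of_real \<tau> * u) = d (\<Phi> u)" using inj_onD[OF \<phi>_inj] \<Phi>1 \<Phi>2 by metis
  have "\<Lambda> (of_real \<tau> * u) = G (d (\<Phi> u)) * (H (\<Phi> u) * f (\<Phi> u) / f 1)"
    using H_d[of "\<Phi> u"] \<Phi>1 by (simp add: \<Lambda>_def eq)
  also have "\<dots> = (f (\<Phi> u) * G (d (\<Phi> u))) * H (\<Phi> u) / f 1" by simp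
  also have "\<dots> = \<Lambda> u / f 1"
    using G_eq[OF \<Phi>_slit[OF uR(1) u(1)]] by (simp add: \<Lambda>_def)
  also have "\<dots> = of_real (\<tau> powr s) * \<Lambda> u"
    using \<tau> by (simp add: f_1 powr_minus field_simps)
  finally show ?thesis .
qed

lemma strip_exp: "w \<in> strip \<tau> \<Longrightarrow> exp (w * of_real (ln \<tau>)) \<notin> \<real>\<^sub>\<le>\<^sub>0 \<and> Ln (exp (w * of_real (ln \<tau>))) = w * of_real (ln \<tau>)"
proof -
  assume "w \<in> strip \<tau>"
  then have "\<bar>Im (w * of_real (ln \<tau>))\<bar> < pi"
    using \<tau> by (simp add: strip_def abs_mult pos_less_divide_eq)
  then have Im: "- pi < Im (w * of_real (ln \<tau>))" "Im (w * of_real (ln \<tau>)) < pi"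
    by (auto simp: abs_less_iff)
  then have Ln: "Ln (exp (w * of_real (ln \<tau>))) = w * of_real (ln \<tau>)" by (intro Ln_exp) auto
  have "exp (w * of_real (ln \<tau>)) \<notin> \<real>\<^sub>\<le>\<^sub>0"
  proof
    assume "exp (w * of_real (ln \<tau>)) \<in> \<real>\<^sub>\<le>\<^sub>0"
    then have "Im (Ln (exp (w * of_real (ln \<tau>)))) = pi"
      using exp_not_eq_zero[of "w * of_real (ln \<tau>)"]
      by (subst Im_Ln_eq_pi) (auto simp: complex_nonpos_Reals_iff complex_eq_iff order_le_less simp del: Ln_exp exp_not_eq_zero)
    then show False using Ln Im by simp
  qed
  with Ln show ?thesis by blast
qed

lemma Ln_strip: "u \<notin> \<real>\<^sub>\<le>\<^sub>0 \<Longrightarrow> Ln u / of_real (ln \<tau>) \<in> strip \<tau>"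
proof -
  assume "u \<notin> \<real>\<^sub>\<le>\<^sub>0"
  then have "u \<noteq> 0" "Im (Ln u) < pi" by (auto simp: Im_Ln_less_pi)
  then have "\<bar>Im (Ln u)\<bar> < pi" using mpi_less_Im_Ln[of u] by (simp add: abs_less_iff)
  then show ?thesis using \<tau> by (simp add: strip_def divide_strict_right_mono)
qed

text \<open>With \<open>u = exp (w * ln \<tau>)\<close>, multiplication of \<open>u\<close> by
  \<tau> is the shift of \<open>w\<close> by 1, so dividing \<Lambda> by the power \<open>s\<close>
  of \<open>u\<close> leaves a function of period 1. It is given only for
  \<open>Re w < ln R / ln \<tau>\<close>, hence the periodic extension.\<close>

lemma \<omega>_exists:
  obtains \<omega> where "\<omega> holomorphic_on strip \<tau>" "\<And>w. w \<in> strip \<tau> \<Longrightarrow> \<omega> (w + 1) = \<omega> w"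
    "\<And>u. u \<in> ball 0 R \<Longrightarrow> u \<notin> \<real>\<^sub>\<le>\<^sub>0 \<Longrightarrow> \<Lambda> u = u powr of_real s * \<omega> (Ln u / of_real (ln \<tau>))"
proof -
  define l where "l = ln \<tau>"
  have l: "l > 0" using \<tau> by (simp add: l_def)
  define a where "a = ln R / l"
  define h where "h w = exp (- of_real s * (w * of_real l)) * \<Lambda> (exp (w * of_real l))" for w
  have nm: "norm (exp (w * of_real l)) < R \<longleftrightarrow> Re w < a" for w
  proof -
    have "norm (exp (w * of_real l)) < R \<longleftrightarrow> Re w * l < ln R"
      using R by (simp add: ln_less_cancel_iff[symmetric])
    then show ?thesis using l by (simp add: a_def pos_less_divide_eq)
  qed
  have strip_eq: "w \<in> strip \<tau> \<longleftrightarrow> \<bar>Im w\<bar> < pi / l" for w by (simp add: strip_def l_def)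
  have dom: "exp (w * of_real l) \<in> ball 0 R - \<real>\<^sub>\<le>\<^sub>0" if "Re w < a" "\<bar>Im w\<bar> < pi / l" for w
    using that nm strip_exp[of w] strip_eq by (simp add: l_def)
  have "h holomorphic_on {w. Re w < a \<and> \<bar>Im w\<bar> < pi / l}"
  proof -
    have "\<Lambda> \<circ> (\<lambda>w. exp (w * of_real l)) holomorphic_on {w. Re w < a \<and> \<bar>Im w\<bar> < pi / l}"
      by (rule holomorphic_on_compose_gen[OF _ \<Lambda>_hol]) (use dom in \<open>auto intro!: holomorphic_intros\<close>)
    then show ?thesis unfolding h_def by (auto intro!: holomorphic_intros simp: o_def)
  qed
  note h_hol = this
  have h_per: "h (w + 1) = h w" if w: "Re w < a - 1" "\<bar>Im w\<bar> < pi / l" for w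
  proof -
    have \<tau>_exp: "exp (of_real l) = (of_real \<tau> :: complex)"
    proof -
      have "exp (of_real l) = (of_real (exp l) :: complex)" by (rule exp_of_real)
      then show ?thesis using \<tau> by (simp add: l_def)
    qed
    then have eq: "exp ((w + 1) * of_real l) = of_real \<tau> * exp (w * of_real l)"
      by (simp add: distrib_right exp_add)
    have "norm (exp ((w + 1) * of_real l)) < R" using nm[of "w + 1"] w by simp
    then have "\<Lambda> (exp ((w + 1) * of_real l)) = of_real (\<tau> powr s) * \<Lambda> (exp (w * of_real l))"
      unfolding eq using dom[of w] w by (intro \<Lambda>_\<tau>) auto
    moreover have "of_real (\<tau> powr s) = exp (of_real s * of_real l :: complex)"
      using \<tau> by (simp add: powr_def l_def flip: exp_of_real of_real_mult)
    moreover have "exp (- of_real s * ((w + 1) * of_real l)) * exp (of_real s * of_real l)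
        = exp (- of_real s * (w * of_real l))"
      by (simp add: algebra_simps flip: exp_add)
    ultimately show ?thesis unfolding h_def by (simp add: mult.assoc[symmetric])
  qed
  obtain \<omega> where \<omega>: "\<omega> holomorphic_on {w. \<bar>Im w\<bar> < pi / l}"
      "\<And>w. \<bar>Im w\<bar> < pi / l \<Longrightarrow> \<omega> (w + 1) = \<omega> w"
      "\<And>w. Re w < a \<Longrightarrow> \<bar>Im w\<bar> < pi / l \<Longrightarrow> \<omega> w = h w"
    by (rule periodic_extension[OF h_hol], erule (1) h_per, rule that)
  show ?thesis
  proof (rule that)
    show "\<omega> holomorphic_on strip \<tau>" using \<omega>(1) by (simp add: strip_def l_def)
    show "\<omega> (w + 1) = \<omega> w" if "w \<in> strip \<tau>" for w using \<omega>(2) that strip_eq by blast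
    fix u :: complex assume u: "u \<in> ball 0 R" "u \<notin> \<real>\<^sub>\<le>\<^sub>0"
    define w where "w = Ln u / of_real l"
    have u0: "u \<noteq> 0" using u by auto
    have wl: "w * of_real l = Ln u" using l by (simp add: w_def)
    then have eu: "exp (w * of_real l) = u" using u0 by simp
    have "Re w < a" using nm[of w] u eu by simp
    moreover have "\<bar>Im w\<bar> < pi / l" using Ln_strip[OF u(2)] strip_eq by (simp add: w_def l_def)
    ultimately have "\<omega> w = exp (- of_real s * Ln u) * \<Lambda> u" using \<omega>(3) by (simp add: h_def wl eu u0)
    moreover have "u powr of_real s = exp (of_real s * Ln u)" using u0 by (simp add: powr_def)
    ultimately show "\<Lambda> u = u powr of_real s * \<omega> (Ln u / of_real (ln \<tau>))"
      by (simp add: w_def[symmetric] l_def[symmetric] exp_minus)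
  qed
qed

end

text \<open>Periodicity reduces the closed substrip to one compact rectangle.\<close>

lemma periodic_bounded:
  fixes g :: "complex \<Rightarrow> complex"
  assumes cont: "continuous_on {w. \<bar>Im w\<bar> < b} g"
    and per: "\<And>w. \<bar>Im w\<bar> < b \<Longrightarrow> g (w + 1) = g w" and b': "b' < b"
  obtains K where "\<And>w. \<bar>Im w\<bar> \<le> b' \<Longrightarrow> norm (g w) \<le> K"
proof -
  have pern: "g (w + of_nat n) = g w" if "\<bar>Im w\<bar> < b" for w n
  proof (induction n)
    case (Suc n)
    then show ?case using per[of "w + of_nat n"] that by (simp add: algebra_simps)
  qed simp
  have peri: "g (w + of_int n) = g w" if "\<bar>Im w\<bar> < b" for w n
  proof (cases "n \<ge> 0")
    case True
    then show ?thesis using pern[OF that, of "nat n"] by (simp add: of_nat_nat)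
  next
    case False
    then show ?thesis using pern[of "w + of_int n" "nat (- n)"] that by (simp add: of_nat_nat)
  qed
  define B where "B = cbox (Complex 0 (- b')) (Complex 1 b')"
  have "compact (g ` B)"
    by (rule compact_continuous_image)
       (use b' in \<open>auto intro!: continuous_on_subset[OF cont] simp: B_def in_cbox_complex_iff\<close>)
  then obtain K where K: "\<And>w. w \<in> B \<Longrightarrow> norm (g w) \<le> K"
    using compact_imp_bounded[of "g ` B"] unfolding bounded_iff by blast
  show ?thesis
  proof (rule that)
    fix w assume w: "\<bar>Im w\<bar> \<le> b'"
    have "w - of_int \<lfloor>Re w\<rfloor> \<in> B"
      using w by (auto simp: B_def in_cbox_complex_iff) linarith
    then have "norm (g (w - of_int \<lfloor>Re w\<rfloor>)) \<le> K" by (rule K)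
    then show "norm (g w) \<le> K" using peri[of w "- \<lfloor>Re w\<rfloor>"] w b' by simp
  qed
qed

section \<open>The expansion with its error term\<close>

context green_chart
begin

lemma exp_notin_nonpos: "\<bar>Im w\<bar> < pi \<Longrightarrow> exp w \<notin> \<real>\<^sub>\<le>\<^sub>0"
  using strip_exp[of "w / of_real (ln \<tau>)"] \<tau>
  by (simp add: strip_def divide_strict_right_mono)

lemma \<phi>_1: "\<phi> 1 = 0" and \<Phi>_0: "\<Phi> 0 = 1"
proof -
  show "\<phi> 1 = 0" using \<phi>_\<rho>[of 1] e by simp
  then show "\<Phi> 0 = 1" using \<Phi>_\<phi>[of 1] e R by simp
qed

lemma small_radius:
  obtains r where "0 < r" "r < e" "\<And>z. z \<in> cball 1 r \<Longrightarrow> \<phi> z \<in> ball 0 R"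
proof -
  have "eventually (\<lambda>z. \<phi> z \<in> ball 0 R) (nhds 1)"
    using e R by (intro holomorphic_near[OF \<phi>_hol]) (auto simp: \<phi>_1)
  then obtain r where r: "r > 0" "\<And>z. z \<in> ball 1 r \<Longrightarrow> \<phi> z \<in> ball 0 R"
    using eventually_nhds_ball[of _ "1 :: complex"] by blast
  show ?thesis
  proof (rule that)
    show "0 < min r e / 2" "min r e / 2 < e" using r e by auto
    show "\<phi> z \<in> ball 0 R" if "z \<in> cball 1 (min r e / 2)" for z
      using r(1) e(1) that by (intro r(2)) (auto simp: min_def split: if_splits)
  qed
qed

lemma \<Lambda>_\<phi>: "z \<in> ball 1 e \<Longrightarrow> \<phi> z \<in> ball 0 R \<Longrightarrow> \<Lambda> (\<phi> z) = G z * H z"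
  by (simp add: \<Lambda>_def \<Phi>_\<phi>)

text \<open>The holomorphic factor, equal to 1 at 1, that is left when the power of \<phi> is
  replaced by the power of \<open>1 - z\<close> and \<open>H\<close> is divided out.\<close>

definition A :: "complex \<Rightarrow> complex" where
  "A z = exp (of_real s * Ln (\<rho> z)) / H z"

lemma \<rho>_notin: "z \<in> ball 1 e \<Longrightarrow> \<rho> z \<notin> \<real>\<^sub>\<le>\<^sub>0"
  using \<rho>_pos[of z] by (auto simp: complex_nonpos_Reals_iff)

lemma Ln_\<rho>_hol: "(\<lambda>z. Ln (\<rho> z)) holomorphic_on ball 1 e"
  using \<rho>_notin by (intro holomorphic_intros \<rho>_hol)

lemma A_hol: "A holomorphic_on ball 1 e"
  unfolding A_def by (intro holomorphic_intros Ln_\<rho>_hol H_hol H_nz)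

lemma A_1: "A 1 = 1"
  by (simp add: A_def \<rho>_1 H_1)

lemma \<phi>_powr:
  assumes "z \<in> ball 1 e" "z \<in> slit c"
  shows "\<phi> z powr of_real s = (1 - z) powr of_real s * (A z * H z)"
proof -
  have nz: "1 - z \<noteq> 0" "\<phi> z \<noteq> 0" using assms \<phi>_slit[of z] by (auto simp: slit_def)
  then show ?thesis
    using H_nz[OF assms(1)] by (simp add: powr_def Ln_\<phi>[OF assms] A_def distrib_left exp_add)
qed

text \<open>Exactly, \<open>G z\<close> is the power of \<open>1 - z\<close> times
  \<open>A z * \<omega> (Ln (\<phi> z) / l)\<close>. Replacing \<open>A z\<close> by 1 and
  \<open>Ln (\<phi> z)\<close> by \<open>Ln (1 - z)\<close> costs a multiple of
  \<open>norm (z - 1)\<close>, as long as the arguments of \<omega> stay in a closed substrip. The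
  radius may not depend on \<delta>, but that condition does; so points farther from 1 than some
  \<eta> are handled by compactness.\<close>

lemma expansion:
  assumes \<omega>: "\<omega> holomorphic_on strip \<tau>" "\<And>w. w \<in> strip \<tau> \<Longrightarrow> \<omega> (w + 1) = \<omega> w"
    and \<omega>_\<Lambda>: "\<And>u. u \<in> ball 0 R \<Longrightarrow> u \<notin> \<real>\<^sub>\<le>\<^sub>0 \<Longrightarrow> \<Lambda> u = u powr of_real s * \<omega> (Ln u / of_real (ln \<tau>))"
    and g: "\<And>z. z \<in> slit 1 \<Longrightarrow> g z = G z"
  shows "singular_expansion g (2 * (s + 1)) \<tau> \<omega>"
proof -
  define l where "l = ln \<tau>"
  have l: "l > 0" using \<tau> by (simp add: l_def)
  have strip_eq: "strip \<tau> = {w. \<bar>Im w\<bar> < pi / l}" by (simp add: strip_def l_def)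
  obtain r where r: "0 < r" "r < e" "\<And>z. z \<in> cball 1 r \<Longrightarrow> \<phi> z \<in> ball 0 R"
    by (rule small_radius) (rule that)
  obtain K1 where K1: "K1 \<ge> 0" "\<And>z. z \<in> cball 1 r \<Longrightarrow> norm (A z - 1) \<le> K1 * norm (z - 1)"
    using holomorphic_lipschitz_at_centre[OF A_hol r(1,2)] unfolding A_1 by blast
  obtain K2 where K2: "K2 \<ge> 0" "\<And>z. z \<in> cball 1 r \<Longrightarrow> norm (Ln (\<rho> z)) \<le> K2 * norm (z - 1)"
    using holomorphic_lipschitz_at_centre[OF Ln_\<rho>_hol r(1,2)] unfolding \<rho>_1 by auto
  have main: "\<exists>K. \<forall>z\<in>sector \<delta> 1 r. norm (A z * \<omega> (Ln (\<phi> z) / l) - \<omega> (Ln (1 - z) / l)) \<le> K * norm (z - 1)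
        \<and> g z = (1 - z) powr of_real s * (A z * \<omega> (Ln (\<phi> z) / l))"
    if \<delta>: "0 < \<delta>" "\<delta> < pi" for \<delta>
  proof -
    have sec: "z \<in> cball 1 r" "z \<in> ball 1 e" "z \<in> slit c" "g z = G z"
        "1 - z \<noteq> 0" "\<bar>Im (Ln (1 - z))\<bar> < \<delta>" if "z \<in> sector \<delta> 1 r" for z
    proof -
      have z: "z \<noteq> 1" "norm (z - 1) < r" "\<bar>Arg (1 - z)\<bar> < \<delta>" using that by (auto simp: sector_def)
      then show "z \<in> cball 1 r" and ze: "z \<in> ball 1 e" and "1 - z \<noteq> 0"
        using r by (auto simp: dist_norm norm_minus_commute)
      then show "\<bar>Im (Ln (1 - z))\<bar> < \<delta>" using z(3) by (simp add: Arg_eq_Im_Ln)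
      then have nn: "1 - z \<notin> \<real>\<^sub>\<le>\<^sub>0"
        using exp_notin_nonpos[of "Ln (1 - z)"] \<delta> \<open>1 - z \<noteq> 0\<close> by simp
      then show "z \<in> slit c" using ball_slit[OF ze] by simp
      have "\<bar>Re (1 - z)\<bar> < 1" using ze e(2) abs_Re_le_cmod[of "1 - z"] by (simp add: dist_norm)
      then have "z \<in> slit 1" using nn by (auto simp: slit_def complex_nonpos_Reals_iff)
      then show "g z = G z" by (rule g)
    qed
    have geq: "g z = (1 - z) powr of_real s * (A z * \<omega> (Ln (\<phi> z) / l))" if "z \<in> sector \<delta> 1 r" for z
    proof -
      note z = sec[OF that]
      have "\<phi> z \<notin> \<real>\<^sub>\<le>\<^sub>0" using \<phi>_slit z by blast
      then have "G z * H z = \<phi> z powr of_real s * \<omega> (Ln (\<phi> z) / l)"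
        using \<omega>_\<Lambda>[of "\<phi> z"] \<Lambda>_\<phi>[OF z(2)] r(3)[OF z(1)] by (simp add: l_def)
      then show ?thesis using H_nz[OF z(2)] \<phi>_powr[OF z(2,3)] z(4) by simp
    qed
    \<comment> \<open>Halfway between \<open>\<delta> / l\<close>, the bound for
      \<open>Im w1\<close>, and the edge \<open>pi / l\<close> of the strip.\<close>
    define b1 where "b1 = (\<delta> + pi) / 2 / l"
    have b1: "b1 < pi / l" using \<delta> l by (simp add: b1_def field_simps)
    obtain K\<omega> where K\<omega>: "\<And>w. \<bar>Im w\<bar> \<le> b1 \<Longrightarrow> norm (\<omega> w) \<le> K\<omega>"
      by (rule periodic_bounded[of "pi / l" \<omega> b1])
         (use \<omega> b1 in \<open>auto simp: strip_eq holomorphic_on_imp_continuous_on\<close>)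
    have open_strip: "open (strip \<tau>)"
      unfolding strip_eq by (intro open_Collect_less continuous_intros)
    have d\<omega>_hol: "deriv \<omega> holomorphic_on strip \<tau>" using \<omega>(1) open_strip by (rule holomorphic_deriv)
    have d\<omega>_per: "deriv \<omega> (w + 1) = deriv \<omega> w" if "\<bar>Im w\<bar> < pi / l" for w
    proof -
      have w: "w \<in> strip \<tau>" "w + 1 \<in> strip \<tau>" using that by (auto simp: strip_eq)
      have "((\<lambda>x. \<omega> (x + 1)) has_field_derivative deriv \<omega> (w + 1)) (at w)"
        using holomorphic_derivI[OF \<omega>(1) open_strip w(2)] DERIV_shift by blast
      then have "(\<omega> has_field_derivative deriv \<omega> (w + 1)) (at w)"
        using open_strip w(1) by (rule has_field_derivative_transform_within_open) (rule \<omega>(2))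
      then show ?thesis by (simp add: DERIV_imp_deriv)
    qed
    obtain K' where K': "\<And>w. \<bar>Im w\<bar> \<le> b1 \<Longrightarrow> norm (deriv \<omega> w) \<le> K'"
      by (rule periodic_bounded[of "pi / l" "deriv \<omega>" b1])
         (use d\<omega>_hol d\<omega>_per b1 in \<open>auto simp: strip_eq holomorphic_on_imp_continuous_on\<close>)
    have lip: "norm (\<omega> x - \<omega> y) \<le> K' * norm (x - y)" if "\<bar>Im x\<bar> \<le> b1" "\<bar>Im y\<bar> \<le> b1" for x y
    proof (rule field_differentiable_bound[where S = "{w. \<bar>Im w\<bar> \<le> b1}"])
      have "{w. \<bar>Im w\<bar> \<le> b1} = {w. Im w \<le> b1} \<inter> {w. Im w \<ge> - b1}" by (auto simp: abs_le_iff)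
      then show "convex {w. \<bar>Im w\<bar> \<le> b1}"
        by (simp add: convex_Int convex_halfspace_Im_le convex_halfspace_Im_ge)
      show "(\<omega> has_field_derivative deriv \<omega> z) (at z within {w. \<bar>Im w\<bar> \<le> b1})" if "z \<in> {w. \<bar>Im w\<bar> \<le> b1}" for z
        using that b1 by (intro holomorphic_derivI[OF \<omega>(1) open_strip]) (auto simp: strip_eq)
    qed (use K' that in auto)
    \<comment> \<open>Below this distance, adding \<open>Ln (\<rho> z) / l\<close> cannot push the
      argument of \<omega> beyond \<open>b1\<close>. The summand 1 guards against
      \<open>K2 = 0\<close>.\<close>
    define \<eta> where "\<eta> = min r ((pi - \<delta>) / 2 / (K2 + 1))"
    have \<eta>: "0 < \<eta>" "\<eta> \<le> r" "K2 * \<eta> \<le> (pi - \<delta>) / 2"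
    proof -
      show "0 < \<eta>" "\<eta> \<le> r" using r \<delta> K2(1) by (auto simp: \<eta>_def)
      have "\<eta> \<le> ((pi - \<delta>) / 2) / (K2 + 1)" by (simp add: \<eta>_def)
      then have "\<eta> * (K2 + 1) \<le> (pi - \<delta>) / 2"
        by (subst (asm) pos_le_divide_eq) (use K2(1) in auto)
      then show "K2 * \<eta> \<le> (pi - \<delta>) / 2" using \<open>0 < \<eta>\<close> by (simp add: algebra_simps)
    qed
    \<comment> \<open>A compact set of logarithms of \<open>1 - z\<close>: it covers the part of the
      sector with distance between \<eta> and \<open>r\<close> from 1, and \<open>G\<close> is
      continuous there.\<close>
    define Q where "Q = cbox (Complex (ln \<eta>) (- \<delta>)) (Complex (ln r) \<delta>)"
    have Q: "1 - exp w \<in> slit c" if "w \<in> Q" for w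
    proof -
      have "norm (exp w) \<le> r"
        using that r by (simp add: Q_def in_cbox_complex_iff ln_ge_iff)
      then have "1 - exp w \<in> ball 1 e" using r by (simp add: dist_norm)
      moreover have "exp w \<notin> \<real>\<^sub>\<le>\<^sub>0"
        using that \<delta> by (intro exp_notin_nonpos) (auto simp: Q_def in_cbox_complex_iff abs_less_iff)
      ultimately show ?thesis using ball_slit by simp
    qed
    have "continuous_on Q (\<lambda>w. G (1 - exp w))"
      by (rule continuous_on_compose2[OF holomorphic_on_imp_continuous_on[OF G_hol]])
         (use Q in \<open>auto intro!: continuous_intros\<close>)
    then have "compact ((\<lambda>w. G (1 - exp w) * exp (- (of_real s * w))) ` Q)"
      unfolding Q_def by (intro compact_continuous_image continuous_intros compact_cbox)
    then obtain K3 where K3: "\<And>w. w \<in> Q \<Longrightarrow> norm (G (1 - exp w) * exp (- (of_real s * w))) \<le> K3"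
      using compact_imp_bounded[of "(\<lambda>w. G (1 - exp w) * exp (- (of_real s * w))) ` Q"]
      unfolding bounded_iff by blast
    \<comment> \<open>The first entry serves distances below \<eta>. For the others the difference
      is at most \<open>K3 + K\<omega>\<close>, and the distance is at least \<eta>.\<close>
    define K where "K = max (K1 * K\<omega> + K' * (K2 / l)) ((K3 + K\<omega>) / \<eta>)"
    have bound: "norm (A z * \<omega> (Ln (\<phi> z) / l) - \<omega> (Ln (1 - z) / l)) \<le> K * norm (z - 1)"
      if "z \<in> sector \<delta> 1 r" for z
    proof -
      note z = sec[OF that]
      define w1 where "w1 = Ln (1 - z) / l"
      define w2 where "w2 = Ln (\<phi> z) / l"
      have w12: "w2 - w1 = Ln (\<rho> z) / l" using Ln_\<phi>[OF z(2,3)] by (simp add: w1_def w2_def add_divide_distrib)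
      have Im1: "\<bar>Im w1\<bar> < \<delta> / l" using z(6) l by (simp add: w1_def divide_strict_right_mono)
      have "\<delta> / l \<le> b1" using \<delta> l by (simp add: b1_def field_simps)
      then have Im1': "\<bar>Im w1\<bar> \<le> b1" using Im1 by simp
      show ?thesis
      proof (cases "norm (z - 1) < \<eta>")
        case True
        have "\<bar>Im (Ln (\<rho> z))\<bar> \<le> K2 * norm (z - 1)"
          using K2(2)[OF z(1)] abs_Im_le_cmod order_trans by blast
        also have "\<dots> \<le> K2 * \<eta>" using True K2(1) by (intro mult_left_mono) auto
        finally have "\<bar>Im (Ln (\<rho> z))\<bar> \<le> (pi - \<delta>) / 2" using \<eta>(3) by simp
        moreover have "\<bar>Im (w2 - w1)\<bar> = \<bar>Im (Ln (\<rho> z))\<bar> / l" using l unfolding w12 by simp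
        ultimately have "\<bar>Im (w2 - w1)\<bar> \<le> (pi - \<delta>) / 2 / l"
          using l by (simp only: divide_right_mono less_imp_le)
        moreover have "Im w2 = Im w1 + Im (w2 - w1)" by simp
        ultimately have "\<bar>Im w2\<bar> \<le> \<delta> / l + (pi - \<delta>) / 2 / l"
          using Im1 by linarith
        also have "\<dots> = b1" using l by (simp add: b1_def field_simps)
        finally have Im2: "\<bar>Im w2\<bar> \<le> b1" .
        have K'0: "K' \<ge> 0" using order_trans[OF norm_ge_zero K'[OF Im1']] .
        have "A z * \<omega> w2 - \<omega> w1 = (A z - 1) * \<omega> w2 + (\<omega> w2 - \<omega> w1)" by (simp add: algebra_simps)
        then have "norm (A z * \<omega> w2 - \<omega> w1) \<le> norm ((A z - 1) * \<omega> w2) + norm (\<omega> w2 - \<omega> w1)"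
          using norm_triangle_ineq by metis
        also have "\<dots> \<le> (K1 * norm (z - 1)) * K\<omega> + K' * norm (w2 - w1)"
          unfolding norm_mult using K1 K\<omega>[OF Im2] lip[OF Im2 Im1'] z(1)
          by (intro add_mono mult_mono) auto
        also have "\<dots> \<le> (K1 * norm (z - 1)) * K\<omega> + K' * (K2 * norm (z - 1) / l)"
          using K2(2)[OF z(1)] l K'0 unfolding w12
          by (intro add_left_mono mult_left_mono) (auto simp: norm_divide divide_right_mono)
        also have "\<dots> = (K1 * K\<omega> + K' * (K2 / l)) * norm (z - 1)" by (simp add: algebra_simps)
        also have "\<dots> \<le> K * norm (z - 1)" by (intro mult_right_mono) (auto simp: K_def)
        finally show ?thesis by (simp add: w1_def w2_def)
      next
        case False
        have "norm (z - 1) \<le> r" using z(1) by (simp add: dist_norm norm_minus_commute)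
        then have "Ln (1 - z) \<in> Q"
          using False z(5,6) \<eta>(1) r(1) by (auto simp: Q_def in_cbox_complex_iff norm_minus_commute abs_less_iff)
        then have "norm (G z * exp (- (of_real s * Ln (1 - z)))) \<le> K3"
          using K3[of "Ln (1 - z)"] z(5) by simp
        moreover have "A z * \<omega> w2 = G z * exp (- (of_real s * Ln (1 - z)))"
          using geq[OF that] z(4,5) by (simp add: powr_def w2_def exp_minus field_simps)
        ultimately have "norm (A z * \<omega> w2) \<le> K3" by simp
        then have le: "norm (A z * \<omega> w2 - \<omega> w1) \<le> K3 + K\<omega>"
          using K\<omega>[OF Im1'] norm_triangle_ineq4[of "A z * \<omega> w2" "\<omega> w1"] by linarith
        also have "K3 + K\<omega> = (K3 + K\<omega>) / \<eta> * \<eta>" using \<eta> by simp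
        also have "\<dots> \<le> K * norm (z - 1)"
        proof (rule mult_mono)
          have "0 \<le> K3 + K\<omega>" using order_trans[OF norm_ge_zero le] .
          then show "0 \<le> K" using \<eta> by (auto simp: K_def le_max_iff_disj)
        qed (use False \<eta> in \<open>auto simp: K_def\<close>)
        finally show ?thesis by (simp add: w1_def w2_def)
      qed
    qed
    show ?thesis using bound geq by blast
  qed
  show ?thesis
    unfolding singular_expansion_def
  proof (rule exI[of _ r], intro conjI allI impI r(1))
    fix \<delta> assume "0 < \<delta> \<and> \<delta> < pi"
    then obtain K where K: "\<And>z. z \<in> sector \<delta> 1 r \<Longrightarrow>
        norm (A z * \<omega> (Ln (\<phi> z) / l) - \<omega> (Ln (1 - z) / l)) \<le> K * norm (z - 1)
        \<and> g z = (1 - z) powr of_real s * (A z * \<omega> (Ln (\<phi> z) / l))"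
      using main by blast
    have s_eq: "2 * (s + 1) / 2 - 1 = s" by (simp add: field_simps)
    show "\<exists>K. \<forall>z\<in>sector \<delta> 1 r. \<exists>e. norm e \<le> K * norm (z - 1) \<and>
        g z = (1 - z) powr of_real (2 * (s + 1) / 2 - 1) * (\<omega> (Ln (1 - z) / of_real (ln \<tau>)) + e)"
    proof (rule exI[of _ K], rule ballI)
      fix z assume "z \<in> sector \<delta> 1 r"
      then show "\<exists>e. norm e \<le> K * norm (z - 1) \<and>
          g z = (1 - z) powr of_real (2 * (s + 1) / 2 - 1) * (\<omega> (Ln (1 - z) / of_real (ln \<tau>)) + e)"
        using K[of z]
        unfolding s_eq
        by (intro exI[of _ "A z * \<omega> (Ln (\<phi> z) / l) - \<omega> (Ln (1 - z) / l)"]) (simp add: l_def)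
    qed
  qed
qed

end

section \<open>Boundary values on the cut when \<omega> is constant\<close>

lemma open_imp_fsigma:
  assumes "open (S :: 'a :: euclidean_space set)"
  shows "fsigma S"
proof -
  obtain C :: "nat \<Rightarrow> 'a set" where "\<And>n. compact (C n)" "\<Union>(range C) = S"
    using open_Union_compact_subsets[OF assms] by metis
  then show ?thesis using fsigma.intros[of C] compact_imp_closed by metis
qed

lemma dist_1_of_real: "dist (1 :: complex) (of_real y) = \<bar>y - 1\<bar>"
proof -
  have "dist (of_real 1 :: complex) (of_real y) = dist 1 y" by (rule dist_of_real)
  then show ?thesis by (simp add: dist_real_def abs_minus_commute)
qed

lemma tendsto_Ln_of_real:
  assumes "(v \<longlongrightarrow> of_real y) F" "y > 0"
  shows "((\<lambda>n. Ln (v n)) \<longlongrightarrow> of_real (ln y)) F"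
  using tendsto_Ln[OF assms(1)] assms(2) by (simp add: Ln_of_real)

context green_chart
begin

text \<open>An asymptotic statement becomes an identity by homogeneity: dividing \<open>u\<close> by
  powers of \<tau> drives the corresponding points \<open>zn\<close> to 1 inside one sector, while
  the quotient of \<Lambda> by the power of \<open>u\<close> does not change. The expansion
  evaluates that quotient in the limit.\<close>

lemma expansion_constant:
  assumes expn: "singular_expansion g (2 * (s + 1)) \<tau> \<omega>"
    and g: "\<And>z. z \<in> slit 1 \<Longrightarrow> g z = G z" and \<omega>: "\<And>w. w \<in> strip \<tau> \<Longrightarrow> \<omega> w = c0"
    and u: "u \<in> ball 0 R" "u \<notin> \<real>\<^sub>\<le>\<^sub>0"
  shows "\<Lambda> u = u powr of_real s * c0"
proof -
  define l where "l = ln \<tau>"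
  have l: "l > 0" using \<tau> by (simp add: l_def)
  have u0: "u \<noteq> 0" using u by auto
  obtain r where r: "r > 0" and ex: "\<And>\<delta>. 0 < \<delta> \<Longrightarrow> \<delta> < pi \<Longrightarrow> \<exists>K. \<forall>z\<in>sector \<delta> 1 r. \<exists>e.
           norm e \<le> K * norm (z - 1) \<and>
           g z = (1 - z) powr of_real (2 * (s + 1) / 2 - 1) * (\<omega> (Ln (1 - z) / of_real (ln \<tau>)) + e)"
    using expn unfolding singular_expansion_def by blast
  define un where "un n = u / of_real (\<tau> ^ n)" for n
  have \<tau>n: "\<tau> ^ n \<ge> 1" for n using \<tau> by simp
  have unR: "un n \<in> ball 0 R" "un n \<notin> \<real>\<^sub>\<le>\<^sub>0" for n
  proof -
    have "norm u / \<tau> ^ n \<le> norm u / 1" using \<tau>n[of n] by (intro divide_left_mono) auto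
    then show "un n \<in> ball 0 R" using u(1) \<tau> by (simp add: un_def norm_divide norm_power)
    show "un n \<notin> \<real>\<^sub>\<le>\<^sub>0"
    proof
      assume "un n \<in> \<real>\<^sub>\<le>\<^sub>0"
      moreover have "Re (un n) = Re u / \<tau> ^ n" "Im (un n) = Im u / \<tau> ^ n"
        by (simp_all add: un_def del: of_real_power)
      ultimately show False using u(2) \<tau>n[of n] \<tau>
        by (auto simp: complex_nonpos_Reals_iff divide_le_0_iff)
    qed
  qed
  have \<Lambda>_un: "\<Lambda> u = of_real ((\<tau> powr s) ^ n) * \<Lambda> (un n)" for n
  proof (induction n)
    case (Suc n)
    have "un n = of_real \<tau> * un (Suc n)" using \<tau> by (simp add: un_def)
    then have "\<Lambda> (un n) = of_real (\<tau> powr s) * \<Lambda> (un (Suc n))"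
      using \<Lambda>_\<tau>[OF unR(2)[of "Suc n"]] unR(1)[of n] by simp
    then show ?case using Suc by (simp add: mult_ac)
  qed (simp add: un_def)
  have Ln_un: "Ln (un n) = Ln u - of_nat n * of_real l" for n
    using \<tau> u0 Ln_divide_of_real[of "\<tau> ^ n" u] by (simp add: un_def l_def ln_realpow del: of_real_power)
  define zn where "zn n = \<Phi> (un n)" for n
  have zn: "zn n \<in> ball 1 e" "zn n \<in> slit c" "\<phi> (zn n) = un n" for n
    using \<Phi>_ball[OF unR(1)] \<Phi>_slit[OF unR] by (auto simp: zn_def)
  have "un \<longlonglongrightarrow> 0"
  proof -
    have "(\<lambda>n. u * of_real ((1 / \<tau>) ^ n)) \<longlonglongrightarrow> u * of_real 0"
      using \<tau> by (intro tendsto_intros LIMSEQ_realpow_zero) auto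
    then show ?thesis by (simp add: un_def[abs_def] power_one_over divide_inverse power_inverse)
  qed
  moreover have "isCont \<Phi> 0"
    using holomorphic_on_imp_continuous_on[OF \<Phi>_hol] R by (simp add: continuous_on_eq_continuous_at)
  ultimately have lim: "zn \<longlonglongrightarrow> 1"
    using isCont_tendsto_compose[of 0 \<Phi> un] by (simp add: zn_def[abs_def] \<Phi>_0)
  have cont1: "isCont h 1" if "h holomorphic_on ball 1 e" for h
    using holomorphic_on_imp_continuous_on[OF that] e by (simp add: continuous_on_eq_continuous_at)
  have A_lim: "(\<lambda>n. A (zn n)) \<longlonglongrightarrow> 1"
    using isCont_tendsto_compose[OF cont1[OF A_hol] lim] A_1 by simp
  have Ln_\<rho>_lim: "(\<lambda>n. Ln (\<rho> (zn n))) \<longlonglongrightarrow> 0"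
    using isCont_tendsto_compose[OF cont1[OF Ln_\<rho>_hol] lim] \<rho>_1 by simp
  define a where "a = \<bar>Im (Ln u)\<bar>"
  have a: "0 \<le> a" "a < pi"
    using Im_Ln_less_pi[OF u(2)] mpi_less_Im_Ln[OF u0] by (auto simp: a_def abs_less_iff)
  \<comment> \<open>\<open>Ln (1 - zn n)\<close> differs from \<open>Ln u\<close> by a real number
    and a null sequence, so its imaginary part tends to that of \<open>Ln u\<close>. Hence
    \<open>zn\<close> is eventually in any sector with angle between \<open>a\<close> and
    \<pi>.\<close>
  define \<delta> where "\<delta> = (a + pi) / 2"
  have \<delta>: "0 < \<delta>" "\<delta> < pi" "a < \<delta>" using a pi_gt_zero by (auto simp: \<delta>_def simp del: pi_gt_zero)
  have Ln_zn: "Ln (1 - zn n) = Ln u - of_nat n * of_real l - Ln (\<rho> (zn n))" for n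
    using Ln_\<phi>[OF zn(1,2)] by (simp add: zn(3) Ln_un)
  have nz: "1 - zn n \<noteq> 0" for n using zn(2)[of n] by (auto simp: slit_def)
  have "(\<lambda>n. Im (Ln u - Ln (\<rho> (zn n)))) \<longlonglongrightarrow> Im (Ln u - 0)"
    by (intro tendsto_intros Ln_\<rho>_lim)
  then have "(\<lambda>n. \<bar>Im (Ln u - Ln (\<rho> (zn n)))\<bar>) \<longlonglongrightarrow> a"
    unfolding a_def by (intro tendsto_rabs) simp
  then have ev1: "eventually (\<lambda>n. \<bar>Im (Ln u - Ln (\<rho> (zn n)))\<bar> < \<delta>) sequentially"
    using \<delta>(3) by (rule order_tendstoD)
  have ev2: "eventually (\<lambda>n. dist (zn n) 1 < r) sequentially"
    using lim r by (rule tendstoD)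
  have ev: "eventually (\<lambda>n. zn n \<in> sector \<delta> 1 r) sequentially"
    using ev1 ev2
  proof eventually_elim
    case (elim n)
    have "Arg (1 - zn n) = Im (Ln u - Ln (\<rho> (zn n)))"
      using nz[of n] by (simp add: Arg_eq_Im_Ln Ln_zn)
    then show ?case using elim nz[of n] by (auto simp: sector_def dist_norm)
  qed
  obtain K where K: "\<And>z. z \<in> sector \<delta> 1 r \<Longrightarrow> \<exists>e. norm e \<le> K * norm (z - 1) \<and>
           g z = (1 - z) powr of_real (2 * (s + 1) / 2 - 1) * (\<omega> (Ln (1 - z) / of_real (ln \<tau>)) + e)"
    using ex[OF \<delta>(1,2)] by blast
  have s_eq: "2 * (s + 1) / 2 - 1 = s" by (simp add: field_simps)
  \<comment> \<open>The quotient that is invariant under \<open>u \<mapsto> u / \<tau>\<close>; it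
    is to be identified with \<open>c0\<close>.\<close>
  define L where "L = \<Lambda> u * exp (- (of_real s * Ln u))"
  have step: "norm (L * A (zn n) - c0) \<le> K * norm (zn n - 1)" if sec: "zn n \<in> sector \<delta> 1 r" for n
  proof -
    obtain \<epsilon> where \<epsilon>: "norm \<epsilon> \<le> K * norm (zn n - 1)"
        "g (zn n) = (1 - zn n) powr of_real s * (\<omega> (Ln (1 - zn n) / of_real (ln \<tau>)) + \<epsilon>)"
      using K[OF sec] unfolding s_eq by blast
    have notin: "1 - zn n \<notin> \<real>\<^sub>\<le>\<^sub>0" using ball_slit[OF zn(1)] zn(2) by blast
    have "\<bar>Re (1 - zn n)\<bar> < 1"
      using zn(1)[of n] e(2) abs_Re_le_cmod[of "1 - zn n"] by (simp add: dist_norm)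
    then have "zn n \<in> slit 1" using notin by (auto simp: slit_def complex_nonpos_Reals_iff)
    then have "G (zn n) = (1 - zn n) powr of_real s * (c0 + \<epsilon>)"
      using \<epsilon>(2) g \<omega>[OF Ln_strip[OF notin]] by simp
    then have "\<Lambda> (un n) = (1 - zn n) powr of_real s * (c0 + \<epsilon>) * H (zn n)"
      using \<Lambda>_\<phi>[OF zn(1)[of n]] unR(1)[of n] by (simp add: zn(3))
    then have "\<Lambda> (un n) * A (zn n) = \<phi> (zn n) powr of_real s * (c0 + \<epsilon>)"
      using \<phi>_powr[OF zn(1,2)[of n]] by (simp add: mult_ac)
    also have "\<phi> (zn n) powr of_real s = exp (of_real s * (Ln u - of_nat n * of_real l))"
      using unR(2)[of n] by (auto simp: zn(3) powr_def Ln_un)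
    finally have "\<Lambda> (un n) * A (zn n) = exp (of_real s * (Ln u - of_nat n * of_real l)) * (c0 + \<epsilon>)" .
    moreover have "of_real ((\<tau> powr s) ^ n) = exp (of_nat n * (of_real s * of_real l) :: complex)"
    proof -
      have "(\<tau> powr s) ^ n = exp (real n * (s * l))"
        using \<tau> by (simp add: powr_def l_def exp_of_nat_mult)
      then show ?thesis by (simp add: exp_of_real[symmetric] del: exp_of_real)
    qed
    ultimately have "L * A (zn n) = exp (of_nat n * (of_real s * of_real l))
        * exp (of_real s * (Ln u - of_nat n * of_real l)) * exp (- (of_real s * Ln u)) * (c0 + \<epsilon>)"
      by (simp add: L_def \<Lambda>_un[of n] mult_ac)
    also have "\<dots> = exp 0 * (c0 + \<epsilon>)"
      by (simp only: exp_add[symmetric]) (simp add: algebra_simps)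
    finally show ?thesis using \<epsilon>(1) by simp
  qed
  have ev3: "eventually (\<lambda>n. norm (L * A (zn n) - c0) \<le> K * norm (zn n - 1)) sequentially"
    using ev by eventually_elim (rule step)
  have "(\<lambda>n. K * norm (zn n - 1)) \<longlonglongrightarrow> K * norm (1 - 1 :: complex)"
    by (intro tendsto_intros lim)
  then have "(\<lambda>n. K * norm (zn n - 1)) \<longlonglongrightarrow> 0" by simp
  then have lim0: "(\<lambda>n. L * A (zn n) - c0) \<longlonglongrightarrow> 0"
    by (rule Lim_null_comparison[OF ev3])
  have "(\<lambda>n. L * A (zn n) - c0) \<longlonglongrightarrow> L * 1 - c0"
    by (intro tendsto_intros A_lim)
  from LIMSEQ_unique[OF this lim0] have "L = c0" by simp
  then show ?thesis using u0 by (simp add: L_def powr_def exp_minus field_simps)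
qed

lemma G_eq_on_ball:
  assumes \<Lambda>c: "\<And>u. u \<in> ball 0 R \<Longrightarrow> u \<notin> \<real>\<^sub>\<le>\<^sub>0 \<Longrightarrow> \<Lambda> u = u powr of_real s * c0"
    and z: "z \<in> ball 1 e" "z \<in> slit c" "\<phi> z \<in> ball 0 R"
  shows "G z * H z = \<phi> z powr of_real s * c0"
  using \<Lambda>c[OF z(3)] \<phi>_slit[OF z(1)] z \<Lambda>_\<phi>[OF z(1,3)] by simp

text \<open>Otherwise \<open>G\<close> would vanish near 1 and, by the identity theorem, at
  0.\<close>

lemma constant_nonzero:
  assumes \<Lambda>c: "\<And>u. u \<in> ball 0 R \<Longrightarrow> u \<notin> \<real>\<^sub>\<le>\<^sub>0 \<Longrightarrow> \<Lambda> u = u powr of_real s * c0"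
  shows "c0 \<noteq> 0"
proof
  assume c0: "c0 = 0"
  obtain r where r: "0 < r" "r < e" "\<And>z. z \<in> cball 1 r \<Longrightarrow> \<phi> z \<in> ball 0 R"
    by (rule small_radius) (rule that)
  define U where "U = ball 1 r \<inter> slit c"
  have "open U" by (simp add: U_def open_Int open_slit)
  have G0: "G z = 0" if "z \<in> U" for z
  proof -
    have z: "z \<in> ball 1 e" "z \<in> cball 1 r" "z \<in> slit c" using that r by (auto simp: U_def)
    then have "G z * H z = 0" using G_eq_on_ball[OF \<Lambda>c z(1,3) r(3)[OF z(2)]] c0 by simp
    then show ?thesis using H_nz[OF z(1)] by simp
  qed
  define p where "p = 1 + \<i> * of_real (r / 2)"
  have p: "p \<in> U" using r by (simp add: p_def U_def slit_def dist_norm norm_mult)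
  have "G 0 = 0"
  proof (rule analytic_continuation[OF G_hol open_slit slit_connected])
    show "U \<subseteq> slit c" by (simp add: U_def)
    show "p islimpt U" using \<open>open U\<close> p interior_limit_point interior_open by blast
  qed (use p c G0 in \<open>auto simp: U_def zero_in_slit\<close>)
  then show False using G_0 by simp
qed

text \<open>The points for which one of the iterates number 0 to \<open>n\<close> falls into
  \<open>Z\<close>. Elsewhere the iterated functional equation has continuous factors, also on the
  cut.\<close>

fun bad :: "nat \<Rightarrow> complex set" where
  "bad 0 = Z"
| "bad (Suc n) = Z \<union> {z \<in> - Z. d z \<in> bad n}"

text \<open>\<open>d\<close> is not constant, as it fixes both 0 and 1, and the complement of the
  countable closed set \<open>Z\<close> is connected; so every value has only countably many
  preimages.\<close>

lemma countable_bad: "countable (bad n)"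
proof (induction n)
  case (Suc n)
  have co: "Topological_Spaces.connected (- Z)"
    using connected_open_diff_countable[of UNIV Z] Z(2) convex_connected[OF convex_UNIV, where 'a = complex]
    by (simp add: Compl_eq_Diff_UNIV)
  have fs: "fsigma (- Z)" using Z(1) by (simp add: open_imp_fsigma open_Compl)
  have "countable {z \<in> - Z. d z = \<zeta>}" for \<zeta>
  proof (rule ccontr)
    assume "uncountable {z \<in> - Z. d z = \<zeta>}"
    then have "- Z \<subseteq> {z \<in> - Z. d z = \<zeta>}"
      using holomorphic_countable_equal[OF d_hol holomorphic_on_const _ co fs] Z(1) by auto
    moreover have "0 \<in> - Z" "1 \<in> - Z" using Z c zero_in_slit[of c] by auto
    ultimately have "d 0 = d 1" by auto
    then show False using d_0 d_1 by simp
  qed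
  then have "countable (\<Union>\<zeta>\<in>bad n. {z \<in> - Z. d z = \<zeta>})" by (rule countable_UN[OF Suc])
  moreover have "{z \<in> - Z. d z \<in> bad n} = (\<Union>\<zeta>\<in>bad n. {z \<in> - Z. d z = \<zeta>})" by auto
  ultimately show ?case using Z(2) by simp
qed (use Z in simp)

lemma not_bad: "z \<notin> bad n \<Longrightarrow> k \<le> n \<Longrightarrow> (d ^^ k) z \<notin> Z"
proof (induction n arbitrary: z k)
  case (Suc n)
  show ?case
  proof (cases k)
    case 0
    then show ?thesis using Suc by auto
  next
    case (Suc k')
    have "d z \<notin> bad n" "k' \<le> n" using Suc.prems Suc by auto
    then have "(d ^^ k') (d z) \<notin> Z" by (rule Suc.IH)
    then show ?thesis by (simp add: Suc funpow_swap1)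
  qed
qed auto

lemma isCont_off_Z:
  assumes "h holomorphic_on - Z" "z \<notin> Z"
  shows "isCont h z"
proof -
  have "open (- Z)" using Z by auto
  then show ?thesis
    using holomorphic_on_imp_continuous_on[OF assms(1)] assms(2)
    by (simp add: continuous_on_eq_continuous_at)
qed

text \<open>One more iterate than in \<open>not_bad\<close> is allowed, because
  \<open>d ^^ Suc n\<close> applies \<open>d\<close> only at the iterates up to number
  \<open>n\<close>.\<close>

lemma isCont_funpow:
  assumes "z \<notin> bad n" "k \<le> Suc n"
  shows "isCont (d ^^ k) z"
  using assms(2)
proof (induction k)
  case (Suc k)
  have "isCont d ((d ^^ k) z)"
    by (rule isCont_off_Z[OF d_hol not_bad[OF assms(1)]]) (use Suc in simp)
  moreover have "isCont (d ^^ k) z" using Suc by simp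
  ultimately have "isCont (\<lambda>z. d ((d ^^ k) z)) z" by (rule isCont_o2[rotated])
  then show ?case by (simp add: o_def)
qed (simp add: id_def)

text \<open>At a point \<open>y\<close> of the cut whose orbit reaches the disc, the right-hand side
  \<open>M\<close> of the iterated functional equation is continuous, so \<open>G\<close> has the
  same limit from both sides. But a multiple of the power \<open>s\<close> of \<phi> has boundary
  values whose arguments differ by \<open>2 * s * pi\<close>, and \<open>s\<close> lies strictly
  between -1 and 0.\<close>

lemma no_gap:
  assumes \<Lambda>c: "\<And>u. u \<in> ball 0 R \<Longrightarrow> u \<notin> \<real>\<^sub>\<le>\<^sub>0 \<Longrightarrow> \<Lambda> u = u powr of_real s * c0"
    and gap: "\<And>\<epsilon>. \<epsilon> > 0 \<Longrightarrow> \<exists>x r N. 1 < x \<and> x < 1 + \<epsilon> \<and> r > 0 \<and>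
      (\<forall>z. dist z (of_real x) < r \<longrightarrow> Im z \<noteq> 0 \<longrightarrow> norm ((d ^^ N) z) \<le> 1 / 2)"
  shows False
proof -
  have c0: "c0 \<noteq> 0" using constant_nonzero[OF \<Lambda>c] .
  obtain r where r: "0 < r" "r < e" "\<And>z. z \<in> cball 1 r \<Longrightarrow> \<phi> z \<in> ball 0 R"
    by (rule small_radius) (rule that)
  obtain x r1 N where x: "1 < x" "x < 1 + r" "r1 > 0"
      and N: "\<And>z. dist z (of_real x) < r1 \<Longrightarrow> Im z \<noteq> 0 \<Longrightarrow> norm ((d ^^ N) z) \<le> 1 / 2"
    using gap[OF r(1)] by blast
  define r2 where "r2 = min r1 (min (x - 1) (1 + r - x))"
  have r2: "0 < r2" "r2 \<le> r1" "r2 \<le> x - 1" "r2 \<le> 1 + r - x" using x by (auto simp: r2_def)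
  \<comment> \<open>The gap point \<open>x\<close> itself may be bad. The interval consists of gap
    points in the chart, is uncountable, and so contains a point that is not bad.\<close>
  have "uncountable {x<..<x + r2}" using r2 by (simp add: uncountable_open_interval)
  then have "uncountable (of_real ` {x<..<x + r2} :: complex set)"
    using countable_image_inj_on[of of_real "{x<..<x + r2}"] by (auto simp: inj_on_def)
  then have "\<not> of_real ` {x<..<x + r2} \<subseteq> bad N" proof (intro notI)
    assume "of_real ` {x<..<x + r2} \<subseteq> bad N" "uncountable (of_real ` {x<..<x + r2} :: complex set)"
    then show False using countable_subset[OF _ countable_bad] by blast
  qed
  then obtain w where "w \<in> of_real ` {x<..<x + r2}" "w \<notin> bad N" by blast
  then obtain y where y: "x < y" "y < x + r2" "of_real y \<notin> bad N" by auto
  have y1: "1 < y" "y < 1 + r" using y x r2 by auto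
  define M where "M z = (\<Prod>k<N. f ((d ^^ k) z)) * G ((d ^^ N) z)" for z
  \<comment> \<open>Approaches \<open>y\<close> from above for \<sigma> = 1 and from below for
    \<sigma> = -1.\<close>
  define zs where "zs \<sigma> n = Complex y (\<sigma> / real (Suc n))" for \<sigma> n
  have zs_lim: "zs \<sigma> \<longlonglongrightarrow> of_real y" for \<sigma>
  proof -
    have "(\<lambda>n. \<sigma> / real (Suc n)) \<longlonglongrightarrow> 0" by (rule LIMSEQ_Suc[OF lim_const_over_n])
    then have "(\<lambda>n. Complex y (\<sigma> / real (Suc n))) \<longlonglongrightarrow> Complex y 0"
      by (intro tendsto_Complex tendsto_const)
    then show ?thesis by (simp add: zs_def[abs_def] complex_of_real_def)
  qed
  have zs_Im: "Im (zs \<sigma> n) \<noteq> 0" if "\<sigma> \<noteq> 0" for \<sigma> n using that by (simp add: zs_def)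
  \<comment> \<open>The bound is known only off the real axis. Being a closed condition it passes to
    \<open>y\<close>, and 1/2 leaves room inside the unit disc, where \<open>G\<close> is
    continuous.\<close>
  have half: "norm ((d ^^ N) (of_real y)) \<le> 1 / 2"
  proof (rule Lim_norm_ubound[of sequentially])
    show "(\<lambda>n. (d ^^ N) (zs 1 n)) \<longlonglongrightarrow> (d ^^ N) (of_real y)"
      using isCont_tendsto_compose[OF isCont_funpow[OF y(3), of N] zs_lim] by simp
    have "eventually (\<lambda>n. dist (zs 1 n) (of_real y) < x + r2 - y) sequentially"
      using zs_lim by (rule tendstoD) (use y in simp)
    then show "eventually (\<lambda>n. norm ((d ^^ N) (zs 1 n)) \<le> 1 / 2) sequentially"
    proof eventually_elim
      case (elim n)
      have "dist (zs 1 n) (of_real x) \<le> dist (zs 1 n) (of_real y) + dist (of_real y :: complex) (of_real x)"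
        by (rule dist_triangle)
      also have "\<dots> < r1" using elim y r2 by (simp add: dist_of_real) (simp add: dist_real_def)
      finally show ?case by (rule N) (simp add: zs_Im)
    qed
  qed simp
  have Mcont: "isCont M (of_real y)"
  proof -
    have fk: "isCont (\<lambda>z. f ((d ^^ k) z)) (of_real y)" if "k < N" for k
    proof -
      have 1: "isCont (d ^^ k) (of_real y)" by (rule isCont_funpow[OF y(3)]) (use that in simp)
      have 2: "isCont f ((d ^^ k) (of_real y))"
        by (rule isCont_off_Z[OF f_hol not_bad[OF y(3)]]) (use that in simp)
      show ?thesis by (rule isCont_o2[OF 1 2])
    qed
    have "(d ^^ N) (of_real y) \<in> ball 0 1" using half by simp
    then have "(d ^^ N) (of_real y) \<in> slit c" using ball_subset_slit[OF c] by blast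
    then have "isCont G ((d ^^ N) (of_real y))"
      using holomorphic_on_imp_continuous_on[OF G_hol] continuous_on_eq_continuous_at[OF open_slit]
      by blast
    moreover have "isCont (d ^^ N) (of_real y)" by (rule isCont_funpow[OF y(3)]) simp
    ultimately have Gk: "isCont (\<lambda>z. G ((d ^^ N) z)) (of_real y)"
      by (simp only: isCont_o2)
    have "n \<le> N \<Longrightarrow> isCont (\<lambda>z. \<Prod>k<n. f ((d ^^ k) z)) (of_real y)" for n
    proof (induction n)
      case (Suc n)
      then have "isCont (\<lambda>z. (\<Prod>k<n. f ((d ^^ k) z)) * f ((d ^^ n) z)) (of_real y)"
        using fk[of n] by (intro isCont_mult) simp_all
      then show ?case by (simp only: prod.lessThan_Suc)
    qed simp
    from isCont_mult[OF this[OF order_refl] Gk] show ?thesis by (simp only: M_def[abs_def])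
  qed
  have yb: "of_real y \<in> ball (1 :: complex) e" "of_real y \<in> cball (1 :: complex) r"
    using y1 r by (auto simp: dist_1_of_real)
  have cont_y: "isCont h (of_real y)" if "h holomorphic_on ball 1 e" for h
    using holomorphic_on_imp_continuous_on[OF that] yb by (simp add: continuous_on_eq_continuous_at del: mem_ball)
  have "of_real y \<notin> slit c" using y1 by (simp add: slit_def)
  then have "\<phi> (of_real y) \<in> \<real>\<^sub>\<le>\<^sub>0" using \<phi>_slit[OF yb(1)] by blast
  moreover have "\<phi> (of_real y) \<noteq> 0"
    using \<phi>_\<rho>[OF yb(1)] \<rho>_pos[OF yb(1)] y1 by auto
  moreover define v where "v = - Re (\<phi> (of_real y))"
  ultimately have v: "v > 0" "\<phi> (of_real y) = of_real (- v)"
    by (auto simp: complex_nonpos_Reals_iff complex_eq_iff)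
  have lim_eq: "exp (of_real s * (of_real (ln v) - \<i> * of_real (\<sigma> * pi))) * c0 = M (of_real y) * H (of_real y)"
    if \<sigma>: "\<sigma> = 1 \<or> \<sigma> = - 1" for \<sigma> :: real
  proof -
    \<comment> \<open>\<phi> tends to the negative number \<open>- v\<close>, where
      \<open>Ln\<close> jumps. Passing to \<open>- \<phi>\<close> makes the logarithm continuous and
      shows the jump as an explicit summand with the sign of \<sigma>.\<close>
    define E where "E n = exp (of_real s * (Ln (- \<phi> (zs \<sigma> n)) - \<i> * of_real (\<sigma> * pi))) * c0" for n
    have ev: "eventually (\<lambda>n. zs \<sigma> n \<in> ball 1 r) sequentially"
    proof -
      have "of_real y \<in> ball (1 :: complex) r"
        using y1 by (simp add: dist_1_of_real)
      then show ?thesis using topological_tendstoD[OF zs_lim open_ball] by blast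
    qed
    have "(\<lambda>n. M (zs \<sigma> n) * H (zs \<sigma> n)) \<longlonglongrightarrow> M (of_real y) * H (of_real y)"
      by (intro tendsto_mult isCont_tendsto_compose[OF Mcont zs_lim] isCont_tendsto_compose[OF cont_y[OF H_hol] zs_lim])
    moreover have "eventually (\<lambda>n. M (zs \<sigma> n) * H (zs \<sigma> n) = E n) sequentially"
      using ev
    proof eventually_elim
      case (elim n)
      have z: "zs \<sigma> n \<in> ball 1 e" "zs \<sigma> n \<in> cball 1 r" "zs \<sigma> n \<in> slit c"
        using elim r zs_Im[of \<sigma> n] \<sigma> by (auto simp: slit_def)
      have "M (zs \<sigma> n) = G (zs \<sigma> n)" using G_iterate[OF z(3), of N] by (simp add: M_def)
      then have "M (zs \<sigma> n) * H (zs \<sigma> n) = \<phi> (zs \<sigma> n) powr of_real s * c0"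
        using G_eq_on_ball[OF \<Lambda>c z(1,3) r(3)[OF z(2)]] by simp
      moreover have "\<phi> (zs \<sigma> n) \<noteq> 0" using \<phi>_slit[OF z(1)] z(3) by auto
      moreover have "Ln (\<phi> (zs \<sigma> n)) = Ln (- \<phi> (zs \<sigma> n)) - \<i> * of_real (\<sigma> * pi)"
      proof (cases "\<sigma> = 1")
        case True
        then have "Im (\<phi> (zs \<sigma> n)) < 0" using Im_\<phi>_neg[OF z(1)] by (simp add: zs_def)
        then show ?thesis using Ln_minus[of "\<phi> (zs \<sigma> n)"] True \<open>\<phi> (zs \<sigma> n) \<noteq> 0\<close> by simp
      next
        case False
        then have "\<sigma> = - 1" using \<sigma> by simp
        then have "Im (\<phi> (zs \<sigma> n)) > 0" using Im_\<phi>_pos[OF z(1)] by (simp add: zs_def)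
        then show ?thesis using Ln_minus[of "\<phi> (zs \<sigma> n)"] \<open>\<sigma> = - 1\<close> \<open>\<phi> (zs \<sigma> n) \<noteq> 0\<close> by simp
      qed
      ultimately show ?case by (simp add: powr_def E_def)
    qed
    ultimately have E1: "E \<longlonglongrightarrow> M (of_real y) * H (of_real y)"
      by (rule Lim_transform_eventually)
    have "(\<lambda>n. - \<phi> (zs \<sigma> n)) \<longlonglongrightarrow> - \<phi> (of_real y)"
      by (intro tendsto_minus isCont_tendsto_compose[OF cont_y[OF \<phi>_hol] zs_lim])
    then have "(\<lambda>n. - \<phi> (zs \<sigma> n)) \<longlonglongrightarrow> of_real v" using v by simp
    then have "(\<lambda>n. Ln (- \<phi> (zs \<sigma> n))) \<longlonglongrightarrow> of_real (ln v)" using v(1) by (rule tendsto_Ln_of_real)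
    then have "E \<longlonglongrightarrow> exp (of_real s * (of_real (ln v) - \<i> * of_real (\<sigma> * pi))) * c0"
      unfolding E_def by (intro tendsto_intros)
    from LIMSEQ_unique[OF this E1] show ?thesis .
  qed
  have "exp (of_real s * (of_real (ln v) - \<i> * of_real (1 * pi)))
      = exp (of_real s * (of_real (ln v) - \<i> * of_real (- 1 * pi)))"
  proof -
    have "exp (of_real s * (of_real (ln v) - \<i> * of_real (1 * pi))) * c0
        = exp (of_real s * (of_real (ln v) - \<i> * of_real (- 1 * pi))) * c0"
      using lim_eq[of 1] lim_eq[of "- 1"] by (metis (no_types))
    then show ?thesis by (simp only: mult_right_cancel[OF c0])
  qed
  then have "Im (exp (of_real s * (of_real (ln v) - \<i> * of_real (1 * pi))))
      = Im (exp (of_real s * (of_real (ln v) - \<i> * of_real (- 1 * pi))))" by simp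
  then have "sin (- (s * pi)) = sin (s * pi)" unfolding Im_exp by simp
  then have "sin (- (s * pi)) = 0" by simp
  moreover have "sin (- (s * pi)) > 0"
    using s by (intro sin_gt_zero) (auto simp: mult_less_0_iff intro: mult_strict_right_mono[of "- s" 1 pi, simplified])
  ultimately show False by simp
qed

end

section \<open>Cantor Julia sets\<close>

lemma middle_thirds_stage_bounds: "x \<in> middle_thirds_stage n \<Longrightarrow> 0 \<le> x \<and> x \<le> 1"
proof (induction n arbitrary: x)
  case (Suc n)
  then consider y where "y \<in> middle_thirds_stage n" "x = y / 3"
    | y where "y \<in> middle_thirds_stage n" "x = 2 / 3 + y / 3"
    by auto
  then show ?case by cases (use Suc.IH in fastforce)+
qed simp

text \<open>No point of a later stage lies strictly between 1/3 and 2/3, so an interval stays in one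
  of the two copies and can be rescaled by 3.\<close>

lemma middle_thirds_stage_interval:
  assumes "{a..b} \<subseteq> middle_thirds_stage n" "a \<le> b"
  shows "b - a \<le> 1 / 3 ^ n"
  using assms
proof (induction n arbitrary: a b)
  case (Suc n)
  have pt: "(\<exists>y\<in>middle_thirds_stage n. x = y / 3) \<or> (\<exists>y\<in>middle_thirds_stage n. x = 2 / 3 + y / 3)"
    if "x \<in> {a..b}" for x
    using that Suc.prems(1) by auto
  have split: "x \<le> 1 / 3 \<or> 2 / 3 \<le> x" if "x \<in> {a..b}" for x
    using pt[OF that] middle_thirds_stage_bounds by fastforce
  show ?case
  proof (cases "a \<le> 1 / 3")
    case True
    have b: "b \<le> 1 / 3"
    proof (rule ccontr)
      assume "\<not> b \<le> 1 / 3"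
      then show False using split[of b] split[of "1 / 2"] True Suc.prems(2) by (cases "b \<le> 1 / 2") auto
    qed
    have "{3 * a..3 * b} \<subseteq> middle_thirds_stage n"
    proof
      fix y assume "y \<in> {3 * a..3 * b}"
      then have x: "y / 3 \<in> {a..b}" by auto
      then show "y \<in> middle_thirds_stage n"
        using pt[OF x] b middle_thirds_stage_bounds by fastforce
    qed
    then have "3 * b - 3 * a \<le> 1 / 3 ^ n" using Suc.IH Suc.prems(2) by simp
    then show ?thesis by simp
  next
    case False
    have a: "a \<ge> 2 / 3" using split[of a] Suc.prems(2) False by auto
    have "{3 * a - 2..3 * b - 2} \<subseteq> middle_thirds_stage n"
    proof
      fix y assume "y \<in> {3 * a - 2..3 * b - 2}"
      then have x: "2 / 3 + y / 3 \<in> {a..b}" by (auto simp: field_simps)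
      have "y \<in> middle_thirds_stage n" if "w \<in> middle_thirds_stage n" "2 / 3 + y / 3 = w / 3" for w
        using that x a middle_thirds_stage_bounds[OF that(1)] by (auto simp: field_simps)
      then show "y \<in> middle_thirds_stage n"
        using pt[OF x] by (auto simp: field_simps)
    qed
    then have "(3 * b - 2) - (3 * a - 2) \<le> 1 / 3 ^ n" using Suc.prems(2) by (intro Suc.IH) auto
    then show ?thesis by simp
  qed
qed auto

lemma connected_in_middle_thirds_set:
  assumes C: "Topological_Spaces.connected C" "C \<subseteq> middle_thirds_set" and xy: "x \<in> C" "y \<in> C"
  shows "x = y"
proof -
  have *: "y \<le> x" if xy: "x \<in> C" "y \<in> C" for x y
  proof (rule ccontr)
    assume "\<not> y \<le> x"
    then have lt: "x < y" by simp
    then obtain n where n: "(1 / 3) ^ n < y - x"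
      using real_arch_pow_inv[of "y - x" "1 / 3"] by auto
    have "{x..y} \<subseteq> C" using C(1) xy by (rule connected_contains_Icc)
    then have "{x..y} \<subseteq> middle_thirds_stage n" using C(2) unfolding middle_thirds_set_def by blast
    then have "y - x \<le> 1 / 3 ^ n" using lt by (intro middle_thirds_stage_interval) auto
    then show False using n by (simp add: power_one_over)
  qed
  then show ?thesis using xy by (intro order_antisym) auto
qed

section \<open>Convergence at finite points of the Riemann sphere\<close>

lemma continuous_on_stereographic: "continuous_on UNIV (\<lambda>z. inverse_stereographic (Finite z))"
proof -
  have "(norm z)\<^sup>2 + 1 \<noteq> 0" for z :: complex
    using zero_le_power2[of "norm z"] by linarith
  then show ?thesis by (auto intro!: continuous_intros)
qed

lemma tendsto_Finite:
  assumes "(g \<longlongrightarrow> z) F"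
  shows "((\<lambda>x. Finite (g x)) \<longlongrightarrow> Finite z) F"
proof -
  have "isCont (\<lambda>z. inverse_stereographic (Finite z)) z"
    using continuous_on_stereographic continuous_on_eq_continuous_at[OF open_UNIV] by blast
  then have "((\<lambda>x. inverse_stereographic (Finite (g x))) \<longlongrightarrow> inverse_stereographic (Finite z)) F"
    using assms by (rule isCont_tendsto_compose)
  then show ?thesis
    unfolding tendsto_iff dist_riemann_sphere_def .
qed

lemma continuous_on_Finite: "continuous_on S Finite"
  by (simp add: continuous_on_def tendsto_Finite)

text \<open>With \<open>t\<close> the squared modulus of \<open>w\<close>, the vertical coordinates
  alone differ by \<open>2 * t / (t + 1)\<close>, which increases with \<open>t\<close> and equals
  2/5 at \<open>t = 1/4\<close>.\<close>

lemma Finite_close_to_0: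
  assumes "dist (Finite w) (Finite 0) < 2 / 5"
  shows "norm w \<le> 1 / 2"
proof (rule ccontr)
  assume "\<not> norm w \<le> 1 / 2"
  then have "(1 / 2)\<^sup>2 \<le> (norm w)\<^sup>2" by (intro power_mono) auto
  then have w: "(norm w)\<^sup>2 \<ge> 1 / 4" by (simp add: power_divide)
  define t where "t = (norm w)\<^sup>2"
  have "dist ((t - 1) / (t + 1)) (- 1) \<le> dist (Finite w) (Finite 0)"
    using dist_snd_le[of "inverse_stereographic (Finite w)" "inverse_stereographic (Finite 0)"]
    by (simp add: dist_riemann_sphere_def t_def)
  moreover have "dist ((t - 1) / (t + 1)) (- 1) = 2 * t / (t + 1)"
    using w by (simp add: t_def[symmetric] dist_real_def field_simps)
  moreover have "2 * t / (t + 1) \<ge> 2 / 5" using w by (simp add: t_def[symmetric] field_simps)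
  ultimately show False using assms by simp
qed

text \<open>Projection from the pole \<open>(0, 1)\<close>, a left inverse of
  \<open>inverse_stereographic\<close> on finite points. It is the chart in which limits at finite
  points of the sphere are computed.\<close>

definition stereographic :: "complex \<times> real \<Rightarrow> complex" where
  "stereographic p = (1 / (1 - snd p)) *\<^sub>R fst p"

lemma stereographic_Finite: "stereographic (inverse_stereographic (Finite w)) = w"
proof -
  define t where "t = (norm w)\<^sup>2 + 1"
  have nz: "t \<noteq> 0" using zero_le_power2[of "norm w"] unfolding t_def by linarith
  have eq: "inverse_stereographic (Finite w) = ((2 / t) *\<^sub>R w, (t - 2) / t)"
    by (simp add: t_def)
  have "1 - (t - 2) / t = 2 / t" using nz by (simp add: field_simps)
  then have "stereographic (inverse_stereographic (Finite w)) = (1 / (2 / t)) *\<^sub>R ((2 / t) *\<^sub>R w)"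
    unfolding eq stereographic_def fst_conv snd_conv by (rule arg_cong)
  also have "\<dots> = w" using nz by simp
  finally show ?thesis .
qed

lemma near_Finite:
  "((\<lambda>u. stereographic (inverse_stereographic u)) \<longlongrightarrow> z) (at (Finite z))"
  "eventually (\<lambda>u. u = Finite (stereographic (inverse_stereographic u))) (at (Finite z))"
proof -
  have lim: "(inverse_stereographic \<longlongrightarrow> inverse_stereographic (Finite z)) (at (Finite z))"
    unfolding tendsto_iff by (auto simp: eventually_at dist_riemann_sphere_def)
  have nz: "(norm z)\<^sup>2 + 1 > 0" using zero_le_power2[of "norm z"] by linarith
  have ne: "1 - snd (inverse_stereographic (Finite z)) \<noteq> 0"
    using nz by (simp add: field_simps)
  have "((\<lambda>u. stereographic (inverse_stereographic u)) \<longlongrightarrow> stereographic (inverse_stereographic (Finite z))) (at (Finite z))"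
    unfolding stereographic_def by (intro tendsto_intros lim ne)
  then show "((\<lambda>u. stereographic (inverse_stereographic u)) \<longlongrightarrow> z) (at (Finite z))"
    by (simp only: stereographic_Finite)
  have "((\<lambda>u. 1 - snd (inverse_stereographic u)) \<longlongrightarrow> 1 - snd (inverse_stereographic (Finite z))) (at (Finite z))"
    by (intro tendsto_intros lim)
  then have "eventually (\<lambda>u. 1 - snd (inverse_stereographic u) \<noteq> 0) (at (Finite z))"
    using ne by (rule tendsto_imp_eventually_ne)
  then show "eventually (\<lambda>u. u = Finite (stereographic (inverse_stereographic u))) (at (Finite z))"
  proof eventually_elim
    case (elim u)
    then show ?case by (cases u) (simp_all del: inverse_stereographic.simps(1) add: stereographic_Finite)
  qed
qed

lemma at_Finite_nontrivial: "at (Finite z) \<noteq> bot"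
proof
  assume "at (Finite z) = bot"
  then have "open {Finite z}" by (simp add: at_eq_bot_iff)
  then have "open (Finite -` {Finite z})" using continuous_on_Finite by (intro open_vimage)
  moreover have "Finite -` {Finite z} = {z}" by auto
  ultimately show False using not_open_singleton[of z] by simp
qed

text \<open>Near \<open>Finite z\<close> all points are finite, so the limit that defines
  \<open>sphere_map\<close> is an ordinary limit in the chart.\<close>

lemma sphere_map_Finite:
  assumes "isCont h z"
  shows "sphere_map h (Finite z) = Finite (h z)"
  unfolding sphere_map_def
proof (rule tendsto_Lim[OF at_Finite_nontrivial])
  have "((\<lambda>u. Finite (h (stereographic (inverse_stereographic u)))) \<longlongrightarrow> Finite (h z)) (at (Finite z))"
    by (intro tendsto_Finite isCont_tendsto_compose[OF assms] near_Finite)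
  moreover have "eventually (\<lambda>u. Finite (h (stereographic (inverse_stereographic u)))
      = (case u of Finite z \<Rightarrow> Finite (h z) | Infinity \<Rightarrow> Infinity)) (at (Finite z))"
    using near_Finite(2)
  proof eventually_elim
    case (elim u)
    then show ?case
      by (cases u) (simp_all del: inverse_stereographic.simps(1) add: stereographic_Finite)
  qed
  ultimately show "((\<lambda>u. case u of Finite z \<Rightarrow> Finite (h z) | Infinity \<Rightarrow> Infinity) \<longlongrightarrow> Finite (h z)) (at (Finite z))"
    by (rule Lim_transform_eventually)
qed

text \<open>The homeomorphism would map the segment to a connected subset of the middle-thirds set,
  hence to one point, against injectivity.\<close>

lemma cantor_set_no_segment:
  fixes J :: "riemann_sphere set"
  assumes J: "cantor_set J" and ab: "a < b"
  shows "\<exists>x\<in>{a..b}. Finite (of_real x) \<notin> J"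
proof (rule ccontr)
  assume "\<not> (\<exists>x\<in>{a..b}. Finite (of_real x) \<notin> J)"
  then have sub: "(\<lambda>x. Finite (of_real x)) ` {a..b} \<subseteq> J" by auto
  obtain h k where hk: "homeomorphism J middle_thirds_set h k"
    using J unfolding cantor_set_def homeomorphic_def by blast
  define C where "C = h ` (\<lambda>x. Finite (of_real x)) ` {a..b}"
  have "continuous_on {a..b} (\<lambda>x :: real. Finite (of_real x))"
    by (rule continuous_on_compose2[OF continuous_on_Finite[of UNIV]]) (auto intro!: continuous_intros)
  then have "Topological_Spaces.connected ((\<lambda>x. Finite (of_real x)) ` {a..b})"
    by (rule connected_continuous_image) simp
  then have "Topological_Spaces.connected C"
    unfolding C_def
    by (rule connected_continuous_image[OF continuous_on_subset[OF homeomorphism_cont1[OF hk] sub]])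
  moreover have "C \<subseteq> middle_thirds_set"
    unfolding C_def using image_mono[OF sub, of h] homeomorphism_image1[OF hk] by (simp only:)
  moreover have "h (Finite (of_real a)) \<in> C" unfolding C_def by (intro imageI) (use ab in simp)
  moreover have "h (Finite (of_real b)) \<in> C" unfolding C_def by (intro imageI) (use ab in simp)
  ultimately have eq: "h (Finite (of_real a)) = h (Finite (of_real b))"
    by (rule connected_in_middle_thirds_set)
  have "Finite (of_real a) \<in> J" by (rule subsetD[OF sub]) (use ab in simp)
  then have "k (h (Finite (of_real a))) = Finite (of_real a)" by (rule homeomorphism_apply1[OF hk])
  moreover have "Finite (of_real b) \<in> J" by (rule subsetD[OF sub]) (use ab in simp)
  then have "k (h (Finite (of_real b))) = Finite (of_real b)" by (rule homeomorphism_apply1[OF hk])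
  ultimately show False using ab eq by simp
qed

section \<open>Fatou points on the cut, and the two results on \<omega>\<close>

context green_dynamics
begin

lemma funpow_sphere_map:
  assumes "z \<in> slit c"
  shows "(sphere_map d ^^ n) (Finite z) = Finite ((d ^^ n) z)"
proof (induction n)
  case (Suc n)
  have "isCont d ((d ^^ n) z)"
    using holomorphic_on_imp_continuous_on[OF d_hol_slit] continuous_on_eq_continuous_at[OF open_slit]
      funpow_d_slit[OF assms] by blast
  then show ?case using Suc by (simp add: sphere_map_Finite)
qed simp

text \<open>Around a Fatou point \<open>x\<close> of the cut some subsequence of iterates converges
  uniformly on a disc. At nonreal points, which lie in the slit plane, its limit can only be 0;
  uniformity then provides one iterate that brings all of them close to 0.\<close>

lemma gap:
  assumes J: "cantor_set (julia_set (sphere_map d))" and \<epsilon>: "\<epsilon> > 0"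
  shows "\<exists>x r N. 1 < x \<and> x < 1 + \<epsilon> \<and> r > 0 \<and>
      (\<forall>z. dist z (of_real x) < r \<longrightarrow> Im z \<noteq> 0 \<longrightarrow> norm ((d ^^ N) z) \<le> 1 / 2)"
proof -
  have "1 + \<epsilon> / 3 < 1 + \<epsilon> / 2" using \<epsilon> by simp
  then obtain x where x: "x \<in> {1 + \<epsilon> / 3..1 + \<epsilon> / 2}" "Finite (of_real x) \<notin> julia_set (sphere_map d)"
    using cantor_set_no_segment[OF J] by blast
  then have "Finite (of_real x) \<in> fatou_set (sphere_map d)" by (simp add: julia_set_def)
  then obtain U where U: "open U" "Finite (of_real x) \<in> U"
      "normal_family_on U (range (\<lambda>n. sphere_map d ^^ n))"
    unfolding fatou_set_def by blast
  have "open (Finite -` U)" using U(1) continuous_on_Finite by (rule open_vimage)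
  moreover have "of_real x \<in> Finite -` U" using U(2) by simp
  ultimately obtain \<rho> where \<rho>: "\<rho> > 0" "cball (of_real x) \<rho> \<subseteq> Finite -` U"
    using open_contains_cball_eq[of "Finite -` U"] by blast
  define K where "K = Finite ` cball (of_real x) \<rho>"
  have K: "compact K"
    unfolding K_def by (rule compact_continuous_image[OF continuous_on_Finite compact_cball])
  have KU: "K \<subseteq> U" unfolding K_def using \<rho>(2) by (simp only: image_subset_iff_subset_vimage)
  have "\<exists>(r :: nat \<Rightarrow> nat) g. strict_mono r \<and> (\<forall>K. compact K \<and> K \<subseteq> U \<longrightarrow>
      uniform_limit K ((\<lambda>n. sphere_map d ^^ n) \<circ> r) g sequentially)"
    by (rule U(3)[unfolded normal_family_on_def, THEN spec, THEN mp, OF order_refl])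
  then obtain r :: "nat \<Rightarrow> nat" and g where r: "strict_mono r"
    and r2: "\<forall>K. compact K \<and> K \<subseteq> U \<longrightarrow> uniform_limit K ((\<lambda>n. sphere_map d ^^ n) \<circ> r) g sequentially"
    by (elim exE conjE)
  have ul: "uniform_limit K ((\<lambda>n. sphere_map d ^^ n) \<circ> r) g sequentially"
    by (rule r2[THEN spec, THEN mp, OF conjI[OF K KU]])
  have g0: "g (Finite z) = Finite 0" if z: "z \<in> cball (of_real x) \<rho>" "Im z \<noteq> 0" for z
  proof -
    have "Finite z \<in> K" using z by (simp add: K_def)
    then have "(\<lambda>n. ((\<lambda>n. sphere_map d ^^ n) \<circ> r) n (Finite z)) \<longlonglongrightarrow> g (Finite z)"
      using ul by (rule tendsto_uniform_limitI[rotated])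
    moreover have sl: "z \<in> slit c" using z by (simp add: slit_def)
    ultimately have 1: "(\<lambda>n. Finite ((d ^^ r n) z)) \<longlonglongrightarrow> g (Finite z)"
      by (simp add: funpow_sphere_map)
    have "(\<lambda>n. (d ^^ r n) z) \<longlonglongrightarrow> 0"
      using LIMSEQ_subseq_LIMSEQ[OF orbit_tendsto_0[OF sl] r] by (simp add: o_def)
    then have "(\<lambda>n. Finite ((d ^^ r n) z)) \<longlonglongrightarrow> Finite 0" by (rule tendsto_Finite)
    from LIMSEQ_unique[OF 1 this] show ?thesis .
  qed
  have "eventually (\<lambda>n. \<forall>y\<in>K. dist (((\<lambda>n. sphere_map d ^^ n) \<circ> r) n y) (g y) < 2 / 5) sequentially"
    using ul by (rule uniform_limitD) simp
  then obtain n where n: "\<And>y. y \<in> K \<Longrightarrow> dist ((sphere_map d ^^ r n) y) (g y) < 2 / 5"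
    unfolding eventually_sequentially by auto
  have "norm ((d ^^ r n) z) \<le> 1 / 2" if z: "dist z (of_real x) < \<rho>" "Im z \<noteq> 0" for z
  proof (rule Finite_close_to_0)
    have zb: "z \<in> cball (of_real x) \<rho>" using z(1) by (simp add: dist_commute)
    moreover have "z \<in> slit c" using z by (simp add: slit_def)
    ultimately show "dist (Finite ((d ^^ r n) z)) (Finite 0) < 2 / 5"
      using n[of "Finite z"] g0[OF zb z(2)] by (simp add: funpow_sphere_map K_def)
  qed
  then show ?thesis using x(1) \<epsilon> \<rho>(1) by (intro exI[of _ x] exI[of _ \<rho>] exI[of _ "r n"]) auto
qed

theorem omega_exists:
  assumes "\<And>z. z \<in> slit 1 \<Longrightarrow> g z = G z"
  shows "\<exists>\<omega>. \<omega> holomorphic_on strip \<tau> \<and> (\<forall>z\<in>strip \<tau>. \<omega> (z + 1) = \<omega> z) \<and>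
    singular_expansion g (2 * (s + 1)) \<tau> \<omega>"
proof -
  obtain \<phi> H \<rho> \<Phi> e R where "green_chart d f G0 c s \<tau> Z \<phi> H \<rho> \<Phi> e R"
    using chart_exists by blast
  then interpret green_chart d f G0 c s \<tau> Z \<phi> H \<rho> \<Phi> e R .
  obtain \<omega> where "\<omega> holomorphic_on strip \<tau>" "\<And>w. w \<in> strip \<tau> \<Longrightarrow> \<omega> (w + 1) = \<omega> w"
    "\<And>u. u \<in> ball 0 R \<Longrightarrow> u \<notin> \<real>\<^sub>\<le>\<^sub>0 \<Longrightarrow> \<Lambda> u = u powr of_real s * \<omega> (Ln u / of_real (ln \<tau>))"
    by (rule \<omega>_exists) (rule that)
  then show ?thesis using expansion[of \<omega> g] assms by blast
qed

theorem omega_not_constant: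
  assumes "\<And>z. z \<in> slit 1 \<Longrightarrow> g z = G z" and "singular_expansion g (2 * (s + 1)) \<tau> \<omega>"
    and "cantor_set (julia_set (sphere_map d))"
  shows "\<not> \<omega> constant_on strip \<tau>"
proof
  assume "\<omega> constant_on strip \<tau>"
  then obtain c0 where c0: "\<And>w. w \<in> strip \<tau> \<Longrightarrow> \<omega> w = c0" by (auto simp: constant_on_def)
  obtain \<phi> H \<rho> \<Phi> e R where "green_chart d f G0 c s \<tau> Z \<phi> H \<rho> \<Phi> e R"
    using chart_exists by blast
  then interpret green_chart d f G0 c s \<tau> Z \<phi> H \<rho> \<Phi> e R .
  show False
    using no_gap[OF expansion_constant[OF assms(2,1) c0] gap[OF assms(3)]] .
qed

end

section \<open>Fourier series of periodic holomorphic functions\<close>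

lemma open_Im_strip: "open {z. \<bar>Im z\<bar> < a}"
  by (intro open_Collect_less continuous_intros)

lemma convex_Im_strip: "convex {z. \<bar>Im z\<bar> < a}"
proof -
  have "{z. \<bar>Im z\<bar> < a} = {z. Im z < a} \<inter> {z. Im z > - a}" by (auto simp: abs_less_iff)
  then show ?thesis by (simp add: convex_Int convex_halfspace_Im_lt convex_halfspace_Im_gt)
qed

lemma deriv_periodic:
  assumes hol: "h holomorphic_on {z. \<bar>Im z\<bar> < a}"
    and per: "\<And>z. \<bar>Im z\<bar> < a \<Longrightarrow> h (z + 1) = h z" and z: "\<bar>Im z\<bar> < a"
  shows "deriv h (z + 1) = deriv h z"
proof -
  have "((\<lambda>x. h (x + 1)) has_field_derivative deriv h (z + 1)) (at z)"
    using holomorphic_derivI[OF hol open_Im_strip, of "z + 1"] z DERIV_shift by fastforce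
  then have "(h has_field_derivative deriv h (z + 1)) (at z)"
    by (rule has_field_derivative_transform_within_open[OF _ open_Im_strip[of a]]) (use z per in auto)
  then show ?thesis by (simp add: DERIV_imp_deriv)
qed

text \<open>For a primitive \<open>F\<close>, the difference \<open>F (x + 1) - F x\<close> has
  derivative 0. The integral over a horizontal period at any height is this one constant.\<close>

lemma integral_period_shift:
  assumes hol: "h holomorphic_on {z. \<bar>Im z\<bar> < a}"
    and per: "\<And>z. \<bar>Im z\<bar> < a \<Longrightarrow> h (z + 1) = h z" and y: "\<bar>y\<bar> < a"
  shows "integral {0..1} (\<lambda>t. h (of_real t)) = integral {0..1} (\<lambda>t. h (of_real t + \<i> * of_real y))"
proof -
  define S where "S = {z. \<bar>Im z\<bar> < a}"
  have S: "convex S" "open S" "h holomorphic_on S"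
    by (simp_all add: S_def convex_Im_strip open_Im_strip hol)
  obtain F where F: "\<And>x. x \<in> S \<Longrightarrow> (F has_field_derivative h x) (at x within S)"
    by (rule holomorphic_convex_primitive'[OF S]) (rule that)
  have F': "(F has_field_derivative h x) (at x)" if "x \<in> S" for x
    using F[OF that] at_within_open[OF that] open_Im_strip by (simp add: S_def)
  have "\<exists>C. \<forall>x\<in>S. F (x + 1) - F x = C"
  proof (rule has_field_derivative_zero_constant)
    fix x assume x: "x \<in> S"
    then have "x + 1 \<in> S" by (simp add: S_def)
    then have "((\<lambda>x. F (x + 1)) has_field_derivative h (x + 1)) (at x)"
      using F' DERIV_shift by blast
    then have "((\<lambda>x. F (x + 1) - F x) has_field_derivative h (x + 1) - h x) (at x)"
      by (intro DERIV_diff F' x)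
    then show "((\<lambda>x. F (x + 1) - F x) has_field_derivative 0) (at x within S)"
      using per x by (simp add: S_def has_field_derivative_at_within)
  qed (simp add: S_def convex_Im_strip)
  then obtain C where C: "\<And>x. x \<in> S \<Longrightarrow> F (x + 1) - F x = C" by blast
  have int: "integral {0..1} (\<lambda>t. h (of_real t + \<i> * of_real y)) = C" if y: "\<bar>y\<bar> < a" for y
  proof -
    have "((\<lambda>t. h (of_real t + \<i> * of_real y)) has_integral
        F (of_real 1 + \<i> * of_real y) - F (of_real 0 + \<i> * of_real y)) {0..1}"
    proof (rule fundamental_theorem_of_calculus)
      fix t :: real
      have "((\<lambda>t. of_real t + \<i> * of_real y) has_vector_derivative 1) (at t within {0..1})"
        by (auto intro!: derivative_eq_intros simp: has_vector_derivative_def scaleR_conv_of_real)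
      then have "((F \<circ> (\<lambda>t. of_real t + \<i> * of_real y)) has_vector_derivative
          1 * h (of_real t + \<i> * of_real y)) (at t within {0..1})"
        by (rule field_vector_diff_chain_within)
           (use F'[of "of_real t + \<i> * of_real y"] y in \<open>simp add: S_def has_field_derivative_at_within\<close>)
      then show "((\<lambda>t. F (of_real t + \<i> * of_real y)) has_vector_derivative
          h (of_real t + \<i> * of_real y)) (at t within {0..1})" by (simp add: o_def)
    qed simp
    moreover have "F (of_real 1 + \<i> * of_real y) - F (of_real 0 + \<i> * of_real y) = C"
      using C[of "\<i> * of_real y"] y by (simp add: S_def add.commute)
    ultimately show ?thesis by (simp add: integral_unique)
  qed
  have "integral {0..1} (\<lambda>t. h (of_real t)) = C" using int[of 0] y by simp
  then show ?thesis using int[OF y] by simp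
qed

text \<open>The path of integration is moved to the height at which the exponential factor is
  small.\<close>

lemma fourier_coefficient_decay:
  assumes hol: "h holomorphic_on {z. \<bar>Im z\<bar> < a}"
    and per: "\<And>z. \<bar>Im z\<bar> < a \<Longrightarrow> h (z + 1) = h z" and y: "0 \<le> y" "y < a"
  obtains K where "K \<ge> 0" "\<And>k. norm (fourier_coefficient h k) \<le> K * exp (- (2 * pi * y * \<bar>of_int k\<bar>))"
proof -
  obtain K where K: "\<And>w. \<bar>Im w\<bar> \<le> y \<Longrightarrow> norm (h w) \<le> K"
    using periodic_bounded[OF holomorphic_on_imp_continuous_on[OF hol] per y(2)] by blast
  have "norm (fourier_coefficient h k) \<le> K * exp (- (2 * pi * y * \<bar>of_int k\<bar>))" for k
  proof -
    define b where "b = - 2 * of_int k * of_real pi * \<i>"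
    define H where "H z = h z * exp (b * z)" for z
    \<comment> \<open>The exponential factor has modulus \<open>exp (2 * pi * k * v)\<close>, so the
      shift must go against the sign of \<open>k\<close>.\<close>
    define v where "v = (if k \<ge> 0 then - y else y)"
    have v: "\<bar>v\<bar> = y" "k * v = - (\<bar>of_int k\<bar> * y)" using y by (auto simp: v_def)
    have H_hol: "H holomorphic_on {z. \<bar>Im z\<bar> < a}"
      unfolding H_def by (intro holomorphic_intros hol)
    have ek: "exp b = 1"
      unfolding b_def exp_eq_1 by (auto intro!: exI[of _ "- k"])
    have H_per: "H (z + 1) = H z" if "\<bar>Im z\<bar> < a" for z
      using per[OF that] ek by (simp add: H_def distrib_left exp_add)
    have H_bound: "norm (H (of_real t + \<i> * of_real v)) \<le> K * exp (- (2 * pi * y * \<bar>of_int k\<bar>))" for t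
    proof -
      have "norm (exp (b * (of_real t + \<i> * of_real v))) = exp (2 * pi * (of_int k * v))"
        by (simp add: b_def mult_ac)
      also have "\<dots> = exp (- (2 * pi * y * \<bar>of_int k\<bar>))"
        unfolding v(2) by (simp add: mult_ac)
      finally have "norm (exp (b * (of_real t + \<i> * of_real v))) = exp (- (2 * pi * y * \<bar>of_int k\<bar>))" .
      then show ?thesis
        unfolding H_def norm_mult using K[of "of_real t + \<i> * of_real v"] v by (simp add: mult_right_mono)
    qed
    have "fourier_coefficient h k = integral {0..1} (\<lambda>t. H (of_real t))"
      by (simp add: fourier_coefficient_def H_def b_def)
    also have "\<dots> = integral {0..1} (\<lambda>t. H (of_real t + \<i> * of_real v))"
      by (rule integral_period_shift[OF H_hol H_per]) (use v y in auto)
    finally have eq: "fourier_coefficient h k = integral {0..1} (\<lambda>t. H (of_real t + \<i> * of_real v))" .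
    have cont: "continuous_on {0..1} (\<lambda>t. H (of_real t + \<i> * of_real v))"
      by (rule continuous_on_compose2[OF holomorphic_on_imp_continuous_on[OF H_hol]])
         (use v y in \<open>auto intro!: continuous_intros\<close>)
    have "norm (integral {0..1} (\<lambda>t. H (of_real t + \<i> * of_real v)))
        \<le> K * exp (- (2 * pi * y * \<bar>of_int k\<bar>)) * (1 - 0)"
      by (rule integral_bound) (use cont H_bound in auto)
    then show ?thesis using eq by simp
  qed
  moreover have "K \<ge> 0" using order_trans[OF norm_ge_zero K[of 0]] y by simp
  ultimately show ?thesis using that by blast
qed

lemma summable_on_int_geometric:
  fixes q :: real
  assumes "0 \<le> q" "q < 1"
  shows "(\<lambda>k :: int. q ^ nat \<bar>k\<bar>) summable_on UNIV"
proof -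
  have sn: "(\<lambda>n. q ^ n) summable_on UNIV"
  proof (rule norm_summable_imp_summable_on)
    have "norm q < 1" using assms by simp
    then show "summable (\<lambda>n. norm (q ^ n))"
      unfolding norm_power by (intro summable_geometric) simp
  qed
  have inj_int: "inj int" by (simp add: inj_on_def)
  have "((\<lambda>k :: int. q ^ nat \<bar>k\<bar>) \<circ> int) summable_on UNIV" using sn by (simp add: o_def)
  then have 1: "(\<lambda>k :: int. q ^ nat \<bar>k\<bar>) summable_on range int"
    by (rule summable_on_reindex[OF inj_int, THEN iffD2])
  have inj: "inj (\<lambda>n. - int n - 1)" by (auto simp: inj_on_def)
  have "(\<lambda>n. q * q ^ n) summable_on UNIV" by (intro summable_on_cmult_right sn)
  moreover have "(\<lambda>n. q * q ^ n) = (\<lambda>k :: int. q ^ nat \<bar>k\<bar>) \<circ> (\<lambda>n. - int n - 1)"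
  proof
    fix n
    have "nat \<bar>- int n - 1\<bar> = Suc n" by simp
    then show "q * q ^ n = ((\<lambda>k :: int. q ^ nat \<bar>k\<bar>) \<circ> (\<lambda>n. - int n - 1)) n"
      by (simp only: comp_apply power_Suc)
  qed
  ultimately have "((\<lambda>k :: int. q ^ nat \<bar>k\<bar>) \<circ> (\<lambda>n. - int n - 1)) summable_on UNIV" by simp
  then have 2: "(\<lambda>k :: int. q ^ nat \<bar>k\<bar>) summable_on range (\<lambda>n. - int n - 1)"
    by (rule summable_on_reindex[OF inj, THEN iffD2])
  have "range int \<union> range (\<lambda>n. - int n - 1) = UNIV"
  proof (intro equalityI subsetI UNIV_I)
    fix k :: int
    show "k \<in> range int \<union> range (\<lambda>n. - int n - 1)"
    proof (cases "k \<ge> 0")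
      case True
      then show ?thesis by (auto intro: image_eqI[of _ _ "nat k"])
    next
      case False
      then have "k = - int (nat (- k - 1)) - 1" by simp
      then show ?thesis by blast
    qed
  qed
  moreover have "range int \<inter> range (\<lambda>n. - int n - 1) = {}" by auto
  ultimately show ?thesis using summable_on_Un_disjoint[OF 1 2] by simp
qed

lemma exp_integral_01:
  "((\<lambda>t. exp (2 * of_int n * of_real pi * \<i> * of_real t)) has_integral (if n = 0 then 1 else 0)) {0..1 :: real}"
proof (cases "n = 0")
  case True
  have "((\<lambda>t :: real. 1 :: complex) has_integral (1 - 0) *\<^sub>R 1) {0..1}"
    using has_integral_const_real[of "1 :: complex" 0 1] by simp
  then show ?thesis using True by simp
next
  case False
  define c where "c = 2 * of_int n * of_real pi * \<i>"
  have c: "c \<noteq> 0" using False by (simp add: c_def)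
  have "((\<lambda>t. exp (c * of_real t)) has_integral exp (c * of_real 1) / c - exp (c * of_real 0) / c) {0..1 :: real}"
  proof (rule fundamental_theorem_of_calculus)
    fix t :: real
    have "((\<lambda>z. exp (c * z) / c) has_field_derivative exp (c * of_real t)) (at (of_real t))"
      using c by (auto intro!: derivative_eq_intros)
    moreover have "(complex_of_real has_vector_derivative 1) (at t within {0..1})"
      by (auto intro!: derivative_eq_intros simp: has_vector_derivative_def scaleR_conv_of_real)
    ultimately show "((\<lambda>t. exp (c * of_real t) / c) has_vector_derivative exp (c * of_real t)) (at t within {0..1})"
      using field_vector_diff_chain_within[of of_real 1 t "{0..1}" "\<lambda>z. exp (c * z) / c" "exp (c * of_real t)"]
      by (simp add: o_def has_field_derivative_at_within)
  qed simp
  moreover have "exp c = 1" unfolding c_def exp_eq_1 by auto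
  ultimately show ?thesis using False by (simp add: c_def)
qed

text \<open>Absolute summability makes the series converge uniformly, so it may be multiplied by the
  exponential of index \<open>- m\<close> and integrated term by term: only \<open>c m\<close>
  survives, while the constant integrates to 0.\<close>

lemma fourier_series_constant:
  fixes c :: "int \<Rightarrow> complex"
  assumes c: "(\<lambda>k. norm (c k)) summable_on UNIV"
    and const: "\<And>x :: real. (\<Sum>\<^sub>\<infinity>k. c k * exp (2 * of_int k * of_real pi * \<i> * of_real x)) = s0"
    and m: "m \<noteq> 0"
  shows "c m = 0"
proof -
  define E where "E k t = exp (2 * of_int k * of_real pi * \<i> * of_real t)" for k :: int and t :: real
  have nE: "norm (E k t) = 1" for k t by (simp add: E_def)
  have EE: "E k t * E j t = E (k + j) t" for k j t
    by (simp add: E_def algebra_simps flip: exp_add)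
  have E_cont: "continuous_on A (E k)" for A k unfolding E_def by (intro continuous_intros)
  define F where "F X t = (\<Sum>k\<in>X. c k * E k t * E (- m) t)" for X t
  have "uniform_limit {0..1} F (\<lambda>t. \<Sum>\<^sub>\<infinity>k. c k * E k t * E (- m) t) (finite_subsets_at_top UNIV)"
    unfolding F_def by (rule Weierstrass_m_test_general[OF _ c]) (simp add: norm_mult nE)
  moreover have "(\<Sum>\<^sub>\<infinity>k. c k * E k t * E (- m) t) = s0 * E (- m) t" for t
    using const[of t] by (simp add: infsum_cmult_left' E_def)
  ultimately have ul: "uniform_limit {0..1} F (\<lambda>t. s0 * E (- m) t) (finite_subsets_at_top UNIV)" by simp
  have cont: "continuous_on {0..1} (F X)" for X
    unfolding F_def by (intro continuous_intros E_cont)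
  obtain I J where IJ: "\<And>X. (F X has_integral I X) {0..1}" "((\<lambda>t. s0 * E (- m) t) has_integral J) {0..1}"
      "(I \<longlongrightarrow> J) (finite_subsets_at_top UNIV)"
    by (rule uniform_limit_integral[OF ul cont]) (auto intro: that)
  have "(E (- m) has_integral 0) {0..1}"
    using exp_integral_01[of "- m"] m by (simp add: E_def[abs_def])
  then have "J = s0 * 0"
    by (intro has_integral_unique[OF IJ(2)] has_integral_mult_right)
  then have J: "J = 0" by simp
  have I: "I X = c m" if X: "finite X" "m \<in> X" for X
  proof -
    have "(F X has_integral (\<Sum>k\<in>X. c k * (if k - m = 0 then 1 else 0))) {0..1}"
      unfolding F_def
    proof (rule has_integral_sum[OF X(1)])
      fix k
      have "((\<lambda>t. c k * E (k - m) t) has_integral c k * (if k - m = 0 then 1 else 0)) {0..1}"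
        unfolding E_def by (rule has_integral_mult_right[OF exp_integral_01])
      then show "((\<lambda>t. c k * E k t * E (- m) t) has_integral c k * (if k - m = 0 then 1 else 0)) {0..1}"
        by (simp add: mult.assoc EE)
    qed
    moreover have "(\<Sum>k\<in>X. c k * (if k - m = 0 then 1 else 0)) = c m"
      using X by (simp add: if_distrib sum.delta cong: if_cong)
    ultimately show ?thesis using has_integral_unique[OF IJ(1)[of X]] by simp
  qed
  have "eventually (\<lambda>X. I X = c m) (finite_subsets_at_top UNIV)"
    unfolding eventually_finite_subsets_at_top using I by (intro exI[of _ "{m}"]) auto
  then have "(I \<longlongrightarrow> c m) (finite_subsets_at_top UNIV)" by (rule tendsto_eventually)
  from tendsto_unique[OF _ this IJ(3)] show ?thesis using J by simp
qed

text \<open>In the product for 1/\<Gamma>, the modulus of \<open>x + k + i t\<close> relative to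
  \<open>x + k\<close> decreases in \<open>x\<close>. Growth in \<open>t\<close> is therefore at
  most that on the line with real part 1/2, where the reflection formula gives the modulus.\<close>

lemma norm_rGamma_le_half:
  assumes "x \<ge> 1 / 2"
  shows "norm (rGamma (Complex x t)) * norm (rGamma (1 / 2 :: complex))
    \<le> norm (rGamma (Complex (1 / 2) t)) * norm (rGamma (of_real x :: complex))"
proof (rule tendsto_le[OF sequentially_bot])
  show "(\<lambda>n. norm (rGamma_series (Complex x t) n) * norm (rGamma_series (1 / 2 :: complex) n))
      \<longlonglongrightarrow> norm (rGamma (Complex x t)) * norm (rGamma (1 / 2 :: complex))"
    by (intro tendsto_intros)
  show "(\<lambda>n. norm (rGamma_series (Complex (1 / 2) t) n) * norm (rGamma_series (of_real x :: complex) n))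
      \<longlonglongrightarrow> norm (rGamma (Complex (1 / 2) t)) * norm (rGamma (of_real x :: complex))"
    by (intro tendsto_intros)
  have factor: "norm (Complex x t + of_nat k) * norm (1 / 2 + of_nat k :: complex)
      \<le> norm (Complex (1 / 2) t + of_nat k) * norm (of_real x + of_nat k :: complex)" for k
  proof -
    define u where "u = x + real k"
    define v where "v = 1 / 2 + real k"
    have uv: "0 < v" "v \<le> u" using assms by (auto simp: u_def v_def)
    have "v * v \<le> u * u" using uv by (intro mult_mono) auto
    then have "t * t * (v * v) \<le> t * t * (u * u)" by (intro mult_left_mono) auto
    then have "(u\<^sup>2 + t\<^sup>2) * v\<^sup>2 \<le> (v\<^sup>2 + t\<^sup>2) * u\<^sup>2" by (simp add: power2_eq_square algebra_simps)
    then have "sqrt (u\<^sup>2 + t\<^sup>2) * v \<le> sqrt (v\<^sup>2 + t\<^sup>2) * u"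
      using uv real_sqrt_le_mono[of "(u\<^sup>2 + t\<^sup>2) * v\<^sup>2" "(v\<^sup>2 + t\<^sup>2) * u\<^sup>2"] by (simp add: real_sqrt_mult)
    moreover have "norm (Complex x t + of_nat k) = sqrt (u\<^sup>2 + t\<^sup>2)"
      "norm (Complex (1 / 2) t + of_nat k) = sqrt (v\<^sup>2 + t\<^sup>2)"
      by (simp_all add: cmod_def u_def v_def)
    moreover have "norm (1 / 2 + of_nat k :: complex) = v"
      using norm_of_real[of v, where 'a = complex] uv by (simp add: v_def)
    moreover have "norm (of_real x + of_nat k :: complex) = u"
      using norm_of_real[of u, where 'a = complex] uv by (simp add: u_def)
    ultimately show ?thesis by simp
  qed
  have "norm (rGamma_series (Complex x t) n) * norm (rGamma_series (1 / 2 :: complex) n)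
      \<le> norm (rGamma_series (Complex (1 / 2) t) n) * norm (rGamma_series (of_real x :: complex) n)" for n
  proof -
    have "(\<Prod>k\<le>n. norm (Complex x t + of_nat k) * norm (1 / 2 + of_nat k :: complex))
      \<le> (\<Prod>k\<le>n. norm (Complex (1 / 2) t + of_nat k) * norm (of_real x + of_nat k :: complex))"
      by (intro prod_mono conjI factor mult_nonneg_nonneg norm_ge_zero)
    then have P: "norm (pochhammer (Complex x t) (n + 1)) * norm (pochhammer (1 / 2 :: complex) (n + 1))
      \<le> norm (pochhammer (Complex (1 / 2) t) (n + 1)) * norm (pochhammer (of_real x :: complex) (n + 1))"
      by (simp add: pochhammer_Suc_prod prod.distrib prod_norm atLeast0AtMost)
    \<comment> \<open>Both sides carry the same denominator, since the real parts \<open>x\<close>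
      and \<open>1 / 2\<close> occur once on each of them.\<close>
    define D where "D = fact n * exp (x * ln (real n)) * (fact n * exp (1 / 2 * ln (real n)))"
    have "D > 0" by (simp add: D_def)
    moreover have "norm (rGamma_series (Complex x t) n) * norm (rGamma_series (1 / 2 :: complex) n)
      = norm (pochhammer (Complex x t) (n + 1)) * norm (pochhammer (1 / 2 :: complex) (n + 1)) / D"
      "norm (rGamma_series (Complex (1 / 2) t) n) * norm (rGamma_series (of_real x :: complex) n)
      = norm (pochhammer (Complex (1 / 2) t) (n + 1)) * norm (pochhammer (of_real x :: complex) (n + 1)) / D"
      by (simp_all add: rGamma_series_def norm_divide norm_mult D_def)
    ultimately show ?thesis using P by (simp add: divide_right_mono)
  qed
  then show "eventually (\<lambda>n. norm (rGamma_series (Complex x t) n) * norm (rGamma_series (1 / 2 :: complex) n)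
      \<le> norm (rGamma_series (Complex (1 / 2) t) n) * norm (rGamma_series (of_real x :: complex) n)) sequentially"
    by (rule always_eventually[OF allI])
qed

lemma norm_sin_le_exp: "norm (sin z) \<le> exp \<bar>Im z\<bar>"
proof -
  have "norm (exp (\<i> * z) - exp (- (\<i> * z))) \<le> exp (- Im z) + exp (Im z)"
    using norm_triangle_ineq4[of "exp (\<i> * z)" "exp (- (\<i> * z))"] by simp
  also have "\<dots> \<le> exp \<bar>Im z\<bar> + exp \<bar>Im z\<bar>" by (intro add_mono) auto
  finally show ?thesis by (simp add: sin_exp_eq norm_divide norm_mult)
qed

text \<open>On this line \<open>1 - z\<close> is the conjugate of \<open>z\<close>, so the
  reflection formula expresses the squared modulus by a sine.\<close>

lemma norm_rGamma_half: "norm (rGamma (Complex (1 / 2) t)) \<le> exp (pi * \<bar>t\<bar> / 2)"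
proof -
  have "1 - Complex (1 / 2) t = cnj (Complex (1 / 2) t)" by (simp add: complex_eq_iff)
  then have "rGamma (Complex (1 / 2) t) * cnj (rGamma (Complex (1 / 2) t)) = sin (of_real pi * Complex (1 / 2) t) / of_real pi"
    using rGamma_reflection_complex[of "Complex (1 / 2) t"] by (simp add: cnj_rGamma)
  then have "norm (rGamma (Complex (1 / 2) t)) ^ 2 = norm (sin (of_real pi * Complex (1 / 2) t)) / pi"
    by (metis complex_mod_cnj norm_divide norm_mult norm_of_real power2_eq_square abs_of_pos pi_gt_zero)
  also have "\<dots> \<le> exp (pi * \<bar>t\<bar>) / 1"
    using norm_sin_le_exp[of "of_real pi * Complex (1 / 2) t"] pi_ge_two
    by (intro frac_le) (auto simp: abs_mult)
  also have "\<dots> = exp (pi * \<bar>t\<bar> / 2) ^ 2" by (simp add: exp_double[symmetric])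
  finally show ?thesis by (rule power2_le_imp_le) simp
qed

text \<open>For small \<open>x\<close> the comparison applies only to \<open>x + 1\<close>; stepping
  back costs a factor linear in \<open>t\<close>, which \<open>exp (pi / 8 * \<bar>t\<bar>)\<close>
  absorbs. Hence the exponent 5\<pi>/8 = \<pi>/2 + \<pi>/8.\<close>

lemma rGamma_growth:
  assumes "x > 0"
  obtains C where "C \<ge> 0" "\<And>t. norm (rGamma (Complex x t)) \<le> C * exp (5 * pi / 8 * \<bar>t\<bar>)"
proof -
  define r where "r = norm (rGamma (1 / 2 :: complex))"
  define C1 where "C1 = norm (rGamma (of_real (x + 1) :: complex)) / r"
  have "(1 / 2 :: complex) \<notin> \<int>\<^sub>\<le>\<^sub>0"
    using nonpos_Ints_nonpos by (force elim!: nonpos_Ints_cases simp: complex_eq_iff)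
  then have r: "r > 0" by (simp add: r_def rGamma_eq_zero_iff)
  have b1: "norm (rGamma (Complex (x + 1) t)) \<le> C1 * exp (pi * \<bar>t\<bar> / 2)" for t
  proof -
    have "norm (rGamma (Complex (x + 1) t)) * r \<le> norm (rGamma (Complex (1 / 2) t)) * norm (rGamma (of_real (x + 1) :: complex))"
      unfolding r_def by (rule norm_rGamma_le_half) (use assms in simp)
    also have "\<dots> \<le> exp (pi * \<bar>t\<bar> / 2) * norm (rGamma (of_real (x + 1) :: complex))"
      by (intro mult_right_mono norm_rGamma_half norm_ge_zero)
    finally show ?thesis using r by (simp add: C1_def pos_le_divide_eq mult.commute)
  qed
  have C1: "C1 \<ge> 0" using r by (simp add: C1_def)
  have "norm (rGamma (Complex x t)) \<le> ((x + 8) * C1) * exp (5 * pi / 8 * \<bar>t\<bar>)" for t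
  proof -
    have "Complex x t + 1 = Complex (x + 1) t" by (simp add: complex_eq_iff)
    then have "rGamma (Complex x t) = Complex x t * rGamma (Complex (x + 1) t)"
      using rGamma_plus1[of "Complex x t"] by simp
    then have "norm (rGamma (Complex x t)) \<le> norm (Complex x t) * (C1 * exp (pi * \<bar>t\<bar> / 2))"
      using b1[of t] by (simp add: norm_mult mult_left_mono)
    also have "norm (Complex x t) \<le> x + \<bar>t\<bar>"
      using cmod_le[of "Complex x t"] assms by simp
    also have "x + \<bar>t\<bar> \<le> (x + 8) * exp (pi / 8 * \<bar>t\<bar>)"
    proof -
      have "1 * \<bar>t\<bar> \<le> pi * \<bar>t\<bar>" using pi_ge_two by (intro mult_right_mono) auto
      then have "\<bar>t\<bar> / 8 \<le> pi / 8 * \<bar>t\<bar>" by simp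
      also have "\<dots> \<le> exp (pi / 8 * \<bar>t\<bar>)" using exp_ge_add_one_self[of "pi / 8 * \<bar>t\<bar>"] by linarith
      finally have "\<bar>t\<bar> \<le> 8 * exp (pi / 8 * \<bar>t\<bar>)" by simp
      moreover have "x * 1 \<le> x * exp (pi / 8 * \<bar>t\<bar>)" using assms by (intro mult_left_mono) auto
      ultimately show ?thesis by (simp add: distrib_right)
    qed
    finally have "norm (rGamma (Complex x t)) \<le> (x + 8) * exp (pi / 8 * \<bar>t\<bar>) * (C1 * exp (pi * \<bar>t\<bar> / 2))"
      using C1 by (simp add: mult_right_mono)
    also have "\<dots> = ((x + 8) * C1) * (exp (pi / 8 * \<bar>t\<bar>) * exp (pi * \<bar>t\<bar> / 2))" by simp
    also have "exp (pi / 8 * \<bar>t\<bar>) * exp (pi * \<bar>t\<bar> / 2) = exp (5 * pi / 8 * \<bar>t\<bar>)"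
      by (simp add: field_simps flip: exp_add)
    finally show ?thesis .
  qed
  then show ?thesis using that[of "(x + 8) * C1"] C1 assms by simp
qed

section \<open>Periodic functions determined by their Fourier coefficients\<close>

lemma fourier_coefficient_eq:
  "fourier_coefficient f k = integral {0..1} (\<lambda>t. f (of_real t) * exp (2 * of_int (- k) * of_real pi * \<i> * of_real t))"
  by (simp add: fourier_coefficient_def)

text \<open>Divide \<open>g - g x\<close> by \<open>B\<close>, which has simple zeros exactly at the
  translates of \<open>x\<close>. The quotient \<open>k\<close> is again periodic and holomorphic,
  and its coefficients \<open>K n\<close> have constant modulus for \<open>n \<ge> 0\<close> and for
  \<open>n < 0\<close>. As they decay, they all vanish, and the recursion at index 0, where
  \<open>g x\<close> enters, yields \<open>g x = 0\<close>.\<close>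

lemma fourier_unique_0:
  fixes g :: "complex \<Rightarrow> complex"
  assumes hol: "g holomorphic_on {z. \<bar>Im z\<bar> < a}" and a: "a > 0"
    and per: "\<And>z. \<bar>Im z\<bar> < a \<Longrightarrow> g (z + 1) = g z"
    and zero: "\<And>n. fourier_coefficient g n = 0"
  shows "g (of_real x) = 0"
proof -
  define S where "S = {z. \<bar>Im z\<bar> < a}"
  have S: "open S" by (simp add: S_def open_Im_strip)
  define B where "B z = exp (2 * of_real pi * \<i> * (z - of_real x)) - 1" for z
  \<comment> \<open>At a zero of \<open>B\<close> the derivative of \<open>B\<close> is
    \<open>2 * pi * \<i>\<close>, so this is the limit of the quotient.\<close>
  define k where "k z = (if B z = 0 then deriv g z / (2 * of_real pi * \<i>) else (g z - g (of_real x)) / B z)" for z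
  have e1: "exp (2 * of_real pi * \<i>) = (1 :: complex)"
    unfolding exp_eq_1 by (auto intro!: exI[of _ 1])
  have B_per: "B (z + 1) = B z" for z
  proof -
    have "2 * of_real pi * \<i> * (z + 1 - of_real x) = 2 * of_real pi * \<i> * (z - of_real x) + 2 * of_real pi * \<i>"
      by (simp add: algebra_simps)
    then show ?thesis by (simp only: B_def exp_add e1 mult_1_right)
  qed
  have k_per: "k (z + 1) = k z" if "\<bar>Im z\<bar> < a" for z
    using that deriv_periodic[OF hol per that] per[OF that] by (simp add: k_def B_per)
  have B_hol: "B holomorphic_on T" for T unfolding B_def by (intro holomorphic_intros)
  have per_int: "g (z + of_int n) = g z" if "\<bar>Im z\<bar> < a" for z n
  proof (induction n rule: int_induct[of _ 0])
    case (step1 i)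
    then show ?case using per[of "z + of_int i"] that by (simp add: add.assoc)
  next
    case (step2 i)
    then show ?case using per[of "z + of_int (i - 1)"] that by (simp add: algebra_simps)
  qed simp
  have k_hol: "k holomorphic_on S"
    unfolding holomorphic_on_open[OF S]
  proof
    fix z0 assume z0: "z0 \<in> S"
    show "\<exists>f'. (k has_field_derivative f') (at z0)"
    proof (cases "B z0 = 0")
      case False
      define U where "U = {z \<in> S. B z \<noteq> 0}"
      have "open U"
      proof -
        have "continuous_on S B" using B_hol by (rule holomorphic_on_imp_continuous_on)
        then have "open (S \<inter> B -` (- {0}))" using S by (intro continuous_open_preimage) auto
        moreover have "U = S \<inter> B -` (- {0})" by (auto simp: U_def)
        ultimately show ?thesis by simp
      qed
      have "(\<lambda>z. (g z - g (of_real x)) / B z) holomorphic_on U"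
        by (intro holomorphic_intros B_hol holomorphic_on_subset[OF hol]) (auto simp: U_def S_def)
      then have "k holomorphic_on U"
        by (rule holomorphic_transform) (simp add: k_def U_def)
      then show ?thesis using holomorphic_on_open[OF \<open>open U\<close>] z0 False by (auto simp: U_def)
    next
      case True
      then have "exp (2 * of_real pi * \<i> * (z0 - of_real x)) = 1" by (simp add: B_def)
      then obtain n :: int where n: "Im z0 = 0" "2 * pi * (Re z0 - x) = of_int (2 * n) * pi"
        unfolding exp_eq_1 by auto
      then have z0_eq: "z0 = of_real x + of_int n" by (simp add: complex_eq_iff)
      define r where "r = min a 1"
      have r: "r > 0" "r \<le> a" "r \<le> 1" using a by (auto simp: r_def)
      define U where "U = ball z0 r"
      have US: "U \<subseteq> S"
      proof
        fix z assume "z \<in> U"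
        then have "norm (z - z0) < r" by (simp add: U_def dist_norm norm_minus_commute)
        then have "\<bar>Im (z - z0)\<bar> < r" using abs_Im_le_cmod[of "z - z0"] by linarith
        then show "z \<in> S" using n r by (simp add: S_def)
      qed
      have gz0: "g z0 = g (of_real x)" using per_int[of "of_real x" n] a by (simp add: z0_eq)
      have B_z0: "B z = exp (2 * of_real pi * \<i> * (z - z0)) - 1" for z
      proof -
        have "2 * of_real pi * \<i> * (z - of_real x) = 2 * of_real pi * \<i> * (z - z0) + 2 * of_int n * of_real pi * \<i>"
          by (simp add: z0_eq algebra_simps)
        moreover have "exp (2 * of_int n * of_real pi * \<i>) = (1 :: complex)"
          unfolding exp_eq_1 by auto
        ultimately show ?thesis by (simp only: B_def exp_add mult_1_right)
      qed
      have B_nz: "B z \<noteq> 0" if "z \<in> U" "z \<noteq> z0" for z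
      proof
        assume "B z = 0"
        then have "exp (2 * of_real pi * \<i> * (z - z0)) = 1" by (simp add: B_z0)
        then obtain m :: int where m: "Im (z - z0) = 0" "2 * pi * Re (z - z0) = of_int (2 * m) * pi"
          unfolding exp_eq_1 by auto
        then have Re: "Re (z - z0) = of_int m" by simp
        have "norm (z - z0) < 1" using that(1) r by (simp add: U_def dist_norm norm_minus_commute)
        then have "\<bar>Re (z - z0)\<bar> < 1" using abs_Re_le_cmod[of "z - z0"] by linarith
        then have "m = 0" using Re by simp
        then have "z = z0" using Re m(1) by (simp add: complex_eq_iff)
        then show False using that by simp
      qed
      have dB: "deriv B z0 = 2 * of_real pi * \<i>"
      proof (rule DERIV_imp_deriv)
        have "((\<lambda>z. exp (2 * of_real pi * \<i> * (z - z0)) - 1) has_field_derivative 2 * of_real pi * \<i>) (at z0)"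
          by (auto intro!: derivative_eq_intros)
        then show "(B has_field_derivative 2 * of_real pi * \<i>) (at z0)" by (simp add: B_z0[abs_def])
      qed
      \<comment> \<open>Near a zero \<open>z0\<close> of \<open>B\<close>, numerator and denominator
        are both divided by \<open>z - z0\<close>; the new denominator \<beta> has no zero.\<close>
      define \<alpha> where "\<alpha> z = (if z = z0 then deriv g z0 else (g z - g z0) / (z - z0))" for z
      define \<beta> where "\<beta> z = (if z = z0 then deriv B z0 else (B z - B z0) / (z - z0))" for z
      have "\<alpha> holomorphic_on U" unfolding \<alpha>_def
        by (intro pole_lemma_open holomorphic_on_subset[OF hol] US[unfolded S_def]) (simp add: U_def)
      moreover have "\<beta> holomorphic_on U" unfolding \<beta>_def
        by (intro pole_lemma_open B_hol) (simp add: U_def)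
      moreover have "\<beta> z \<noteq> 0" if "z \<in> U" for z
        using B_nz[OF that] True by (simp add: \<beta>_def dB)
      ultimately have "(\<lambda>z. \<alpha> z / \<beta> z) holomorphic_on U" by (intro holomorphic_intros)
      then have "k holomorphic_on U"
      proof (rule holomorphic_transform)
        fix z assume z: "z \<in> U"
        show "\<alpha> z / \<beta> z = k z"
        proof (cases "z = z0")
          case True
          then show ?thesis using \<open>B z0 = 0\<close> by (simp add: \<alpha>_def \<beta>_def k_def dB)
        next
          case False
          then show ?thesis using B_nz[OF z False] \<open>B z0 = 0\<close> by (simp add: \<alpha>_def \<beta>_def k_def gz0)
        qed
      qed
      moreover have "open U" "z0 \<in> U" using r by (auto simp: U_def)
      ultimately show ?thesis using holomorphic_on_open by blast
    qed
  qed
  define \<zeta> where "\<zeta> = exp (- (2 * of_real pi * \<i> * of_real x))"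
  have n\<zeta>: "norm \<zeta> = 1" by (simp add: \<zeta>_def)
  have kB: "k z * B z = g z - g (of_real x)" if "z \<in> S" for z
  proof (cases "B z = 0")
    case True
    then have "exp (2 * of_real pi * \<i> * (z - of_real x)) = 1" by (simp add: B_def)
    then obtain n :: int where n: "Im z = 0" "2 * pi * (Re z - x) = of_int (2 * n) * pi"
      unfolding exp_eq_1 by auto
    then have "z = of_real x + of_int n" by (simp add: complex_eq_iff)
    then show ?thesis using per_int[of "of_real x" n] a True by simp
  qed (simp add: k_def)
  define K where "K = fourier_coefficient k"
  define E where "E n t = exp (2 * of_int (- n) * of_real pi * \<i> * of_real t)" for n :: int and t :: real
  have cont: "continuous_on {0..1} (\<lambda>t. h (of_real t) * E n t)" if "h holomorphic_on S" for h n
    unfolding E_def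
    by (intro continuous_intros continuous_on_compose2[OF holomorphic_on_imp_continuous_on[OF that]])
       (use a in \<open>auto simp: S_def\<close>)
  have int: "((\<lambda>t. h (of_real t) * E n t) has_integral fourier_coefficient h n) {0..1}"
    if "h holomorphic_on S" for h n
    using integrable_continuous_real[OF cont[OF that, of n]]
    unfolding fourier_coefficient_eq E_def[symmetric] by (rule integrable_integral)
  have cint: "((\<lambda>t. g (of_real x) * E n t) has_integral (if n = 0 then g (of_real x) else 0)) {0..1}" for n
  proof -
    have "(E n has_integral (if - n = 0 then 1 else 0)) {0..1}"
      unfolding E_def[abs_def] by (rule exp_integral_01)
    from has_integral_mult_right[OF this, of "g (of_real x)"] show ?thesis by (cases "n = 0") simp_all
  qed
  \<comment> \<open>Compares the coefficients of index \<open>n\<close> in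
    \<open>k z * B z = g z - g x\<close>; all coefficients of \<open>g\<close> vanish.\<close>
  have rec: "\<zeta> * K (n - 1) - K n = (if n = 0 then - g (of_real x) else 0)" for n
  proof -
    have "((\<lambda>t. \<zeta> * (k (of_real t) * E (n - 1) t) - k (of_real t) * E n t) has_integral \<zeta> * K (n - 1) - K n) {0..1}"
      unfolding K_def by (intro has_integral_diff has_integral_mult_right int k_hol)
    moreover have "\<zeta> * (k (of_real t) * E (n - 1) t) - k (of_real t) * E n t
        = g (of_real t) * E n t - g (of_real x) * E n t" for t
    proof -
      have "\<zeta> * E (n - 1) t = exp (2 * of_real pi * \<i> * (of_real t - of_real x)) * E n t"
        unfolding \<zeta>_def E_def exp_add[symmetric] by (rule arg_cong[of _ _ exp]) (simp add: algebra_simps)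
      then have "\<zeta> * (k (of_real t) * E (n - 1) t) - k (of_real t) * E n t = k (of_real t) * B (of_real t) * E n t"
        by (simp add: B_def algebra_simps)
      also have "\<dots> = (g (of_real t) - g (of_real x)) * E n t"
        using kB[of "of_real t"] a by (simp add: S_def)
      finally show ?thesis by (simp add: algebra_simps)
    qed
    ultimately have 1: "((\<lambda>t. g (of_real t) * E n t - g (of_real x) * E n t) has_integral \<zeta> * K (n - 1) - K n) {0..1}"
      by simp
    have 2: "((\<lambda>t. g (of_real t) * E n t - g (of_real x) * E n t) has_integral 0 - (if n = 0 then g (of_real x) else 0)) {0..1}"
      using int[of g n] hol zero cint by (intro has_integral_diff) (auto simp: S_def)
    from has_integral_unique[OF 1 2] show ?thesis by simp
  qed
  obtain C where C: "\<And>n. norm (K n) \<le> C * exp (- (2 * pi * (a / 2) * \<bar>of_int n\<bar>))"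
  proof -
    have kd: "k holomorphic_on {z. \<bar>Im z\<bar> < a}" using k_hol by (simp add: S_def)
    show thesis
      by (rule fourier_coefficient_decay[OF kd, of "a / 2"])
         (erule k_per, use a in simp, use a in simp, rule that, unfold K_def)
  qed
  define q where "q = exp (- (2 * pi * (a / 2)))"
  have q: "0 \<le> q" "q < 1" using a by (auto simp: q_def)
  have Cq: "norm (K n) \<le> C * q ^ nat \<bar>n\<bar>" for n
  proof -
    have "q ^ nat \<bar>n\<bar> = exp (- (2 * pi * (a / 2) * \<bar>of_int n\<bar>))"
      unfolding q_def exp_of_nat_mult[symmetric] by (simp add: mult_ac)
    then show ?thesis using C[of n] by simp
  qed
  have lim: "(\<lambda>n. C * q ^ n) \<longlonglongrightarrow> 0"
    using q by (intro tendsto_mult_right_zero LIMSEQ_realpow_zero)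
  have "norm (K (int n)) = norm (K 0)" for n
  proof (induction n)
    case (Suc n)
    have "K (int (Suc n)) = \<zeta> * K (int n)" using rec[of "int (Suc n)"] by simp
    then show ?case using Suc n\<zeta> by (simp add: norm_mult)
  qed simp
  then have "norm (K 0) \<le> C * q ^ n" for n using Cq[of "int n"] by simp
  then have "norm (K 0) \<le> 0" using lim by (intro tendsto_lowerbound[OF lim]) auto
  moreover have "norm (K (- 1 - int n)) = norm (K (- 1))" for n
  proof (induction n)
    case (Suc n)
    have "K (- 1 - int n) = \<zeta> * K (- 1 - int (Suc n))" using rec[of "- 1 - int n"] by simp
    then show ?case using Suc n\<zeta> by (simp add: norm_mult)
  qed simp
  then have "norm (K (- 1)) \<le> C * q ^ (Suc n)" for n
    using Cq[of "- 1 - int n"] by (simp add: nat_add_distrib)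
  then have "norm (K (- 1)) \<le> 0" using LIMSEQ_Suc[OF lim] by (intro tendsto_lowerbound[OF LIMSEQ_Suc[OF lim]]) auto
  ultimately show ?thesis using rec[of 0] by simp
qed

text \<open>After subtraction of the mean all coefficients vanish, so the function is 0 on the real
  axis and then, by the identity theorem, on the strip.\<close>

lemma fourier_constant:
  fixes h :: "complex \<Rightarrow> complex"
  assumes hol: "h holomorphic_on {z. \<bar>Im z\<bar> < a}" and a: "a > 0"
    and per: "\<And>z. \<bar>Im z\<bar> < a \<Longrightarrow> h (z + 1) = h z"
    and zero: "\<And>n. n \<noteq> 0 \<Longrightarrow> fourier_coefficient h n = 0"
  shows "h constant_on {z. \<bar>Im z\<bar> < a}"
proof -
  define C where "C = fourier_coefficient h 0"
  define g where "g z = h z - C" for z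
  have g_hol: "g holomorphic_on {z. \<bar>Im z\<bar> < a}" unfolding g_def by (intro holomorphic_intros hol)
  have "fourier_coefficient g n = 0" for n
  proof -
    have "continuous_on {0..1} (\<lambda>t. h (of_real t) * exp (2 * of_int (- n) * of_real pi * \<i> * of_real t))"
      by (intro continuous_intros continuous_on_compose2[OF holomorphic_on_imp_continuous_on[OF hol]])
         (use a in auto)
    then have "((\<lambda>t. h (of_real t) * exp (2 * of_int (- n) * of_real pi * \<i> * of_real t)) has_integral fourier_coefficient h n) {0..1}"
      unfolding fourier_coefficient_eq by (intro integrable_integral integrable_continuous_real)
    then have "((\<lambda>t. h (of_real t) * exp (2 * of_int (- n) * of_real pi * \<i> * of_real t)
        - C * exp (2 * of_int (- n) * of_real pi * \<i> * of_real t)) has_integral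
        fourier_coefficient h n - C * (if - n = 0 then 1 else 0)) {0..1}"
      by (intro has_integral_diff has_integral_mult_right exp_integral_01)
    then have "fourier_coefficient g n = fourier_coefficient h n - C * (if - n = 0 then 1 else 0)"
      unfolding fourier_coefficient_eq by (intro integral_unique) (simp add: g_def left_diff_distrib)
    then show ?thesis using zero[of n] by (cases "n = 0") (auto simp: C_def)
  qed
  then have g0: "g (of_real x) = 0" for x
    using g_hol a per by (intro fourier_unique_0[of g a]) (auto simp: g_def)
  have "g z = 0" if "z \<in> {z. \<bar>Im z\<bar> < a}" for z
  proof (rule analytic_continuation[OF g_hol open_Im_strip, of "range of_real" 0])
    show "Topological_Spaces.connected {z. \<bar>Im z\<bar> < a}" by (intro convex_connected convex_Im_strip)
    show "(0 :: complex) islimpt range of_real"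
      unfolding islimpt_approachable
    proof (intro allI impI)
      fix e :: real assume "e > 0"
      then show "\<exists>x'\<in>range of_real. x' \<noteq> (0 :: complex) \<and> dist x' 0 < e"
        by (intro bexI[OF _ rangeI[of of_real "e / 2"]]) auto
    qed
  qed (use g0 a that in auto)
  then show ?thesis unfolding constant_on_def by (intro exI[of _ C]) (simp add: g_def)
qed

text \<open>The factors 1/\<Gamma> grow more slowly than the coefficients of \<open>h\<close> decay,
  so uniqueness of Fourier series applies to the products. For \<open>k \<noteq> 0\<close> the
  argument of 1/\<Gamma> is not real, hence that factor is nonzero and the coefficient of
  \<open>h\<close> itself must vanish.\<close>

lemma fourier_modified_series_constant:
  fixes h :: "complex \<Rightarrow> complex"
  assumes l: "l > 0" and hol: "h holomorphic_on {z. \<bar>Im z\<bar> < pi / l}"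
    and per: "\<And>z. \<bar>Im z\<bar> < pi / l \<Longrightarrow> h (z + 1) = h z" and m: "0 < m" "m < l"
    and const: "\<And>x :: real. (\<Sum>\<^sub>\<infinity>k::int\<in>UNIV. fourier_coefficient h (- k)
        * rGamma (1 - (of_real m - 2 * of_int k * of_real pi * \<i>) / of_real l)
        * exp (2 * of_int k * of_real pi * \<i> * of_real x)) = s0"
  shows "h constant_on {z. \<bar>Im z\<bar> < pi / l}"
proof -
  define x0 where "x0 = 1 - m / l"
  have x0: "x0 > 0" using l m by (simp add: x0_def)
  define g where "g k = rGamma (Complex x0 (2 * of_int k * pi / l))" for k :: int
  have g_eq: "rGamma (1 - (of_real m - 2 * of_int k * of_real pi * \<i>) / of_real l) = g k" for k
  proof -
    have "1 - (of_real m - 2 * of_int k * of_real pi * \<i>) / of_real l = Complex x0 (2 * of_int k * pi / l)"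
      using l by (simp add: complex_eq_iff x0_def)
    then show ?thesis by (simp add: g_def)
  qed
  define c where "c k = fourier_coefficient h (- k) * g k" for k
  obtain C1 where C1: "C1 \<ge> 0" "\<And>t. norm (rGamma (Complex x0 t)) \<le> C1 * exp (5 * pi / 8 * \<bar>t\<bar>)"
    using rGamma_growth[OF x0] by blast
  obtain C2 where C2: "C2 \<ge> 0" "\<And>k. norm (fourier_coefficient h k) \<le> C2 * exp (- (2 * pi * (3 * pi / (4 * l)) * \<bar>of_int k\<bar>))"
  proof (rule fourier_coefficient_decay[OF hol per, of "3 * pi / (4 * l)"])
    show "3 * pi / (4 * l) < pi / l" "0 \<le> 3 * pi / (4 * l)" using l by (auto simp: field_simps)
  qed (use that in auto)
  \<comment> \<open>The exponent is the difference of the rates: 3/2 - 5/4 = 1/4.\<close>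
  define q where "q = exp (- (pi * pi / (4 * l)))"
  have q: "0 \<le> q" "q < 1" using l by (auto simp: q_def)
  have c_bound: "norm (c k) \<le> (C2 * C1) * q ^ nat \<bar>k\<bar>" for k
  proof -
    have "norm (c k) \<le> (C2 * exp (- (2 * pi * (3 * pi / (4 * l)) * \<bar>of_int k\<bar>))) * (C1 * exp (5 * pi / 8 * \<bar>2 * of_int k * pi / l\<bar>))"
      unfolding c_def norm_mult g_def
      using C2(2)[of "- k"] C1(2)[of "2 * of_int k * pi / l"] C2(1) by (intro mult_mono) auto
    also have "\<dots> = (C2 * C1) * (exp (- (2 * pi * (3 * pi / (4 * l)) * \<bar>of_int k\<bar>)) * exp (5 * pi / 8 * \<bar>2 * of_int k * pi / l\<bar>))"
      by simp
    also have "exp (- (2 * pi * (3 * pi / (4 * l)) * \<bar>of_int k\<bar>)) * exp (5 * pi / 8 * \<bar>2 * of_int k * pi / l\<bar>)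
        = exp (real (nat \<bar>k\<bar>) * (- (pi * pi / (4 * l))))"
      unfolding exp_add[symmetric] using l by (intro arg_cong[of _ _ exp]) (simp add: abs_mult field_simps)
    also have "\<dots> = q ^ nat \<bar>k\<bar>" by (simp only: q_def exp_of_nat_mult)
    finally show ?thesis .
  qed
  have c_sum: "(\<lambda>k. norm (c k)) summable_on UNIV"
  proof (rule summable_on_comparison_test)
    show "(\<lambda>k. (C2 * C1) * q ^ nat \<bar>k\<bar>) summable_on UNIV"
      by (intro summable_on_cmult_right summable_on_int_geometric q)
  qed (use c_bound in auto)
  have "(\<Sum>\<^sub>\<infinity>k. c k * exp (2 * of_int k * of_real pi * \<i> * of_real x)) = s0" for x :: real
    using const[of x] by (simp add: c_def g_eq)
  then have c0: "c k = 0" if "k \<noteq> 0" for k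
    using that by (intro fourier_series_constant[OF c_sum])
  show ?thesis
  proof (rule fourier_constant[OF hol _ per])
    fix n :: int assume n: "n \<noteq> 0"
    have "Complex x0 (2 * of_int (- n) * pi / l) \<notin> \<int>\<^sub>\<le>\<^sub>0"
    proof
      assume "Complex x0 (2 * of_int (- n) * pi / l) \<in> \<int>\<^sub>\<le>\<^sub>0"
      then obtain j :: int where "Complex x0 (2 * of_int (- n) * pi / l) = of_int j"
        by (auto elim: nonpos_Ints_cases)
      then show False using n l by (simp add: complex_eq_iff)
    qed
    then have "g (- n) \<noteq> 0" by (simp add: g_def rGamma_eq_zero_iff)
    then show "fourier_coefficient h n = 0" using c0[of "- n"] n by (simp add: c_def)
  qed (use l in auto)
qed

section \<open>Resolvents of finite matrices\<close>

definition resolvent_matrix :: "('v \<Rightarrow> 'v \<Rightarrow> real) \<Rightarrow> complex \<Rightarrow> 'v \<Rightarrow> 'v \<Rightarrow> complex" where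
  "resolvent_matrix Q z x y = (if x = y then 1 else 0) - z * of_real (Q x y)"

text \<open>The zeros of the determinant of \<open>I - z Q\<close>, expressed through null vectors.
  This form needs no enumeration of \<open>S\<close> and is the one to which energy arguments
  apply.\<close>

definition singular_set :: "'v set \<Rightarrow> ('v \<Rightarrow> 'v \<Rightarrow> real) \<Rightarrow> complex set" where
  "singular_set S Q = {z. \<exists>u. (\<exists>x\<in>S. u x \<noteq> 0) \<and> (\<forall>x\<in>S. u x = z * (\<Sum>w\<in>S. of_real (Q x w) * u w))}"

definition resolvent :: "'v set \<Rightarrow> ('v \<Rightarrow> 'v \<Rightarrow> real) \<Rightarrow> complex \<Rightarrow> 'v \<Rightarrow> 'v \<Rightarrow> complex" where
  "resolvent S Q z = matrix_inverse_on S (resolvent_matrix Q z)"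

text \<open>The predicate under the description operator in
  \<open>matrix_inverse_on\<close>.\<close>

definition inverse_on :: "'v set \<Rightarrow> ('v \<Rightarrow> 'v \<Rightarrow> complex) \<Rightarrow> ('v \<Rightarrow> 'v \<Rightarrow> complex) \<Rightarrow> bool" where
  "inverse_on S A N \<longleftrightarrow> (\<forall>x y. x \<notin> S \<or> y \<notin> S \<longrightarrow> N x y = 0) \<and>
        (\<forall>x\<in>S. \<forall>y\<in>S. (\<Sum>w\<in>S. A x w * N w y) = (if x = y then 1 else 0)) \<and>
        (\<forall>x\<in>S. \<forall>y\<in>S. (\<Sum>w\<in>S. N x w * A w y) = (if x = y then 1 else 0))"

lemma inverse_on_unique:
  assumes "finite S" "inverse_on S A N" "inverse_on S A N'"
  shows "N = N'"
proof (intro ext)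
  fix x y
  show "N x y = N' x y"
  proof (cases "x \<in> S \<and> y \<in> S")
    case True
    have "N x y = (\<Sum>w\<in>S. N x w * (if w = y then 1 else 0))"
      using True assms(1) by (simp add: if_distrib sum.delta cong: if_cong)
    also have "\<dots> = (\<Sum>w\<in>S. N x w * (\<Sum>v\<in>S. A w v * N' v y))"
      using assms(3) True by (intro sum.cong) (auto simp: inverse_on_def)
    also have "\<dots> = (\<Sum>w\<in>S. \<Sum>v\<in>S. N x w * A w v * N' v y)"
      by (simp add: sum_distrib_left mult.assoc)
    also have "\<dots> = (\<Sum>v\<in>S. \<Sum>w\<in>S. N x w * A w v * N' v y)"
      by (rule sum.swap)
    also have "\<dots> = (\<Sum>v\<in>S. (\<Sum>w\<in>S. N x w * A w v) * N' v y)"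
      by (simp add: sum_distrib_right)
    also have "\<dots> = (\<Sum>v\<in>S. (if x = v then 1 else 0) * N' v y)"
      using assms(2) True by (intro sum.cong) (auto simp: inverse_on_def)
    also have "\<dots> = N' x y"
      using True assms(1) by (simp add: if_distrib[of "\<lambda>a. a * _"] sum.delta' cong: if_cong)
    finally show ?thesis .
  next
    case False
    then have "x \<notin> S \<or> y \<notin> S" by blast
    then show ?thesis using assms(2,3) unfolding inverse_on_def by metis
  qed
qed

lemma matrix_inverse_on_eqI:
  assumes "finite S" "inverse_on S A N"
  shows "matrix_inverse_on S A = N"
  unfolding matrix_inverse_on_def inverse_on_def[symmetric]
  using assms by (intro the_equality inverse_on_unique)

lemma holomorphic_det:
  assumes "\<And>i j. i < n \<Longrightarrow> j < n \<Longrightarrow> (\<lambda>z. M z i j) holomorphic_on U"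
  shows "(\<lambda>z. Determinant.det (Matrix.mat n n (\<lambda>(i, j). M z i j))) holomorphic_on U"
proof -
  have eq: "Determinant.det (Matrix.mat n n (\<lambda>(i, j). M z i j))
    = (\<Sum>p\<in>{p. p permutes {0..<n}}. signof p * (\<Prod>i = 0..<n. M z i (p i)))" for z
  proof -
    have "p i < n" if "p permutes {0..<n}" "i < n" for p i
      using permutes_in_image[OF that(1), of i] that(2) by simp
    then show ?thesis
      by (subst det_def'[of _ n]) (auto intro!: sum.cong prod.cong)
  qed
  show ?thesis
    unfolding eq
  proof (intro holomorphic_intros)
    fix p i assume "p \<in> {p. p permutes {0..<n}}" "i \<in> {0..<n}"
    then show "(\<lambda>z. M z i (p i)) holomorphic_on U"
      using permutes_in_image[of p "{0..<n}" i] by (intro assms) auto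
  qed
qed

lemma resolvent_matrix_hol: "(\<lambda>z. resolvent_matrix Q z x y) holomorphic_on U"
  unfolding resolvent_matrix_def by (intro holomorphic_intros)

text \<open>After an enumeration of \<open>S\<close>, \<open>D\<close> is the determinant and
  \<open>N\<close> the adjugate divided by it, both of which depend holomorphically on
  \<open>z\<close>. The value \<open>D 0 = 1\<close> shows that \<open>D\<close> is not identically
  zero.\<close>

lemma resolvent_exists:
  fixes S :: "'v set" and Q :: "'v \<Rightarrow> 'v \<Rightarrow> real"
  assumes fin: "finite S"
  obtains D N where "D holomorphic_on UNIV" "D 0 = 1" "singular_set S Q = {z. D z = 0}"
    "\<And>z. D z \<noteq> 0 \<Longrightarrow> inverse_on S (resolvent_matrix Q z) (N z)"
    "\<And>x y. (\<lambda>z. N z x y) holomorphic_on {z. D z \<noteq> 0}"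
proof -
  define n where "n = card S"
  obtain e where e: "bij_betw e {0..<n} S"
    using ex_bij_betw_nat_finite[OF fin] unfolding n_def by blast
  define e' where "e' = the_inv_into {0..<n} e"
  have e': "e' x < n" "e (e' x) = x" if "x \<in> S" for x
    using that e the_inv_into_into[of e "{0..<n}" x "{0..<n}"] f_the_inv_into_f_bij_betw[OF e, of x]
    by (auto simp: e'_def bij_betw_def)
  have e'e: "e' (e i) = i" if "i < n" for i
    using that e by (auto simp: e'_def bij_betw_def intro: the_inv_into_f_f)
  have eS: "e i \<in> S" if "i < n" for i using e that by (auto simp: bij_betw_def)
  have e_inj: "e i = e j \<longleftrightarrow> i = j" if "i < n" "j < n" for i j
    using that e by (auto simp: bij_betw_def inj_on_def)
  have sum_e: "(\<Sum>w\<in>S. h w) = (\<Sum>i = 0..<n. h (e i))" for h :: "'v \<Rightarrow> complex"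
    using sum.reindex_bij_betw[OF e, of h] by simp
  define M where "M z i j = resolvent_matrix Q z (e i) (e j)" for z i j
  define MM where "MM z = Matrix.mat n n (\<lambda>(i, j). M z i j)" for z
  have MM: "MM z \<in> carrier_mat n n" for z by (simp add: MM_def)
  define D where "D z = Determinant.det (MM z)" for z
  define N where "N z x y = (if x \<in> S \<and> y \<in> S then adj_mat (MM z) $$ (e' x, e' y) / D z else 0)" for z x y
  have D_hol: "D holomorphic_on U" for U
    unfolding D_def MM_def M_def by (intro holomorphic_det resolvent_matrix_hol)
  have "MM 0 = 1\<^sub>m n"
    by (rule eq_matI) (auto simp: MM_def M_def resolvent_matrix_def e_inj)
  then have D0: "D 0 = 1" by (simp add: D_def)
  have sing: "singular_set S Q = {z. D z = 0}"
  proof (intro equalityI subsetI)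
    fix z assume "z \<in> singular_set S Q"
    then obtain u x where u: "x \<in> S" "u x \<noteq> 0" "\<And>x. x \<in> S \<Longrightarrow> u x = z * (\<Sum>w\<in>S. of_real (Q x w) * u w)"
      by (auto simp: singular_set_def)
    define v where "v = Matrix.vec n (\<lambda>i. u (e i))"
    have "MM z *\<^sub>v v = 0\<^sub>v n"
    proof (rule eq_vecI)
      fix i assume "i < dim_vec (0\<^sub>v n :: complex Matrix.vec)"
      then have i: "i < n" by simp
      have "vec_index (MM z *\<^sub>v v) i = (\<Sum>j = 0..<n. M z i j * u (e j))"
        using i by (simp add: MM_def v_def scalar_prod_def)
      also have "\<dots> = (\<Sum>w\<in>S. resolvent_matrix Q z (e i) w * u w)"
        by (simp add: sum_e M_def)
      also have "\<dots> = u (e i) - z * (\<Sum>w\<in>S. of_real (Q (e i) w) * u w)"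
        using fin eS[OF i]
        by (simp add: resolvent_matrix_def left_diff_distrib sum_subtractf sum_distrib_left mult.assoc
            if_distrib[of "\<lambda>a. a * _"] sum.delta' cong: if_cong)
      also have "\<dots> = 0" using u(3)[OF eS[OF i]] by simp
      finally show "vec_index (MM z *\<^sub>v v) i = vec_index (0\<^sub>v n) i" using i by simp
    qed (simp add: MM_def)
    moreover have "v \<noteq> 0\<^sub>v n"
    proof
      assume "v = 0\<^sub>v n"
      then have "vec_index v (e' x) = 0" using e'[OF u(1)] by simp
      then show False using e'[OF u(1)] u(2) by (simp add: v_def)
    qed
    moreover have "v \<in> carrier_vec n" by (simp add: v_def)
    ultimately show "z \<in> {z. D z = 0}"
      using det_0_iff_vec_prod_zero_field[OF MM[of z]] by (auto simp: D_def)
  next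
    fix z assume "z \<in> {z. D z = 0}"
    then obtain v where v: "v \<in> carrier_vec n" "v \<noteq> 0\<^sub>v n" "MM z *\<^sub>v v = 0\<^sub>v n"
      using det_0_iff_vec_prod_zero_field[OF MM[of z]] by (auto simp: D_def)
    define u where "u x = vec_index v (e' x)" for x
    have "\<exists>i<n. vec_index v i \<noteq> 0"
    proof (rule ccontr)
      assume "\<not> (\<exists>i<n. vec_index v i \<noteq> 0)"
      then have "v = 0\<^sub>v n" using v(1) by (intro eq_vecI) auto
      then show False using v(2) by simp
    qed
    then obtain i where i: "i < n" "vec_index v i \<noteq> 0" by blast
    have "u (e i) \<noteq> 0" using i e'e by (simp add: u_def)
    moreover have "u x = z * (\<Sum>w\<in>S. of_real (Q x w) * u w)" if x: "x \<in> S" for x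
    proof -
      have "0 = vec_index (MM z *\<^sub>v v) (e' x)" using v(3) e'[OF x] by simp
      also have "\<dots> = (\<Sum>j = 0..<n. M z (e' x) j * vec_index v j)"
        using e'[OF x] v(1) by (simp add: MM_def scalar_prod_def)
      also have "\<dots> = (\<Sum>j = 0..<n. resolvent_matrix Q z x (e j) * u (e j))"
        using e'[OF x] by (intro sum.cong) (auto simp: M_def u_def e'e)
      also have "\<dots> = (\<Sum>w\<in>S. resolvent_matrix Q z x w * u w)" by (simp add: sum_e)
      also have "\<dots> = u x - z * (\<Sum>w\<in>S. of_real (Q x w) * u w)"
        using fin x
        by (simp add: resolvent_matrix_def left_diff_distrib sum_subtractf sum_distrib_left mult.assoc
            if_distrib[of "\<lambda>a. a * _"] sum.delta' cong: if_cong)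
      finally show ?thesis by simp
    qed
    ultimately show "z \<in> singular_set S Q" using eS[OF i(1)] unfolding singular_set_def by blast
  qed
  have inv: "inverse_on S (resolvent_matrix Q z) (N z)" if D: "D z \<noteq> 0" for z
  proof -
    note adj = adj_mat[OF MM[of z]]
    have 1: "(\<Sum>w\<in>S. resolvent_matrix Q z x w * N z w y) = (if x = y then 1 else 0)"
      if "x \<in> S" "y \<in> S" for x y
    proof -
      have "(\<Sum>w\<in>S. resolvent_matrix Q z x w * N z w y)
          = (\<Sum>i = 0..<n. M z (e' x) i * adj_mat (MM z) $$ (i, e' y)) / D z"
        using that eS e'e e' by (simp add: sum_e N_def M_def sum_divide_distrib)
      also have "(\<Sum>i = 0..<n. M z (e' x) i * adj_mat (MM z) $$ (i, e' y)) = (MM z * adj_mat (MM z)) $$ (e' x, e' y)"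
        using e'[OF that(1)] e'[OF that(2)] adj(1) by (simp add: MM_def scalar_prod_def)
      also have "\<dots> = (if e' x = e' y then D z else 0)"
        using e'[OF that(1)] e'[OF that(2)] by (simp add: adj(2) D_def)
      also have "(e' x = e' y) = (x = y)" using e'(2)[OF that(1)] e'(2)[OF that(2)] by metis
      finally show ?thesis using D by simp
    qed
    have 2: "(\<Sum>w\<in>S. N z x w * resolvent_matrix Q z w y) = (if x = y then 1 else 0)"
      if "x \<in> S" "y \<in> S" for x y
    proof -
      have "(\<Sum>w\<in>S. N z x w * resolvent_matrix Q z w y)
          = (\<Sum>i = 0..<n. adj_mat (MM z) $$ (e' x, i) * M z i (e' y)) / D z"
        using that eS e'e e' by (simp add: sum_e N_def M_def sum_divide_distrib)
      also have "(\<Sum>i = 0..<n. adj_mat (MM z) $$ (e' x, i) * M z i (e' y)) = (adj_mat (MM z) * MM z) $$ (e' x, e' y)"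
        using e'[OF that(1)] e'[OF that(2)] adj(1) by (simp add: MM_def scalar_prod_def)
      also have "\<dots> = (if e' x = e' y then D z else 0)"
        using e'[OF that(1)] e'[OF that(2)] by (simp add: adj(3) D_def)
      also have "(e' x = e' y) = (x = y)" using e'(2)[OF that(1)] e'(2)[OF that(2)] by metis
      finally show ?thesis using D by simp
    qed
    show ?thesis unfolding inverse_on_def using 1 2 by (auto simp: N_def)
  qed
  have N_hol: "(\<lambda>z. N z x y) holomorphic_on {z. D z \<noteq> 0}" for x y
  proof (cases "x \<in> S \<and> y \<in> S")
    case True
    then have lt: "e' x < n" "e' y < n" using e' by auto
    have "adj_mat (MM z) $$ (e' x, e' y) = (- 1) ^ (e' y + e' x) *
        Determinant.det (Matrix.mat (n - 1) (n - 1) (\<lambda>(i, j). M z (if i < e' y then i else Suc i) (if j < e' x then j else Suc j)))" for z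
    proof -
      have "mat_delete (MM z) (e' y) (e' x)
        = Matrix.mat (n - 1) (n - 1) (\<lambda>(i, j). M z (if i < e' y then i else Suc i) (if j < e' x then j else Suc j))"
        by (rule eq_matI) (auto simp: mat_delete_def MM_def)
      then show ?thesis using lt MM[of z] by (simp add: adj_mat_def cofactor_def)
    qed
    moreover have "(\<lambda>z. Determinant.det (Matrix.mat (n - 1) (n - 1)
        (\<lambda>(i, j). M z (if i < e' y then i else Suc i) (if j < e' x then j else Suc j)))) holomorphic_on U" for U
      by (rule holomorphic_det) (simp only: M_def resolvent_matrix_hol)
    ultimately show ?thesis
      using True by (auto simp: N_def intro!: holomorphic_intros D_hol)
  qed (auto simp: N_def)
  show ?thesis using that[OF D_hol D0 sing inv N_hol] .
qed

context
  fixes S :: "'v set" and Q :: "'v \<Rightarrow> 'v \<Rightarrow> real"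
  assumes fin: "finite S"
begin

lemma resolvent_inverse: "z \<notin> singular_set S Q \<Longrightarrow> inverse_on S (resolvent_matrix Q z) (resolvent S Q z)"
proof -
  assume z: "z \<notin> singular_set S Q"
  obtain D N where DN: "D holomorphic_on UNIV" "D 0 = 1" "singular_set S Q = {z. D z = 0}"
    "\<And>z. D z \<noteq> 0 \<Longrightarrow> inverse_on S (resolvent_matrix Q z) (N z)"
    "\<And>x y. (\<lambda>z. N z x y) holomorphic_on {z. D z \<noteq> 0}"
    by (rule resolvent_exists[OF fin, of Q]) (rule that)
  have "inverse_on S (resolvent_matrix Q z) (N z)" using z DN(3) by (intro DN(4)) simp
  then show ?thesis using matrix_inverse_on_eqI[OF fin] by (simp add: resolvent_def)
qed

text \<open>The singular points are the zeros of an entire function with value 1 at 0: there are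
  none if it is constant, and countably many otherwise.\<close>

lemma singular_set_props:
  shows "closed (singular_set S Q)" "countable (singular_set S Q)"
    and "(\<lambda>z. resolvent S Q z x y) holomorphic_on - singular_set S Q"
proof -
  obtain D N where DN: "D holomorphic_on UNIV" "D 0 = 1" "singular_set S Q = {z. D z = 0}"
    "\<And>z. D z \<noteq> 0 \<Longrightarrow> inverse_on S (resolvent_matrix Q z) (N z)"
    "\<And>x y. (\<lambda>z. N z x y) holomorphic_on {z. D z \<noteq> 0}"
    by (rule resolvent_exists[OF fin, of Q]) (rule that)
  show "closed (singular_set S Q)"
    unfolding DN(3) using holomorphic_on_imp_continuous_on[OF DN(1)]
    by (intro closed_Collect_eq continuous_on_const)
  have "\<not> D constant_on UNIV \<or> (\<forall>z. D z = 1)"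
  proof (cases "D constant_on UNIV")
    case True
    then obtain y where y: "\<And>z. D z = y" by (auto simp: constant_on_def)
    then show ?thesis using DN(2) y[of 0] by simp
  qed simp
  then show "countable (singular_set S Q)"
  proof
    assume "\<not> D constant_on UNIV"
    then have "countable {z \<in> UNIV. D z = 0}"
      by (intro holomorphic_countable_zeros[OF DN(1)] fsigma_UNIV) auto
    then show ?thesis by (simp add: DN(3))
  qed (simp add: DN(3))
  have "resolvent S Q z = N z" if "D z \<noteq> 0" for z
    using matrix_inverse_on_eqI[OF fin DN(4)[OF that]] by (simp add: resolvent_def)
  then show "(\<lambda>z. resolvent S Q z x y) holomorphic_on - singular_set S Q"
    using DN(5)[of x y] by (rule_tac holomorphic_transform[of "\<lambda>z. N z x y"]) (auto simp: DN(3) Collect_neg_eq)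
qed

lemma resolvent_cnj:
  assumes "z \<notin> singular_set S Q"
  shows "resolvent S Q (cnj z) x y = cnj (resolvent S Q z x y)"
proof -
  have I: "inverse_on S (resolvent_matrix Q z) (resolvent S Q z)" using resolvent_inverse[OF assms] .
  have c: "cnj (resolvent_matrix Q z x y) = resolvent_matrix Q (cnj z) x y" for x y
    by (simp add: resolvent_matrix_def)
  have cs: "(\<Sum>w\<in>S. resolvent_matrix Q (cnj z) x w * cnj (resolvent S Q z w y))
      = cnj (\<Sum>w\<in>S. resolvent_matrix Q z x w * resolvent S Q z w y)"
    "(\<Sum>w\<in>S. cnj (resolvent S Q z x w) * resolvent_matrix Q (cnj z) w y)
      = cnj (\<Sum>w\<in>S. resolvent S Q z x w * resolvent_matrix Q z w y)" for x y
    by (simp_all add: cnj_sum c)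
  have "inverse_on S (resolvent_matrix Q (cnj z)) (\<lambda>x y. cnj (resolvent S Q z x y))"
    using I unfolding inverse_on_def cs by simp
  from matrix_inverse_on_eqI[OF fin this] show ?thesis by (simp add: resolvent_def)
qed

lemma resolvent_matrix_sum:
  assumes "x \<in> S"
  shows "(\<Sum>w\<in>S. resolvent_matrix Q z x w * u w) = u x - z * (\<Sum>w\<in>S. of_real (Q x w) * u w)"
  using fin assms
  by (simp add: resolvent_matrix_def left_diff_distrib sum_subtractf sum_distrib_left mult.assoc
      if_distrib[of "\<lambda>a. a * _"] sum.delta' cong: if_cong)

lemma resolvent_solution:
  assumes z: "z \<notin> singular_set S Q"
    and u: "\<And>x. x \<in> S \<Longrightarrow> u x - z * (\<Sum>w\<in>S. of_real (Q x w) * u w) = b x" and x: "x \<in> S"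
  shows "u x = (\<Sum>y\<in>S. resolvent S Q z x y * b y)"
proof -
  have I: "inverse_on S (resolvent_matrix Q z) (resolvent S Q z)" using resolvent_inverse[OF z] .
  have "(\<Sum>y\<in>S. resolvent S Q z x y * b y)
      = (\<Sum>y\<in>S. resolvent S Q z x y * (\<Sum>w\<in>S. resolvent_matrix Q z y w * u w))"
    using u by (intro sum.cong) (auto simp: resolvent_matrix_sum)
  also have "\<dots> = (\<Sum>y\<in>S. \<Sum>w\<in>S. resolvent S Q z x y * resolvent_matrix Q z y w * u w)"
    by (simp add: sum_distrib_left mult.assoc)
  also have "\<dots> = (\<Sum>w\<in>S. \<Sum>y\<in>S. resolvent S Q z x y * resolvent_matrix Q z y w * u w)"
    by (rule sum.swap)
  also have "\<dots> = (\<Sum>w\<in>S. (\<Sum>y\<in>S. resolvent S Q z x y * resolvent_matrix Q z y w) * u w)"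
    by (simp add: sum_distrib_right)
  also have "\<dots> = (\<Sum>w\<in>S. (if x = w then 1 else 0) * u w)"
    using I x by (intro sum.cong) (auto simp: inverse_on_def)
  also have "\<dots> = u x"
    using x fin by (simp add: if_distrib[of "\<lambda>a. a * _"] sum.delta' cong: if_cong)
  finally show ?thesis by simp
qed

lemma resolvent_solves:
  assumes z: "z \<notin> singular_set S Q" and x: "x \<in> S"
    and u: "\<And>x. x \<in> S \<Longrightarrow> u x = (\<Sum>y\<in>S. resolvent S Q z x y * b y)"
  shows "u x - z * (\<Sum>w\<in>S. of_real (Q x w) * u w) = b x"
proof -
  have I: "inverse_on S (resolvent_matrix Q z) (resolvent S Q z)" using resolvent_inverse[OF z] .
  have "u x - z * (\<Sum>w\<in>S. of_real (Q x w) * u w) = (\<Sum>w\<in>S. resolvent_matrix Q z x w * u w)"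
    by (simp add: resolvent_matrix_sum[OF x])
  also have "\<dots> = (\<Sum>w\<in>S. \<Sum>y\<in>S. resolvent_matrix Q z x w * resolvent S Q z w y * b y)"
    using u by (intro sum.cong) (auto simp: sum_distrib_left mult.assoc)
  also have "\<dots> = (\<Sum>y\<in>S. \<Sum>w\<in>S. resolvent_matrix Q z x w * resolvent S Q z w y * b y)"
    by (rule sum.swap)
  also have "\<dots> = (\<Sum>y\<in>S. (\<Sum>w\<in>S. resolvent_matrix Q z x w * resolvent S Q z w y) * b y)"
    by (simp add: sum_distrib_right)
  also have "\<dots> = (\<Sum>y\<in>S. (if x = y then 1 else 0) * b y)"
    using I x by (intro sum.cong) (auto simp: inverse_on_def)
  also have "\<dots> = b x"
    using x fin by (simp add: if_distrib[of "\<lambda>a. a * _"] sum.delta' cong: if_cong)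
  finally show ?thesis .
qed

end

text \<open>Relabelling rows and columns; it will be applied to isomorphisms of cell graphs. A
  column of the second resolvent, pulled back along \<alpha>, solves the linear system that
  determines the column of the first.\<close>

lemma singular_set_bij:
  assumes \<alpha>: "bij_betw \<alpha> S S'" and Q: "\<And>x y. x \<in> S \<Longrightarrow> y \<in> S \<Longrightarrow> Q' (\<alpha> x) (\<alpha> y) = Q x y"
    and x: "x \<in> S" "y \<in> S" and fin: "finite S" and z: "z \<notin> singular_set S Q"
  shows "z \<notin> singular_set S' Q'" "resolvent S' Q' z (\<alpha> x) (\<alpha> y) = resolvent S Q z x y"
proof -
  have img: "\<alpha> ` S = S'" "inj_on \<alpha> S" using \<alpha> by (auto simp: bij_betw_def)
  have sum_\<alpha>: "(\<Sum>w\<in>S'. h w) = (\<Sum>w\<in>S. h (\<alpha> w))" for h :: "'b \<Rightarrow> complex"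
    using sum.reindex_bij_betw[OF \<alpha>, of h] by simp
  have fin': "finite S'" using fin img by auto
  show nz: "z \<notin> singular_set S' Q'"
  proof
    assume "z \<in> singular_set S' Q'"
    then obtain u x where u: "x \<in> S'" "u x \<noteq> 0" "\<And>x. x \<in> S' \<Longrightarrow> u x = z * (\<Sum>w\<in>S'. of_real (Q' x w) * u w)"
      by (auto simp: singular_set_def)
    obtain x0 where x0: "x0 \<in> S" "x = \<alpha> x0" using u(1) img by auto
    have "u (\<alpha> x) = z * (\<Sum>w\<in>S. of_real (Q x w) * u (\<alpha> w))" if "x \<in> S" for x
      using u(3)[of "\<alpha> x"] that img Q by (auto simp: sum_\<alpha> intro!: sum.cong)
    then have "z \<in> singular_set S Q"
      using u(2) x0 unfolding singular_set_def by (intro CollectI exI[of _ "\<lambda>x. u (\<alpha> x)"]) auto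
    then show False using z by simp
  qed
  define b where "b w = (if w = \<alpha> y then 1 else 0 :: complex)" for w
  define u where "u w = (\<Sum>v\<in>S'. resolvent S' Q' z w v * b v)" for w
  have yS: "\<alpha> y \<in> S'" "\<alpha> x \<in> S'" using x img by auto
  have u_eq: "u w = resolvent S' Q' z w (\<alpha> y)" for w
    using yS fin' by (simp add: u_def b_def if_distrib sum.delta' cong: if_cong)
  have "u (\<alpha> w) - z * (\<Sum>v\<in>S. of_real (Q w v) * u (\<alpha> v)) = b (\<alpha> w)" if "w \<in> S" for w
  proof -
    have "u (\<alpha> w) - z * (\<Sum>v\<in>S'. of_real (Q' (\<alpha> w) v) * u v) = b (\<alpha> w)"
      by (rule resolvent_solves[OF fin' nz]) (use that img in \<open>auto simp: u_def\<close>)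
    then show ?thesis using that Q by (simp add: sum_\<alpha>)
  qed
  from resolvent_solution[OF fin z this x(1)]
  have "u (\<alpha> x) = (\<Sum>w\<in>S. resolvent S Q z x w * b (\<alpha> w))" .
  also have "\<dots> = (\<Sum>w\<in>S. resolvent S Q z x w * (if w = y then 1 else 0))"
    using img x by (intro sum.cong) (auto simp: b_def inj_on_def)
  also have "\<dots> = resolvent S Q z x y"
    using x fin by (simp add: if_distrib sum.delta' cong: if_cong)
  finally show "resolvent S' Q' z (\<alpha> x) (\<alpha> y) = resolvent S Q z x y" by (simp add: u_eq)
qed

section \<open>Cells and boundaries\<close>

lemma degree_in_eq: "degree_in G x = card (neighbours G x)"
proof -
  have "out_arcs (with_proj G) x = Pair x ` neighbours G x"
    by (auto simp: out_arcs_def image_iff)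
  then show ?thesis by (simp add: out_degree_def card_image inj_on_def)
qed

lemma graph_isomorphism_compose:
  assumes f: "graph_isomorphism f X Y" and g: "graph_isomorphism g Y Z"
  shows "graph_isomorphism (g \<circ> f) X Z"
proof -
  have "f x \<in> pverts Y" if "x \<in> pverts X" for x
    using f that by (auto simp: graph_isomorphism_def bij_betw_def)
  then show ?thesis
    using f g by (auto simp: graph_isomorphism_def intro: bij_betw_trans)
qed

lemma graph_isomorphism_neighbours:
  assumes f: "graph_isomorphism f X Y" and x: "x \<in> pverts X"
    and wf: "\<And>x y. (x, y) \<in> parcs X \<Longrightarrow> y \<in> pverts X" "\<And>x y. (x, y) \<in> parcs Y \<Longrightarrow> y \<in> pverts Y"
  shows "bij_betw f (neighbours X x) (neighbours Y (f x))"
proof -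
  have bij: "bij_betw f (pverts X) (pverts Y)" and
    arcs: "\<And>x y. x \<in> pverts X \<Longrightarrow> y \<in> pverts X \<Longrightarrow> (x, y) \<in> parcs X \<longleftrightarrow> (f x, f y) \<in> parcs Y"
    using f by (auto simp: graph_isomorphism_def)
  have "inj_on f (neighbours X x)"
    using bij wf(1) by (auto simp: bij_betw_def inj_on_def)
  moreover have "f ` neighbours X x = neighbours Y (f x)"
  proof (intro equalityI subsetI)
    fix y assume "y \<in> f ` neighbours X x"
    then show "y \<in> neighbours Y (f x)" using arcs[OF x] wf(1) by auto
  next
    fix y assume y: "y \<in> neighbours Y (f x)"
    then have "y \<in> f ` pverts X" using wf(2) bij by (auto simp: bij_betw_def)
    then obtain w where "w \<in> pverts X" "y = f w" by blast
    then show "y \<in> f ` neighbours X x" using y arcs[OF x] by auto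
  qed
  ultimately show ?thesis by (simp add: bij_betw_def)
qed

locale symmetric_graph =
  fixes X :: "'v pair_pre_digraph"
  assumes bidirected: "pair_bidirected_digraph X"
begin

lemma arc_sym: "(x, y) \<in> parcs X \<Longrightarrow> (y, x) \<in> parcs X"
  using bidirected unfolding pair_bidirected_digraph_def pair_sym_digraph_def pair_sym_digraph_axioms_def
  by (auto simp: symmetric_def dest: symD)

lemma arc_verts: "(x, y) \<in> parcs X \<Longrightarrow> x \<in> pverts X" "(x, y) \<in> parcs X \<Longrightarrow> y \<in> pverts X"
  using bidirected unfolding pair_bidirected_digraph_def pair_sym_digraph_def pair_wf_digraph_def by force+

lemma arc_irrefl: "(x, y) \<in> parcs X \<Longrightarrow> x \<noteq> y"
  using bidirected unfolding pair_bidirected_digraph_def pair_loopfree_digraph_def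
    pair_loopfree_digraph_axioms_def by force

context
  fixes F' :: "'v set"
begin

lemma spanned_wf: "pair_wf_digraph (spanned_subgraph X (pverts X - F'))"
  by unfold_locales (auto simp: spanned_subgraph_def)

interpretation sp: pair_wf_digraph "spanned_subgraph X (pverts X - F')"
  by (rule spanned_wf)

lemma cells_eq: "cells X F' = sp.sccs_verts"
  by (simp add: cells_def)

lemma cell_subset: "C \<in> cells X F' \<Longrightarrow> C \<subseteq> pverts X - F'" "C \<in> cells X F' \<Longrightarrow> C \<noteq> {}"
proof -
  assume C: "C \<in> cells X F'"
  show "C \<subseteq> pverts X - F'"
    using C sp.sccs_verts_subsets unfolding cells_eq by (auto simp: spanned_subgraph_def)
  show "C \<noteq> {}" using C unfolding cells_eq sp.in_sccs_verts_conv_reachable by blast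
qed

lemma in_some_cell: "x \<in> pverts X - F' \<Longrightarrow> \<exists>C\<in>cells X F'. x \<in> C"
proof -
  assume "x \<in> pverts X - F'"
  then have "x \<in> pverts (spanned_subgraph X (pverts X - F'))" by (simp add: spanned_subgraph_def)
  then have "sp.scc_of x \<in> cells X F'" and "x \<in> sp.scc_of x"
    unfolding cells_eq by (rule sp.scc_of_in_sccs_verts, simp add: sp.scc_of_def)
  then show ?thesis by blast
qed

lemma cell_unique: "C \<in> cells X F' \<Longrightarrow> D \<in> cells X F' \<Longrightarrow> x \<in> C \<Longrightarrow> x \<in> D \<Longrightarrow> C = D"
  using sp.sccs_verts_disjoint unfolding cells_eq by blast

lemma cell_closed:
  assumes C: "C \<in> cells X F'" and x: "x \<in> C" and xy: "(x, y) \<in> parcs X" and y: "y \<notin> F'"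
  shows "y \<in> C"
proof (rule ccontr)
  assume nC: "y \<notin> C"
  have "x \<in> pverts X - F'" using cell_subset[OF C] x by blast
  moreover have "y \<in> pverts X - F'" using arc_verts[OF xy] y by blast
  ultimately have "(x, y) \<in> parcs (spanned_subgraph X (pverts X - F'))"
      "(y, x) \<in> parcs (spanned_subgraph X (pverts X - F'))"
    using xy arc_sym[OF xy] by (auto simp: spanned_subgraph_def)
  then have "reachable (with_proj (spanned_subgraph X (pverts X - F'))) x y"
      "reachable (with_proj (spanned_subgraph X (pverts X - F'))) y x"
    using sp.reachable_adjI by auto
  then show False
    using C x nC unfolding cells_eq sp.in_sccs_verts_conv_reachable by blast
qed

text \<open>A cell is connected, so a property that passes along its arcs spreads over the whole
  cell.\<close>

lemma cell_induct:
  assumes C: "C \<in> cells X F'" and x: "x \<in> C" "P x" and y: "y \<in> C"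
    and step: "\<And>a b. a \<in> C \<Longrightarrow> b \<in> C \<Longrightarrow> (a, b) \<in> parcs X \<Longrightarrow> P a \<Longrightarrow> P b"
  shows "P y"
proof -
  have "reachable (with_proj (spanned_subgraph X (pverts X - F'))) x y"
    using C x(1) y unfolding cells_eq sp.in_sccs_verts_conv_reachable by blast
  then have "y \<in> C \<and> P y"
  proof (induction rule: sp.reachable_induct)
    case base
    then show ?case using x by simp
  next
    case (step a b)
    then have ab: "(a, b) \<in> parcs X" "b \<in> pverts X - F'" by (auto simp: spanned_subgraph_def)
    then have "b \<in> C" using cell_closed[OF C _ ab(1)] step by blast
    then show ?case using assms(5)[of a b] step ab by blast
  qed
  then show ?thesis by blast
qed

end

lemma boundary_subset: "C \<in> cells X F' \<Longrightarrow> boundary X C \<subseteq> F'"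
  using cell_closed[of C F'] by (auto simp: boundary_def)

lemma boundaryI: "C \<in> cells X F' \<Longrightarrow> y \<in> C \<Longrightarrow> (x, y) \<in> parcs X \<Longrightarrow> x \<in> F' \<Longrightarrow> x \<in> boundary X C"
  using cell_subset[of C F'] arc_verts arc_sym by (fastforce simp: boundary_def)

end

section \<open>Cell boundaries, symmetries and degrees in a symmetrically self-similar graph\<close>

locale sss_graph = symmetric_graph X for X :: "'v pair_pre_digraph" +
  fixes F :: "'v set" and \<psi> :: "'v \<Rightarrow> 'v" and v0 :: 'v
  assumes sss: "symmetrically_self_similar X F \<psi>" and origin: "origin_vertex X \<psi> v0"
begin

abbreviation "V \<equiv> pverts X"
abbreviation "E \<equiv> parcs X"
abbreviation "Cells \<equiv> cells X F"
abbreviation "bd \<equiv> boundary X"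
abbreviation "hat C \<equiv> C \<union> boundary X C"
abbreviation "XF \<equiv> reduced_graph X F"

lemma ss: "self_similar X F \<psi>"
  using sss by (simp add: symmetrically_self_similar_def)

lemma F_V: "F \<subseteq> V" and F_indep: "x \<in> F \<Longrightarrow> y \<in> F \<Longrightarrow> (x, y) \<notin> E"
  and V_inf: "infinite V" and iso: "graph_isomorphism \<psi> X XF"
  and conn: "Digraph_Component.connected (with_proj X)"
  using ss by (auto simp: self_similar_def)

lemma bd_inter:
  "C \<in> Cells \<Longrightarrow> D \<in> Cells \<Longrightarrow> x \<in> bd C \<Longrightarrow> x \<in> bd D \<Longrightarrow> y \<in> bd C \<Longrightarrow> y \<in> bd D \<Longrightarrow> x \<noteq> y \<Longrightarrow> C = D"
  using ss unfolding self_similar_def by blast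

lemma finite_nb: "finite (neighbours X x)"
proof (cases "x \<in> V")
  case True
  then show ?thesis using sss by (simp add: symmetrically_self_similar_def locally_finite_def)
next
  case False
  then have "neighbours X x = {}" using arc_verts by auto
  then show ?thesis by simp
qed

lemma finite_cell: "C \<in> Cells \<Longrightarrow> finite C"
  using sss by (simp add: symmetrically_self_similar_def)

lemma finite_bd: "C \<in> Cells \<Longrightarrow> finite (bd C)"
proof -
  assume "C \<in> Cells"
  moreover have "bd C \<subseteq> (\<Union>x\<in>C. neighbours X x)" by (auto simp: boundary_def)
  ultimately show ?thesis using finite_cell finite_nb by (meson finite_UN finite_subset)
qed

lemma finite_hat: "C \<in> Cells \<Longrightarrow> finite (hat C)"
  using finite_cell finite_bd by blast

lemma bd_F: "C \<in> Cells \<Longrightarrow> bd C \<subseteq> F"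
  by (rule boundary_subset)

lemma cell_disj_bd: "C \<inter> bd C = {}"
  by (auto simp: boundary_def)

lemma bij_\<psi>: "bij_betw \<psi> V F"
  using iso by (simp add: graph_isomorphism_def reduced_graph_def)

lemma \<psi>_F: "x \<in> V \<Longrightarrow> \<psi> x \<in> F"
  using bij_\<psi> by (auto simp: bij_betw_def)

lemma \<psi>_inj: "x \<in> V \<Longrightarrow> y \<in> V \<Longrightarrow> \<psi> x = \<psi> y \<longleftrightarrow> x = y"
  using bij_\<psi> by (auto simp: bij_betw_def inj_on_def)

lemma \<psi>_surj: "p \<in> F \<Longrightarrow> \<exists>x\<in>V. p = \<psi> x"
  using bij_\<psi> by (auto simp: bij_betw_def)

lemma \<psi>_arc:
  assumes "x \<in> V" "y \<in> V"
  shows "(x, y) \<in> E \<longleftrightarrow> x \<noteq> y \<and> (\<exists>K\<in>Cells. \<psi> x \<in> bd K \<and> \<psi> y \<in> bd K)"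
proof -
  have "(x, y) \<in> E \<longleftrightarrow> (\<psi> x, \<psi> y) \<in> parcs XF"
    using iso assms by (simp add: graph_isomorphism_def)
  then show ?thesis using assms \<psi>_F \<psi>_inj by (auto simp: reduced_graph_def)
qed

lemma v0_V: "v0 \<in> V" and \<psi>_v0: "\<psi> v0 = v0" and v0_F: "v0 \<in> F"
proof -
  show 1: "v0 \<in> V" and 2: "\<psi> v0 = v0" using origin by (auto simp: origin_vertex_def)
  then show "v0 \<in> F" using \<psi>_F[OF 1] by simp
qed

lemma has_neighbour: "x \<in> V \<Longrightarrow> \<exists>y. (x, y) \<in> E"
proof (rule ccontr)
  assume x: "x \<in> V" and no: "\<nexists>y. (x, y) \<in> E"
  have "V \<noteq> {x}" using V_inf by auto
  then obtain y where y: "y \<in> V" "y \<noteq> x" using x by blast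
  define M where "M = mk_symmetric (with_proj X)"
  have M: "pverts M = V" "parcs M = E"
    using arc_sym by (auto simp: M_def mk_symmetric_def)
  have "strongly_connected (with_proj M)" using conn by (simp add: connected_def M_def)
  then have "(y, x) \<in> rtrancl_on V E"
    using x y by (simp add: strongly_connected_def M reachable_def)
  then have "x = y"
  proof (cases rule: rtrancl_on.cases)
    case (rtrancl_on_into_rtrancl_on b)
    then show ?thesis using no arc_sym by blast
  qed simp
  then show False using y by simp
qed

lemma cg_verts [simp]: "pverts (cell_graph X C) = hat C"
  by (simp add: cell_graph_def spanned_subgraph_def)

lemma cg_arcs: "(x, y) \<in> parcs (cell_graph X C) \<longleftrightarrow> (x, y) \<in> E \<and> x \<in> hat C \<and> y \<in> hat C"
  by (auto simp: cell_graph_def spanned_subgraph_def)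

lemma cg_arc_cell:
  assumes "C \<in> Cells" "(x, y) \<in> parcs (cell_graph X C)"
  shows "x \<in> C \<or> y \<in> C"
  using assms bd_F[OF assms(1)] F_indep by (auto simp: cg_arcs)

lemma cg_sym: "(x, y) \<in> parcs (cell_graph X C) \<Longrightarrow> (y, x) \<in> parcs (cell_graph X C)"
  using arc_sym by (auto simp: cg_arcs)

lemma cg_nb_cell:
  assumes "C \<in> Cells" "x \<in> C"
  shows "neighbours (cell_graph X C) x = neighbours X x"
proof -
  have "y \<in> hat C" if "(x, y) \<in> E" for y
    using assms that arc_verts[OF that] by (auto simp: boundary_def)
  then show ?thesis using assms by (auto simp: cg_arcs)
qed

lemma cg_nb_bd:
  assumes "C \<in> Cells" "x \<in> bd C"
  shows "neighbours (cell_graph X C) x = neighbours X x \<inter> C"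
  using assms bd_F[OF assms(1)] F_indep by (auto simp: cg_arcs)

lemma cg_finite_nb: "finite (neighbours (cell_graph X C) x)"
  by (rule finite_subset[OF _ finite_nb[of x]]) (auto simp: cg_arcs)

lemma cg_has_nb:
  assumes "C \<in> Cells" "x \<in> hat C"
  shows "neighbours (cell_graph X C) x \<noteq> {}"
proof (cases "x \<in> C")
  case True
  then have "x \<in> V" using cell_subset[OF assms(1)] by blast
  then show ?thesis using has_neighbour[of x] cg_nb_cell[OF assms(1) True] by auto
next
  case False
  then have x: "x \<in> bd C" using assms by blast
  then obtain y where "y \<in> C" "(y, x) \<in> E" by (auto simp: boundary_def)
  then show ?thesis using cg_nb_bd[OF assms(1) x] arc_sym by auto
qed

definition m :: "'v set \<Rightarrow> 'v \<Rightarrow> nat" where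
  "m C x = card (neighbours (cell_graph X C) x)"

lemma m_pos: "C \<in> Cells \<Longrightarrow> x \<in> hat C \<Longrightarrow> m C x > 0"
  using cg_has_nb cg_finite_nb by (simp add: m_def card_gt_0_iff)

lemma exists_cell: "\<exists>C\<in>Cells. \<exists>x\<in>bd C. \<exists>y\<in>bd C. x \<noteq> y"
proof -
  obtain y where y: "(v0, y) \<in> E" using has_neighbour v0_V by blast
  then have "y \<in> V" using arc_verts by blast
  then show ?thesis using \<psi>_arc[OF v0_V, of y] y \<psi>_inj[OF v0_V, of y] by blast
qed

text \<open>By \<open>card_bd\<close> all cells have boundaries of this size.\<close>

definition \<theta> :: nat where "\<theta> = card (bd (SOME C. C \<in> Cells))"

lemma cell_iso:
  assumes "C \<in> Cells" "D \<in> Cells"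
  shows "\<exists>\<alpha>. graph_isomorphism \<alpha> (cell_graph X C) (cell_graph X D) \<and> \<alpha> ` bd C = bd D"
  using sss assms by (simp add: symmetrically_self_similar_def)

lemma card_bd:
  assumes "C \<in> Cells"
  shows "card (bd C) = \<theta>"
proof -
  have D: "(SOME C. C \<in> Cells) \<in> Cells" using assms by (rule someI)
  obtain \<alpha> where \<alpha>: "graph_isomorphism \<alpha> (cell_graph X (SOME C. C \<in> Cells)) (cell_graph X C)"
      "\<alpha> ` bd (SOME C. C \<in> Cells) = bd C"
    using cell_iso[OF D assms] by blast
  have "inj_on \<alpha> (bd (SOME C. C \<in> Cells))"
    using \<alpha>(1) unfolding graph_isomorphism_def bij_betw_def by (auto intro: inj_on_subset)
  then show ?thesis using card_image \<alpha>(2) unfolding \<theta>_def by metis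
qed

lemma \<theta>_ge_2: "\<theta> \<ge> 2"
proof -
  obtain C x y where C: "C \<in> Cells" "x \<in> bd C" "y \<in> bd C" "x \<noteq> y" using exists_cell by blast
  have "card {x, y} \<le> card (bd C)" using C finite_bd by (intro card_mono) auto
  then show ?thesis using C card_bd by simp
qed

lemma bd_other:
  assumes "C \<in> Cells"
  shows "\<exists>y\<in>bd C. y \<noteq> x"
proof (rule ccontr)
  assume "\<not> ?thesis"
  then have "bd C \<subseteq> {x}" by blast
  then have "card (bd C) \<le> 1" using card_mono[of "{x}" "bd C"] by simp
  then show False using card_bd[OF assms] \<theta>_ge_2 by simp
qed

text \<open>An isomorphism of the cell graphs is followed by an automorphism of the second one,
  which exists because automorphisms act transitively on pairs of distinct boundary
  vertices.\<close>

lemma cell_iso_pair: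
  assumes C: "C \<in> Cells" "x \<in> bd C" "x' \<in> bd C" "x \<noteq> x'" and D: "D \<in> Cells" "y \<in> bd D" "y' \<in> bd D" "y \<noteq> y'"
  shows "\<exists>\<alpha>. graph_isomorphism \<alpha> (cell_graph X C) (cell_graph X D) \<and> \<alpha> ` bd C = bd D \<and> \<alpha> x = y \<and> \<alpha> x' = y'"
proof -
  obtain \<alpha> where \<alpha>: "graph_isomorphism \<alpha> (cell_graph X C) (cell_graph X D)" "\<alpha> ` bd C = bd D"
    using cell_iso[OF C(1) D(1)] by blast
  have "inj_on \<alpha> (hat C)" using \<alpha>(1) by (simp add: graph_isomorphism_def bij_betw_def)
  then have ne: "\<alpha> x \<noteq> \<alpha> x'" using C by (auto simp: inj_on_def)
  have in_bd: "\<alpha> x \<in> bd D" "\<alpha> x' \<in> bd D" using \<alpha>(2) C by auto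
  have "\<exists>\<beta>. graph_isomorphism \<beta> (cell_graph X D) (cell_graph X D) \<and>
             \<beta> ` bd D = bd D \<and> \<beta> (\<alpha> x) = y \<and> \<beta> (\<alpha> x') = y'"
    using sss D ne in_bd unfolding symmetrically_self_similar_def by blast
  then obtain \<beta> where \<beta>: "graph_isomorphism \<beta> (cell_graph X D) (cell_graph X D)"
             "\<beta> ` bd D = bd D" "\<beta> (\<alpha> x) = y" "\<beta> (\<alpha> x') = y'" by blast
  have "(\<beta> \<circ> \<alpha>) ` bd C = bd D" by (simp only: image_comp[symmetric] \<alpha>(2) \<beta>(2))
  then show ?thesis
    using graph_isomorphism_compose[OF \<alpha>(1) \<beta>(1)] \<beta>(3,4)
    by (intro exI[of _ "\<beta> \<circ> \<alpha>"]) simp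
qed

lemma cell_iso_vertex:
  assumes C: "C \<in> Cells" "x \<in> bd C" and D: "D \<in> Cells" "y \<in> bd D"
  shows "\<exists>\<alpha>. graph_isomorphism \<alpha> (cell_graph X C) (cell_graph X D) \<and> \<alpha> ` bd C = bd D \<and> \<alpha> x = y"
proof -
  obtain x' where x': "x' \<in> bd C" "x' \<noteq> x" using bd_other[OF C(1)] by blast
  obtain y' where y': "y' \<in> bd D" "y' \<noteq> y" using bd_other[OF D(1)] by blast
  show ?thesis using cell_iso_pair[OF C x'(1) _ D y'(1)] x' y' by blast
qed

lemma cell_iso_m:
  assumes "graph_isomorphism \<alpha> (cell_graph X C) (cell_graph X D)" "x \<in> hat C"
  shows "m D (\<alpha> x) = m C x"
  using bij_betw_same_card[OF graph_isomorphism_neighbours[OF assms(1), of x]] assms(2)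
  by (simp add: m_def cg_arcs)

definition cells_at :: "'v \<Rightarrow> 'v set set" where
  "cells_at x = {C \<in> Cells. x \<in> bd C}"

text \<open>No two vertices of \<open>F\<close> are adjacent, so every neighbour of \<open>x\<close>
  lies in a cell, and \<open>x\<close> is then on the boundary of that cell.\<close>

lemma neighbours_split:
  assumes "x \<in> F"
  shows "neighbours X x = (\<Union>C\<in>cells_at x. neighbours X x \<inter> C)"
proof (intro equalityI subsetI)
  fix y assume "y \<in> neighbours X x"
  then have xy: "(x, y) \<in> E" by simp
  then have "y \<in> V - F" using arc_verts F_indep[OF assms] by blast
  then obtain C where C: "C \<in> Cells" "y \<in> C" using in_some_cell by blast
  then have "x \<in> bd C" using boundaryI xy assms by blast
  then show "y \<in> (\<Union>C\<in>cells_at x. neighbours X x \<inter> C)" using C xy by (auto simp: cells_at_def)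
qed auto

text \<open>Every cell at \<open>x\<close> contains a neighbour of \<open>x\<close>, and cells are
  disjoint; so there are at most as many cells as neighbours.\<close>

lemma cells_at_finite:
  assumes "x \<in> F"
  shows "finite (cells_at x)"
proof -
  define h where "h C = (SOME y. y \<in> neighbours X x \<inter> C)" for C
  have h: "h C \<in> neighbours X x \<inter> C" if "C \<in> cells_at x" for C
  proof -
    have "neighbours X x \<inter> C \<noteq> {}"
      using that cg_nb_bd[of C x] cg_has_nb[of C x] by (auto simp: cells_at_def)
    then show ?thesis unfolding h_def by (meson ex_in_conv someI_ex)
  qed
  have "inj_on h (cells_at x)"
  proof (rule inj_onI)
    fix C D assume CD: "C \<in> cells_at x" "D \<in> cells_at x" "h C = h D"
    then show "C = D" using h[OF CD(1)] h[OF CD(2)] cell_unique[of C F D "h C"] by (auto simp: cells_at_def)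
  qed
  moreover have "h ` cells_at x \<subseteq> neighbours X x" using h by blast
  ultimately show ?thesis using finite_nb finite_imageD finite_subset by metis
qed

lemma sum_neighbours_F:
  fixes g :: "'v \<Rightarrow> 'a :: comm_monoid_add"
  assumes "x \<in> F"
  shows "(\<Sum>y\<in>neighbours X x. g y) = (\<Sum>C\<in>cells_at x. \<Sum>y\<in>neighbours (cell_graph X C) x. g y)"
proof -
  have "(\<Sum>y\<in>neighbours X x. g y) = (\<Sum>y\<in>(\<Union>C\<in>cells_at x. neighbours X x \<inter> C). g y)"
    using neighbours_split[OF assms] by simp
  also have "\<dots> = (\<Sum>C\<in>cells_at x. \<Sum>y\<in>neighbours X x \<inter> C. g y)"
    by (rule sum.UNION_disjoint[OF cells_at_finite[OF assms]])
       (use finite_nb cell_unique[of _ F] in \<open>auto simp: cells_at_def\<close>)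
  also have "\<dots> = (\<Sum>C\<in>cells_at x. \<Sum>y\<in>neighbours (cell_graph X C) x. g y)"
    using cg_nb_bd by (intro sum.cong) (auto simp: cells_at_def)
  finally show ?thesis .
qed

lemma reduced_neighbours:
  assumes "x \<in> F"
  shows "neighbours XF x = (\<Union>C\<in>cells_at x. bd C - {x})"
  using assms bd_F by (auto simp: reduced_graph_def cells_at_def)

text \<open>Different cells share at most one boundary vertex. For cells at \<open>x\<close> this is
  \<open>x\<close> itself, so the rest of their boundaries is disjoint.\<close>

lemma sum_reduced_neighbours:
  fixes g :: "'v \<Rightarrow> 'a :: comm_monoid_add"
  assumes "x \<in> F"
  shows "(\<Sum>y\<in>neighbours XF x. g y) = (\<Sum>C\<in>cells_at x. \<Sum>y\<in>bd C - {x}. g y)"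
  unfolding reduced_neighbours[OF assms]
proof (rule sum.UNION_disjoint[OF cells_at_finite[OF assms]])
  show "\<forall>C\<in>cells_at x. finite (bd C - {x})" using finite_bd by (auto simp: cells_at_def)
  show "\<forall>C\<in>cells_at x. \<forall>D\<in>cells_at x. C \<noteq> D \<longrightarrow> (bd C - {x}) \<inter> (bd D - {x}) = {}"
    using bd_inter unfolding cells_at_def by blast
qed

lemma \<psi>_neighbours: "x \<in> V \<Longrightarrow> bij_betw \<psi> (neighbours X x) (neighbours XF (\<psi> x))"
  by (rule graph_isomorphism_neighbours[OF iso]) (auto simp: reduced_graph_def dest: arc_verts)

lemma card_bd_minus: "C \<in> Cells \<Longrightarrow> x \<in> bd C \<Longrightarrow> card (bd C - {x}) = \<theta> - 1"
  using finite_bd card_bd by simp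

lemma card_reduced_neighbours:
  assumes "x \<in> F"
  shows "card (neighbours XF x) = card (cells_at x) * (\<theta> - 1)"
proof -
  have "card (neighbours XF x) = (\<Sum>C\<in>cells_at x. \<Sum>y\<in>bd C - {x}. 1)"
    using sum_reduced_neighbours[OF assms, of "\<lambda>_. 1 :: nat"] by (simp only: card_eq_sum)
  also have "\<dots> = (\<Sum>C\<in>cells_at x. \<theta> - 1)"
    using card_bd_minus[of _ x] by (intro sum.cong refl) (simp only: card_eq_sum[symmetric] cells_at_def mem_Collect_eq)
  finally show ?thesis by simp
qed

text \<open>The origin has the same degree in \<open>X\<close> and in the reduced graph.\<close>

lemma m_bd:
  assumes C: "C \<in> Cells" "x \<in> bd C"
  shows "m C x = \<theta> - 1"
proof -
  have m: "m D v0 = m C x" if "D \<in> cells_at v0" for D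
  proof -
    have D: "D \<in> Cells" "v0 \<in> bd D" using that by (auto simp: cells_at_def)
    obtain \<alpha> where \<alpha>: "graph_isomorphism \<alpha> (cell_graph X C) (cell_graph X D)" "\<alpha> x = v0"
      using cell_iso_vertex[OF C D] by blast
    have "m D (\<alpha> x) = m C x" by (rule cell_iso_m[OF \<alpha>(1)]) (rule UnI2[OF C(2)])
    then show ?thesis by (simp only: \<alpha>(2))
  qed
  have "card (neighbours X v0) = (\<Sum>D\<in>cells_at v0. m D v0)"
    using sum_neighbours_F[OF v0_F, of "\<lambda>_. 1 :: nat"] by (simp add: m_def)
  also have "\<dots> = card (cells_at v0) * m C x" using m by simp
  finally have 1: "card (neighbours X v0) = card (cells_at v0) * m C x" .
  have 2: "card (neighbours XF v0) = card (cells_at v0) * (\<theta> - 1)"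
    by (rule card_reduced_neighbours[OF v0_F])
  have "card (neighbours X v0) = card (neighbours XF v0)"
    using bij_betw_same_card[OF \<psi>_neighbours[OF v0_V]] \<psi>_v0 by simp
  moreover have "card (neighbours X v0) > 0"
    using has_neighbour[OF v0_V] finite_nb by (auto simp: card_gt_0_iff)
  ultimately show ?thesis using 1 2 by auto
qed

lemma degree_F:
  assumes "x \<in> F"
  shows "card (neighbours X x) = card (cells_at x) * (\<theta> - 1)"
    and "card (neighbours XF x) = card (cells_at x) * (\<theta> - 1)"
proof -
  have "card (neighbours X x) = (\<Sum>D\<in>cells_at x. m D x)"
    using sum_neighbours_F[OF assms, of "\<lambda>_. 1 :: nat"] by (simp add: m_def)
  then show "card (neighbours X x) = card (cells_at x) * (\<theta> - 1)"
    using m_bd by (simp add: cells_at_def)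
qed (rule card_reduced_neighbours[OF assms])

lemma cells_at_pos: "x \<in> F \<Longrightarrow> card (cells_at x) > 0"
proof -
  assume x: "x \<in> F"
  then have "card (neighbours X x) > 0"
    using has_neighbour[of x] F_V finite_nb by (auto simp: card_gt_0_iff)
  then show ?thesis using degree_F(1)[OF x] by auto
qed

end

context sss_graph
begin

section \<open>Cliques and 2-cells\<close>

text \<open>Since \<psi> is an isomorphism onto the reduced graph, these sets are cliques of
  \<open>X\<close> with \<theta> vertices, and every edge of \<open>X\<close> lies in exactly one of
  them.\<close>

definition clique :: "'v set \<Rightarrow> 'v set" where
  "clique K = {a \<in> V. \<psi> a \<in> bd K}"

text \<open>They index the cliques that make up the cell graph of \<open>C\<close>; their number is
  the mass scaling factor.\<close>

definition subcells :: "'v set \<Rightarrow> 'v set set" where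
  "subcells C = {K \<in> Cells. clique K \<subseteq> hat C}"

lemma clique_bij: "K \<in> Cells \<Longrightarrow> bij_betw \<psi> (clique K) (bd K)"
proof -
  assume K: "K \<in> Cells"
  have "\<psi> ` clique K = bd K"
    using \<psi>_surj bd_F[OF K] by (force simp: clique_def)
  then show ?thesis using \<psi>_inj by (auto simp: bij_betw_def inj_on_def clique_def)
qed

lemma clique_card: "K \<in> Cells \<Longrightarrow> card (clique K) = \<theta>" "K \<in> Cells \<Longrightarrow> finite (clique K)"
  using clique_bij bij_betw_same_card bij_betw_finite card_bd finite_bd by metis+

lemma clique_two: "K \<in> Cells \<Longrightarrow> \<exists>a\<in>clique K. \<exists>b\<in>clique K. a \<noteq> b"
proof (rule ccontr)
  assume K: "K \<in> Cells" and no: "\<not> (\<exists>a\<in>clique K. \<exists>b\<in>clique K. a \<noteq> b)"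
  then have "clique K \<subseteq> {SOME a. a \<in> clique K}" by (metis singletonI someI subsetI)
  then have "card (clique K) \<le> 1" using card_mono[of "{SOME a. a \<in> clique K}" "clique K"] by simp
  then show False using clique_card(1)[OF K] \<theta>_ge_2 by simp
qed

lemma clique_arc: "K \<in> Cells \<Longrightarrow> a \<in> clique K \<Longrightarrow> b \<in> clique K \<Longrightarrow> a \<noteq> b \<Longrightarrow> (a, b) \<in> E"
  using \<psi>_arc[of a b] by (auto simp: clique_def)

lemma arc_clique: "(a, b) \<in> E \<Longrightarrow> \<exists>K\<in>Cells. a \<in> clique K \<and> b \<in> clique K"
  using \<psi>_arc[of a b] arc_verts[of a b] by (auto simp: clique_def)

lemma clique_unique:
  "K \<in> Cells \<Longrightarrow> K' \<in> Cells \<Longrightarrow> a \<in> clique K \<Longrightarrow> b \<in> clique K \<Longrightarrow> a \<in> clique K' \<Longrightarrow> b \<in> clique K' \<Longrightarrow>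
    a \<noteq> b \<Longrightarrow> K = K'"
  using bd_inter[of K K' "\<psi> a" "\<psi> b"] \<psi>_inj by (auto simp: clique_def)

lemma clique_in_hat:
  assumes C: "C \<in> Cells" and K: "K \<in> Cells" and a: "a \<in> C" "a \<in> clique K"
  shows "clique K \<subseteq> hat C"
proof
  fix b assume b: "b \<in> clique K"
  show "b \<in> hat C"
  proof (cases "b = a")
    case False
    then have "(a, b) \<in> E" using clique_arc[OF K a(2) b] by blast
    then have "b \<in> neighbours (cell_graph X C) a" using cg_nb_cell[OF C a(1)] by simp
    then show ?thesis by (simp add: cg_arcs)
  qed (use a in simp)
qed

definition offdiag :: "'v set \<Rightarrow> ('v \<times> 'v) set" where
  "offdiag W = {(a, b). a \<in> W \<and> b \<in> W \<and> a \<noteq> b}"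

text \<open>An arc of the cell graph has an endpoint in \<open>C\<close>, since \<open>F\<close>
  spans no edges. The clique through the arc then consists of that endpoint and neighbours of it,
  hence stays in \<open>hat C\<close>.\<close>

lemma cell_arcs_cliques:
  assumes C: "C \<in> Cells"
  shows "parcs (cell_graph X C) = (\<Union>K\<in>subcells C. offdiag (clique K))"
proof (intro equalityI subrelI)
  fix a b assume ab: "(a, b) \<in> parcs (cell_graph X C)"
  then have abE: "(a, b) \<in> E" by (simp add: cg_arcs)
  then obtain K where K: "K \<in> Cells" "a \<in> clique K" "b \<in> clique K" using arc_clique by blast
  have "clique K \<subseteq> hat C"
    using cg_arc_cell[OF C ab] clique_in_hat[OF C K(1)] K by blast
  then show "(a, b) \<in> (\<Union>K\<in>subcells C. offdiag (clique K))"
    using K arc_irrefl[OF abE] by (auto simp: subcells_def offdiag_def)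
next
  fix a b assume "(a, b) \<in> (\<Union>K\<in>subcells C. offdiag (clique K))"
  then obtain K where K: "K \<in> Cells" "clique K \<subseteq> hat C" "a \<in> clique K" "b \<in> clique K" "a \<noteq> b"
    by (auto simp: subcells_def offdiag_def)
  then have "(a, b) \<in> E" using clique_arc by blast
  then show "(a, b) \<in> parcs (cell_graph X C)" using K unfolding cg_arcs by blast
qed

lemma cell_arcs_finite: "C \<in> Cells \<Longrightarrow> finite (parcs (cell_graph X C))"
proof -
  assume C: "C \<in> Cells"
  have "parcs (cell_graph X C) \<subseteq> hat C \<times> hat C" by (auto simp: cell_graph_def spanned_subgraph_def)
  then show ?thesis using finite_hat[OF C] finite_subset by blast
qed

lemma offdiag_card:
  assumes "finite W"
  shows "card (offdiag W) = card W * (card W - 1)"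
proof -
  have "offdiag W = (SIGMA a:W. W - {a})" by (auto simp: offdiag_def)
  then show ?thesis using assms by simp
qed

text \<open>A cell is determined by its clique, and the cliques in question are subsets of a finite
  set.\<close>

lemma subcells_finite: "C \<in> Cells \<Longrightarrow> finite (subcells C)"
proof -
  assume C: "C \<in> Cells"
  have inj: "inj_on clique (subcells C)"
  proof (rule inj_onI)
    fix K K' assume K: "K \<in> subcells C" "K' \<in> subcells C" "clique K = clique K'"
    then have "K \<in> Cells" "K' \<in> Cells" by (auto simp: subcells_def)
    obtain a b where "a \<in> clique K" "b \<in> clique K" "a \<noteq> b"
      using clique_two[OF \<open>K \<in> Cells\<close>] by blast
    then show "K = K'" using clique_unique[OF \<open>K \<in> Cells\<close> \<open>K' \<in> Cells\<close>, of a b] K(3) by simp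
  qed
  have "clique ` subcells C \<subseteq> Pow (hat C)" by (auto simp: subcells_def)
  then have "finite (clique ` subcells C)" using finite_hat[OF C] finite_subset by blast
  then show ?thesis using inj finite_imageD by blast
qed

lemma sum_cell_arcs:
  fixes g :: "'v \<times> 'v \<Rightarrow> 'a :: comm_monoid_add"
  assumes C: "C \<in> Cells"
  shows "(\<Sum>p\<in>parcs (cell_graph X C). g p) = (\<Sum>K\<in>subcells C. \<Sum>p\<in>offdiag (clique K). g p)"
  unfolding cell_arcs_cliques[OF C]
proof (rule sum.UNION_disjoint[OF subcells_finite[OF C]])
  show "\<forall>K\<in>subcells C. finite (offdiag (clique K))"
  proof
    fix K assume "K \<in> subcells C"
    then have "finite (clique K)" using clique_card by (auto simp: subcells_def)
    moreover have "offdiag (clique K) \<subseteq> clique K \<times> clique K" by (auto simp: offdiag_def)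
    ultimately show "finite (offdiag (clique K))" using finite_subset by blast
  qed
  show "\<forall>K\<in>subcells C. \<forall>K'\<in>subcells C. K \<noteq> K' \<longrightarrow> offdiag (clique K) \<inter> offdiag (clique K') = {}"
    using clique_unique unfolding offdiag_def subcells_def by blast
qed

lemma sum_by_vertex:
  fixes g :: "'v \<Rightarrow> 'v \<Rightarrow> 'a :: comm_monoid_add"
  assumes C: "C \<in> Cells"
  shows "(\<Sum>p\<in>parcs (cell_graph X C). g (fst p) (snd p)) = (\<Sum>x\<in>hat C. \<Sum>y\<in>neighbours (cell_graph X C) x. g x y)"
proof -
  have "parcs (cell_graph X C) = (SIGMA x:hat C. neighbours (cell_graph X C) x)"
    by (auto simp: cell_graph_def spanned_subgraph_def)
  then show ?thesis using finite_hat[OF C] cg_finite_nb by (simp add: sum.Sigma case_prod_beta)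
qed

text \<open>Arcs of the cell graph counted by first vertex and by clique.\<close>

lemma sum_m:
  assumes C: "C \<in> Cells"
  shows "(\<Sum>x\<in>hat C. m C x) = card (subcells C) * (\<theta> * (\<theta> - 1))"
proof -
  have "(\<Sum>x\<in>hat C. m C x) = (\<Sum>p\<in>parcs (cell_graph X C). 1)"
    using sum_by_vertex[OF C, of "\<lambda>_ _. 1 :: nat"] by (simp add: m_def)
  also have "\<dots> = (\<Sum>K\<in>subcells C. \<theta> * (\<theta> - 1))"
    unfolding sum_cell_arcs[OF C]
    using offdiag_card clique_card by (intro sum.cong) (auto simp: subcells_def)
  finally show ?thesis by simp
qed

text \<open>This yields \<mu> > 1. Arcs leaving the boundary end in \<open>C\<close>, and reversal
  injects them into the arcs leaving \<open>C\<close>. The total degree is thus at least twice the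
  boundary part \<theta>(\<theta> - 1), which is what a single clique contributes.\<close>

lemma subcells_ge_2:
  assumes C: "C \<in> Cells"
  shows "card (subcells C) \<ge> 2"
proof -
  have bd: "(\<Sum>x\<in>bd C. m C x) = \<theta> * (\<theta> - 1)" using m_bd[OF C] card_bd[OF C] by simp
  have "(\<Sum>x\<in>bd C. m C x) = card (SIGMA x:bd C. neighbours (cell_graph X C) x)"
    using finite_bd[OF C] cg_finite_nb by (simp add: m_def)
  also have "\<dots> \<le> card (SIGMA x:C. neighbours (cell_graph X C) x)"
  proof (rule card_inj_on_le[of prod.swap])
    show "prod.swap ` (SIGMA x:bd C. neighbours (cell_graph X C) x) \<subseteq> (SIGMA x:C. neighbours (cell_graph X C) x)"
    proof
      fix p assume "p \<in> prod.swap ` (SIGMA x:bd C. neighbours (cell_graph X C) x)"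
      then obtain x y where p: "p = (y, x)" "x \<in> bd C" "y \<in> neighbours (cell_graph X C) x" by auto
      then have "y \<in> C" using cg_nb_bd[OF C p(2)] by blast
      moreover have "x \<in> neighbours (cell_graph X C) y" using p(3) cg_sym by simp
      ultimately show "p \<in> (SIGMA x:C. neighbours (cell_graph X C) x)" using p(1) by simp
    qed
    show "finite (SIGMA x:C. neighbours (cell_graph X C) x)"
      using finite_cell[OF C] cg_finite_nb by blast
  qed (auto simp: inj_on_def)
  also have "\<dots> = (\<Sum>x\<in>C. m C x)" using finite_cell[OF C] cg_finite_nb by (simp add: m_def)
  finally have "2 * (\<theta> * (\<theta> - 1)) \<le> (\<Sum>x\<in>C. m C x) + (\<Sum>x\<in>bd C. m C x)" using bd by simp
  also have "\<dots> = (\<Sum>x\<in>hat C. m C x)"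
    using cell_disj_bd finite_cell[OF C] finite_bd[OF C] by (simp add: sum.union_disjoint)
  finally have "2 * (\<theta> * (\<theta> - 1)) \<le> card (subcells C) * (\<theta> * (\<theta> - 1))"
    unfolding sum_m[OF C] .
  moreover have "\<theta> * (\<theta> - 1) > 0" using \<theta>_ge_2 by simp
  ultimately show ?thesis by (simp only: mult_le_cancel2)
qed

text \<open>The 2-cell that contains \<open>\<psi> ` C\<close> consists of \<open>\<psi> ` C\<close> and of the 1-cells in \<open>subcells C\<close>.\<close>

lemma clique_outside: "K \<in> Cells \<Longrightarrow> \<exists>c\<in>clique K. c \<in> V - F"
proof -
  assume K: "K \<in> Cells"
  obtain a b where ab: "a \<in> clique K" "b \<in> clique K" "a \<noteq> b" using clique_two[OF K] by blast
  have "(a, b) \<in> E" by (rule clique_arc[OF K ab])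
  then have "a \<notin> F \<or> b \<notin> F" using F_indep[of a b] by blast
  then obtain c where c: "c \<in> clique K" "c \<notin> F" using ab(1,2) by blast
  have "c \<in> V" using c(1) by (simp add: clique_def)
  then show ?thesis using c by blast
qed

lemma subcell_of_exists:
  assumes K: "K \<in> Cells"
  shows "\<exists>C\<in>Cells. K \<in> subcells C"
proof -
  obtain c where c: "c \<in> clique K" "c \<in> V - F" using clique_outside[OF K] by blast
  obtain C where C: "C \<in> Cells" "c \<in> C" using in_some_cell[OF c(2)] by blast
  have "K \<in> subcells C" using K clique_in_hat[OF C(1) K C(2) c(1)] by (simp add: subcells_def)
  then show ?thesis using C(1) by blast
qed

lemma subcells_of_2cell:
  assumes D: "D \<in> cells X (\<psi> ` F)"
  shows "\<exists>C\<in>Cells. {K \<in> Cells. K \<subseteq> D} = subcells C"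
proof -
  have \<psi>F: "\<psi> ` F \<subseteq> F" using \<psi>_F F_V by blast
  have D_sub: "D \<subseteq> V - \<psi> ` F" using cell_subset(1)[OF D] .
  have closed: "y \<in> D" if "x \<in> D" "(x, y) \<in> E" "y \<notin> \<psi> ` F" for x y
    using that by (rule cell_closed[OF D])
  have K_disj: "y \<notin> \<psi> ` F" if "K \<in> Cells" "y \<in> K" for K y
    using cell_subset(1)[OF that(1)] that(2) \<psi>F by blast
  have cell_in: "K \<subseteq> D" if K: "K \<in> Cells" and x: "x \<in> K" "x \<in> D" for K x
  proof
    fix y assume y: "y \<in> K"
    show "y \<in> D"
    proof (rule cell_induct[where P = "\<lambda>y. y \<in> D", OF K x y])
      fix a b assume ab: "a \<in> K" "b \<in> K" "(a, b) \<in> E" "a \<in> D"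
      show "b \<in> D" by (rule closed[OF ab(4,3) K_disj[OF K ab(2)]])
    qed
  qed
  \<comment> \<open>Membership in the set that is claimed to be the 2-cell of \<open>C\<close>. It
    passes along arcs inside \<open>D\<close>, so by connectedness all of \<open>D\<close> belongs
    to a single \<open>C\<close>.\<close>
  define L where "L x C \<longleftrightarrow> (\<exists>c\<in>C. x = \<psi> c) \<or> (\<exists>K\<in>subcells C. x \<in> K)" for x C
  have L_step: "L y C" if C: "C \<in> Cells" and xy: "x \<in> D" "y \<in> D" "(x, y) \<in> E" "L x C" for x y C
    using xy(4) unfolding L_def
  proof (elim disjE bexE)
    fix c assume c: "c \<in> C" "x = \<psi> c"
    have cV: "c \<in> V" using cell_subset(1)[OF C] c(1) by blast
    have xF: "x \<in> F" using \<psi>_F[OF cV] c(2) by simp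
    have "y \<notin> F" using F_indep[OF xF] xy(3) by blast
    then have "y \<in> V - F" using arc_verts(2)[OF xy(3)] by blast
    then obtain K where K: "K \<in> Cells" "y \<in> K" using in_some_cell[of y F] by blast
    have "x \<in> bd K" by (rule boundaryI[OF K xy(3) xF])
    then have "c \<in> clique K" using cV c(2) by (simp add: clique_def)
    then have "K \<in> subcells C" using clique_in_hat[OF C K(1) c(1)] K(1) by (simp add: subcells_def)
    then show "(\<exists>c\<in>C. y = \<psi> c) \<or> (\<exists>K\<in>subcells C. y \<in> K)" using K(2) by blast
  next
    fix K assume K: "K \<in> subcells C" "x \<in> K"
    then have KC: "K \<in> Cells" "clique K \<subseteq> hat C" by (auto simp: subcells_def)
    show "(\<exists>c\<in>C. y = \<psi> c) \<or> (\<exists>K\<in>subcells C. y \<in> K)"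
    proof (cases "y \<in> F")
      case False
      then have "y \<in> K" by (rule cell_closed[OF KC(1) K(2) xy(3)])
      then show ?thesis using K(1) by blast
    next
      case True
      have y: "y \<in> bd K" by (rule boundaryI[OF KC(1) K(2) arc_sym[OF xy(3)] True])
      obtain c where c: "c \<in> V" "y = \<psi> c" using \<psi>_surj[OF True] by blast
      then have "c \<notin> F" using D_sub xy(2) by blast
      moreover have "c \<in> clique K" using c y by (simp add: clique_def)
      ultimately have "c \<in> C" using KC(2) bd_F[OF C] by blast
      then show ?thesis using c(2) by blast
    qed
  qed
  obtain p where p: "p \<in> D" using cell_subset(2)[OF D] by blast
  have "\<exists>C\<in>Cells. L p C"
  proof (cases "p \<in> F")
    case True
    obtain c where c: "c \<in> V" "p = \<psi> c" using \<psi>_surj[OF True] by blast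
    then have "c \<in> V - F" using D_sub p by blast
    then obtain C where "C \<in> Cells" "c \<in> C" using in_some_cell[of c F] by blast
    then show ?thesis using c(2) unfolding L_def by blast
  next
    case False
    then have "p \<in> V - F" using D_sub p by blast
    then obtain K where K: "K \<in> Cells" "p \<in> K" using in_some_cell[of p F] by blast
    obtain C where "C \<in> Cells" "K \<in> subcells C" using subcell_of_exists[OF K(1)] by blast
    then show ?thesis using K(2) unfolding L_def by blast
  qed
  then obtain C where C: "C \<in> Cells" "L p C" by blast
  have L_D: "L x C" if "x \<in> D" for x
  proof (rule cell_induct[where P = "\<lambda>x. L x C", OF D p C(2) that])
    fix a b assume "a \<in> D" "b \<in> D" "(a, b) \<in> E" "L a C"
    then show "L b C" by (rule L_step[OF C(1)])
  qed
  have L_K: "K \<in> subcells C" if K: "K \<in> Cells" "K \<subseteq> D" for K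
  proof -
    obtain x where x: "x \<in> K" using cell_subset(2)[OF K(1)] by blast
    have xF: "x \<notin> F" using cell_subset(1)[OF K(1)] x by blast
    have "L x C" using L_D x K(2) by blast
    then show ?thesis unfolding L_def
    proof (elim disjE bexE)
      fix c assume "c \<in> C" "x = \<psi> c"
      then show ?thesis using xF \<psi>_F[of c] cell_subset(1)[OF C(1)] by blast
    next
      fix K' assume K': "K' \<in> subcells C" "x \<in> K'"
      then have "K' \<in> Cells" by (simp add: subcells_def)
      then have "K' = K" by (rule cell_unique[OF _ K(1) K'(2) x])
      then show ?thesis using K'(1) by simp
    qed
  qed
  have not\<psi>F: "\<psi> c \<notin> \<psi> ` F" if "c \<in> V - F" for c
  proof
    assume "\<psi> c \<in> \<psi> ` F"
    then obtain c' where "c' \<in> F" "\<psi> c = \<psi> c'" by blast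
    then show False using \<psi>_inj[of c c'] that F_V by blast
  qed
  have bd_D: "\<psi> c \<in> D" if K: "K \<in> Cells" "K \<subseteq> D" and c: "c \<in> clique K" "c \<in> V - F" for K c
  proof -
    have "\<psi> c \<in> bd K" using c(1) by (simp add: clique_def)
    then obtain y where y: "y \<in> K" "(y, \<psi> c) \<in> E" by (auto simp: boundary_def)
    show ?thesis by (rule closed[OF subsetD[OF K(2) y(1)] y(2) not\<psi>F[OF c(2)]])
  qed
  have cell_by_bd: "K \<subseteq> D" if K: "K \<in> Cells" and c: "c \<in> clique K" "\<psi> c \<in> D" for K c
  proof -
    have "\<psi> c \<in> bd K" using c(1) by (simp add: clique_def)
    then obtain y where y: "y \<in> K" "(y, \<psi> c) \<in> E" by (auto simp: boundary_def)
    have "y \<in> D" by (rule closed[OF c(2) arc_sym[OF y(2)] K_disj[OF K y(1)]])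
    then show ?thesis by (rule cell_in[OF K y(1)])
  qed
  have "\<exists>c\<in>C. \<psi> c \<in> D"
  proof -
    have "\<exists>x. x \<in> D \<and> x \<in> F"
    proof (cases "p \<in> F")
      case False
      then have "p \<in> V - F" using D_sub p by blast
      then obtain K where K: "K \<in> Cells" "p \<in> K" using in_some_cell[of p F] by blast
      have KD: "K \<subseteq> D" by (rule cell_in[OF K p])
      obtain c where c: "c \<in> clique K" "c \<in> V - F" using clique_outside[OF K(1)] by blast
      show ?thesis using bd_D[OF K(1) KD c] \<psi>_F[of c] c(2) by blast
    qed (use p in blast)
    then obtain x where x: "x \<in> D" "x \<in> F" by blast
    show ?thesis using L_D[OF x(1)] unfolding L_def
    proof (elim disjE bexE)
      fix K assume "K \<in> subcells C" "x \<in> K"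
      then show ?thesis using cell_subset(1)[of K F] x(2) by (auto simp: subcells_def)
    qed (use x(1) in blast)
  qed
  then obtain c0 where c0: "c0 \<in> C" "\<psi> c0 \<in> D" by blast
  have CV: "c \<in> V - F" if "c \<in> C" for c using cell_subset(1)[OF C(1)] that by blast
  have \<psi>C: "\<psi> c \<in> D" if "c \<in> C" for c
  proof (rule cell_induct[OF C(1) c0(1) _ that, of "\<lambda>c. \<psi> c \<in> D"])
    fix a b assume ab: "a \<in> C" "b \<in> C" "(a, b) \<in> E" "\<psi> a \<in> D"
    obtain K where K: "K \<in> Cells" "a \<in> clique K" "b \<in> clique K" using arc_clique[OF ab(3)] by blast
    show "\<psi> b \<in> D" by (rule bd_D[OF K(1) cell_by_bd[OF K(1,2) ab(4)] K(3) CV[OF ab(2)]])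
  qed (rule c0(2))
  have "K \<subseteq> D" if "K \<in> subcells C" for K
  proof -
    have K: "K \<in> Cells" "clique K \<subseteq> hat C" using that by (auto simp: subcells_def)
    obtain c where c: "c \<in> clique K" "c \<in> V - F" using clique_outside[OF K(1)] by blast
    then have "c \<in> C" using K(2) bd_F[OF C(1)] by blast
    then show ?thesis using cell_by_bd[OF K(1) c(1)] \<psi>C by blast
  qed
  then have "{K \<in> Cells. K \<subseteq> D} = subcells C"
    using L_K by (auto simp: subcells_def)
  then show ?thesis using C(1) by blast
qed

lemma mass_scaling_eq: "\<exists>C\<in>Cells. mass_scaling X F \<psi> = card (subcells C)"
proof -
  obtain C where C: "C \<in> Cells" using exists_cell by blast
  obtain c where c: "c \<in> C" using cell_subset(2)[OF C] by blast
  have cVF: "c \<in> V" "c \<notin> F" using cell_subset(1)[OF C] c by blast+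
  have "\<psi> c \<notin> \<psi> ` F"
  proof
    assume "\<psi> c \<in> \<psi> ` F"
    then obtain c' where "c' \<in> F" "\<psi> c = \<psi> c'" by blast
    then show False using \<psi>_inj[of c c'] cVF F_V by blast
  qed
  then have "\<psi> c \<in> V - \<psi> ` F" using \<psi>_F[OF cVF(1)] F_V by blast
  then obtain D where "D \<in> cells X (\<psi> ` F)" using in_some_cell[of "\<psi> c" "\<psi> ` F"] by blast
  then have "(SOME D. D \<in> cells X (\<psi> ` F)) \<in> cells X (\<psi> ` F)" by (rule someI)
  then obtain C' where "C' \<in> Cells" "{K \<in> Cells. K \<subseteq> (SOME D. D \<in> cells X (\<psi> ` F))} = subcells C'"
    using subcells_of_2cell[of "SOME D. D \<in> cells X (\<psi> ` F)"] by blast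
  then show ?thesis by (auto simp: mass_scaling_def Let_def)
qed

end

context sss_graph
begin

section \<open>The Dirichlet problem on a cell\<close>

abbreviation "Q C B \<equiv> cell_transition_matrix X C B"
abbreviation "sing C B \<equiv> singular_set (hat C) (Q C B)"
abbreviation "N C B z \<equiv> resolvent (hat C) (Q C B) z"

definition av :: "'v set \<Rightarrow> ('v \<Rightarrow> complex) \<Rightarrow> 'v \<Rightarrow> complex" where
  "av C u x = (\<Sum>y\<in>neighbours (cell_graph X C) x. u y) / of_nat (m C x)"

lemma av_cong: "(\<And>y. y \<in> hat C \<Longrightarrow> u y = u' y) \<Longrightarrow> av C u x = av C u' x"
  unfolding av_def by (intro arg_cong2[where f = "(/)"] sum.cong) (auto simp: cg_arcs)

lemma cell_resolvent_eq: "cell_resolvent X C B z = N C B z"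
  unfolding cell_resolvent_def resolvent_def cg_verts
  by (intro arg_cong2[where f = matrix_inverse_on] refl ext) (simp add: resolvent_matrix_def)

lemma Q_sum:
  assumes C: "C \<in> Cells" and x: "x \<in> hat C"
  shows "(\<Sum>w\<in>hat C. of_real (Q C B x w) * u w) = (if x \<in> B then 0 else av C u x)"
proof (cases "x \<in> B")
  case False
  have sub: "neighbours (cell_graph X C) x \<subseteq> hat C" by (auto simp: cg_arcs)
  have "(\<Sum>w\<in>hat C. of_real (Q C B x w) * u w)
      = (\<Sum>w\<in>hat C. if w \<in> neighbours (cell_graph X C) x then u w / of_nat (m C x) else 0)"
    using x False by (intro sum.cong) (auto simp: cell_transition_matrix_def degree_in_eq m_def)
  also have "\<dots> = (\<Sum>w\<in>hat C \<inter> neighbours (cell_graph X C) x. u w / of_nat (m C x))"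
    by (rule sum.inter_restrict[OF finite_hat[OF C], symmetric])
  also have "hat C \<inter> neighbours (cell_graph X C) x = neighbours (cell_graph X C) x" using sub by blast
  finally show ?thesis using False by (simp add: av_def sum_divide_distrib)
qed (simp add: cell_transition_matrix_def)

lemma sing_iff:
  assumes C: "C \<in> Cells"
  shows "z \<in> sing C B \<longleftrightarrow>
    (\<exists>u. (\<exists>x\<in>hat C. u x \<noteq> 0) \<and> (\<forall>x\<in>hat C. u x = (if x \<in> B then 0 else z * av C u x)))"
proof -
  have "(\<forall>x\<in>hat C. u x = z * (\<Sum>w\<in>hat C. of_real (Q C B x w) * u w)) \<longleftrightarrow>
      (\<forall>x\<in>hat C. u x = (if x \<in> B then 0 else z * av C u x))" for u
    by (rule ball_cong[OF refl]) (simp add: Q_sum[OF C])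
  then show ?thesis by (simp add: singular_set_def)
qed

text \<open>In terms of functions, the linear system prescribes the values \<open>b\<close> on
  \<open>B\<close>, and elsewhere the defect \<open>b\<close> from the equation
  \<open>u = z * av C u\<close>.\<close>

lemma dirichlet_solves:
  assumes C: "C \<in> Cells" and z: "z \<notin> sing C B" and x: "x \<in> hat C"
    and u: "\<And>x. x \<in> hat C \<Longrightarrow> u x = (\<Sum>y\<in>hat C. N C B z x y * b y)"
  shows "u x = b x + (if x \<in> B then 0 else z * av C u x)"
  using resolvent_solves[OF finite_hat[OF C] z x u] unfolding Q_sum[OF C x]
  by (simp add: algebra_simps split: if_splits)

lemma dirichlet_unique:
  assumes C: "C \<in> Cells" and z: "z \<notin> sing C B"
    and u: "\<And>x. x \<in> hat C \<Longrightarrow> u x = b x + (if x \<in> B then 0 else z * av C u x)" and x: "x \<in> hat C"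
  shows "u x = (\<Sum>y\<in>hat C. N C B z x y * b y)"
proof (rule resolvent_solution[OF finite_hat[OF C] z _ x])
  fix y assume y: "y \<in> hat C"
  show "u y - z * (\<Sum>w\<in>hat C. of_real (Q C B y w) * u w) = b y"
    unfolding Q_sum[OF C y] using u[OF y] by (simp add: algebra_simps split: if_splits)
qed

lemma resolvent_column:
  assumes C: "C \<in> Cells" and z: "z \<notin> sing C B" and x: "x \<in> hat C" and y: "y \<in> hat C"
  shows "N C B z x y = (if x = y then 1 else 0) + (if x \<in> B then 0 else z * av C (\<lambda>w. N C B z w y) x)"
proof (rule dirichlet_solves[OF C z x, where u = "\<lambda>w. N C B z w y" and b = "\<lambda>x. if x = y then 1 else 0"])
  fix x show "N C B z x y = (\<Sum>w\<in>hat C. N C B z x w * (if w = y then 1 else 0))"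
    using y finite_hat[OF C] by (simp add: if_distrib sum.delta' cong: if_cong)
qed

lemma sum_m_av:
  assumes C: "C \<in> Cells"
  shows "(\<Sum>x\<in>hat C. of_nat (m C x) * a x * av C u x) = (\<Sum>p\<in>parcs (cell_graph X C). a (fst p) * u (snd p))"
proof -
  have "(\<Sum>p\<in>parcs (cell_graph X C). a (fst p) * u (snd p))
      = (\<Sum>x\<in>hat C. \<Sum>y\<in>neighbours (cell_graph X C) x. a x * u y)"
    by (rule sum_by_vertex[OF C])
  also have "\<dots> = (\<Sum>x\<in>hat C. of_nat (m C x) * a x * av C u x)"
  proof (rule sum.cong[OF refl])
    fix x assume "x \<in> hat C"
    then have "m C x \<noteq> 0" using m_pos[OF C, of x] by simp
    then show "(\<Sum>y\<in>neighbours (cell_graph X C) x. a x * u y) = of_nat (m C x) * a x * av C u x"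
      by (simp add: av_def sum_distrib_left[symmetric])
  qed
  finally show ?thesis by simp
qed

lemma arcs_swap:
  fixes g :: "'v \<Rightarrow> 'v \<Rightarrow> 'a :: comm_monoid_add"
  shows "(\<Sum>p\<in>parcs (cell_graph X C). g (snd p) (fst p)) = (\<Sum>p\<in>parcs (cell_graph X C). g (fst p) (snd p))"
  by (rule sum.reindex_bij_witness[of _ prod.swap prod.swap]) (use cg_sym in auto)

text \<open>Weighted by the degrees \<open>m\<close>, averaging becomes a sum over arcs, and arcs
  can be reversed; so it is a symmetric operator.\<close>

lemma green_symmetry:
  assumes C: "C \<in> Cells"
  shows "(\<Sum>x\<in>hat C. of_nat (m C x) * a x * (u x - z * av C u x))
    = (\<Sum>x\<in>hat C. of_nat (m C x) * u x * (a x - z * av C a x))"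
proof -
  have "(\<Sum>x\<in>hat C. of_nat (m C x) * a x * av C u x) = (\<Sum>x\<in>hat C. of_nat (m C x) * u x * av C a x)"
    unfolding sum_m_av[OF C] using arcs_swap[of "\<lambda>x y. u x * a y" C] by (simp add: mult.commute)
  moreover have "(\<Sum>x\<in>hat C. of_nat (m C x) * a x * (u x - z * av C u x))
    = (\<Sum>x\<in>hat C. of_nat (m C x) * a x * u x) - z * (\<Sum>x\<in>hat C. of_nat (m C x) * a x * av C u x)" for a u
    by (simp add: right_diff_distrib sum_subtractf sum_distrib_left mult_ac)
  ultimately show ?thesis by (simp add: mult_ac)
qed

text \<open>The squared norm of \<open>u\<close> with the degrees as weights; as a sum over arcs it
  can be split into cliques.\<close>

definition mass :: "'v set \<Rightarrow> ('v \<Rightarrow> complex) \<Rightarrow> real" where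
  "mass C u = (\<Sum>p\<in>parcs (cell_graph X C). (cmod (u (fst p)))\<^sup>2)"

text \<open>The quadratic form of \<open>av\<close>. Only real parts are summed, because the
  imaginary parts of opposite arcs cancel.\<close>

definition corr :: "'v set \<Rightarrow> ('v \<Rightarrow> complex) \<Rightarrow> real" where
  "corr C u = (\<Sum>p\<in>parcs (cell_graph X C). Re (cnj (u (fst p)) * u (snd p)))"

lemma energy_identity:
  assumes C: "C \<in> Cells"
  shows "(\<Sum>x\<in>hat C. of_nat (m C x) * cnj (u x) * (u x - z * av C u x))
    = of_real (mass C u) - z * of_real (corr C u)"
proof -
  let ?A = "parcs (cell_graph X C)"
  define e where "e = (\<Sum>p\<in>?A. cnj (u (fst p)) * u (snd p))"
  have "cnj e = (\<Sum>p\<in>?A. cnj (u (snd p)) * u (fst p))"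
    by (simp add: e_def cnj_sum mult.commute)
  also have "\<dots> = e" unfolding e_def by (rule arcs_swap[of "\<lambda>x y. cnj (u x) * u y" C])
  finally have "Im e = 0" by (metis complex_cnj_cancel_iff complex_is_Real_iff Reals_cnj_iff)
  then have e: "e = of_real (corr C u)" by (simp add: complex_eq_iff e_def corr_def)
  have M: "(\<Sum>x\<in>hat C. of_nat (m C x) * cnj (u x) * u x) = of_real (mass C u)"
  proof -
    have "mass C u = (\<Sum>x\<in>hat C. real (m C x) * (cmod (u x))\<^sup>2)"
      unfolding mass_def
      by (subst sum_by_vertex[OF C, of "\<lambda>x y. (cmod (u x))\<^sup>2"]) (simp add: m_def)
    moreover have "of_nat (m C x) * cnj (u x) * u x = of_real (real (m C x) * (cmod (u x))\<^sup>2)" for x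
    proof -
      have "of_real (real (m C x) * (cmod (u x))\<^sup>2) = of_nat (m C x) * (u x * cnj (u x))"
        by (simp only: complex_norm_square of_real_mult of_real_of_nat_eq)
      then show ?thesis by (simp only: mult_ac)
    qed
    ultimately show ?thesis by (simp only: of_real_sum)
  qed
  have "(\<Sum>x\<in>hat C. of_nat (m C x) * cnj (u x) * (u x - z * av C u x))
     = (\<Sum>x\<in>hat C. of_nat (m C x) * cnj (u x) * u x)
       - z * (\<Sum>x\<in>hat C. of_nat (m C x) * cnj (u x) * av C u x)"
    by (simp add: right_diff_distrib sum_subtractf sum_distrib_left mult_ac)
  then show ?thesis unfolding M sum_m_av[OF C] e_def[symmetric] e .
qed

lemma mass_minus_corr: "mass C u - corr C u = (\<Sum>p\<in>parcs (cell_graph X C). (cmod (u (fst p) - u (snd p)))\<^sup>2) / 2"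
proof -
  let ?A = "parcs (cell_graph X C)"
  have "(\<Sum>p\<in>?A. (cmod (u (fst p) - u (snd p)))\<^sup>2)
      = (\<Sum>p\<in>?A. (cmod (u (fst p)))\<^sup>2 + (cmod (u (snd p)))\<^sup>2 - 2 * Re (cnj (u (fst p)) * u (snd p)))"
    by (intro sum.cong refl) (unfold cmod_power2, simp add: power2_eq_square algebra_simps)
  also have "\<dots> = mass C u + (\<Sum>p\<in>?A. (cmod (u (snd p)))\<^sup>2) - 2 * corr C u"
    by (simp add: sum.distrib sum_subtractf mass_def corr_def sum_distrib_left)
  also have "(\<Sum>p\<in>?A. (cmod (u (snd p)))\<^sup>2) = mass C u"
    unfolding mass_def by (rule arcs_swap[of "\<lambda>x y. (cmod (u x))\<^sup>2" C])
  finally show ?thesis by simp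
qed

lemma corr_le: "corr C u \<le> mass C u"
proof -
  have "0 \<le> mass C u - corr C u" unfolding mass_minus_corr by (simp add: sum_nonneg)
  then show ?thesis by simp
qed

text \<open>Zero energy makes \<open>u\<close> equal at the ends of every arc; the cell is
  connected, and every boundary vertex has a neighbour in it.\<close>

lemma constant_of_energy:
  assumes C: "C \<in> Cells" and u: "mass C u = corr C u" and xy: "x \<in> hat C" "y \<in> hat C"
  shows "u x = u y"
proof -
  have "(\<Sum>p\<in>parcs (cell_graph X C). (cmod (u (fst p) - u (snd p)))\<^sup>2) = 0"
    using mass_minus_corr[of C u] u by simp
  then have "\<forall>p\<in>parcs (cell_graph X C). (cmod (u (fst p) - u (snd p)))\<^sup>2 = 0"
    by (subst (asm) sum_nonneg_eq_0_iff[OF cell_arcs_finite[OF C]]) auto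
  then have arc: "u a = u b" if "(a, b) \<in> parcs (cell_graph X C)" for a b using that by force
  obtain c where c: "c \<in> C" using cell_subset(2)[OF C] by blast
  have in_C: "u x = u c" if "x \<in> C" for x
  proof (rule cell_induct[where P = "\<lambda>x. u x = u c", OF C c refl that])
    fix a b assume "a \<in> C" "b \<in> C" "(a, b) \<in> E" "u a = u c"
    then show "u b = u c" using arc[of a b] by (simp add: cg_arcs)
  qed
  have "u x = u c" if hx: "x \<in> hat C" for x
  proof (cases "x \<in> C")
    case False
    then have x: "x \<in> bd C" using hx by blast
    obtain y where y: "y \<in> neighbours (cell_graph X C) x" using cg_has_nb[OF C hx] by blast
    then have "y \<in> C" using cg_nb_bd[OF C x] by blast
    then show ?thesis using in_C arc[of x y] y by simp
  qed (rule in_C)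
  then show ?thesis using xy by simp
qed

lemma mass_pos:
  assumes C: "C \<in> Cells" and x: "x \<in> hat C" "u x \<noteq> 0"
  shows "mass C u > 0"
proof -
  obtain y where "(x, y) \<in> parcs (cell_graph X C)" using cg_has_nb[OF C x(1)] by blast
  then show ?thesis unfolding mass_def
    using x(2) by (intro sum_pos2[OF cell_arcs_finite[OF C]]) auto
qed

text \<open>On a clique \<open>W\<close> the combination below is \<open>(\<theta> - 1) * |\<Sum>a\<in>W. u a|\<^sup>2\<close>.\<close>

lemma corr_ge:
  assumes C: "C \<in> Cells"
  shows "- mass C u \<le> real (\<theta> - 1) * corr C u"
proof -
  have *: "(\<Sum>p\<in>offdiag W. (cmod (u (fst p)))\<^sup>2 + real (card W - 1) * Re (cnj (u (fst p)) * u (snd p))) \<ge> 0"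
    if W: "finite W" for W
  proof -
    have off: "offdiag W = (SIGMA a:W. W - {a})" by (auto simp: offdiag_def)
    have "(\<Sum>p\<in>offdiag W. (cmod (u (fst p)))\<^sup>2 + real (card W - 1) * Re (cnj (u (fst p)) * u (snd p)))
        = (\<Sum>a\<in>W. \<Sum>b\<in>W - {a}. (cmod (u a))\<^sup>2 + real (card W - 1) * Re (cnj (u a) * u b))"
      unfolding off using W by (simp add: sum.Sigma case_prod_beta)
    also have "\<dots> = (\<Sum>a\<in>W. real (card W - 1) * Re (cnj (u a) * (\<Sum>b\<in>W. u b)))"
    proof (rule sum.cong[OF refl])
      fix a assume a: "a \<in> W"
      have sq: "(cmod (u a))\<^sup>2 = Re (cnj (u a) * u a)"
        unfolding cmod_power2 by (simp add: power2_eq_square)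
      have "(\<Sum>b\<in>W - {a}. (cmod (u a))\<^sup>2 + real (card W - 1) * Re (cnj (u a) * u b))
          = real (card W - 1) * (cmod (u a))\<^sup>2 + (\<Sum>b\<in>W - {a}. real (card W - 1) * Re (cnj (u a) * u b))"
        using W a by (simp only: sum.distrib sum_constant card_Diff_singleton)
      also have "(\<Sum>b\<in>W - {a}. real (card W - 1) * Re (cnj (u a) * u b))
          = real (card W - 1) * Re (cnj (u a) * (\<Sum>b\<in>W - {a}. u b))"
        by (simp only: sum_distrib_left Re_sum)
      also have "real (card W - 1) * (cmod (u a))\<^sup>2 + \<dots>
          = real (card W - 1) * (Re (cnj (u a) * u a) + Re (cnj (u a) * (\<Sum>b\<in>W - {a}. u b)))"
        by (simp only: sq distrib_left)
      also have "Re (cnj (u a) * u a) + Re (cnj (u a) * (\<Sum>b\<in>W - {a}. u b)) = Re (cnj (u a) * (\<Sum>b\<in>W. u b))"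
        using sum.remove[OF W a, of u] by (simp only: distrib_left plus_complex.sel)
      finally show "(\<Sum>b\<in>W - {a}. (cmod (u a))\<^sup>2 + real (card W - 1) * Re (cnj (u a) * u b))
        = real (card W - 1) * Re (cnj (u a) * (\<Sum>b\<in>W. u b))" .
    qed
    also have "\<dots> = real (card W - 1) * Re ((\<Sum>a\<in>W. cnj (u a)) * (\<Sum>b\<in>W. u b))"
      by (simp only: sum_distrib_left[symmetric] Re_sum[symmetric] sum_distrib_right[symmetric])
    also have "(\<Sum>a\<in>W. cnj (u a)) = cnj (\<Sum>b\<in>W. u b)" by (simp add: cnj_sum)
    also have "Re (cnj (\<Sum>b\<in>W. u b) * (\<Sum>b\<in>W. u b)) = (cmod (\<Sum>b\<in>W. u b))\<^sup>2"
      unfolding cmod_power2 times_complex.sel complex_cnj by (simp add: power2_eq_square sum_negf)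
    finally show ?thesis by simp
  qed
  have "mass C u + real (\<theta> - 1) * corr C u
      = (\<Sum>p\<in>parcs (cell_graph X C). (cmod (u (fst p)))\<^sup>2 + real (\<theta> - 1) * Re (cnj (u (fst p)) * u (snd p)))"
    unfolding mass_def corr_def sum.distrib sum_distrib_left ..
  also have "\<dots> = (\<Sum>K\<in>subcells C. \<Sum>p\<in>offdiag (clique K).
      (cmod (u (fst p)))\<^sup>2 + real (\<theta> - 1) * Re (cnj (u (fst p)) * u (snd p)))"
    by (rule sum_cell_arcs[OF C])
  also have "\<dots> \<ge> 0"
  proof (rule sum_nonneg)
    fix K assume "K \<in> subcells C"
    then have "K \<in> Cells" by (simp add: subcells_def)
    then show "0 \<le> (\<Sum>p\<in>offdiag (clique K).
      (cmod (u (fst p)))\<^sup>2 + real (\<theta> - 1) * Re (cnj (u (fst p)) * u (snd p)))"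
      using *[of "clique K"] clique_card[of K] by simp
  qed
  finally show ?thesis by simp
qed

end

text \<open>Equality would force \<open>z\<close> to be the real number \<open>a / e\<close>, which
  the two bounds on \<open>e\<close> place on one of the cuts.\<close>

lemma slit_energy:
  assumes "a > 0" "e \<le> a" "- a \<le> c * e" "c > 0" "z \<in> slit c"
  shows "complex_of_real a \<noteq> z * of_real e"
proof
  assume eq: "complex_of_real a = z * of_real e"
  then have e: "e \<noteq> 0" using assms(1) by auto
  then have "z = of_real (a / e)" using eq by (simp add: field_simps)
  then have z: "Im z = 0" "Re z = a / e" by simp_all
  then have "- c < a / e" "a / e < 1" using assms(5) by (auto simp: slit_def)
  then show False using assms(1-4) e by (cases "e > 0") (auto simp: field_simps)
qed

context sss_graph
begin

section \<open>The transition function\<close>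

text \<open>The constant of \<open>corr_ge\<close>, and therefore the end of the left cut.\<close>

abbreviation "c \<equiv> real (\<theta> - 1)"

lemma c_ge_1: "c \<ge> 1" using \<theta>_ge_2 by simp

text \<open>A null vector would satisfy \<open>mass = z * corr\<close>, which
  \<open>slit_energy\<close> excludes.\<close>

lemma nonsingular_slit:
  assumes C: "C \<in> Cells" and z: "z \<in> slit c"
  shows "z \<notin> sing C B"
proof
  assume "z \<in> sing C B"
  then obtain u x where u: "x \<in> hat C" "u x \<noteq> 0"
    "\<And>x. x \<in> hat C \<Longrightarrow> u x = (if x \<in> B then 0 else z * av C u x)"
    using sing_iff[OF C] by blast
  have "of_real (mass C u) - z * of_real (corr C u) = (\<Sum>x\<in>hat C. of_nat (m C x) * cnj (u x) * (u x - z * av C u x))"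
    by (rule energy_identity[OF C, symmetric])
  also have "\<dots> = (\<Sum>x\<in>hat C. 0)"
    using u(3) by (intro sum.cong refl) (auto split: if_splits)
  finally have "of_real (mass C u) = z * of_real (corr C u)" by simp
  then show False
    using slit_energy[OF mass_pos[of C x u, OF C u(1,2)] corr_le corr_ge[OF C] _ z] c_ge_1 by auto
qed

text \<open>At 1, a null vector has zero energy, so it is constant; but it vanishes on
  \<open>B\<close>.\<close>

lemma nonsingular_1:
  assumes C: "C \<in> Cells" and B: "B \<inter> hat C \<noteq> {}"
  shows "1 \<notin> sing C B"
proof
  assume "1 \<in> sing C B"
  then obtain u x where u: "x \<in> hat C" "u x \<noteq> 0"
    "\<And>x. x \<in> hat C \<Longrightarrow> u x = (if x \<in> B then 0 else 1 * av C u x)"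
    using sing_iff[OF C] by blast
  have "of_real (mass C u) - 1 * of_real (corr C u) = (\<Sum>x\<in>hat C. of_nat (m C x) * cnj (u x) * (u x - 1 * av C u x))"
    by (rule energy_identity[OF C, symmetric])
  also have "\<dots> = (\<Sum>x\<in>hat C. 0)"
    using u(3) by (intro sum.cong refl) (auto split: if_splits)
  finally have "complex_of_real (mass C u) = of_real (corr C u)" by simp
  then have "mass C u = corr C u" by (simp only: of_real_eq_iff)
  moreover obtain y where "y \<in> B" "y \<in> hat C" using B by blast
  ultimately have "u x = u y" by (intro constant_of_energy[OF C _ u(1)])
  then show False using u(2) u(3)[OF \<open>y \<in> hat C\<close>] \<open>y \<in> B\<close> by simp
qed

lemma resolvent_transport:
  assumes \<alpha>: "graph_isomorphism \<alpha> (cell_graph X C) (cell_graph X D)" and B: "B \<subseteq> hat C" and C: "C \<in> Cells"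
    and z: "z \<notin> sing C B" and xy: "x \<in> hat C" "y \<in> hat C"
  shows "z \<notin> sing D (\<alpha> ` B)" "N D (\<alpha> ` B) z (\<alpha> x) (\<alpha> y) = N C B z x y"
proof -
  have bij: "bij_betw \<alpha> (hat C) (hat D)" using \<alpha> by (simp add: graph_isomorphism_def)
  have Q: "Q D (\<alpha> ` B) (\<alpha> x) (\<alpha> y) = Q C B x y" if "x \<in> hat C" "y \<in> hat C" for x y
  proof -
    have inj: "inj_on \<alpha> (hat C)" using bij by (simp add: bij_betw_def)
    have "\<alpha> x \<in> \<alpha> ` B \<longleftrightarrow> x \<in> B" by (rule inj_on_image_mem_iff[OF inj that(1) B])
    moreover have "\<alpha> x \<in> hat D" using bij that(1) by (rule bij_betwE[THEN bspec])
    moreover have "(x, y) \<in> parcs (cell_graph X C) \<longleftrightarrow> (\<alpha> x, \<alpha> y) \<in> parcs (cell_graph X D)"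
      using \<alpha> that by (simp add: graph_isomorphism_def)
    moreover have "degree_in (cell_graph X D) (\<alpha> x) = degree_in (cell_graph X C) x"
      using cell_iso_m[OF \<alpha> that(1)] by (simp add: degree_in_eq m_def)
    ultimately show ?thesis using that(1) by (simp add: cell_transition_matrix_def)
  qed
  show "z \<notin> sing D (\<alpha> ` B)" "N D (\<alpha> ` B) z (\<alpha> x) (\<alpha> y) = N C B z x y"
    by (rule singular_set_bij[OF bij Q xy finite_hat[OF C] z], assumption+)+
qed

text \<open>\<open>C0\<close> and \<open>v1\<close> repeat the choice made inside
  \<open>transition_function\<close>, so that \<open>d\<close> can be unfolded to a statement about
  them.\<close>

definition C0 :: "'v set" where
  "C0 = fst (SOME (C, v). C \<in> Cells \<and> v \<in> bd C)"

definition v1 :: 'v where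
  "v1 = snd (SOME (C, v). C \<in> Cells \<and> v \<in> bd C)"

abbreviation "B0 \<equiv> bd C0 - {v1}"

definition Z :: "complex set" where "Z = sing C0 B0"

abbreviation "d \<equiv> transition_function X F"

text \<open>The Green function at \<open>v1\<close> of the walk on the cell graph that is absorbed
  in the other boundary vertices.\<close>

definition f :: "complex \<Rightarrow> complex" where "f z = N C0 B0 z v1 v1"

lemma C0: "C0 \<in> Cells" and v1: "v1 \<in> bd C0"
proof -
  let ?p = "SOME (C, v). C \<in> Cells \<and> v \<in> bd C"
  have "\<exists>p. case p of (C, v) \<Rightarrow> C \<in> Cells \<and> v \<in> bd C" using exists_cell by auto
  then have "case ?p of (C, v) \<Rightarrow> C \<in> Cells \<and> v \<in> bd C" by (rule someI_ex)
  then show "C0 \<in> Cells" "v1 \<in> bd C0" by (auto simp: C0_def v1_def case_prod_beta)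
qed

lemma d_eq: "d z = (\<Sum>w\<in>B0. N C0 B0 z v1 w)"
  unfolding transition_function_def C0_def v1_def Let_def case_prod_beta
    cell_transition_function_def cell_resolvent_eq ..

text \<open>Isomorphisms of cell graphs carry \<open>v1\<close> to \<open>v\<close> and any other
  boundary vertex to any prescribed one. Hence the absorption generating function is the same for
  all targets \<open>w\<close>, and each gets an equal share of \<open>d z\<close>.\<close>

lemma transport:
  assumes z: "z \<notin> Z" and C: "C \<in> Cells" "v \<in> bd C"
  shows "z \<notin> sing C (bd C - {v})" "N C (bd C - {v}) z v v = f z"
    and "w \<in> bd C - {v} \<Longrightarrow> N C (bd C - {v}) z v w = d z / of_nat (\<theta> - 1)"
proof -
  have sub: "B0 \<subseteq> hat C0" by blast
  have *: "z \<notin> sing C (bd C - {v}) \<and> N C (bd C - {v}) z v v = N C0 B0 z v1 v1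
    \<and> N C (bd C - {v}) z v (\<alpha> w) = N C0 B0 z v1 w"
    if \<alpha>: "graph_isomorphism \<alpha> (cell_graph X C0) (cell_graph X C)" "\<alpha> ` bd C0 = bd C" "\<alpha> v1 = v"
      and w: "w \<in> bd C0" for \<alpha> w
  proof -
    have "inj_on \<alpha> (hat C0)" using \<alpha>(1) by (simp add: graph_isomorphism_def bij_betw_def)
    then have "\<alpha> ` B0 = bd C - {v}"
      using inj_on_image_set_diff[of \<alpha> "hat C0" "bd C0" "{v1}"] v1 \<alpha>(2,3) by (simp add: sub)
    then show ?thesis
      using resolvent_transport[OF \<alpha>(1) sub C0 z[unfolded Z_def], of v1 v1]
        resolvent_transport[OF \<alpha>(1) sub C0 z[unfolded Z_def], of v1 w] v1 w \<alpha>(3) by simp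
  qed
  obtain \<alpha> where \<alpha>: "graph_isomorphism \<alpha> (cell_graph X C0) (cell_graph X C)" "\<alpha> ` bd C0 = bd C" "\<alpha> v1 = v"
    using cell_iso_vertex[OF C0 v1 C] by blast
  show "z \<notin> sing C (bd C - {v})" "N C (bd C - {v}) z v v = f z"
    using *[OF \<alpha> v1] by (auto simp: f_def)
  assume w: "w \<in> bd C - {v}"
  have "N C0 B0 z v1 w' = N C (bd C - {v}) z v w" if w': "w' \<in> B0" for w'
  proof -
    obtain \<beta> where \<beta>: "graph_isomorphism \<beta> (cell_graph X C0) (cell_graph X C)" "\<beta> ` bd C0 = bd C"
      "\<beta> v1 = v" "\<beta> w' = w"
      using cell_iso_pair[OF C0 v1 _ _ C, of w' w] w w' by blast
    show ?thesis using *[OF \<beta>(1-3), of w'] \<beta>(4) w' by simp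
  qed
  then have "d z = of_nat (card B0) * N C (bd C - {v}) z v w" by (simp add: d_eq)
  moreover have "card B0 = \<theta> - 1" by (rule card_bd_minus[OF C0 v1])
  moreover have "\<theta> - 1 \<noteq> 0" using \<theta>_ge_2 by simp
  ultimately show "N C (bd C - {v}) z v w = d z / of_nat (\<theta> - 1)" by (simp add: field_simps)
qed

text \<open>The defect of harmonicity at the boundary, in terms of the boundary values.\<close>

lemma residual:
  assumes z: "z \<notin> Z" and C: "C \<in> Cells" "v \<in> bd C" and u: "\<And>x. x \<in> C \<Longrightarrow> u x = z * av C u x"
  shows "f z * (u v - z * av C u v) = u v - d z / of_nat (\<theta> - 1) * (\<Sum>w\<in>bd C - {v}. u w)"
proof -
  let ?B = "bd C - {v}" and ?N = "N C (bd C - {v}) z"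
  \<comment> \<open>With only \<open>bd C - {v}\<close> as absorbing set, \<open>u\<close> solves a
    Dirichlet problem whose data are its values there and its defect at \<open>v\<close>. Row
    \<open>v\<close> of the resolvent, known from \<open>transport\<close>, reads this off.\<close>
  define b where "b x = (if x \<in> ?B then u x else u x - z * av C u x)" for x
  have v: "v \<in> hat C" "v \<notin> C" using C cell_disj_bd by auto
  have "u v = (\<Sum>y\<in>hat C. ?N v y * b y)"
    by (rule dirichlet_unique[OF C(1) transport(1)[OF z C]]) (use v in \<open>auto simp: b_def\<close>)
  also have "\<dots> = (\<Sum>y\<in>bd C. ?N v y * b y)"
    using finite_hat[OF C(1)] u cell_disj_bd[of C] by (intro sum.mono_neutral_right) (auto simp: b_def)
  also have "\<dots> = ?N v v * b v + (\<Sum>y\<in>?B. ?N v y * b y)"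
    by (rule sum.remove[OF finite_bd[OF C(1)] C(2)])
  also have "(\<Sum>y\<in>?B. ?N v y * b y) = (\<Sum>y\<in>?B. d z / of_nat (\<theta> - 1) * u y)"
    using transport(3)[OF z C] by (intro sum.cong) (auto simp: b_def)
  finally have "u v = f z * b v + d z / of_nat (\<theta> - 1) * (\<Sum>y\<in>?B. u y)"
    by (simp only: transport(2)[OF z C] sum_distrib_left)
  moreover have "b v = u v - z * av C u v" by (simp add: b_def)
  ultimately show ?thesis by (simp only: algebra_simps)
qed

lemma harmonic_extension:
  assumes C: "C \<in> Cells" and z: "z \<notin> sing C (bd C)"
  obtains u where "\<And>x. x \<in> bd C \<Longrightarrow> u x = b x" "\<And>x. x \<in> C \<Longrightarrow> u x = z * av C u x"
proof -
  define b' where "b' y = (if y \<in> bd C then b y else 0)" for y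
  define u where "u x = (\<Sum>y\<in>hat C. N C (bd C) z x y * b' y)" for x
  have u: "u x = b' x + (if x \<in> bd C then 0 else z * av C u x)" if "x \<in> hat C" for x
    by (rule dirichlet_solves[OF C z that]) (simp add: u_def)
  show ?thesis
  proof (rule that)
    show "u x = b x" if "x \<in> bd C" for x using u[of x] that by (simp add: b'_def)
    show "u x = z * av C u x" if "x \<in> C" for x
      using u[of x] that cell_disj_bd[of C] by (auto simp: b'_def)
  qed
qed

text \<open>For the harmonic extension of the indicator of \<open>v1\<close>, the right-hand side of
  \<open>residual\<close> is 1, so the factor \<open>f z\<close> on the left cannot vanish.\<close>

lemma f_nonzero:
  assumes z: "z \<notin> Z" "z \<notin> sing C0 (bd C0)"
  shows "f z \<noteq> 0"
proof -
  obtain u where u: "\<And>x. x \<in> bd C0 \<Longrightarrow> u x = (if x = v1 then 1 else 0)" "\<And>x. x \<in> C0 \<Longrightarrow> u x = z * av C0 u x"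
    by (rule harmonic_extension[OF C0 z(2), of "\<lambda>x. if x = v1 then 1 else 0"]) (rule that)
  have "(\<Sum>w\<in>B0. u w) = 0" using u(1) by (intro sum.neutral) auto
  then have "f z * (u v1 - z * av C0 u v1) = 1" using residual[OF z(1) C0 v1 u(2)] u(1)[OF v1] by simp
  then show ?thesis by auto
qed

lemma Z_slit: "Z \<inter> slit c = {}" and Z_1: "1 \<notin> Z"
  and Z_closed: "closed Z" and Z_countable: "countable Z"
proof -
  show "Z \<inter> slit c = {}" using nonsingular_slit[OF C0] by (auto simp: Z_def)
  have "B0 \<inter> hat C0 \<noteq> {}" using bd_other[OF C0, of v1] by blast
  then show "1 \<notin> Z" using nonsingular_1[OF C0] by (simp add: Z_def)
  show "closed Z" "countable Z" unfolding Z_def by (rule singular_set_props[OF finite_hat[OF C0]])+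
qed

lemma d_hol: "d holomorphic_on - Z" and f_hol: "f holomorphic_on - Z"
  unfolding d_eq[abs_def] f_def[abs_def] Z_def
  by (intro holomorphic_intros singular_set_props(3)[OF finite_hat[OF C0]])+

lemma d_cnj: "z \<notin> Z \<Longrightarrow> d (cnj z) = cnj (d z)" and f_cnj: "z \<notin> Z \<Longrightarrow> f (cnj z) = cnj (f z)"
  unfolding d_eq f_def Z_def by (simp_all add: cnj_sum resolvent_cnj[OF finite_hat[OF C0]])

text \<open>The energy has only boundary terms, since \<open>u\<close> solves the equation inside;
  \<open>residual\<close> makes them a form in the boundary values that depends on \<open>z\<close>
  only through \<open>f z\<close> and \<open>d z\<close>.\<close>

lemma energy_of_extension:
  assumes z: "z \<in> slit c" and u: "\<And>x. x \<in> C0 \<Longrightarrow> u x = z * av C0 u x"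
  shows "of_real (mass C0 u) - z * of_real (corr C0 u)
    = of_nat (\<theta> - 1) / f z * (\<Sum>v\<in>bd C0. cnj (u v) * (u v - d z / of_nat (\<theta> - 1) * (\<Sum>w\<in>bd C0 - {v}. u w)))"
proof -
  have zZ: "z \<notin> Z" using Z_slit z by blast
  have f0: "f z \<noteq> 0" using f_nonzero[OF zZ nonsingular_slit[OF C0 z]] .
  have "of_real (mass C0 u) - z * of_real (corr C0 u)
      = (\<Sum>x\<in>hat C0. of_nat (m C0 x) * cnj (u x) * (u x - z * av C0 u x))"
    by (rule energy_identity[OF C0, symmetric])
  also have "\<dots> = (\<Sum>x\<in>bd C0. of_nat (m C0 x) * cnj (u x) * (u x - z * av C0 u x))"
    using finite_hat[OF C0] u cell_disj_bd[of C0] by (intro sum.mono_neutral_right) auto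
  also have "\<dots> = (\<Sum>v\<in>bd C0. of_nat (\<theta> - 1) / f z * (cnj (u v) * (u v - d z / of_nat (\<theta> - 1) * (\<Sum>w\<in>bd C0 - {v}. u w))))"
  proof (rule sum.cong[OF refl])
    fix v assume v: "v \<in> bd C0"
    have "u v - z * av C0 u v = (u v - d z / of_nat (\<theta> - 1) * (\<Sum>w\<in>bd C0 - {v}. u w)) / f z"
      using residual[OF zZ C0 v u] f0 by (simp only: nonzero_eq_divide_eq mult.commute simp_thms)
    then show "of_nat (m C0 v) * cnj (u v) * (u v - z * av C0 u v)
      = of_nat (\<theta> - 1) / f z * (cnj (u v) * (u v - d z / of_nat (\<theta> - 1) * (\<Sum>w\<in>bd C0 - {v}. u w)))"
      unfolding m_bd[OF C0 v] by simp
  qed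
  finally show ?thesis by (simp only: sum_distrib_left)
qed

text \<open>The boundary form has eigenvalue 1 - d(z) on constants and 1 + d(z)/(\<theta> - 1) on
  vectors of sum zero. If \<open>d z\<close> lay on a cut, these would be real without having the
  same strict sign, so some nonnegative combination of the two energies would vanish, against
  \<open>slit_energy\<close>.\<close>

lemma d_in_slit:
  assumes z: "z \<in> slit c"
  shows "d z \<in> slit c"
proof (rule ccontr)
  assume nd: "d z \<notin> slit c"
  define \<delta> where "\<delta> = Re (d z)"
  have \<delta>: "d z = of_real \<delta>" "\<delta> \<ge> 1 \<or> \<delta> \<le> - c"
    using nd by (auto simp: slit_def \<delta>_def complex_eq_iff)
  have cpos: "c > 0" using c_ge_1 by linarith
  have ns: "z \<notin> sing C0 (bd C0)" by (rule nonsingular_slit[OF C0 z])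
  have f0: "f z \<noteq> 0" using f_nonzero[OF _ ns] Z_slit z by blast
  obtain w1 where w1: "w1 \<in> bd C0" "w1 \<noteq> v1" using bd_other[OF C0] by blast
  obtain u where u: "\<And>x. x \<in> bd C0 \<Longrightarrow> u x = 1" "\<And>x. x \<in> C0 \<Longrightarrow> u x = z * av C0 u x"
    by (rule harmonic_extension[OF C0 ns, of "\<lambda>x. 1"]) (rule that)
  \<comment> \<open>A simplest boundary vector of sum zero, for the second eigenvalue.\<close>
  define b where "b x = (if x = v1 then 1 else if x = w1 then - 1 else 0 :: complex)" for x
  obtain u' where u': "\<And>x. x \<in> bd C0 \<Longrightarrow> u' x = b x" "\<And>x. x \<in> C0 \<Longrightarrow> u' x = z * av C0 u' x"
    by (rule harmonic_extension[OF C0 ns, of b]) (rule that)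
  have "(\<Sum>v\<in>bd C0. cnj (u v) * (u v - d z / of_nat (\<theta> - 1) * (\<Sum>w\<in>bd C0 - {v}. u w))) = (\<Sum>v\<in>bd C0. 1 - d z)"
  proof (rule sum.cong[OF refl])
    fix v assume v: "v \<in> bd C0"
    have "(\<Sum>w\<in>bd C0 - {v}. u w) = of_nat (\<theta> - 1)"
      using u(1) card_bd_minus[OF C0 v] by simp
    then show "cnj (u v) * (u v - d z / of_nat (\<theta> - 1) * (\<Sum>w\<in>bd C0 - {v}. u w)) = 1 - d z"
      using u(1)[OF v] \<theta>_ge_2 by simp
  qed
  then have 1: "of_real (mass C0 u) - z * of_real (corr C0 u) = of_nat (\<theta> - 1) / f z * (of_nat \<theta> * (1 - d z))"
    using energy_of_extension[OF z u(2)] card_bd[OF C0] by (simp only: sum_constant)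
  have "(\<Sum>v\<in>bd C0. cnj (u' v) * (u' v - d z / of_nat (\<theta> - 1) * (\<Sum>w\<in>bd C0 - {v}. u' w)))
      = (\<Sum>v\<in>{v1, w1}. cnj (u' v) * (u' v - d z / of_nat (\<theta> - 1) * (\<Sum>w\<in>bd C0 - {v}. u' w)))"
    using finite_bd[OF C0] v1 w1 u'(1) by (intro sum.mono_neutral_right) (auto simp: b_def)
  also have "\<dots> = 2 * (1 + d z / of_nat (\<theta> - 1))"
  proof -
    have sum0: "(\<Sum>w\<in>bd C0. u' w) = 0"
    proof -
      have "(\<Sum>w\<in>bd C0. u' w) = (\<Sum>w\<in>{v1, w1}. b w)"
        using finite_bd[OF C0] v1 w1 u'(1) by (intro sum.mono_neutral_cong_right) (auto simp: b_def)
      then show ?thesis using w1 by (simp add: b_def)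
    qed
    have rest: "(\<Sum>w\<in>bd C0 - {v}. u' w) = - u' v" if "v \<in> bd C0" for v
      using sum.remove[OF finite_bd[OF C0] that, of u'] sum0 by (simp add: eq_neg_iff_add_eq_0 add.commute)
    show ?thesis
      using w1 v1 u'(1)[OF v1] u'(1)[OF w1(1)] by (simp add: rest b_def)
  qed
  finally have 2: "of_real (mass C0 u') - z * of_real (corr C0 u')
      = of_nat (\<theta> - 1) / f z * (2 * (1 + d z / of_nat (\<theta> - 1)))"
    using energy_of_extension[OF z u'(2)] by (simp only:)
  have m1: "mass C0 u > 0" by (rule mass_pos[OF C0, of v1]) (use v1 u(1) in auto)
  have m2: "mass C0 u' > 0" by (rule mass_pos[OF C0, of v1]) (use v1 u'(1) in \<open>auto simp: b_def\<close>)
  \<comment> \<open>Weights that cancel the two boundary terms: each is, up to sign, the boundary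
    term of the other function. The sign condition on \<delta> makes both nonnegative.\<close>
  obtain s t :: real where st: "s \<ge> 0" "t \<ge> 0" "s + t > 0" "s * (\<theta> * (1 - \<delta>)) + t * (2 * (1 + \<delta> / c)) = 0"
  proof (cases "\<delta> \<ge> 1")
    case True
    have "1 + \<delta> / c > 0" using True cpos by (simp add: add_pos_nonneg)
    moreover have "real \<theta> * (\<delta> - 1) \<ge> 0" using True by simp
    moreover have "2 * k * (\<theta> * (1 - \<delta>)) + (\<theta> * (\<delta> - 1)) * (2 * k) = 0" for k by (simp add: algebra_simps)
    moreover have "2 * k \<ge> 0" "2 * k + l > 0" if "k > 0" "l \<ge> 0" for k l :: real
      using that by linarith+
    ultimately show ?thesis
      by (intro that[of "2 * (1 + \<delta> / c)" "\<theta> * (\<delta> - 1)"]) (auto simp only:)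
  next
    case False
    then have "\<delta> \<le> - c" using \<delta>(2) by blast
    then have "1 + \<delta> / c \<le> 0" "1 - \<delta> > 0" using cpos by (auto simp: field_simps)
    moreover have "real \<theta> * (1 - \<delta>) > 0" using \<theta>_ge_2 \<open>1 - \<delta> > 0\<close> by simp
    moreover have "- (2 * k) * (\<theta> * (1 - \<delta>)) + (\<theta> * (1 - \<delta>)) * (2 * k) = 0" for k by (simp add: algebra_simps)
    moreover have "- (2 * k) \<ge> 0" "k \<le> 0 \<Longrightarrow> - (2 * k) + l > 0" if "k \<le> 0" "l > 0" for k l :: real
      using that by linarith+
    ultimately show ?thesis
      by (intro that[of "- (2 * (1 + \<delta> / c))" "\<theta> * (1 - \<delta>)"]) (auto simp only: intro: less_imp_le)
  qed
  define M where "M = s * mass C0 u + t * mass C0 u'"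
  define E' where "E' = s * corr C0 u + t * corr C0 u'"
  have "M > 0"
  proof (cases "s = 0")
    case True then show ?thesis using st m2 by (simp add: M_def)
  next
    case False
    then have "s * mass C0 u > 0" using st m1 by simp
    moreover have "t * mass C0 u' \<ge> 0" using st m2 by simp
    ultimately show ?thesis by (simp add: M_def)
  qed
  moreover have "E' \<le> M" unfolding E'_def M_def
    using corr_le st by (intro add_mono mult_left_mono)
  moreover have "- M \<le> c * E'"
  proof -
    have "s * (- mass C0 u) + t * (- mass C0 u') \<le> s * (c * corr C0 u) + t * (c * corr C0 u')"
      using corr_ge[OF C0] st by (intro add_mono mult_left_mono) auto
    then show ?thesis by (simp add: M_def E'_def algebra_simps)
  qed
  ultimately have "complex_of_real M \<noteq> z * of_real E'" using slit_energy[of M E' c z] cpos z by blast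
  moreover have "complex_of_real M - z * of_real E'
     = of_real s * (of_real (mass C0 u) - z * of_real (corr C0 u))
       + of_real t * (of_real (mass C0 u') - z * of_real (corr C0 u'))"
    by (simp add: M_def E'_def algebra_simps)
  moreover have "\<dots> = of_nat (\<theta> - 1) / f z * of_real (s * (\<theta> * (1 - \<delta>)) + t * (2 * (1 + \<delta> / c)))"
    unfolding 1 2 \<delta>(1) of_real_add of_real_mult of_real_diff of_real_divide of_real_of_nat_eq
      of_real_1 of_real_numeral by (simp only: distrib_left mult.left_commute)
  ultimately show False unfolding st(4) by simp
qed

end

section \<open>Size of the transition function in the disc, and its derivative at 1\<close>

context sss_graph
begin

lemma av_bound:
  assumes C: "C \<in> Cells" and x: "x \<in> hat C" and u: "\<And>y. y \<in> neighbours (cell_graph X C) x \<Longrightarrow> cmod (u y) \<le> K"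
  shows "cmod (av C u x) \<le> K"
proof -
  have m: "real (m C x) > 0" using m_pos[OF C x] by simp
  have "cmod (\<Sum>y\<in>neighbours (cell_graph X C) x. u y) \<le> (\<Sum>y\<in>neighbours (cell_graph X C) x. K)"
    by (rule order_trans[OF norm_sum sum_mono[OF u]])
  then have "cmod (\<Sum>y\<in>neighbours (cell_graph X C) x. u y) \<le> K * real (m C x)"
    by (simp add: m_def mult.commute)
  then show ?thesis using m by (simp add: av_def norm_divide pos_divide_le_eq)
qed

text \<open>At a point off \<open>B\<close> where the modulus is largest, averaging cannot increase
  it and the factor \<open>z\<close> shrinks it, so it is 0 there.\<close>

lemma maximum_principle:
  assumes C: "C \<in> Cells" and z: "norm z < 1" and K: "K \<ge> 0"
    and B: "\<And>x. x \<in> hat C \<Longrightarrow> x \<in> B \<Longrightarrow> cmod (u x) \<le> K"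
    and u: "\<And>x. x \<in> hat C \<Longrightarrow> x \<notin> B \<Longrightarrow> u x = z * av C u x" and x: "x \<in> hat C"
  shows "cmod (u x) \<le> K"
proof -
  have fin: "finite ((\<lambda>x. cmod (u x)) ` hat C)" and ne: "(\<lambda>x. cmod (u x)) ` hat C \<noteq> {}"
    using finite_hat[OF C] x by auto
  obtain p where p: "p \<in> hat C" "Max ((\<lambda>x. cmod (u x)) ` hat C) = cmod (u p)"
    using Max_in[OF fin ne] by blast
  have max: "cmod (u y) \<le> cmod (u p)" if "y \<in> hat C" for y
    using Max_ge[OF fin, of "cmod (u y)"] that p(2) by auto
  have "cmod (u p) \<le> K"
  proof (cases "p \<in> B")
    case False
    have "cmod (av C u p) \<le> cmod (u p)"
      by (rule av_bound[OF C p(1)]) (auto simp: cg_arcs intro: max)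
    then have "cmod (u p) \<le> norm z * cmod (u p)"
      using arg_cong[OF u[OF p(1) False], of cmod] mult_left_mono[of "cmod (av C u p)" "cmod (u p)" "norm z"]
      by (simp add: norm_mult)
    then have "(1 - norm z) * cmod (u p) \<le> 0" by (simp add: algebra_simps)
    then have "cmod (u p) \<le> 0" using z by (simp add: mult_le_0_iff)
    then show ?thesis using K by linarith
  qed (rule B[OF p(1)])
  then show ?thesis using max[OF x] by linarith
qed

lemma disc_slit: "norm z < 1 \<Longrightarrow> z \<in> slit c"
  using ball_subset_slit[OF c_ge_1] by auto

text \<open>Boundary vertices are not adjacent, so the walk needs at least two steps from one to
  another. Analytically, one factor \<open>norm z\<close> is gained on the cell and a second at
  \<open>v1\<close>.\<close>

lemma d_small:
  assumes z: "norm z < 1"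
  shows "norm (d z) \<le> (norm z)\<^sup>2"
proof -
  have zs: "z \<notin> sing C0 B0" by (rule nonsingular_slit[OF C0 disc_slit[OF z]])
  define h where "h x = (\<Sum>w\<in>B0. N C0 B0 z x w)" for x
  have h_eq: "h x = (if x \<in> B0 then 1 else 0) + (if x \<in> B0 then 0 else z * av C0 h x)" if "x \<in> hat C0" for x
  proof (rule dirichlet_solves[OF C0 zs that])
    fix x
    have "(\<Sum>y\<in>hat C0. N C0 B0 z x y * (if y \<in> B0 then 1 else 0)) = (\<Sum>y\<in>hat C0. if y \<in> B0 then N C0 B0 z x y else 0)"
      by (intro sum.cong) auto
    also have "\<dots> = (\<Sum>y\<in>hat C0 \<inter> B0. N C0 B0 z x y)" by (rule sum.inter_restrict[OF finite_hat[OF C0], symmetric])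
    also have "hat C0 \<inter> B0 = B0" by blast
    finally show "h x = (\<Sum>y\<in>hat C0. N C0 B0 z x y * (if y \<in> B0 then 1 else 0))" by (simp add: h_def)
  qed
  have h1: "cmod (h x) \<le> 1" if "x \<in> hat C0" for x
    by (rule maximum_principle[OF C0 z _ _ _ that, of 1 B0]) (use h_eq in auto)
  have hC: "cmod (h x) \<le> norm z" if "x \<in> C0" for x
  proof -
    have "cmod (av C0 h x) \<le> 1"
      by (rule av_bound[OF C0]) (use that h1 in \<open>auto simp: cg_arcs\<close>)
    moreover have "h x = z * av C0 h x" using h_eq[of x] that cell_disj_bd[of C0] by auto
    ultimately show ?thesis using mult_left_mono[of "cmod (av C0 h x)" 1 "norm z"] by (simp add: norm_mult)
  qed
  have "cmod (av C0 h v1) \<le> norm z"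
    by (rule av_bound[OF C0]) (use v1 hC cg_nb_bd[OF C0 v1] in auto)
  moreover have "h v1 = z * av C0 h v1" using h_eq[of v1] v1 by auto
  ultimately have "cmod (h v1) \<le> norm z * norm z"
    using mult_left_mono[of "cmod (av C0 h v1)" "norm z" "norm z"] by (simp add: norm_mult)
  then show ?thesis by (simp add: h_def d_eq power2_eq_square)
qed

lemma Z_sub: "C \<in> Cells \<Longrightarrow> v \<in> bd C \<Longrightarrow> z \<in> - Z \<Longrightarrow> z \<notin> sing C (bd C - {v})"
  using transport(1)[of z C v] by blast

lemma d_alt:
  assumes C: "C \<in> Cells" "v \<in> bd C" and z: "z \<notin> Z"
  shows "d z = (\<Sum>w\<in>bd C - {v}. N C (bd C - {v}) z v w)"
proof -
  have "(\<Sum>w\<in>bd C - {v}. N C (bd C - {v}) z v w) = (\<Sum>w\<in>bd C - {v}. d z / of_nat (\<theta> - 1))"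
    by (rule sum.cong[OF refl]) (rule transport(3)[OF z C])
  also have "\<dots> = of_nat (\<theta> - 1) * (d z / of_nat (\<theta> - 1))"
    by (simp only: sum_constant card_bd_minus[OF C])
  also have "\<dots> = d z" using \<theta>_ge_2 by simp
  finally show ?thesis by simp
qed

lemma av_1: "C \<in> Cells \<Longrightarrow> x \<in> hat C \<Longrightarrow> av C (\<lambda>_. a) x = a"
  using m_pos[of C x] by (simp add: av_def m_def)

lemma sum_indicator:
  "C \<in> Cells \<Longrightarrow> B \<subseteq> hat C \<Longrightarrow> (\<Sum>y\<in>hat C. g y * (if y \<in> B then 1 else 0)) = (\<Sum>y\<in>B. g y :: complex)"
proof -
  assume C: "C \<in> Cells" and B: "B \<subseteq> hat C"
  have "(\<Sum>y\<in>hat C. g y * (if y \<in> B then 1 else 0)) = (\<Sum>y\<in>hat C. if y \<in> B then g y else 0)"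
    by (intro sum.cong) auto
  also have "\<dots> = (\<Sum>y\<in>hat C \<inter> B. g y)" by (rule sum.inter_restrict[OF finite_hat[OF C], symmetric])
  also have "hat C \<inter> B = B" using B by blast
  finally show ?thesis .
qed

text \<open>Green's identity for the derivative at 1 of the harmonic function with boundary value 1 on
  \<open>bd C - {v}\<close> and for the column of the resolvent at \<open>v\<close>.\<close>

lemma deriv_d_column:
  assumes C: "C \<in> Cells" and v: "v \<in> bd C"
  shows "of_nat (\<theta> - 1) * deriv d 1 = (\<Sum>x\<in>hat C. of_nat (m C x) * N C (bd C - {v}) 1 x v)"
    and d_1: "d 1 = 1"
proof -
  define B where "B = bd C - {v}"
  have B: "B \<subseteq> hat C" "v \<notin> B" "v \<in> hat C" using v by (auto simp: B_def)
  have op: "open (- Z)" "1 \<in> - Z" using Z_closed Z_1 by auto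
  have ns: "z \<notin> sing C B" if "z \<in> - Z" for z using Z_sub[OF C v that] by (simp add: B_def)
  define h where "h z x = (\<Sum>w\<in>B. N C B z x w)" for z x
  have h_eq: "h z x = (if x \<in> B then 1 else 0) + (if x \<in> B then 0 else z * av C (h z) x)"
    if "x \<in> hat C" "z \<in> - Z" for x z
    by (rule dirichlet_solves[OF C ns[OF that(2)] that(1)]) (simp only: h_def sum_indicator[OF C B(1)])
  have h_1: "h 1 x = 1" if "x \<in> hat C" for x
  proof -
    have "1 = (\<Sum>y\<in>hat C. N C B 1 x y * (if y \<in> B then 1 else 0))"
      by (rule dirichlet_unique[OF C ns[OF op(2)] _ that, where u = "\<lambda>_. 1"]) (simp add: av_1[OF C])
    then show ?thesis by (simp only: h_def sum_indicator[OF C B(1)])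
  qed
  have d_h: "d z = h z v" if "z \<in> - Z" for z
    using d_alt[OF C v, of z] that by (simp add: h_def B_def)
  show "d 1 = 1" using d_h[OF op(2)] h_1[OF B(3)] by simp
  define D where "D x = deriv (\<lambda>z. h z x) 1" for x
  have hol: "(\<lambda>z. h z x) holomorphic_on - Z" for x
  proof -
    have "(\<lambda>z. N C B z x w) holomorphic_on - Z" for w
      by (rule holomorphic_on_subset[OF singular_set_props(3)[OF finite_hat[OF C]]]) (use ns in blast)
    then show ?thesis unfolding h_def by (intro holomorphic_intros)
  qed
  have D: "((\<lambda>z. h z x) has_field_derivative D x) (at 1)" for x
    unfolding D_def by (rule holomorphic_derivI[OF hol op])
  have "(d has_field_derivative D v) (at 1)"
    by (rule has_field_derivative_transform_within_open[OF D op]) (simp add: d_h)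
  then have Dv: "deriv d 1 = D v" by (rule DERIV_imp_deriv)
  have D_B: "D x = 0" if "x \<in> B" for x
  proof -
    have "x \<in> hat C" using that B(1) by blast
    then have "((\<lambda>z. h z x) has_field_derivative 0) (at 1)"
      by (intro has_field_derivative_transform_within_open[OF DERIV_const[of 1] op]) (use that h_eq in auto)
    then show ?thesis by (rule DERIV_unique[OF D])
  qed
  \<comment> \<open>Derivative of \<open>h z x = z * av C (h z) x\<close> at 1, where
    \<open>h 1\<close> is the constant 1.\<close>
  have D_off: "D x = 1 + av C D x" if x: "x \<in> hat C" "x \<notin> B" for x
  proof -
    have av': "((\<lambda>z. av C (h z) x) has_field_derivative av C D x) (at 1)"
      unfolding av_def by (intro DERIV_cdivide DERIV_sum D)
    have "((\<lambda>z. z * av C (h z) x) has_field_derivative 1 * av C (h 1) x + av C D x * 1) (at 1)"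
      by (rule DERIV_mult'[OF DERIV_ident av', THEN DERIV_cong]) simp
    then have "((\<lambda>z. h z x) has_field_derivative 1 * av C (h 1) x + av C D x * 1) (at 1)"
      by (rule has_field_derivative_transform_within_open[OF _ op]) (use h_eq x in auto)
    then have "D x = 1 * av C (h 1) x + av C D x * 1" by (rule DERIV_unique[OF D])
    moreover have "av C (h 1) x = av C (\<lambda>_. 1) x" by (rule av_cong) (rule h_1)
    ultimately show ?thesis using av_1[OF C x(1), of 1] by simp
  qed
  \<comment> \<open>\<open>e\<close> is zero on \<open>B\<close> and harmonic except for defect 1 at
    \<open>v\<close>. Paired with \<open>D\<close>, which is zero on \<open>B\<close> with defect 1
    elsewhere, it isolates \<open>D v\<close> on one side of Green's identity.\<close>
  define e where "e x = N C B 1 x v" for x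
  have e: "e x = (if x = v then 1 else 0) + (if x \<in> B then 0 else 1 * av C e x)" if "x \<in> hat C" for x
    unfolding e_def by (rule resolvent_column[OF C ns[OF op(2)] that B(3)])
  have "(\<Sum>x\<in>hat C. of_nat (m C x) * e x * (D x - 1 * av C D x)) = (\<Sum>x\<in>hat C. of_nat (m C x) * e x)"
  proof (rule sum.cong[OF refl])
    fix x assume x: "x \<in> hat C"
    show "of_nat (m C x) * e x * (D x - 1 * av C D x) = of_nat (m C x) * e x"
      using e[OF x] D_off[OF x] B(2) by (cases "x \<in> B") auto
  qed
  moreover have "(\<Sum>x\<in>hat C. of_nat (m C x) * D x * (e x - 1 * av C e x)) = of_nat (m C v) * D v"
  proof -
    have "(\<Sum>x\<in>hat C. of_nat (m C x) * D x * (e x - 1 * av C e x)) = (\<Sum>x\<in>{v}. of_nat (m C x) * D x * (e x - 1 * av C e x))"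
    proof (rule sum.mono_neutral_right[OF finite_hat[OF C]])
      show "{v} \<subseteq> hat C" using B(3) by blast
      show "\<forall>x\<in>hat C - {v}. of_nat (m C x) * D x * (e x - 1 * av C e x) = 0"
      proof
        fix x assume x: "x \<in> hat C - {v}"
        then have "x \<in> hat C" by blast
        then show "of_nat (m C x) * D x * (e x - 1 * av C e x) = 0"
          using e[of x] D_B[of x] x by (cases "x \<in> B") auto
      qed
    qed
    moreover have "e v - 1 * av C e v = 1" using e[OF B(3)] B(2) by simp
    ultimately show ?thesis by simp
  qed
  ultimately have "of_nat (m C v) * D v = (\<Sum>x\<in>hat C. of_nat (m C x) * e x)"
    using green_symmetry[OF C, of e D 1] by simp
  then show "of_nat (\<theta> - 1) * deriv d 1 = (\<Sum>x\<in>hat C. of_nat (m C x) * N C (bd C - {v}) 1 x v)"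
    by (simp only: m_bd[OF C v] Dv e_def B_def)
qed

text \<open>The identity for one column is summed over all boundary vertices \<open>v\<close>. The
  sum \<open>u\<close> of the columns is harmonic inside with boundary value \<open>f 1\<close>,
  hence constant, and the total degree from \<open>sum_m\<close> leaves the number of
  subcells.\<close>

lemma deriv_d_1: "deriv d 1 = f 1 * of_nat (card (subcells C0))"
proof -
  define e where "e v x = N C0 (bd C0 - {v}) 1 x v" for v x
  have Z1: "1 \<in> - Z" using Z_1 by blast
  have e: "e v x = (if x = v then 1 else 0) + (if x \<in> bd C0 - {v} then 0 else 1 * av C0 (e v) x)"
    if "x \<in> hat C0" "v \<in> bd C0" for v x
    unfolding e_def by (rule resolvent_column[OF C0 Z_sub[OF C0 that(2) Z1] that(1)]) (use that in blast)
  have ef: "e v v = f 1" if "v \<in> bd C0" for v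
    unfolding e_def by (rule transport(2)[OF Z_1 C0 that])
  have e0: "e v x = 0" if "v \<in> bd C0" "x \<in> bd C0" "x \<noteq> v" for v x
    using e[of x v] that by auto
  define u where "u x = (\<Sum>v\<in>bd C0. e v x)" for x
  have u_bd: "u x = f 1" if "x \<in> bd C0" for x
  proof -
    have "u x = e x x + (\<Sum>v\<in>bd C0 - {x}. e v x)" unfolding u_def by (rule sum.remove[OF finite_bd[OF C0] that])
    also have "(\<Sum>v\<in>bd C0 - {x}. e v x) = 0" using e0 that by (intro sum.neutral) auto
    finally show ?thesis using ef[OF that] by simp
  qed
  have av_u: "av C0 u x = (\<Sum>v\<in>bd C0. av C0 (e v) x)" for x
    unfolding av_def u_def by (simp add: sum_divide_distrib sum.swap[of _ "bd C0"])
  have u_C: "u x = 1 * av C0 u x" if x: "x \<in> C0" for x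
  proof -
    have "e v x = av C0 (e v) x" if "v \<in> bd C0" for v
      using e[of x v] x that cell_disj_bd[of C0] by auto
    then show ?thesis by (simp add: av_u) (simp add: u_def)
  qed
  define b where "b x = (if x \<in> bd C0 then f 1 else 0)" for x
  have ns: "1 \<notin> sing C0 (bd C0)" using nonsingular_1[OF C0, of "bd C0"] v1 by auto
  have u_const: "u x = f 1" if x: "x \<in> hat C0" for x
  proof -
    have disj: "y \<notin> bd C0" if "y \<in> C0" for y using that cell_disj_bd[of C0] by blast
    have "u x = (\<Sum>y\<in>hat C0. N C0 (bd C0) 1 x y * b y)"
      by (rule dirichlet_unique[OF C0 ns _ x]) (use u_bd u_C disj in \<open>auto simp: b_def\<close>)
    also have "\<dots> = f 1"
      by (rule dirichlet_unique[OF C0 ns _ x, symmetric, where u = "\<lambda>_. f 1"])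
        (use disj av_1[OF C0] in \<open>auto simp: b_def\<close>)
    finally show ?thesis .
  qed
  have "of_nat \<theta> * (of_nat (\<theta> - 1) * deriv d 1) = (\<Sum>v\<in>bd C0. of_nat (\<theta> - 1) * deriv d 1)"
    by (simp only: sum_constant card_bd[OF C0])
  also have "\<dots> = (\<Sum>v\<in>bd C0. \<Sum>x\<in>hat C0. of_nat (m C0 x) * e v x)"
    unfolding e_def by (rule sum.cong[OF refl]) (rule deriv_d_column[OF C0])
  also have "\<dots> = (\<Sum>x\<in>hat C0. \<Sum>v\<in>bd C0. of_nat (m C0 x) * e v x)" by (rule sum.swap)
  also have "\<dots> = (\<Sum>x\<in>hat C0. of_nat (m C0 x) * f 1)"
    by (rule sum.cong[OF refl]) (simp only: sum_distrib_left[symmetric] u_const[unfolded u_def])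
  also have "\<dots> = of_nat (\<Sum>x\<in>hat C0. m C0 x) * f 1" by (simp only: of_nat_sum sum_distrib_right)
  also have "\<dots> = of_nat \<theta> * (of_nat (\<theta> - 1) * (f 1 * of_nat (card (subcells C0))))"
    unfolding sum_m[OF C0] by (simp only: of_nat_mult mult_ac)
  finally show ?thesis using \<theta>_ge_2 by simp
qed

text \<open>The total degree of a cell graph is invariant under isomorphism and determines the
  number of subcells.\<close>

lemma card_subcells:
  assumes C: "C \<in> Cells"
  shows "card (subcells C) = mass_scaling X F \<psi>"
proof -
  have *: "card (subcells C) = card (subcells D)" if C: "C \<in> Cells" and D: "D \<in> Cells" for C D
  proof -
    obtain \<alpha> where \<alpha>: "graph_isomorphism \<alpha> (cell_graph X C) (cell_graph X D)" using cell_iso[OF C D] by blast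
    then have bij: "bij_betw \<alpha> (hat C) (hat D)" by (simp add: graph_isomorphism_def)
    have "(\<Sum>x\<in>hat D. m D x) = (\<Sum>x\<in>hat C. m D (\<alpha> x))" by (rule sum.reindex_bij_betw[OF bij, symmetric])
    also have "\<dots> = (\<Sum>x\<in>hat C. m C x)" by (rule sum.cong[OF refl]) (rule cell_iso_m[OF \<alpha>])
    finally have "card (subcells D) * (\<theta> * (\<theta> - 1)) = card (subcells C) * (\<theta> * (\<theta> - 1))"
      by (simp only: sum_m[OF C] sum_m[OF D])
    moreover have "\<theta> * (\<theta> - 1) \<noteq> 0" using \<theta>_ge_2 by simp
    ultimately show ?thesis by (simp only: mult_cancel2 if_False) simp
  qed
  show ?thesis using mass_scaling_eq *[OF C] by auto
qed

text \<open>\<open>f 1 - 1\<close> is the energy of \<open>g\<close>, the resolvent column without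
  its unit at \<open>v1\<close>, divided by \<theta> - 1; the energy is positive because
  \<open>g\<close> is not constant.\<close>

lemma f_1_real: "\<exists>r>1. f 1 = of_real r"
proof -
  have ns: "1 \<notin> sing C0 B0" using Z_1 by (simp add: Z_def)
  have v1h: "v1 \<in> hat C0" using v1 by blast
  define e where "e x = N C0 B0 1 x v1" for x
  have e: "e x = (if x = v1 then 1 else 0) + (if x \<in> B0 then 0 else 1 * av C0 e x)" if "x \<in> hat C0" for x
    unfolding e_def by (rule resolvent_column[OF C0 ns that v1h])
  define \<delta> where "\<delta> x = (if x = v1 then 1 else 0 :: complex)" for x
  have no_loop: "(v1, v1) \<notin> parcs (cell_graph X C0)" using arc_irrefl by (auto simp: cg_arcs)
  have \<delta>v: "av C0 \<delta> v1 = 0" using no_loop unfolding av_def by (intro divide_eq_0_iff[THEN iffD2] disjI1 sum.neutral) (auto simp: \<delta>_def)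
  define g where "g x = e x - \<delta> x" for x
  have av_g: "av C0 g x = av C0 e x - av C0 \<delta> x" for x
    unfolding av_def g_def by (simp only: sum_subtractf diff_divide_distrib)
  have "(\<Sum>x\<in>hat C0. of_nat (m C0 x) * cnj (g x) * (g x - 1 * av C0 g x))
      = (\<Sum>x\<in>hat C0. of_nat (m C0 x) * cnj (e x) * av C0 \<delta> x)"
  proof (rule sum.cong[OF refl])
    fix x assume x: "x \<in> hat C0"
    have "x \<noteq> v1 \<Longrightarrow> \<delta> x = 0" "\<delta> v1 = 1" by (auto simp: \<delta>_def)
    then show "of_nat (m C0 x) * cnj (g x) * (g x - 1 * av C0 g x) = of_nat (m C0 x) * cnj (e x) * av C0 \<delta> x"
      using e[OF x] \<delta>v unfolding av_g g_def by (cases "x = v1"; cases "x \<in> B0") auto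
  qed
  also have "\<dots> = (\<Sum>p\<in>parcs (cell_graph X C0). cnj (e (fst p)) * \<delta> (snd p))" by (rule sum_m_av[OF C0])
  also have "\<dots> = (\<Sum>p\<in>parcs (cell_graph X C0). \<delta> (fst p) * cnj (e (snd p)))"
    using arcs_swap[of "\<lambda>x y. \<delta> x * cnj (e y)" C0] by (simp only: mult.commute)
  also have "\<dots> = (\<Sum>x\<in>hat C0. of_nat (m C0 x) * \<delta> x * av C0 (\<lambda>y. cnj (e y)) x)" by (rule sum_m_av[OF C0, symmetric])
  also have "\<dots> = (\<Sum>x\<in>{v1}. of_nat (m C0 x) * \<delta> x * av C0 (\<lambda>y. cnj (e y)) x)"
    by (rule sum.mono_neutral_right[OF finite_hat[OF C0]]) (use v1h in \<open>auto simp: \<delta>_def\<close>)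
  also have "\<dots> = of_nat (\<theta> - 1) * cnj (av C0 e v1)"
    using m_bd[OF C0 v1] by (simp add: \<delta>_def av_def cnj_sum)
  also have "av C0 e v1 = f 1 - 1" using e[OF v1h] by (simp add: e_def f_def)
  finally have "of_nat (\<theta> - 1) * cnj (f 1 - 1) = of_real (mass C0 g) - 1 * of_real (corr C0 g)"
    using energy_identity[OF C0, of g 1] by (simp only:)
  then have eq: "cnj (f 1 - 1) = of_real ((mass C0 g - corr C0 g) / real (\<theta> - 1))"
    using \<theta>_ge_2 by (simp add: field_simps)
  define r where "r = (mass C0 g - corr C0 g) / real (\<theta> - 1)"
  have "f 1 - 1 = cnj (of_real r)" using eq unfolding r_def by (metis complex_cnj_cnj)
  then have f1: "f 1 = of_real (1 + r)" by (simp add: algebra_simps)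
  \<comment> \<open>A constant \<open>g\<close> would be 0, as it vanishes at the other boundary
    vertices. The column would then be the unit at \<open>v1\<close>, but it is nonzero at a
    neighbour of \<open>v1\<close>.\<close>
  have "mass C0 g \<noteq> corr C0 g"
  proof
    assume "mass C0 g = corr C0 g"
    then have const: "g x = g y" if "x \<in> hat C0" "y \<in> hat C0" for x y using constant_of_energy[OF C0 _ that] by blast
    obtain w where w: "w \<in> B0" using bd_other[OF C0, of v1] by blast
    then have wh: "w \<in> hat C0" by blast
    have "e w = 0" using e[OF wh] w by auto
    then have "g w = 0" using w by (simp add: g_def \<delta>_def)
    then have ee: "e x = \<delta> x" if "x \<in> hat C0" for x using const[OF that wh] by (simp add: g_def)
    obtain y where y: "(v1, y) \<in> parcs (cell_graph X C0)" using cg_has_nb[OF C0 v1h] by blast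
    then have yC: "y \<in> C0" using cg_nb_bd[OF C0 v1] by blast
    then have yh: "y \<in> hat C0" "y \<notin> B0" "y \<noteq> v1" using cell_disj_bd[of C0] v1 by auto
    have "av C0 e y = av C0 \<delta> y" by (rule av_cong) (rule ee)
    also have "\<dots> = 1 / of_nat (m C0 y)"
      using cg_sym[OF y] cg_finite_nb by (simp add: av_def \<delta>_def)
    finally have "e y \<noteq> 0" using e[OF yh(1)] yh m_pos[OF C0 yh(1)] by simp
    then show False using ee[OF yh(1)] yh by (simp add: \<delta>_def)
  qed
  then have "mass C0 g - corr C0 g > 0" using corr_le[of C0 g] by simp
  then have "r > 0" using \<theta>_ge_2 by (simp add: r_def)
  then show ?thesis using f1 by (intro exI[of _ "1 + r"]) simp
qed

text \<open>By \<open>deriv_d_1\<close>, \<tau> is the product of \<open>f 1\<close> and \<mu>; both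
  factors exceed 1, which places the exponent \<open>s\<close> strictly between -1 and 0.\<close>

lemma time_scaling_props:
  defines "\<tau> \<equiv> time_scaling X F" and "\<mu> \<equiv> real (mass_scaling X F \<psi>)"
  shows "deriv d 1 = of_real \<tau>" "1 < \<mu>" "\<mu> < \<tau>" "f 1 = of_real (\<tau> / \<mu>)"
proof -
  obtain r where r: "r > 1" "f 1 = of_real r" using f_1_real by blast
  have "mass_scaling X F \<psi> \<ge> 2" using subcells_ge_2[OF C0] card_subcells[OF C0] by simp
  then show \<mu>: "1 < \<mu>" by (simp add: \<mu>_def)
  have d: "deriv d 1 = of_real (r * \<mu>)"
    using deriv_d_1 r(2) card_subcells[OF C0] by (simp add: \<mu>_def)
  then have \<tau>: "\<tau> = r * \<mu>" by (simp add: \<tau>_def time_scaling_def)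
  show "deriv d 1 = of_real \<tau>" using d \<tau> by simp
  show "\<mu> < \<tau>" using \<tau> r \<mu> by simp
  show "f 1 = of_real (\<tau> / \<mu>)" using r \<tau> \<mu> by simp
qed

end

context sss_graph
begin

section \<open>The functional equation of the Green function\<close>

definition AV :: "('v \<Rightarrow> complex) \<Rightarrow> 'v \<Rightarrow> complex" where
  "AV u x = (\<Sum>y\<in>neighbours X x. u y) / of_nat (card (neighbours X x))"

lemma AV_bound:
  assumes "K \<ge> 0" "\<And>y. y \<in> neighbours X x \<Longrightarrow> cmod (u y) \<le> K"
  shows "cmod (AV u x) \<le> K"
proof (cases "card (neighbours X x) = 0")
  case False
  have "cmod (\<Sum>y\<in>neighbours X x. u y) \<le> (\<Sum>y\<in>neighbours X x. K)"
    by (rule order_trans[OF norm_sum sum_mono[OF assms(2)]])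
  then have "cmod (\<Sum>y\<in>neighbours X x. u y) \<le> K * real (card (neighbours X x))" by (simp add: mult.commute)
  then show ?thesis using False by (simp add: AV_def norm_divide pos_divide_le_eq)
qed (simp add: AV_def assms(1))

text \<open>Each use of the equation improves the bound by a factor \<open>norm z\<close>.
  Boundedness replaces finiteness of the graph in this uniqueness statement.\<close>

lemma bounded_harmonic_zero:
  assumes z: "norm z < 1" and u: "\<And>x. x \<in> V \<Longrightarrow> u x = z * AV u x"
    and K: "\<And>x. x \<in> V \<Longrightarrow> cmod (u x) \<le> K" and x: "x \<in> V"
  shows "u x = 0"
proof -
  have K0: "K \<ge> 0" using K[OF x] norm_ge_zero[of "u x"] by linarith
  have bound: "cmod (u x) \<le> K * norm z ^ n" if "x \<in> V" for n x
    using that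
  proof (induction n arbitrary: x)
    case (Suc n)
    have "cmod (AV u x) \<le> K * norm z ^ n"
      by (rule AV_bound) (use K0 Suc.IH arc_verts in auto)
    then show ?case
      using u[OF Suc.prems] mult_left_mono[of "cmod (AV u x)" "K * norm z ^ n" "norm z"]
      by (metis norm_ge_zero norm_mult mult.left_commute power_Suc)
  qed (use K in simp)
  have "(\<lambda>n. K * norm z ^ n) \<longlonglongrightarrow> K * 0"
    by (intro tendsto_intros LIMSEQ_power_zero) (use z in simp)
  then have "cmod (u x) \<le> K * 0"
    by (rule LIMSEQ_le_const) (use bound[OF x] in blast)
  then show ?thesis by simp
qed

lemma walk_probability_bounds: "0 \<le> walk_probability X n x y \<and> walk_probability X n x y \<le> 1"
proof (induction n arbitrary: x)
  case (Suc n)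
  have "0 \<le> walk_probability X (Suc n) x y"
    using Suc by (auto intro!: sum_nonneg)
  moreover have "walk_probability X (Suc n) x y \<le> (\<Sum>w\<in>neighbours X x. 1 / real (card (neighbours X x)))"
    unfolding walk_probability.simps degree_in_eq
  proof (rule sum_mono)
    fix w
    show "1 / real (card (neighbours X x)) * walk_probability X n w y \<le> 1 / real (card (neighbours X x))"
      using mult_left_mono[of "walk_probability X n w y" 1 "1 / real (card (neighbours X x))"] Suc.IH[of w] by simp
  qed
  moreover have "(\<Sum>w\<in>neighbours X x. 1 / real (card (neighbours X x))) \<le> 1"
    by simp
  ultimately show ?case by linarith
qed simp

definition green :: "complex \<Rightarrow> 'v \<Rightarrow> complex" where
  "green z x = (\<Sum>n. of_real (walk_probability X n x v0) * z ^ n)"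

lemma green_term_le: "norm (of_real (walk_probability X n x v0) * z ^ n) \<le> norm z ^ n" for z :: complex
  using walk_probability_bounds[of n x v0] mult_right_mono[of "walk_probability X n x v0" 1 "norm z ^ n"]
  by (simp add: norm_mult norm_power)

lemma green_summable: "norm z < 1 \<Longrightarrow> summable (\<lambda>n. of_real (walk_probability X n x v0) * z ^ n)" for z :: complex
  by (rule summable_comparison_test'[OF summable_geometric[of "norm z"], of 0])
    (use green_term_le in simp_all)

lemma green_bound:
  assumes z: "norm z < 1"
  shows "cmod (green z x) \<le> 1 / (1 - norm z)"
proof -
  have "cmod (green z x) \<le> (\<Sum>n. norm z ^ n)"
    unfolding green_def
    by (rule norm_suminf_le[OF green_term_le]) (use summable_geometric[of "norm z"] z in simp)
  then show ?thesis using suminf_geometric[of "norm z"] z by simp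
qed

lemma green_eq:
  assumes z: "norm z < 1"
  shows "green z x = (if x = v0 then 1 else 0) + z * AV (green z) x"
proof -
  let ?a = "\<lambda>n x. of_real (walk_probability X n x v0) * z ^ n"
  have "green z x = ?a 0 x + (\<Sum>n. ?a (Suc n) x)"
    using suminf_split_head[OF green_summable[OF z, of x]] unfolding green_def by simp
  also have "(\<Sum>n. ?a (Suc n) x) = (\<Sum>n. z / of_nat (card (neighbours X x)) * (\<Sum>y\<in>neighbours X x. ?a n y))"
  proof (rule suminf_cong)
    fix n
    have "?a (Suc n) x = (\<Sum>y\<in>neighbours X x. z / of_nat (card (neighbours X x)) * ?a n y)"
      by (simp add: degree_in_eq sum_distrib_right) (intro sum.cong refl, simp)
    then show "?a (Suc n) x = z / of_nat (card (neighbours X x)) * (\<Sum>y\<in>neighbours X x. ?a n y)"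
      by (simp only: sum_distrib_left)
  qed
  also have "\<dots> = z / of_nat (card (neighbours X x)) * (\<Sum>n. \<Sum>y\<in>neighbours X x. ?a n y)"
    by (rule suminf_mult[OF summable_sum[OF green_summable[OF z]]])
  also have "(\<Sum>n. \<Sum>y\<in>neighbours X x. ?a n y) = (\<Sum>y\<in>neighbours X x. green z y)"
    unfolding green_def by (rule suminf_sum[OF green_summable[OF z]])
  finally show ?thesis by (simp add: AV_def)
qed

lemma green_hol: "(\<lambda>z. green z v0) holomorphic_on ball 0 1"
proof (rule power_series_holomorphic)
  fix z :: complex assume "z \<in> ball 0 1"
  then have "norm z < 1" by simp
  from summable_sums[OF green_summable[OF this, of v0]]
  show "(\<lambda>n. of_real (walk_probability X n v0 v0) * (z - 0) ^ n) sums green z v0"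
    by (simp add: green_def)
qed

lemma AV_cell: "C \<in> Cells \<Longrightarrow> x \<in> C \<Longrightarrow> AV u x = av C u x"
  using cg_nb_cell[of C x] by (simp add: AV_def av_def m_def)

text \<open>A bounded solution \<open>u\<close> of the equation for \<open>green z\<close> is built:
  on \<open>F\<close> it is \<open>f z\<close> times the transplanted \<open>green (d z)\<close>, in
  the cells its extension. Summing \<open>residual\<close> over the cells at a vertex of
  \<open>F\<close> gives the equation for \<open>green (d z)\<close> at the preimage under \<psi>.
  Uniqueness identifies \<open>u\<close>, and the fixed point \<open>v0\<close> allows both sides to
  be taken at the same vertex.\<close>

theorem green_functional_equation:
  assumes z: "norm z < 1"
  shows "green z v0 = f z * green (d z) v0"
proof -
  have zs: "z \<in> slit c" by (rule disc_slit[OF z])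
  have zZ: "z \<notin> Z" using Z_slit zs by blast
  have f0: "f z \<noteq> 0" by (rule f_nonzero[OF zZ nonsingular_slit[OF C0 zs]])
  have "(norm z)\<^sup>2 < 1" using z by (simp add: power_less_one_iff abs_square_less_1)
  then have dz: "norm (d z) < 1" using d_small[OF z] by linarith
  define w where "w = green (d z)"
  \<comment> \<open>Bounds \<open>u\<close> on \<open>F\<close>, and by the maximum principle
    everywhere.\<close>
  define K where "K = cmod (f z) * (1 / (1 - norm (d z)))"
  have K0: "K \<ge> 0" unfolding K_def using dz by simp
  define b where "b p = f z * w (the_inv_into V \<psi> p)" for p
  have b_\<psi>: "b (\<psi> y) = f z * w y" if "y \<in> V" for y
    using that bij_\<psi> by (simp add: b_def bij_betw_def the_inv_into_f_f)
  have b_bound: "cmod (b p) \<le> K" for p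
    unfolding b_def K_def w_def norm_mult by (intro mult_left_mono green_bound dz) simp
  define H where "H C = (SOME u. (\<forall>x\<in>bd C. u x = b x) \<and> (\<forall>x\<in>C. u x = z * av C u x))" for C
  have H: "\<forall>x\<in>bd C. H C x = b x" "\<forall>x\<in>C. H C x = z * av C (H C) x" if C: "C \<in> Cells" for C
  proof -
    obtain u where "\<And>x. x \<in> bd C \<Longrightarrow> u x = b x" "\<And>x. x \<in> C \<Longrightarrow> u x = z * av C u x"
      by (rule harmonic_extension[OF C nonsingular_slit[OF C zs], of b]) (rule that)
    then have "\<exists>u. (\<forall>x\<in>bd C. u x = b x) \<and> (\<forall>x\<in>C. u x = z * av C u x)"
      by (intro exI[of _ u] conjI ballI)
    from someI_ex[OF this]
    show "\<forall>x\<in>bd C. H C x = b x" "\<forall>x\<in>C. H C x = z * av C (H C) x" by (auto simp only: H_def)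
  qed
  define u where "u x = (if x \<in> F then b x else H (THE C. C \<in> Cells \<and> x \<in> C) x)" for x
  have uH: "u x = H C x" if C: "C \<in> Cells" and x: "x \<in> hat C" for C x
  proof (cases "x \<in> C")
    case True
    then have "x \<notin> F" using cell_subset(1)[OF C] by blast
    moreover have "(THE C. C \<in> Cells \<and> x \<in> C) = C"
    proof (rule the_equality)
      show "C' = C" if "C' \<in> Cells \<and> x \<in> C'" for C'
        by (rule cell_unique[OF conjunct1[OF that] C conjunct2[OF that] True])
    qed (intro conjI C True)
    ultimately show ?thesis by (simp add: u_def)
  next
    case False
    then have "x \<in> bd C" using x by blast
    moreover have "x \<in> F" using calculation bd_F[OF C] by blast
    ultimately show ?thesis using H(1)[OF C] by (simp add: u_def)
  qed
  have u_F: "u p = b p" if "p \<in> F" for p using that by (simp add: u_def)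
  have u_C: "u x = z * av C u x" if C: "C \<in> Cells" and x: "x \<in> C" for C x
  proof -
    have "av C u x = av C (H C) x" by (rule av_cong) (rule uH[OF C])
    then show ?thesis using H(2)[OF C] uH[OF C, of x] x by simp
  qed
  have u_bound: "cmod (u x) \<le> K" if x: "x \<in> V" for x
  proof (cases "x \<in> F")
    case False
    then obtain C where C: "C \<in> Cells" "x \<in> C" using in_some_cell[of x F] x by blast
    have "cmod (H C x) \<le> K"
      by (rule maximum_principle[OF C(1) z K0, of "bd C"]) (use H[OF C(1)] b_bound C(2) in auto)
    then show ?thesis using uH[OF C(1), of x] C(2) by simp
  qed (use u_F b_bound in simp)
  have u_eq: "u x = (if x = v0 then 1 else 0) + z * AV u x" if x: "x \<in> V" for x
  proof (cases "x \<in> F")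
    case False
    then obtain C where C: "C \<in> Cells" "x \<in> C" using in_some_cell[of x F] x by blast
    show ?thesis using u_C[OF C] AV_cell[OF C] v0_F False by auto
  next
    case True
    obtain y where y: "y \<in> V" "x = \<psi> y" using \<psi>_surj[OF True] by blast
    define n where "n = card (cells_at x)"
    define k where "k = (of_nat (\<theta> - 1) :: complex)"
    have k: "k \<noteq> 0" using \<theta>_ge_2 by (simp add: k_def)
    have n: "(of_nat n :: complex) \<noteq> 0" using cells_at_pos[OF True] by (simp add: n_def)
    have deg: "of_nat (card (neighbours X x)) = of_nat n * k" "of_nat (card (neighbours X y)) = of_nat n * k"
      using degree_F[OF True] bij_betw_same_card[OF \<psi>_neighbours[OF y(1)]] y(2)
      by (simp_all only: n_def k_def of_nat_mult)
    have 1: "(\<Sum>C\<in>cells_at x. av C u x) = of_nat n * AV u x"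
    proof -
      have "(\<Sum>C\<in>cells_at x. av C u x) = (\<Sum>C\<in>cells_at x. (\<Sum>y\<in>neighbours (cell_graph X C) x. u y) / k)"
        using m_bd by (intro sum.cong refl) (auto simp: av_def cells_at_def k_def)
      also have "\<dots> = (\<Sum>y\<in>neighbours X x. u y) / k"
        unfolding sum_neighbours_F[OF True] by (simp only: sum_divide_distrib)
      finally show ?thesis using n k by (simp add: AV_def deg)
    qed
    have 2: "(\<Sum>C\<in>cells_at x. \<Sum>q\<in>bd C - {x}. u q) = f z * (of_nat n * k) * AV w y"
    proof -
      have "(\<Sum>C\<in>cells_at x. \<Sum>q\<in>bd C - {x}. u q) = (\<Sum>q\<in>neighbours XF x. u q)"
        by (rule sum_reduced_neighbours[OF True, symmetric])
      also have "\<dots> = (\<Sum>y'\<in>neighbours X y. u (\<psi> y'))"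
        unfolding y(2) by (rule sum.reindex_bij_betw[OF \<psi>_neighbours[OF y(1)], symmetric])
      also have "\<dots> = (\<Sum>y'\<in>neighbours X y. f z * w y')"
      proof (rule sum.cong[OF refl])
        fix y' assume "y' \<in> neighbours X y"
        then have "y' \<in> V" using arc_verts by auto
        then show "u (\<psi> y') = f z * w y'" using u_F[OF \<psi>_F] b_\<psi> by simp
      qed
      also have "\<dots> = f z * (\<Sum>y'\<in>neighbours X y. w y')" by (simp only: sum_distrib_left)
      also have "(\<Sum>y'\<in>neighbours X y. w y') = of_nat n * k * AV w y"
        using n k by (simp add: AV_def deg)
      finally show ?thesis by simp
    qed
    \<comment> \<open>By 1 the left side is the equation in \<open>X\<close> at \<open>x\<close>. By
      2 the right side is the equation with parameter \<open>d z\<close> at \<open>y\<close>,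
      because the boundary vertices around \<open>x\<close> are the images of the neighbours of
      \<open>y\<close>.\<close>
    have "(\<Sum>C\<in>cells_at x. f z * (u x - z * av C u x)) = (\<Sum>C\<in>cells_at x. u x - d z / k * (\<Sum>q\<in>bd C - {x}. u q))"
      unfolding k_def
      by (intro sum.cong[OF refl] residual[OF zZ]) (use u_C in \<open>auto simp: cells_at_def\<close>)
    then have "f z * (of_nat n * u x - z * (\<Sum>C\<in>cells_at x. av C u x))
        = of_nat n * u x - d z / k * (\<Sum>C\<in>cells_at x. \<Sum>q\<in>bd C - {x}. u q)"
      by (simp only: sum_distrib_left[symmetric] sum_subtractf sum_constant n_def)
    then have "f z * of_nat n * (u x - z * AV u x) = of_nat n * f z * (w y - d z * AV w y)"
      unfolding 1 2 using u_F[OF True] b_\<psi>[OF y(1)] y(2) k by (simp add: algebra_simps)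
    then have "u x - z * AV u x = w y - d z * AV w y" using f0 n by simp
    also have "\<dots> = (if y = v0 then 1 else 0)"
      using green_eq[OF dz, of y] unfolding w_def by (simp add: algebra_simps)
    also have "y = v0 \<longleftrightarrow> x = v0" using \<psi>_inj[OF y(1) v0_V] \<psi>_v0 y(2) by auto
    finally show ?thesis by (simp add: algebra_simps)
  qed
  have "u v0 - green z v0 = 0"
  proof (rule bounded_harmonic_zero[OF z, of "\<lambda>x. u x - green z x"])
    fix x assume x: "x \<in> V"
    have "AV (\<lambda>x. u x - green z x) x = AV u x - AV (green z) x"
      unfolding AV_def by (simp only: sum_subtractf diff_divide_distrib)
    then show "u x - green z x = z * AV (\<lambda>x. u x - green z x) x"
      using u_eq[OF x] green_eq[OF z, of x] by (simp add: right_diff_distrib)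
    show "cmod (u x - green z x) \<le> K + 1 / (1 - norm z)"
      using norm_triangle_ineq4[of "u x" "green z x"] u_bound[OF x] green_bound[OF z, of x] by linarith
  qed (rule v0_V)
  then show ?thesis using u_F[OF v0_F] b_\<psi>[OF v0_V] \<psi>_v0 by (simp add: w_def)
qed

end

section \<open>Non-constancy of \<open>\<sigma>\<close>\<close>

text \<open>\<open>G\<close> shows that the choice in \<open>green_function\<close> is not void, and
  the identity theorem shows that the chosen function equals \<open>G\<close>.\<close>

lemma green_function_continuation:
  assumes G: "G holomorphic_on slit 1" "\<And>z. norm z < 1 \<Longrightarrow> G z = (\<Sum>n. of_real (walk_probability X n v v) * z ^ n)"
    and z: "z \<in> slit 1"
  shows "green_function X v z = G z"
proof -
  let ?P = "\<lambda>G. G holomorphic_on slit_plane \<and>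
        (\<forall>z. norm z < 1 \<longrightarrow> G z = (\<Sum>n. of_real (walk_probability X n v v) * z ^ n))"
  have "?P G" using G by (simp add: slit_plane_eq_slit)
  then have P: "?P (green_function X v)" unfolding green_function_def by (rule someI[of ?P])
  have ball: "ball 0 1 \<subseteq> slit 1" by (rule ball_subset_slit) simp
  have "(\<lambda>z. green_function X v z - G z) holomorphic_on slit 1"
    using P G(1) by (intro holomorphic_intros) (simp_all add: slit_plane_eq_slit)
  then have "green_function X v z - G z = 0"
  proof (rule analytic_continuation[where U = "ball 0 1" and \<xi> = 0])
    show "Topological_Spaces.connected (slit 1)" by (rule slit_connected) simp
    show "(0::complex) islimpt ball 0 1" by (rule interior_limit_point) simp
    show "green_function X v w - G w = 0" if "w \<in> ball 0 1" for w
      using that P G(2)[of w] by simp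
  qed (use ball z open_slit in auto)
  then show ?thesis by simp
qed

theorem corollary3:
  fixes X :: "'v pair_pre_digraph" and F :: "'v set" and \<psi> :: "'v \<Rightarrow> 'v" and v0 :: 'v
  assumes "symmetrically_self_similar X F \<psi>"
    and "bounded_geometry X"
    and "origin_vertex X \<psi> v0"
    and "cantor_set (julia_set (sphere_map (transition_function X F)))"
  shows "\<not> sigma_function X F \<psi> v0 constant_on strip ((time_scaling X F)\<^sup>2)"
proof
  assume const: "sigma_function X F \<psi> v0 constant_on strip ((time_scaling X F)\<^sup>2)"
  interpret sss_graph X F \<psi> v0
  proof (intro sss_graph.intro symmetric_graph.intro sss_graph_axioms.intro)
    show "pair_bidirected_digraph X"
      using assms(1) by (simp add: symmetrically_self_similar_def self_similar_def)
  qed (fact assms(1,3))+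
  define \<tau> where "\<tau> = time_scaling X F"
  define \<mu> where "\<mu> = real (mass_scaling X F \<psi>)"
  \<comment> \<open>Half the spectral dimension minus 1, the exponent in the singular
    expansion.\<close>
  define s where "s = ln \<mu> / ln \<tau> - 1"
  have tm: "deriv d 1 = of_real \<tau>" "1 < \<mu>" "\<mu> < \<tau>" "f 1 = of_real (\<tau> / \<mu>)"
    using time_scaling_props by (simp_all add: \<tau>_def \<mu>_def)
  have ln: "0 < ln \<mu>" "ln \<mu> < ln \<tau>" using tm by simp_all
  have s: "- 1 < s" "s < 0" using ln by (simp_all add: s_def field_simps)
  have "\<tau> powr (- s) = \<tau> / \<mu>"
  proof -
    have "- s * ln \<tau> = ln \<tau> - ln \<mu>" using ln by (simp add: s_def field_simps)
    then have "\<tau> powr (- s) = exp (ln \<tau> - ln \<mu>)" using tm(2,3) by (simp add: powr_def)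
    then show ?thesis using tm(2,3) by (simp add: exp_diff)
  qed
  then have f1: "f 1 = of_real (\<tau> powr (- s))" using tm(4) by simp
  have "green 0 v0 = 1" using green_eq[of 0 v0] by simp
  interpret dyn: green_dynamics d f "\<lambda>z. green z v0" c s \<tau> Z
  proof
    show "1 < \<tau>" using tm by simp
    show "d 1 = 1" by (rule d_1[OF C0 v1])
    show "green 0 v0 \<noteq> 0" using \<open>green 0 v0 = 1\<close> by simp
  qed (fact c_ge_1 Z_closed Z_countable Z_slit Z_1 d_hol f_hol d_in_slit d_small d_cnj tm(1) f1 s
      green_hol green_functional_equation)+
  have G: "green_function X v0 z = dyn.G z" if "z \<in> slit 1" for z
    by (rule green_function_continuation[OF _ _ that])
      (use dyn.G_hol dyn.G_eq_G0 slit_mono[OF c_ge_1] in \<open>auto simp: green_def intro: holomorphic_on_subset\<close>)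
  have ds: "spectral_dimension X F \<psi> = 2 * (s + 1)"
    by (simp add: spectral_dimension_def s_def \<tau>_def \<mu>_def)
  define \<omega> where "\<omega> = omega_function X F \<psi> v0"
  let ?P = "\<lambda>\<omega>. \<omega> holomorphic_on strip (time_scaling X F) \<and>
        (\<forall>z\<in>strip (time_scaling X F). \<omega> (z + 1) = \<omega> z) \<and>
        singular_expansion (green_function X v0) (spectral_dimension X F \<psi>) (time_scaling X F) \<omega>"
  \<comment> \<open>Existence gives the chosen \<omega> its defining properties; nothing else about
    it is used.\<close>
  have "\<exists>\<omega>. ?P \<omega>" unfolding ds \<tau>_def[symmetric] by (rule dyn.omega_exists[OF G])
  then have "?P \<omega>" unfolding \<omega>_def omega_function_def by (rule someI_ex)
  then have \<omega>: "\<omega> holomorphic_on strip \<tau>" "\<And>z. z \<in> strip \<tau> \<Longrightarrow> \<omega> (z + 1) = \<omega> z"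
      "singular_expansion (green_function X v0) (2 * (s + 1)) \<tau> \<omega>"
    unfolding ds \<tau>_def[symmetric] by blast+
  obtain a where a: "sigma_function X F \<psi> v0 z = a" if "z \<in> strip (\<tau>\<^sup>2)" for z
    using const by (auto simp: constant_on_def \<tau>_def)
  \<comment> \<open>Real arguments are enough to compare Fourier coefficients.\<close>
  have real_strip: "of_real x \<in> strip (\<tau>\<^sup>2)" for x
    using tm by (simp add: strip_def ln_realpow)
  have "\<omega> constant_on strip \<tau>"
    unfolding strip_def
  proof (rule fourier_modified_series_constant[of "ln \<tau>" \<omega> "ln \<mu>" a])
    fix x :: real
    show "(\<Sum>\<^sub>\<infinity>k::int\<in>UNIV. fourier_coefficient \<omega> (- k) * rGamma (1 - (of_real (ln \<mu>) - 2 * of_int k * of_real pi * \<i>) / of_real (ln \<tau>))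
        * exp (2 * of_int k * of_real pi * \<i> * of_real x)) = a"
      using a[OF real_strip[of x]] unfolding sigma_function_def \<omega>_def \<mu>_def \<tau>_def .
  qed (use ln \<omega>(1,2) in \<open>auto simp: strip_def\<close>)
  moreover have "\<not> \<omega> constant_on strip \<tau>" by (rule dyn.omega_not_constant[OF G \<omega>(3) assms(4)])
  ultimately show False by contradiction
qed

end
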